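(* Let $n\geq 5$ be an integer. Let $P$ be a polynomial on $\mathbb{R}^n$ of degree at most $n-1$. Let $Q\in C^0(\mathbb{R}^n)$ be such that $Q(0)>0$, $Q\geq 0$, $Qe^{nP}$ is radially symmetric and $\sup_{x\in\mathbb{R}^n}Q(x)e^{nP(x)}<\infty$. Then for every $\kappa\in(0,\infty)$ there exists a solution $u$ to $$(-\Delta)^{\frac n2}u=Qe^{nu}\quad\text{in }\mathbb{R}^n,\qquad \int_{\mathbb{R}^n}Qe^{nu}\,dx=\kappa,$$ such that, for some $c_1,c_2>0$ and some constant $c_v\in\mathbb{R}$, $$u(x)=-\frac{2\kappa}{\Lambda_1}\log|x|+P(x)+c_1|x|^2-c_2|x|^4+c_v+o(1)\quad\text{as }|x|\to\infty.$$ In fact, there exists a radially symmetric function $v$ on $\mathbb{R}^n$ (for which $\Delta v(0)$ is defined) such that $$v(x)=-\frac{2\kappa}{\Lambda_1}\log|x|+\frac{1}{2n}\Delta v(0)\left(|x|^4-|x|^2\right)+o(1)\quad\text{as }|x|\to\infty,$$ and, with the same constant $c_v$, $$u(x)=P(x)+v(x)+c_v-|x|^4,\qquad x\in\mathbb{R}^n.$$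
   Context: $\Lambda_1:=(n-1)!\,|S^n|$, where $|S^n|$ is the volume of the unit sphere $S^n\subset\mathbb{R}^{n+1}$. Meaning of $(-\Delta)^{n/2}u=f$ in $\mathbb{R}^n$: for $n$ even, $(-\Delta)^{n/2}$ is the usual integer power of $-\Delta$ (equation in the sense of distributions). For $n$ odd and $f\in\mathcal{S}'(\mathbb{R}^n)$, $u$ is a solution if $u\in W^{n-1,1}_{loc}(\mathbb{R}^n)$, $\Delta^{\frac{n-1}{2}}u\in L_{\frac12}(\mathbb{R}^n)$ and for every $\varphi$ in the Schwartz space $\mathcal{S}(\mathbb{R}^n)$ $$\int_{\mathbb{R}^n}(-\Delta)^{\frac{n-1}{2}}u\,(-\Delta)^{\frac12}\varphi\,dx=\langle f,\varphi\rangle,$$ where $(-\Delta)^{1/2}$ is the operator with Fourier symbol $|\xi|$, and for $s>0$ $$L_s(\mathbb{R}^n):=\left\{u\in L^1_{loc}(\mathbb{R}^n): \|u\|_{L_s(\mathbb{R}^n)}:=\int_{\mathbb{R}^n}\frac{|u(x)|}{1+|x|^{n+2s}}\,dx<\infty\right\}.$$ *)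

theory Defs
  imports "HOL-Analysis.Analysis" "HOL-Library.Landau_Symbols"
begin

text \<open>
  Euclidean space \<open>\<real>\<^sup>n\<close> is an arbitrary type \<open>'a\<close> of class \<open>euclidean_space\<close>, with
  \<open>n = DIM('a)\<close>.
\<close>

section \<open>Surface area of the sphere\<close>

text \<open>
  Surface measure on the unit sphere through polar coordinates: \<open>\<sigma>(A)\<close> is the dimension of
  the ambient space times the volume of the cone \<open>{t x | 0 < t \<le> 1, x \<in> A}\<close>.
\<close>

definition surface_measure :: "'b::euclidean_space set \<Rightarrow> real" where
  "surface_measure A =
     real DIM('b) * measure lebesgue {t *\<^sub>R x | t x. 0 < t \<and> t \<le> 1 \<and> x \<in> A}"

text \<open>
  If \<open>'a\<close> is \<open>\<real>\<^sup>n\<close>, then \<open>'a \<times> real\<close> is \<open>\<real>\<^sup>n\<^sup>+\<^sup>1\<close>, and its unit sphere is \<open>S\<^sup>n\<close>.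
\<close>

definition Lambda1 :: "'a::euclidean_space itself \<Rightarrow> real" where
  "Lambda1 _ = fact (DIM('a) - 1) * surface_measure (sphere (0 :: 'a \<times> real) 1)"

lemma surface_measure_sphere:
  "surface_measure (sphere (0 :: 'b::euclidean_space) 1) = real DIM('b) * unit_ball_vol (real DIM('b))"
proof -
  have eq: "{t *\<^sub>R x | t x. 0 < t \<and> t \<le> 1 \<and> x \<in> sphere (0 :: 'b) 1} = cball 0 1 - {0}"
  proof (intro equalityI subsetI)
    fix y :: 'b assume y: "y \<in> cball 0 1 - {0}"
    then have "y = norm y *\<^sub>R (y /\<^sub>R norm y)" "0 < norm y" "norm y \<le> 1"
      "y /\<^sub>R norm y \<in> sphere 0 1" by auto
    then show "y \<in> {t *\<^sub>R x | t x. 0 < t \<and> t \<le> 1 \<and> x \<in> sphere (0 :: 'b) 1}"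
      by blast
  qed auto
  have "measure lebesgue (cball (0 :: 'b) 1 - {0}) = measure lebesgue (cball (0 :: 'b) 1)"
    by (rule measure_Diff_null_set) auto
  also have "\<dots> = unit_ball_vol (real DIM('b))"
    by (simp add: content_cball)
  finally show ?thesis
    unfolding surface_measure_def eq by simp
qed

section \<open>Polynomials and radial functions\<close>

definition multi_indices :: "nat \<Rightarrow> ('a::euclidean_space \<Rightarrow> nat) set" where
  "multi_indices d = {\<alpha> \<in> Basis \<rightarrow>\<^sub>E UNIV. (\<Sum>b\<in>Basis. \<alpha> b) \<le> d}"

lemma finite_multi_indices: "finite (multi_indices d :: ('a::euclidean_space \<Rightarrow> nat) set)"
proof (rule finite_subset)
  show "(multi_indices d :: ('a \<Rightarrow> nat) set) \<subseteq> Basis \<rightarrow>\<^sub>E {..d}"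
  proof
    fix \<alpha> :: "'a \<Rightarrow> nat" assume \<alpha>: "\<alpha> \<in> multi_indices d"
    have "\<alpha> b \<le> d" if "b \<in> Basis" for b
      using member_le_sum[OF that, of \<alpha>] \<alpha> by (auto simp: multi_indices_def)
    with \<alpha> show "\<alpha> \<in> Basis \<rightarrow>\<^sub>E {..d}"
      by (auto simp: multi_indices_def PiE_iff)
  qed
qed (auto intro: finite_PiE)

definition polynomial_of_degree_le :: "nat \<Rightarrow> ('a::euclidean_space \<Rightarrow> real) \<Rightarrow> bool" where
  "polynomial_of_degree_le d P \<longleftrightarrow>
     (\<exists>c. \<forall>x. P x = (\<Sum>\<alpha>\<in>multi_indices d. c \<alpha> * (\<Prod>b\<in>Basis. (x \<bullet> b) ^ \<alpha> b)))"

definition radially_symmetric :: "('a::real_normed_vector \<Rightarrow> 'b) \<Rightarrow> bool" where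
  "radially_symmetric f \<longleftrightarrow> (\<forall>x y. norm x = norm y \<longrightarrow> f x = f y)"

section \<open>Derivatives\<close>

definition partial_deriv ::
  "'a::euclidean_space \<Rightarrow> ('a \<Rightarrow> 'b::real_normed_vector) \<Rightarrow> 'a \<Rightarrow> 'b" where
  "partial_deriv b f x = vector_derivative (\<lambda>t. f (x + t *\<^sub>R b)) (at 0)"

fun partial_derivs ::
  "'a::euclidean_space list \<Rightarrow> ('a \<Rightarrow> 'b::real_normed_vector) \<Rightarrow> 'a \<Rightarrow> 'b" where
  "partial_derivs [] f = f"
| "partial_derivs (b # bs) f = partial_deriv b (partial_derivs bs f)"

definition laplacian ::
  "('a::euclidean_space \<Rightarrow> 'b::real_normed_vector) \<Rightarrow> 'a \<Rightarrow> 'b" where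
  "laplacian f x = (\<Sum>b\<in>Basis. partial_deriv b (partial_deriv b f) x)"

definition twice_differentiable_at ::
  "('a::euclidean_space \<Rightarrow> 'b::real_normed_vector) \<Rightarrow> 'a \<Rightarrow> bool" where
  "twice_differentiable_at f x \<longleftrightarrow>
     (\<forall>\<^sub>F y in nhds x. f differentiable (at y)) \<and>
     (\<forall>b\<in>Basis. partial_deriv b f differentiable (at x))"

definition smooth :: "('a::euclidean_space \<Rightarrow> 'b::real_normed_vector) \<Rightarrow> bool" where
  "smooth f \<longleftrightarrow> (\<forall>bs\<in>lists Basis. \<forall>x. partial_derivs bs f differentiable (at x))"

section \<open>Test functions and distributions\<close>

text \<open>Continuity of distributions is sequential continuity at \<open>0\<close>, on \<open>C\<^sub>c\<^sup>\<infinity>\<close> and on the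
  Schwartz space respectively.\<close>

definition test_functions :: "('a::euclidean_space \<Rightarrow> complex) set" where
  "test_functions = {\<phi>. smooth \<phi> \<and> compact (closure {x. \<phi> x \<noteq> 0})}"

definition test_null_sequence :: "(nat \<Rightarrow> 'a::euclidean_space \<Rightarrow> complex) \<Rightarrow> bool" where
  "test_null_sequence \<Phi> \<longleftrightarrow>
     range \<Phi> \<subseteq> test_functions \<and>
     (\<exists>K. compact K \<and> (\<forall>j. \<forall>x. x \<notin> K \<longrightarrow> \<Phi> j x = 0)) \<and>
     (\<forall>bs\<in>lists Basis.
        uniform_limit UNIV (\<lambda>j. partial_derivs bs (\<Phi> j)) (\<lambda>_. 0) sequentially)"

definition schwartz_space :: "('a::euclidean_space \<Rightarrow> complex) set" where
  "schwartz_space =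
     {\<phi>. smooth \<phi> \<and>
          (\<forall>k. \<forall>bs\<in>lists Basis. bounded (range (\<lambda>x. norm x ^ k *\<^sub>R partial_derivs bs \<phi> x)))}"

definition schwartz_null_sequence :: "(nat \<Rightarrow> 'a::euclidean_space \<Rightarrow> complex) \<Rightarrow> bool" where
  "schwartz_null_sequence \<Phi> \<longleftrightarrow>
     range \<Phi> \<subseteq> schwartz_space \<and>
     (\<forall>k. \<forall>bs\<in>lists Basis.
        uniform_limit UNIV (\<lambda>j x. norm x ^ k *\<^sub>R partial_derivs bs (\<Phi> j) x) (\<lambda>_. 0) sequentially)"

definition linear_functional_on ::
  "('a \<Rightarrow> complex) set \<Rightarrow> (('a \<Rightarrow> complex) \<Rightarrow> complex) \<Rightarrow> bool" where
  "linear_functional_on V T \<longleftrightarrow>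
     (\<forall>\<phi>\<in>V. \<forall>\<psi>\<in>V. \<forall>a b. T (\<lambda>x. a * \<phi> x + b * \<psi> x) = a * T \<phi> + b * T \<psi>)"

definition distribution :: "(('a::euclidean_space \<Rightarrow> complex) \<Rightarrow> complex) \<Rightarrow> bool" where
  "distribution T \<longleftrightarrow>
     linear_functional_on test_functions T \<and>
     (\<forall>\<Phi>. test_null_sequence \<Phi> \<longrightarrow> (\<lambda>j. T (\<Phi> j)) \<longlonglongrightarrow> 0)"

definition tempered_distribution :: "(('a::euclidean_space \<Rightarrow> complex) \<Rightarrow> complex) \<Rightarrow> bool" where
  "tempered_distribution T \<longleftrightarrow>
     linear_functional_on schwartz_space T \<and>
     (\<forall>\<Phi>. schwartz_null_sequence \<Phi> \<longrightarrow> (\<lambda>j. T (\<Phi> j)) \<longlonglongrightarrow> 0)"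

definition regular_distribution ::
  "('a::euclidean_space \<Rightarrow> real) \<Rightarrow> ('a \<Rightarrow> complex) \<Rightarrow> complex" where
  "regular_distribution f \<phi> = (\<integral>x. f x *\<^sub>R \<phi> x \<partial>lebesgue)"

section \<open>Function spaces\<close>

definition L1_loc :: "('a::euclidean_space \<Rightarrow> real) \<Rightarrow> bool" where
  "L1_loc u \<longleftrightarrow> (\<forall>K. compact K \<longrightarrow> set_integrable lebesgue K u)"

definition weak_partial_derivs ::
  "'a::euclidean_space list \<Rightarrow> ('a \<Rightarrow> real) \<Rightarrow> ('a \<Rightarrow> real) \<Rightarrow> bool" where
  "weak_partial_derivs bs u g \<longleftrightarrow>
     L1_loc g \<and>
     (\<forall>\<phi>\<in>test_functions.
        (\<integral>x. u x *\<^sub>R partial_derivs bs \<phi> x \<partial>lebesgue)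
          = (-1) ^ length bs * (\<integral>x. g x *\<^sub>R \<phi> x \<partial>lebesgue))"

text \<open>The space \<open>W\<^sup>k\<^sup>,\<^sup>1\<^sub>l\<^sub>o\<^sub>c\<close>; the empty list of directions is the derivative of order \<open>0\<close>.\<close>

definition W1_loc :: "nat \<Rightarrow> ('a::euclidean_space \<Rightarrow> real) \<Rightarrow> bool" where
  "W1_loc k u \<longleftrightarrow>
     L1_loc u \<and> (\<forall>bs\<in>lists Basis. length bs \<le> k \<longrightarrow> (\<exists>g. weak_partial_derivs bs u g))"

text \<open>\<open>w\<close> is a representative of the distribution \<open>\<Delta>\<^sup>m u\<close>; it is unique up to a null set.\<close>

definition weak_laplacian_power ::
  "nat \<Rightarrow> ('a::euclidean_space \<Rightarrow> real) \<Rightarrow> ('a \<Rightarrow> real) \<Rightarrow> bool" where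
  "weak_laplacian_power m u w \<longleftrightarrow>
     L1_loc w \<and>
     (\<forall>\<phi>\<in>test_functions.
        (\<integral>x. u x *\<^sub>R (laplacian ^^ m) \<phi> x \<partial>lebesgue) = (\<integral>x. w x *\<^sub>R \<phi> x \<partial>lebesgue))"

definition L_space :: "real \<Rightarrow> ('a::euclidean_space \<Rightarrow> real) \<Rightarrow> bool" where
  "L_space s u \<longleftrightarrow>
     L1_loc u \<and>
     integrable lebesgue (\<lambda>x. \<bar>u x\<bar> / (1 + norm x powr (real DIM('a) + 2 * s)))"

section \<open>The half-Laplacian on Schwartz functions\<close>

definition fourier_transform :: "('a::euclidean_space \<Rightarrow> complex) \<Rightarrow> 'a \<Rightarrow> complex" where
  "fourier_transform \<phi> \<xi> = (\<integral>x. cis (- (x \<bullet> \<xi>)) * \<phi> x \<partial>lebesgue)"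

definition half_laplacian :: "('a::euclidean_space \<Rightarrow> complex) \<Rightarrow> 'a \<Rightarrow> complex" where
  "half_laplacian \<phi> x =
     (\<integral>\<xi>. cis (x \<bullet> \<xi>) * (norm \<xi> *\<^sub>R fourier_transform \<phi> \<xi>) \<partial>lebesgue) / (2 * pi) ^ DIM('a)"

section \<open>Solutions of \<open>(-\<Delta>)\<^sup>n\<^sup>/\<^sup>2 u = T\<close>\<close>

definition solution_even ::
  "('a::euclidean_space \<Rightarrow> real) \<Rightarrow> (('a \<Rightarrow> complex) \<Rightarrow> complex) \<Rightarrow> bool" where
  "solution_even u T \<longleftrightarrow>
     L1_loc u \<and> distribution T \<and>
     (\<forall>\<phi>\<in>test_functions.
        (\<integral>x. u x *\<^sub>R ((\<lambda>\<psi> y. - laplacian \<psi> y) ^^ (DIM('a) div 2)) \<phi> x \<partial>lebesgue) = T \<phi>)"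

definition solution_odd ::
  "('a::euclidean_space \<Rightarrow> real) \<Rightarrow> (('a \<Rightarrow> complex) \<Rightarrow> complex) \<Rightarrow> bool" where
  "solution_odd u T \<longleftrightarrow>
     tempered_distribution T \<and> W1_loc (DIM('a) - 1) u \<and>
     (\<exists>w. weak_laplacian_power ((DIM('a) - 1) div 2) u w \<and> L_space (1/2) w \<and>
        (\<forall>\<phi>\<in>schwartz_space.
           (\<integral>x. ((-1) ^ ((DIM('a) - 1) div 2) * w x) *\<^sub>R half_laplacian \<phi> x \<partial>lebesgue) = T \<phi>))"

definition is_solution ::
  "('a::euclidean_space \<Rightarrow> real) \<Rightarrow> (('a \<Rightarrow> complex) \<Rightarrow> complex) \<Rightarrow> bool" where
  "is_solution u T \<longleftrightarrow> (if even DIM('a) then solution_even u T else solution_odd u T)"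

end

theory Submission
  imports Defs "HOL-Probability.Probability" "HOL-Complex_Analysis.Complex_Analysis" "HOL-Real_Asymp.Real_Asymp"
begin

text \<open>
  Write \<open>n\<close> for the dimension, \<open>\<gamma> = \<Lambda>\<^sub>1 / 2\<close> and \<open>G = Q e\<^sup>n\<^sup>P\<close>, which is radial and bounded. The logarithmic potential
  of a density \<open>\<rho>\<close> divided by \<open>\<gamma>\<close> solves the equation with right-hand side \<open>\<rho>\<close>; this is a Fourier computation
  in which \<open>ln\<close> and the Riesz kernel of order one are superpositions of heat kernels. Adding a multiple of \<open>|x|\<^sup>4 - |x|\<^sup>2\<close>
  and a constant to the potential gives \<open>v\<close>, and the condition \<open>\<rho> = G exp (n (v + c - |x|\<^sup>4))\<close> with total mass \<open>\<kappa>\<close> is a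
  fixed point equation for \<open>\<rho>\<close>. The multiple is the one for which it equals \<open>\<Delta>v(0) / (2n)\<close>; it is negative, so the
  factor \<open>exp (- n |x|\<^sup>4)\<close> dominates and Schauder's theorem applies once the moment \<open>\<integral> |y|\<^sup>-\<^sup>2 \<rho>\<close> is bounded a priori.
\<close>

text \<open>The multiple can be computed: the potential over \<open>\<gamma>\<close> has Laplacian
  \<open>-(n-2) A / \<gamma>\<close> at 0, where \<open>A = \<integral> |y|^-2 \<rho>\<close>, and
  \<open>|x|^4 - |x|^2\<close> has \<open>-2n\<close>, so it is \<open>-\<beta> A\<close> with
  \<open>\<beta> = (n-2)/(4 n \<gamma>)\<close>. Thus \<open>A\<close> sits in the exponent of the
  new density and no bounded set is obviously invariant. What helps is that \<open>|y|^-2\<close> is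
  dangerous only near 0, while \<open>exp (n \<beta> A |x|^2)\<close> is larger on an annulus
  further out, which carries mass because \<open>G\<close> is positive near 0. The unknown is
  \<open>\<tau>\<close> in \<open>\<rho> = G exp (-|x|^2) \<tau>\<close>: \<open>G\<close> is merely
  continuous, but the new \<open>\<tau>\<close> is the exponential of a potential plus a polynomial,
  so the images are equi-Lipschitz with common decay, hence relatively compact in the sup norm. For
  odd \<open>n\<close>, a polynomial of degree \<open>n-1\<close> leaves a constant under the power
  \<open>(n-1)/2\<close> of the Laplacian. It pairs to 0 since the half-Laplacian of a Schwartz
  function is integrable with integral 0, which the symbol \<open>|\<xi>|\<close>, not smooth at 0,
  does not show at once. \<open>n \<ge> 5\<close> makes \<open>|x|^4\<close> a polynomial of
  admissible degree.\<close>

lemma distr_lborel_affine_unit: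
  fixes y :: "'a::euclidean_space"
  assumes "\<bar>c\<bar> = 1"
  shows "distr lborel borel (\<lambda>x. y + c *\<^sub>R x) = (lborel :: 'a measure)"
proof -
  have "c \<noteq> 0" using assms by auto
  from lborel_affine[OF this, of y] show ?thesis
    using assms by (simp add: density_1)
qed

lemma lborel_reflect:
  fixes f :: "'a::euclidean_space \<Rightarrow> 'b::{banach, second_countable_topology}"
  shows integrable_lborel_reflect: "integrable lborel (\<lambda>x. f (y - x)) \<longleftrightarrow> integrable lborel f"
    and integral_lborel_reflect: "(\<integral>x. f (y - x) \<partial>lborel) = (\<integral>x. f x \<partial>lborel)"
proof -
  have d: "distr lborel borel (\<lambda>x. y - x) = (lborel :: 'a measure)"
    using distr_lborel_affine_unit[of "-1" y] by simp
  have i: "integrable lborel (\<lambda>x. g (y - x))" if "integrable lborel g" for g :: "'a \<Rightarrow> 'b"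
    using that by (intro integrable_distr[of "\<lambda>x. y - x" lborel borel g]) (simp_all add: d)
  show int: "integrable lborel (\<lambda>x. f (y - x)) \<longleftrightarrow> integrable lborel f"
    using i[of f] i[of "\<lambda>x. f (y - x)"] by auto
  show "(\<integral>x. f (y - x) \<partial>lborel) = (\<integral>x. f x \<partial>lborel)"
  proof (cases "integrable lborel f")
    case True
    have "(\<integral>x. f x \<partial>lborel) = (\<integral>x. f x \<partial>distr lborel borel (\<lambda>x. y - x))"
      by (simp add: d)
    also have "\<dots> = (\<integral>x. f (y - x) \<partial>lborel)"
      using True by (intro integral_distr) auto
    finally show ?thesis by simp
  qed (use int in \<open>simp add: not_integrable_integral_eq\<close>)
qed

lemma lborel_shift:
  fixes f :: "'a::euclidean_space \<Rightarrow> 'b::{banach, second_countable_topology}"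
  shows integrable_lborel_shift: "integrable lborel (\<lambda>x. f (x - y)) \<longleftrightarrow> integrable lborel f"
    and integral_lborel_shift: "(\<integral>x. f (x - y) \<partial>lborel) = (\<integral>x. f x \<partial>lborel)"
    and integrable_lborel_shift': "integrable lborel (\<lambda>x. f (x + y)) \<longleftrightarrow> integrable lborel f"
    and integral_lborel_shift': "(\<integral>x. f (x + y) \<partial>lborel) = (\<integral>x. f x \<partial>lborel)"
  using lborel_reflect[of "\<lambda>x. f (x - y)" 0] lborel_reflect[of "\<lambda>x. f (- x)" y] lborel_reflect[of f 0]
    lborel_reflect[of "\<lambda>x. f (x + y)" 0] lborel_reflect[of "\<lambda>x. f (- x)" "-y"]
  by (simp_all add: algebra_simps)

section \<open>Gaussian integrals\<close>

lemma borel_measurable_cis [measurable]: "cis \<in> borel_measurable borel"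
  by (intro borel_measurable_continuous_onI continuous_intros)

text \<open>This is the characteristic function of the standard normal law after the substitution
  \<open>x \<mapsto> c x\<close> with \<open>c^2 = 2 a\<close>.\<close>

lemma gaussian_real:
  fixes a \<xi> :: real
  assumes "a > 0"
  shows "integrable lborel (\<lambda>x. cis (x * \<xi>) * exp (- (a * x\<^sup>2)))"
    and "(\<integral>x. cis (x * \<xi>) * exp (- (a * x\<^sup>2)) \<partial>lborel) = sqrt (pi / a) * exp (- (\<xi>\<^sup>2 / (4 * a)))"
proof -
  have I1: "integrable lborel (\<lambda>x. std_normal_density x *\<^sub>R cis (x * t))" for t
  proof (rule Bochner_Integration.integrable_bound)
    show "integrable lborel std_normal_density"
      using integrable_std_normal_moment[of 0] by simp
  qed (auto simp: normal_density_nonneg)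
  have "char std_normal_distribution t = (\<integral>x. std_normal_density x *\<^sub>R cis (x * t) \<partial>lborel)" for t
    unfolding char_def cis_conv_exp
    by (subst integral_density) (auto simp: normal_density_nonneg mult.commute)
  then have I2: "(\<integral>x. std_normal_density x *\<^sub>R cis (x * t) \<partial>lborel) = exp (- (t^2) / 2)" for t
    by (simp add: char_std_normal_distribution)
  define c where "c = sqrt (2 * a)"
  have c: "c > 0" "c\<^sup>2 = 2 * a" using assms by (auto simp: c_def)
  have H: "has_bochner_integral lborel (\<lambda>x. std_normal_density x *\<^sub>R cis (x * (\<xi> / c))) (exp (- ((\<xi> / c)^2) / 2))"
    using I1[of "\<xi> / c"] I2[of "\<xi> / c"] by (simp add: has_bochner_integral_iff)
  have "has_bochner_integral lborel (\<lambda>x. std_normal_density (0 + c * x) *\<^sub>R cis ((0 + c * x) * (\<xi> / c)))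
          (exp (- ((\<xi> / c)^2) / 2) /\<^sub>R \<bar>c\<bar>)"
    using c iffD1[OF lborel_has_bochner_integral_real_affine_iff H, of c 0] by (simp add: scaleR_conv_of_real)
  then have "has_bochner_integral lborel
      (\<lambda>x. complex_of_real (sqrt (2 * pi)) * (std_normal_density (0 + c * x) *\<^sub>R cis ((0 + c * x) * (\<xi> / c))))
          (complex_of_real (sqrt (2 * pi)) * (exp (- ((\<xi> / c)^2) / 2) /\<^sub>R \<bar>c\<bar>))"
    by (rule has_bochner_integral_mult_right)
  also have "(\<lambda>x. complex_of_real (sqrt (2 * pi)) * (std_normal_density (0 + c * x) *\<^sub>R cis ((0 + c * x) * (\<xi> / c))))
      = (\<lambda>x. cis (x * \<xi>) * exp (- (a * x\<^sup>2)))"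
  proof
    fix x
    have "sqrt (2 * pi) * std_normal_density (0 + c * x) = exp (- (a * x\<^sup>2))"
      by (simp add: std_normal_density_def power_mult_distrib c)
    moreover have "(0 + c * x) * (\<xi> / c) = x * \<xi>" using c by simp
    ultimately show "complex_of_real (sqrt (2 * pi)) * (std_normal_density (0 + c * x) *\<^sub>R cis ((0 + c * x) * (\<xi> / c)))
        = cis (x * \<xi>) * exp (- (a * x\<^sup>2))"
      by (simp only: scaleR_conv_of_real mult.assoc[symmetric] of_real_mult[symmetric])
         (simp only: mult.commute)
  qed
  also have "(complex_of_real (sqrt (2 * pi)) * (exp (- ((\<xi> / c)^2) / 2) /\<^sub>R \<bar>c\<bar>))
      = complex_of_real (sqrt (pi / a) * exp (- (\<xi>\<^sup>2 / (4 * a))))"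
  proof -
    have "sqrt (2 * pi) / c = sqrt (pi / a)"
      using assms by (simp add: c_def real_sqrt_divide real_sqrt_mult)
    moreover have "(\<xi> / c)^2 / 2 = \<xi>\<^sup>2 / (4 * a)" using c by (simp add: power_divide)
    ultimately have "sqrt (2 * pi) * (exp (- ((\<xi> / c)^2) / 2) / \<bar>c\<bar>) = sqrt (pi / a) * exp (- (\<xi>\<^sup>2 / (4 * a)))"
      using c by (simp add: field_simps)
    then have "complex_of_real (sqrt (2 * pi) * (exp (- ((\<xi> / c)^2) / 2) / \<bar>c\<bar>))
        = complex_of_real (sqrt (pi / a) * exp (- (\<xi>\<^sup>2 / (4 * a))))" by (rule arg_cong)
    moreover have "exp (- ((\<xi> / c)^2) / 2) /\<^sub>R \<bar>c\<bar> = exp (- ((\<xi> / c)^2) / 2) / \<bar>c\<bar>"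
      by (metis divide_inverse mult.commute real_scaleR_def)
    ultimately show ?thesis
      by (simp only: of_real_mult)
  qed
  finally show "integrable lborel (\<lambda>x. cis (x * \<xi>) * exp (- (a * x\<^sup>2)))"
    and "(\<integral>x. cis (x * \<xi>) * exp (- (a * x\<^sup>2)) \<partial>lborel) = sqrt (pi / a) * exp (- (\<xi>\<^sup>2 / (4 * a)))"
    by (auto simp: has_bochner_integral_iff)
qed

text \<open>Lebesgue measure is the image of the product measure under the coordinate map, so
  integrals of product functions factor. Gaussians are the only functions this is applied to; all
  other integrals over the space are reduced to Gaussians.\<close>

lemma lborel_integral_prod_Basis:
  fixes f :: "'a::euclidean_space \<Rightarrow> real \<Rightarrow> 'b::{real_normed_field,banach,second_countable_topology}"
  assumes f: "\<And>b. b \<in> Basis \<Longrightarrow> integrable lborel (f b)"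
  shows "integrable lborel (\<lambda>x. \<Prod>b\<in>Basis. f b (x \<bullet> b))"
    and "(\<integral>x. (\<Prod>b\<in>Basis. f b (x \<bullet> b)) \<partial>lborel) = (\<Prod>b\<in>Basis. \<integral>t. f b t \<partial>lborel)"
proof -
  interpret product_sigma_finite "\<lambda>_::'a. lborel :: real measure"
    by standard
  note [measurable] = borel_measurable_integrable[OF f]
  have [measurable]: "(\<lambda>x. \<Prod>b\<in>Basis. f b (x \<bullet> b)) \<in> borel_measurable borel"
    by (intro borel_measurable_prod) measurable
  have eq: "(\<Prod>b\<in>Basis. f b ((\<Sum>c\<in>Basis. g c *\<^sub>R c) \<bullet> b)) = (\<Prod>b\<in>Basis. f b (g b))" for g :: "'a \<Rightarrow> real"
    by (intro prod.cong) (auto simp: inner_sum_left_Basis)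
  have i: "integrable (\<Pi>\<^sub>M b\<in>(Basis::'a set). lborel) (\<lambda>g. \<Prod>b\<in>Basis. f b (g b))"
    by (intro product_integrable_prod f) auto
  show "integrable lborel (\<lambda>x. \<Prod>b\<in>Basis. f b (x \<bullet> b))"
    by (subst lborel_eq) (simp add: integrable_distr_eq eq i)
  show "(\<integral>x. (\<Prod>b\<in>Basis. f b (x \<bullet> b)) \<partial>lborel) = (\<Prod>b\<in>Basis. \<integral>t. f b t \<partial>lborel)"
    by (subst lborel_eq) (simp add: integral_distr eq product_integral_prod f)
qed

lemma norm_sq_sum_Basis: "(norm (x::'a::euclidean_space))\<^sup>2 = (\<Sum>b\<in>Basis. (x \<bullet> b)\<^sup>2)"
  by (simp add: norm_eq_sqrt_inner euclidean_inner[of x x] power2_eq_square sum_nonneg)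

lemma gaussian_fourier:
  fixes \<xi> :: "'a::euclidean_space"
  assumes "a > 0"
  shows "integrable lborel (\<lambda>x::'a. cis (x \<bullet> \<xi>) * exp (- (a * (norm x)\<^sup>2)))"
    and "(\<integral>x. cis (x \<bullet> \<xi>) * exp (- (a * (norm x)\<^sup>2)) \<partial>lborel)
           = of_real ((pi / a) powr (DIM('a) / 2) * exp (- ((norm \<xi>)\<^sup>2 / (4 * a))))"
proof -
  let ?f = "\<lambda>b t. cis (t * (\<xi> \<bullet> b)) * exp (- (a * t\<^sup>2))"
  have cis_sum: "(\<Prod>b\<in>A. cis (g b)) = cis (\<Sum>b\<in>A. g b)" for g and A :: "'a set"
    by (induction A rule: infinite_finite_induct) (auto simp: cis_mult)
  have eq: "(\<Prod>b\<in>Basis. ?f b (x \<bullet> b)) = cis (x \<bullet> \<xi>) * exp (- (a * (norm x)\<^sup>2))" for x :: 'a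
    by (simp add: prod.distrib cis_sum euclidean_inner[of x \<xi>] norm_sq_sum_Basis sum_distrib_left
        sum_negf exp_sum[symmetric] flip: of_real_prod)
  show "integrable lborel (\<lambda>x::'a. cis (x \<bullet> \<xi>) * exp (- (a * (norm x)\<^sup>2)))"
    using lborel_integral_prod_Basis(1)[of ?f] gaussian_real(1)[OF assms] by (simp add: eq)
  have "(\<integral>x. cis (x \<bullet> \<xi>) * exp (- (a * (norm x)\<^sup>2)) \<partial>lborel)
      = (\<Prod>b\<in>Basis. complex_of_real (sqrt (pi / a) * exp (- ((\<xi> \<bullet> b)\<^sup>2 / (4 * a)))))"
    using lborel_integral_prod_Basis(2)[of ?f] gaussian_real[OF assms] by (simp add: eq)
  also have "\<dots> = of_real (sqrt (pi / a) ^ DIM('a) * exp (- ((norm \<xi>)\<^sup>2 / (4 * a))))"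
    by (simp add: prod.distrib norm_sq_sum_Basis sum_divide_distrib sum_negf exp_sum[symmetric]
        flip: of_real_prod of_real_power)
  also have "sqrt (pi / a) ^ DIM('a) = (pi / a) powr (DIM('a) / 2)"
    using assms by (simp add: powr_half_sqrt[symmetric] powr_powr powr_realpow[symmetric] powr_realpow')
  finally show "(\<integral>x. cis (x \<bullet> \<xi>) * exp (- (a * (norm x)\<^sup>2)) \<partial>lborel)
           = of_real ((pi / a) powr (DIM('a) / 2) * exp (- ((norm \<xi>)\<^sup>2 / (4 * a))))" .
qed

lemma gaussian_integral:
  assumes "a > 0"
  shows "integrable lborel (\<lambda>x::'a::euclidean_space. exp (- (a * (norm x)\<^sup>2)))"
    and "(\<integral>x. exp (- (a * (norm (x::'a))\<^sup>2)) \<partial>lborel) = (pi / a) powr (DIM('a) / 2)"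
    and "(\<integral>\<^sup>+x. ennreal (exp (- (a * (norm (x::'a))\<^sup>2))) \<partial>lborel) = ennreal ((pi / a) powr (DIM('a) / 2))"
proof -
  have "integrable lborel (\<lambda>x::'a. complex_of_real (exp (- (a * (norm x)\<^sup>2))))"
    using gaussian_fourier(1)[OF assms, of "0::'a"] by simp
  then show i: "integrable lborel (\<lambda>x::'a. exp (- (a * (norm x)\<^sup>2)))"
    by (simp only: complex_of_real_integrable_eq)
  have "complex_of_real (\<integral>x. exp (- (a * (norm (x::'a))\<^sup>2)) \<partial>lborel) = of_real ((pi / a) powr (DIM('a) / 2))"
    using gaussian_fourier(2)[OF assms, of "0::'a"] by (simp flip: integral_complex_of_real)
  then show e: "(\<integral>x. exp (- (a * (norm (x::'a))\<^sup>2)) \<partial>lborel) = (pi / a) powr (DIM('a) / 2)"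
    using of_real_eq_iff by blast
  show "(\<integral>\<^sup>+x. ennreal (exp (- (a * (norm (x::'a))\<^sup>2))) \<partial>lborel) = ennreal ((pi / a) powr (DIM('a) / 2))"
    using i e by (subst nn_integral_eq_integral) auto
qed

section \<open>Exponential integrals over the line\<close>

text \<open>Integrals \<open>\<integral>\<^sub>0\<^sup>\<infinity> \<dots> dt/t\<close> are written over the whole line with \<open>t = exp r\<close>, which turns
  dilations and inversions of \<open>t\<close> into affine maps of \<open>r\<close>.\<close>

lemma Gamma_exp_integral1:
  assumes "k > (0::real)"
  shows "integrable lborel (\<lambda>r. exp (k * r - exp r))"
    and "(\<integral>r. exp (k * r - exp r) \<partial>lborel) = Gamma k"
proof -
  let ?f = "\<lambda>t::real. t powr (k - 1) / exp t"
  have G: "(?f has_integral Gamma k) {0..}" using Gamma_integral_real[OF assms] .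
  have "?f absolutely_integrable_on {0..}"
    using G by (intro nonnegative_absolutely_integrable_1) auto
  then have A: "?f absolutely_integrable_on {0<..}"
    by (rule set_integrable_subset) auto
  have "(?f has_integral Gamma k) {0<..}"
    using has_integral_interior[of "{0::real..}" ?f "Gamma k"] G by simp
  moreover have range_exp: "range exp = {0::real<..}"
    by (auto simp: image_iff) (metis exp_ln)
  ultimately have "?f absolutely_integrable_on (exp ` UNIV) \<and> integral (exp ` UNIV) ?f = Gamma k"
    using A unfolding range_exp by (auto intro!: integral_unique)
  then have "(\<lambda>x. \<bar>exp x\<bar> * ?f (exp x)) absolutely_integrable_on UNIV \<and>
        integral UNIV (\<lambda>x. \<bar>exp x\<bar> * ?f (exp x)) = Gamma k"
    by (subst has_absolute_integral_change_of_variables_1') (auto intro!: derivative_eq_intros inj_onI)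
  also have "(\<lambda>x. \<bar>exp x\<bar> * ?f (exp x)) = (\<lambda>r. exp (k * r - exp r))"
    by (auto simp: fun_eq_iff powr_def exp_diff exp_add field_simps)
  finally have B: "(\<lambda>r. exp (k * r - exp r)) absolutely_integrable_on UNIV"
    "integral UNIV (\<lambda>r. exp (k * r - exp r)) = Gamma k" by auto
  then have "integrable lebesgue (\<lambda>r. exp (k * r - exp r))"
    by (simp add: set_integrable_def)
  moreover have "(\<lambda>r. exp (k * r - exp r)) \<in> borel_measurable lborel" by measurable
  ultimately show "integrable lborel (\<lambda>r. exp (k * r - exp r))"
    by (simp add: integrable_completion)
  then show "(\<integral>r. exp (k * r - exp r) \<partial>lborel) = Gamma k"
    using B by (subst integral_lborel[symmetric]) auto
qed

lemma Gamma_exp_integral: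
  assumes "k > (0::real)" "a > 0"
  shows "integrable lborel (\<lambda>r. exp (k * r) * exp (- (a * exp r)))"
    and "(\<integral>r. exp (k * r) * exp (- (a * exp r)) \<partial>lborel) = Gamma k * a powr (- k)"
proof -
  have "has_bochner_integral lborel (\<lambda>r. exp (k * r - exp r)) (Gamma k)"
    using Gamma_exp_integral1[OF assms(1)] by (simp add: has_bochner_integral_iff)
  then have "has_bochner_integral lborel (\<lambda>r. exp (k * (ln a + 1 * r) - exp (ln a + 1 * r))) (Gamma k /\<^sub>R \<bar>1\<bar>)"
    using lborel_has_bochner_integral_real_affine_iff[of 1 "\<lambda>r. exp (k * r - exp r)" "Gamma k" "ln a"] by simp
  then have "has_bochner_integral lborel (\<lambda>r. a powr (-k) * exp (k * (ln a + 1 * r) - exp (ln a + 1 * r))) (a powr (-k) * (Gamma k /\<^sub>R \<bar>1\<bar>))"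
    by (rule has_bochner_integral_mult_right)
  also have "(\<lambda>r. a powr (-k) * exp (k * (ln a + 1 * r) - exp (ln a + 1 * r))) = (\<lambda>r. exp (k * r) * exp (- (a * exp r)))"
    using assms by (auto simp: fun_eq_iff powr_def exp_add exp_diff exp_minus field_simps)
  finally show "integrable lborel (\<lambda>r. exp (k * r) * exp (- (a * exp r)))"
    and "(\<integral>r. exp (k * r) * exp (- (a * exp r)) \<partial>lborel) = Gamma k * a powr (- k)"
    by (auto simp: has_bochner_integral_iff)
qed

lemma Gamma_exp_nn_integral:
  assumes "k > (0::real)" "a > 0"
  shows "(\<integral>\<^sup>+r. ennreal (exp (k * r) * exp (- (a * exp r))) \<partial>lborel) = ennreal (Gamma k * a powr (- k))"
  using Gamma_exp_integral[OF assms] by (subst nn_integral_eq_integral) auto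

text \<open>For \<open>a \<le> 1\<close> the difference is nonnegative and equals the integral of
  \<open>exp r * exp (- (s * exp r))\<close> over \<open>s\<close> in \<open>[a, 1]\<close>. Tonelli
  exchanges the integrals, the inner one over \<open>r\<close> is \<open>1/s\<close>, and
  \<open>ln\<close> appears as its primitive.\<close>

lemma frullani_le_1:
  assumes "0 < a" "a \<le> 1"
  shows "has_bochner_integral lborel (\<lambda>r::real. exp (- (a * exp r)) - exp (- exp r)) (- ln a)"
proof (rule has_bochner_integral_nn_integral)
  have "(\<integral>\<^sup>+r. ennreal (exp (- (a * exp r)) - exp (- exp r)) \<partial>lborel)
      = (\<integral>\<^sup>+r. \<integral>\<^sup>+s. ennreal (exp r * exp (- (s * exp r))) * indicator {a..1} s \<partial>lborel \<partial>lborel)"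
  proof (rule nn_integral_cong)
    fix r :: real
    have "(\<integral>\<^sup>+s. ennreal (exp r * exp (- (s * exp r))) * indicator {a..1} s \<partial>lborel)
        = - exp (- (1 * exp r)) - (- exp (- (a * exp r)))"
      using assms by (intro nn_integral_FTC_Icc) (auto intro!: derivative_eq_intros)
    then show "ennreal (exp (- (a * exp r)) - exp (- exp r))
        = (\<integral>\<^sup>+s. ennreal (exp r * exp (- (s * exp r))) * indicator {a..1} s \<partial>lborel)"
      by simp
  qed
  also have "\<dots> = (\<integral>\<^sup>+s. \<integral>\<^sup>+r. ennreal (exp r * exp (- (s * exp r))) * indicator {a..1} s \<partial>lborel \<partial>lborel)"
    by (intro lborel_pair.Fubini') measurable
  also have "\<dots> = (\<integral>\<^sup>+s. ennreal (inverse s) * indicator {a..1} s \<partial>lborel)"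
  proof (rule nn_integral_cong)
    fix s :: real
    show "(\<integral>\<^sup>+r. ennreal (exp r * exp (- (s * exp r))) * indicator {a..1} s \<partial>lborel)
        = ennreal (inverse s) * indicator {a..1} s"
    proof (cases "s \<in> {a..1}")
      case True
      then show ?thesis using assms Gamma_exp_nn_integral[of 1 s]
        by (simp add: powr_minus)
    qed simp
  qed
  also have "\<dots> = ln 1 - ln a"
    using assms by (intro nn_integral_FTC_Icc) (auto intro!: derivative_eq_intros simp: inverse_eq_divide)
  finally show "(\<integral>\<^sup>+r. ennreal (exp (- (a * exp r)) - exp (- exp r)) \<partial>lborel) = ennreal (- ln a)" by simp
qed (use assms in \<open>auto intro!: AE_I2 simp: mult_le_cancel_right1\<close>)

text \<open>For \<open>a > 1\<close> a translation by \<open>ln a\<close> reduces the integral to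
  the one for \<open>1/a\<close>. The integrand has constant sign in both cases, so the absolute
  version comes for free; it is the majorant in the later applications of Fubini.\<close>

lemma frullani:
  assumes "a > 0"
  shows "has_bochner_integral lborel (\<lambda>r::real. exp (- (a * exp r)) - exp (- exp r)) (- ln a)"
    and "has_bochner_integral lborel (\<lambda>r::real. \<bar>exp (- (a * exp r)) - exp (- exp r)\<bar>) \<bar>ln a\<bar>"
proof -
  have "has_bochner_integral lborel (\<lambda>r::real. exp (- (a * exp r)) - exp (- exp r)) (- ln a) \<and>
    has_bochner_integral lborel (\<lambda>r::real. \<bar>exp (- (a * exp r)) - exp (- exp r)\<bar>) \<bar>ln a\<bar>"
  proof (cases "a \<le> 1")
    case True
    then have "(\<lambda>r::real. \<bar>exp (- (a * exp r)) - exp (- exp r)\<bar>) = (\<lambda>r. exp (- (a * exp r)) - exp (- exp r))"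
      using assms by (auto simp: fun_eq_iff mult_le_cancel_right1)
    moreover have "\<bar>ln a\<bar> = - ln a" using assms True by (simp add: ln_le_zero_iff)
    ultimately show ?thesis using frullani_le_1[OF assms True] by simp
  next
    case False
    then have H: "has_bochner_integral lborel (\<lambda>r::real. exp (- (1/a * exp r)) - exp (- exp r)) (- ln (1/a))"
      using assms by (intro frullani_le_1) auto
    have "has_bochner_integral lborel
        (\<lambda>r::real. exp (- (1/a * exp (ln a + 1 * r))) - exp (- exp (ln a + 1 * r))) (- ln (1/a) /\<^sub>R \<bar>1\<bar>)"
      using iffD1[OF lborel_has_bochner_integral_real_affine_iff H, of 1 "ln a"] by simp
    then have H: "has_bochner_integral lborel (\<lambda>r::real. exp (- exp r) - exp (- (a * exp r))) (ln a)"
      using assms by (simp add: exp_add ln_div)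
    from has_bochner_integral_minus[OF H]
    have 1: "has_bochner_integral lborel (\<lambda>r::real. exp (- (a * exp r)) - exp (- exp r)) (- ln a)" by simp
    have "(\<lambda>r::real. \<bar>exp (- (a * exp r)) - exp (- exp r)\<bar>) = (\<lambda>r. exp (- exp r) - exp (- (a * exp r)))"
      using False by (auto simp: fun_eq_iff)
    with H 1 False show ?thesis by simp
  qed
  then show "has_bochner_integral lborel (\<lambda>r::real. exp (- (a * exp r)) - exp (- exp r)) (- ln a)"
    and "has_bochner_integral lborel (\<lambda>r::real. \<bar>exp (- (a * exp r)) - exp (- exp r)\<bar>) \<bar>ln a\<bar>" by auto
qed

section \<open>Integrable weights\<close>

text \<open>Instead of polar coordinates: \<open>(1 + |x|^2)^-k\<close> is a Gamma superposition of
  Gaussians, so by Tonelli its integral is a multiple of the Gamma integral with exponent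
  \<open>k - n/2\<close>, finite exactly because that exponent is positive.\<close>

lemma integrable_decay:
  assumes "k > DIM('a::euclidean_space) / 2"
  shows "integrable lborel (\<lambda>x::'a. (1 + (norm x)\<^sup>2) powr (- k))"
proof -
  let ?n = "real DIM('a)"
  have k: "k > 0" using assms by (smt (verit) divide_nonneg_nonneg of_nat_0_le_iff)
  have "(\<integral>\<^sup>+(x::'a). ennreal (Gamma k * (1 + (norm x)\<^sup>2) powr (- k)) \<partial>lborel)
     = (\<integral>\<^sup>+(x::'a). \<integral>\<^sup>+r. ennreal (exp (k * r) * exp (- ((1 + (norm x)\<^sup>2) * exp r))) \<partial>lborel \<partial>lborel)"
    using k by (intro nn_integral_cong) (subst Gamma_exp_nn_integral; simp add: add_pos_nonneg)
  also have "\<dots> = (\<integral>\<^sup>+r. \<integral>\<^sup>+(x::'a). ennreal (exp (k * r) * exp (- ((1 + (norm x)\<^sup>2) * exp r))) \<partial>lborel \<partial>lborel)"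
    by (intro lborel_pair.Fubini') measurable
  also have "\<dots> = (\<integral>\<^sup>+r. ennreal (pi powr (?n / 2)) * ennreal (exp ((k - ?n / 2) * r) * exp (- (1 * exp r))) \<partial>lborel)"
  proof (rule nn_integral_cong)
    fix r :: real
    have "(\<integral>\<^sup>+(x::'a). ennreal (exp (k * r) * exp (- ((1 + (norm x)\<^sup>2) * exp r))) \<partial>lborel)
       = (\<integral>\<^sup>+(x::'a). ennreal (exp (k * r) * exp (- exp r)) * ennreal (exp (- (exp r * (norm x)\<^sup>2))) \<partial>lborel)"
      by (intro nn_integral_cong)
         (simp add: ennreal_mult'[symmetric] mult_exp_exp algebra_simps)
    also have "\<dots> = ennreal (exp (k * r) * exp (- exp r)) * ennreal ((pi / exp r) powr (?n / 2))"
      by (subst nn_integral_cmult) (auto simp: gaussian_integral(3))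
    also have "\<dots> = ennreal (pi powr (?n / 2)) * ennreal (exp ((k - ?n / 2) * r) * exp (- (1 * exp r)))"
      by (simp add: ennreal_mult'[symmetric] powr_divide powr_def[of "exp r"] exp_diff algebra_simps)
    finally show "(\<integral>\<^sup>+(x::'a). ennreal (exp (k * r) * exp (- ((1 + (norm x)\<^sup>2) * exp r))) \<partial>lborel) = \<dots>" .
  qed
  also have "\<dots> = ennreal (pi powr (?n / 2)) * ennreal (Gamma (k - ?n / 2) * 1 powr (- (k - ?n / 2)))"
    using assms Gamma_exp_nn_integral[of "k - ?n / 2" 1] by (subst nn_integral_cmult) auto
  also have "\<dots> < \<infinity>" by (simp add: ennreal_mult_less_top)
  finally have "integrable lborel (\<lambda>x::'a. Gamma k * (1 + (norm x)\<^sup>2) powr (- k))"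
    using k by (intro integrableI_nonneg) auto
  then show ?thesis using k Gamma_real_pos[OF k] by simp
qed

lemma integrable_exp_neg_abs:
  assumes "c > 0"
  shows "integrable lborel (\<lambda>r::real. exp (- (c * \<bar>r\<bar>)))"
proof (rule Bochner_Integration.integrable_bound)
  show "integrable lborel (\<lambda>r::real. (1 + 2 / c\<^sup>2) * (1 + (norm r)\<^sup>2) powr (- 1))"
    by (intro integrable_mult_right integrable_decay) auto
  show "AE r in lborel. norm (exp (- (c * \<bar>r\<bar>))) \<le> norm ((1 + 2 / c\<^sup>2) * (1 + (norm r)\<^sup>2) powr (- 1))"
  proof (rule AE_I2)
    fix r :: real
    have "1 + c * \<bar>r\<bar> + (c * \<bar>r\<bar>)\<^sup>2 / 2 \<le> exp (c * \<bar>r\<bar>)"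
      using assms by (intro exp_lower_Taylor_quadratic) auto
    moreover have "0 \<le> c * \<bar>r\<bar>" using assms by simp
    moreover have "(c * \<bar>r\<bar>)\<^sup>2 = c\<^sup>2 * r\<^sup>2" by (simp add: power_mult_distrib)
    ultimately have e: "1 + c\<^sup>2 * r\<^sup>2 / 2 \<le> exp (c * \<bar>r\<bar>)" by linarith
    have "(1 + 2 / c\<^sup>2) * (1 + c\<^sup>2 * r\<^sup>2 / 2) = 1 + r\<^sup>2 + c\<^sup>2 * r\<^sup>2 / 2 + 2 / c\<^sup>2"
      using assms by (simp add: field_simps)
    then have "1 + r\<^sup>2 \<le> (1 + 2 / c\<^sup>2) * (1 + c\<^sup>2 * r\<^sup>2 / 2)" by simp
    also have "\<dots> \<le> (1 + 2 / c\<^sup>2) * exp (c * \<bar>r\<bar>)"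
      by (intro mult_left_mono e) auto
    finally have "(1 + r\<^sup>2) \<le> (1 + 2 / c\<^sup>2) * exp (c * \<bar>r\<bar>)" .
    moreover have "0 < 1 + r\<^sup>2" by (simp add: add_pos_nonneg)
    ultimately show "norm (exp (- (c * \<bar>r\<bar>))) \<le> norm ((1 + 2 / c\<^sup>2) * (1 + (norm r)\<^sup>2) powr (- 1))"
      by (simp add: powr_minus exp_minus divide_simps abs_mult)
  qed
qed auto

text \<open>The same superposition, now with \<open>k = p/2\<close>. After integrating over space
  the remaining weight is \<open>exp (k r) (1 + exp r)^(-n/2)\<close>, which decays exponentially at
  both ends since \<open>0 < k < n/2\<close>. At \<open>x = 0\<close> the default value
  \<open>0 powr _ = 0\<close> makes the first step an inequality.\<close>

lemma integrable_riesz_gaussian: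
  assumes "0 < (p::real)" "p < DIM('a::euclidean_space)"
  shows "integrable lborel (\<lambda>x::'a. norm x powr (- p) * exp (- (norm x)\<^sup>2))"
proof -
  let ?n = "real DIM('a)"
  define k where "k = p / 2"
  have k: "k > 0" "k < ?n / 2" using assms by (auto simp: k_def)
  have "(\<integral>\<^sup>+(x::'a). ennreal (Gamma k * (norm x powr (- p) * exp (- (norm x)\<^sup>2))) \<partial>lborel)
     \<le> (\<integral>\<^sup>+(x::'a). \<integral>\<^sup>+r. ennreal (exp (k * r) * exp (- ((norm x)\<^sup>2 * exp r)) * exp (- (norm x)\<^sup>2)) \<partial>lborel \<partial>lborel)"
  proof (rule nn_integral_mono)
    fix x :: 'a
    show "ennreal (Gamma k * (norm x powr (- p) * exp (- (norm x)\<^sup>2)))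
        \<le> (\<integral>\<^sup>+r. ennreal (exp (k * r) * exp (- ((norm x)\<^sup>2 * exp r)) * exp (- (norm x)\<^sup>2)) \<partial>lborel)"
    proof (cases "x = 0")
      case False
      have "norm x powr (- p) = (norm x)\<^sup>2 powr (- k)"
        using False by (simp add: k_def powr_powr flip: powr_numeral)
      moreover have "(\<integral>\<^sup>+r. ennreal (exp (k * r) * exp (- ((norm x)\<^sup>2 * exp r))) * ennreal (exp (- (norm x)\<^sup>2)) \<partial>lborel)
         = ennreal (Gamma k * (norm x)\<^sup>2 powr (- k)) * ennreal (exp (- (norm x)\<^sup>2))"
        using k False by (subst nn_integral_multc) (auto simp: Gamma_exp_nn_integral)
      ultimately show ?thesis
        using k Gamma_real_pos[OF k(1)] by (simp add: ennreal_mult'[symmetric] mult_ac)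
    qed simp
  qed
  also have "\<dots> = (\<integral>\<^sup>+r. \<integral>\<^sup>+(x::'a). ennreal (exp (k * r) * exp (- ((norm x)\<^sup>2 * exp r)) * exp (- (norm x)\<^sup>2)) \<partial>lborel \<partial>lborel)"
    by (intro lborel_pair.Fubini') measurable
  also have "\<dots> \<le> (\<integral>\<^sup>+r. ennreal (pi powr (?n / 2)) * ennreal (exp (- (min k (?n / 2 - k) * \<bar>r\<bar>))) \<partial>lborel)"
  proof (rule nn_integral_mono)
    fix r :: real
    have "(\<integral>\<^sup>+(x::'a). ennreal (exp (k * r) * exp (- ((norm x)\<^sup>2 * exp r)) * exp (- (norm x)\<^sup>2)) \<partial>lborel)
       = (\<integral>\<^sup>+(x::'a). ennreal (exp (k * r)) * ennreal (exp (- ((1 + exp r) * (norm x)\<^sup>2))) \<partial>lborel)"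
      by (intro nn_integral_cong)
         (simp add: ennreal_mult'[symmetric] mult_exp_exp algebra_simps)
    also have "\<dots> = ennreal (exp (k * r)) * ennreal ((pi / (1 + exp r)) powr (?n / 2))"
      by (subst nn_integral_cmult) (auto simp: gaussian_integral(3) add_pos_pos)
    also have "\<dots> = ennreal (pi powr (?n / 2) * (exp (k * r) * (1 + exp r) powr (- (?n / 2))))"
      by (simp add: ennreal_mult'[symmetric] powr_divide powr_minus field_simps add_pos_pos less_imp_le)
    also have "\<dots> \<le> ennreal (pi powr (?n / 2) * exp (- (min k (?n / 2 - k) * \<bar>r\<bar>)))"
    proof (intro ennreal_leI mult_left_mono)
      show "exp (k * r) * (1 + exp r) powr (- (?n / 2)) \<le> exp (- (min k (?n / 2 - k) * \<bar>r\<bar>))"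
      proof (cases "r \<ge> 0")
        case True
        have "(1 + exp r) powr (- (?n / 2)) \<le> exp r powr (- (?n / 2))"
          by (intro powr_mono2') auto
        then have "exp (k * r) * (1 + exp r) powr (- (?n / 2)) \<le> exp (k * r) * exp (- (?n / 2 * r))"
          by (simp add: powr_def)
        also have "\<dots> \<le> exp (- (min k (?n / 2 - k) * \<bar>r\<bar>))"
        proof -
          have "min k (?n / 2 - k) * r \<le> (?n / 2 - k) * r" using True by (intro mult_right_mono) auto
          then show ?thesis using True by (simp add: mult_exp_exp left_diff_distrib)
        qed
        finally show ?thesis .
      next
        case False
        have "(1 + exp r) powr (- (?n / 2)) \<le> 1 powr (- (?n / 2))"
          by (intro powr_mono2') auto
        then have "exp (k * r) * (1 + exp r) powr (- (?n / 2)) \<le> exp (k * r) * 1"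
          by (intro mult_left_mono) auto
        also have "\<dots> \<le> exp (- (min k (?n / 2 - k) * \<bar>r\<bar>))"
        proof -
          have "k * r \<le> min k (?n / 2 - k) * r" using False by (intro mult_right_mono_neg) auto
          then show ?thesis using False by simp
        qed
        finally show ?thesis .
      qed
    qed auto
    finally show "(\<integral>\<^sup>+(x::'a). ennreal (exp (k * r) * exp (- ((norm x)\<^sup>2 * exp r)) * exp (- (norm x)\<^sup>2)) \<partial>lborel)
       \<le> ennreal (pi powr (?n / 2)) * ennreal (exp (- (min k (?n / 2 - k) * \<bar>r\<bar>)))"
      by (simp add: ennreal_mult'[symmetric])
  qed
  also have "\<dots> = ennreal (pi powr (?n / 2)) * (\<integral>\<^sup>+r. ennreal (exp (- (min k (?n / 2 - k) * \<bar>r\<bar>))) \<partial>lborel)"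
    by (subst nn_integral_cmult) auto
  also have "\<dots> < \<infinity>"
    using integrable_exp_neg_abs[of "min k (?n / 2 - k)"] k
    by (simp add: ennreal_mult_less_top nn_integral_eq_integral)
  finally have "integrable lborel (\<lambda>x::'a. Gamma k * (norm x powr (- p) * exp (- (norm x)\<^sup>2)))"
    using k Gamma_real_pos[OF k(1)] by (intro integrableI_nonneg) auto
  then show ?thesis using Gamma_real_pos[OF k(1)] by simp
qed

text \<open>The factor \<open>exp 1\<close> makes the Gaussian weight at least 1 on the unit ball,
  so that the weighted kernel dominates \<open>|z|^-p\<close> there; outside the ball
  \<open>|z|^-p \<le> 1\<close>.\<close>

definition riesz_const :: "'a::euclidean_space itself \<Rightarrow> real \<Rightarrow> real" where
  "riesz_const _ p = exp 1 * (\<integral>x. norm x powr (- p) * exp (- (norm (x::'a))\<^sup>2) \<partial>lborel)"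

text \<open>The singular part of the kernel is integrable and is paired with the sup bound
  \<open>B\<close>; the rest is at most 1 and is paired with the \<open>L1\<close> norm. The bound
  is uniform in \<open>x\<close>, which is what Lipschitz and continuity estimates for potentials
  use.\<close>

lemma riesz_bound:
  fixes \<rho> :: "'a::euclidean_space \<Rightarrow> real"
  assumes p: "0 < (p::real)" "p < DIM('a)" and \<rho>: "integrable lborel \<rho>" "\<And>y. \<bar>\<rho> y\<bar> \<le> B"
  shows "integrable lborel (\<lambda>y. norm (x - y) powr (- p) * \<rho> y)"
    and "(\<integral>y. norm (x - y) powr (- p) * \<bar>\<rho> y\<bar> \<partial>lborel) \<le> riesz_const TYPE('a) p * B + (\<integral>y. \<bar>\<rho> y\<bar> \<partial>lborel)"
proof -
  note [measurable] = borel_measurable_integrable[OF \<rho>(1)]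
  define w :: "'a \<Rightarrow> real" where "w = (\<lambda>z. exp 1 * (norm z powr (- p) * exp (- (norm z)\<^sup>2)))"
  have w: "integrable lborel w" unfolding w_def
    by (intro integrable_mult_right integrable_riesz_gaussian p)
  have B: "B \<ge> 0" using \<rho>(2)[of 0] by auto
  have le: "norm z powr (- p) \<le> w z + 1" for z :: 'a
  proof (cases "norm z \<le> 1")
    case True
    then have "1 \<le> exp 1 * exp (- (norm z)\<^sup>2)"
      by (simp add: exp_add[symmetric] power_le_one)
    from mult_left_mono[OF this, of "norm z powr (- p)"] show ?thesis
      by (simp add: w_def mult_ac)
  next
    case False
    then have "norm z powr (- p) \<le> 1 powr (- p)" using p by (intro powr_mono2') auto
    then show ?thesis by (auto simp: w_def add_nonneg_pos intro: order_trans)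
  qed
  have bound: "norm (x - y) powr (- p) * \<bar>\<rho> y\<bar> \<le> B * w (x - y) + \<bar>\<rho> y\<bar>" for y
  proof -
    have "norm (x - y) powr (- p) * \<bar>\<rho> y\<bar> \<le> (w (x - y) + 1) * \<bar>\<rho> y\<bar>"
      by (intro mult_right_mono le) auto
    moreover have "w (x - y) * \<bar>\<rho> y\<bar> \<le> w (x - y) * B"
      by (intro mult_left_mono \<rho>) (auto simp: w_def)
    ultimately show ?thesis by (simp add: algebra_simps)
  qed
  have i: "integrable lborel (\<lambda>y. B * w (x - y) + \<bar>\<rho> y\<bar>)"
    using w \<rho> by (simp add: integrable_lborel_reflect)
  show 1: "integrable lborel (\<lambda>y. norm (x - y) powr (- p) * \<rho> y)"
    by (rule Bochner_Integration.integrable_bound[OF i])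
       (use bound in \<open>auto simp: abs_mult intro!: AE_I2 order_trans[OF bound]\<close>)
  have "(\<integral>y. norm (x - y) powr (- p) * \<bar>\<rho> y\<bar> \<partial>lborel) \<le> (\<integral>y. B * w (x - y) + \<bar>\<rho> y\<bar> \<partial>lborel)"
    using integrable_abs[OF 1] i bound by (intro integral_mono) (auto simp: abs_mult)
  also have "\<dots> = B * (\<integral>y. w y \<partial>lborel) + (\<integral>y. \<bar>\<rho> y\<bar> \<partial>lborel)"
    using w \<rho> by (simp add: integrable_lborel_reflect integral_lborel_reflect)
  also have "(\<integral>y. w y \<partial>lborel) = riesz_const TYPE('a) p"
    by (simp add: w_def riesz_const_def)
  finally show "(\<integral>y. norm (x - y) powr (- p) * \<bar>\<rho> y\<bar> \<partial>lborel) \<le> riesz_const TYPE('a) p * B + (\<integral>y. \<bar>\<rho> y\<bar> \<partial>lborel)"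
    by (simp add: mult.commute)
qed

section \<open>Partial derivatives\<close>

lemma partial_derivs_append: "partial_derivs (as @ bs) f = partial_derivs as (partial_derivs bs f)"
  by (induction as) auto

lemma has_derivative_line:
  fixes f :: "'a::euclidean_space \<Rightarrow> 'b::real_normed_vector"
  assumes "(f has_derivative f') (at (x + s *\<^sub>R b))"
  shows "((\<lambda>t. f (x + t *\<^sub>R b)) has_vector_derivative f' b) (at s)"
proof -
  interpret f': linear f' using assms has_derivative_linear by blast
  have "((\<lambda>t. f (x + t *\<^sub>R b)) has_derivative (\<lambda>t. f' (t *\<^sub>R b))) (at s)"
    by (rule has_derivative_compose[of "\<lambda>t. x + t *\<^sub>R b" "\<lambda>t. t *\<^sub>R b" s UNIV f f'])
       (auto intro!: derivative_eq_intros assms)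
  then show ?thesis by (simp add: has_vector_derivative_def f'.scaleR)
qed

lemma partial_deriv_eq:
  assumes "(f has_derivative f') (at x)"
  shows "partial_deriv b f x = f' b"
  unfolding partial_deriv_def
  by (rule vector_derivative_at) (rule has_derivative_line, use assms in simp)

lemma has_vector_derivative_partial:
  assumes "f differentiable (at (x + s *\<^sub>R b))"
  shows "((\<lambda>t. f (x + t *\<^sub>R b)) has_vector_derivative partial_deriv b f (x + s *\<^sub>R b)) (at s)"
proof -
  from assms obtain f' where f': "(f has_derivative f') (at (x + s *\<^sub>R b))"
    by (auto simp: differentiable_def)
  from has_derivative_line[OF this] partial_deriv_eq[OF this, of b] show ?thesis by simp
qed

lemma partial_deriv_add:
  assumes "f differentiable (at x)" "g differentiable (at x)"
  shows "partial_deriv b (\<lambda>x. f x + g x) x = partial_deriv b f x + partial_deriv b g x"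
proof -
  from assms obtain f' g' where d: "(f has_derivative f') (at x)" "(g has_derivative g') (at x)"
    by (auto simp: differentiable_def)
  from partial_deriv_eq[OF has_derivative_add[OF this]] show ?thesis
    by (simp add: partial_deriv_eq[OF d(1)] partial_deriv_eq[OF d(2)])
qed

lemma partial_deriv_scaleR:
  assumes "f differentiable (at x)"
  shows "partial_deriv b (\<lambda>x. c *\<^sub>R f x) x = c *\<^sub>R partial_deriv b f x"
proof -
  from assms obtain f' where d: "(f has_derivative f') (at x)"
    by (auto simp: differentiable_def)
  from partial_deriv_eq[OF has_derivative_scaleR_right[OF this]] show ?thesis
    by (simp add: partial_deriv_eq[OF d(1)])
qed

lemma smooth_differentiable: "smooth f \<Longrightarrow> f differentiable (at x)"
  unfolding smooth_def by (metis lists.Nil partial_derivs.simps(1))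

lemma smooth_continuous: "smooth f \<Longrightarrow> continuous_on UNIV f"
  using smooth_differentiable
  by (metis continuous_at_imp_continuous_on differentiable_imp_continuous_within)

lemma smooth_partial_derivs:
  assumes "smooth f" "bs \<in> lists Basis"
  shows "smooth (partial_derivs bs f)"
  using assms unfolding smooth_def by (metis append_in_lists_conv partial_derivs_append)

lemma smooth_partial_deriv: "smooth f \<Longrightarrow> b \<in> Basis \<Longrightarrow> smooth (partial_deriv b f)"
  using smooth_partial_derivs[of f "[b]"] by simp

lemma partial_derivs_add:
  assumes "smooth f" "smooth g" "bs \<in> lists Basis"
  shows "partial_derivs bs (\<lambda>x. f x + g x) = (\<lambda>x. partial_derivs bs f x + partial_derivs bs g x)"
  using assms(3)
proof (induction bs)
  case (Cons b bs)
  then have IH: "partial_derivs bs (\<lambda>x. f x + g x) = (\<lambda>x. partial_derivs bs f x + partial_derivs bs g x)"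
    and bs: "bs \<in> lists Basis" by auto
  show ?case
    unfolding partial_derivs.simps IH
    by (rule ext, rule partial_deriv_add) (use assms bs in \<open>auto simp: smooth_def\<close>)
qed simp

lemma partial_derivs_scaleR:
  assumes "smooth f" "bs \<in> lists Basis"
  shows "partial_derivs bs (\<lambda>x. c *\<^sub>R f x) = (\<lambda>x. c *\<^sub>R partial_derivs bs f x)"
  using assms(2)
proof (induction bs)
  case (Cons b bs)
  then have IH: "partial_derivs bs (\<lambda>x. c *\<^sub>R f x) = (\<lambda>x. c *\<^sub>R partial_derivs bs f x)"
    and bs: "bs \<in> lists Basis" by auto
  show ?case
    unfolding partial_derivs.simps IH
    by (rule ext, rule partial_deriv_scaleR) (use assms bs in \<open>auto simp: smooth_def\<close>)
qed simp

lemma smooth_add: "smooth f \<Longrightarrow> smooth g \<Longrightarrow> smooth (\<lambda>x. f x + g x)"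
  unfolding smooth_def[of "\<lambda>x. f x + g x"]
  by (auto simp: partial_derivs_add smooth_def intro!: differentiable_add)

lemma smooth_scaleR: "smooth f \<Longrightarrow> smooth (\<lambda>x. c *\<^sub>R f x)"
  unfolding smooth_def[of "\<lambda>x. c *\<^sub>R f x"]
  by (auto simp: partial_derivs_scaleR smooth_def intro!: differentiable_scaleR)

section \<open>Schwartz functions\<close>

lemma schwartz_smooth: "\<phi> \<in> schwartz_space \<Longrightarrow> smooth \<phi>"
  by (simp add: schwartz_space_def)

lemma schwartz_partial_derivs:
  assumes "\<phi> \<in> schwartz_space" "bs \<in> lists Basis"
  shows "partial_derivs bs \<phi> \<in> schwartz_space"
  using assms smooth_partial_derivs[OF schwartz_smooth[OF assms(1)] assms(2)]
  by (auto simp: schwartz_space_def partial_derivs_append[symmetric])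

lemma schwartz_partial_deriv: "\<phi> \<in> schwartz_space \<Longrightarrow> b \<in> Basis \<Longrightarrow> partial_deriv b \<phi> \<in> schwartz_space"
  using schwartz_partial_derivs[of \<phi> "[b]"] by simp

lemma schwartz_add:
  assumes "\<phi> \<in> schwartz_space" "\<psi> \<in> schwartz_space"
  shows "(\<lambda>x. \<phi> x + \<psi> x) \<in> schwartz_space"
  using assms unfolding schwartz_space_def
  by (auto simp: smooth_add partial_derivs_add scaleR_add_right intro!: bounded_plus_comp)

lemma schwartz_scaleR:
  assumes "\<phi> \<in> schwartz_space"
  shows "(\<lambda>x. c *\<^sub>R \<phi> x) \<in> schwartz_space"
proof -
  have "bounded (range (\<lambda>x. norm x ^ k *\<^sub>R c *\<^sub>R partial_derivs bs \<phi> x))" if "bs \<in> lists Basis" for k bs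
    using bounded_scaleR_comp[of "\<lambda>x. norm x ^ k *\<^sub>R partial_derivs bs \<phi> x" UNIV c] assms that
    by (simp add: schwartz_space_def mult.commute)
  then show ?thesis using assms unfolding schwartz_space_def
    by (auto simp: smooth_scaleR partial_derivs_scaleR)
qed

lemma schwartz_zero: "(\<lambda>x. 0) \<in> schwartz_space"
proof -
  have *: "partial_derivs bs (\<lambda>x::'a. 0::complex) = (\<lambda>x. 0)" for bs
    by (induction bs) (auto simp: fun_eq_iff partial_deriv_def)
  show ?thesis by (auto simp: schwartz_space_def smooth_def *)
qed

lemma schwartz_sum:
  "(\<And>i. i \<in> I \<Longrightarrow> f i \<in> schwartz_space) \<Longrightarrow> (\<lambda>x. \<Sum>i\<in>I. f i x) \<in> schwartz_space"
  by (induction I rule: infinite_finite_induct) (auto intro: schwartz_zero schwartz_add)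

lemma schwartz_nlap:
  assumes "\<phi> \<in> schwartz_space"
  shows "(\<lambda>x. - laplacian \<phi> x) \<in> schwartz_space"
proof -
  have "(\<lambda>x. (-1) *\<^sub>R (\<Sum>b\<in>Basis. partial_deriv b (partial_deriv b \<phi>) x)) \<in> schwartz_space"
    by (intro schwartz_scaleR schwartz_sum schwartz_partial_deriv assms)
  then show ?thesis by (simp add: laplacian_def[abs_def])
qed

lemma schwartz_nlap_power:
  assumes "\<phi> \<in> schwartz_space"
  shows "((\<lambda>\<psi> x. - laplacian \<psi> x) ^^ m) \<phi> \<in> schwartz_space"
  by (induction m) (auto simp: assms schwartz_nlap)

lemma one_plus_power_le:
  assumes "0 \<le> (a::real)"
  shows "(1 + a) ^ k \<le> 2 ^ k * (1 + a ^ k)"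
proof (cases "a \<le> 1")
  case True
  then have "(1 + a) ^ k \<le> 2 ^ k" using assms by (intro power_mono) auto
  then show ?thesis using assms by (simp add: distrib_left add_increasing2)
next
  case False
  then have "(1 + a) ^ k \<le> (2 * a) ^ k" using assms by (intro power_mono) auto
  then show ?thesis by (simp add: power_mult_distrib distrib_left add_increasing)
qed

lemma schwartz_decay:
  fixes \<phi> :: "'a::euclidean_space \<Rightarrow> complex"
  assumes "\<phi> \<in> schwartz_space"
  obtains C where "C \<ge> 0" "\<And>x. norm (\<phi> x) \<le> C * (1 + (norm x)\<^sup>2) powr (- real k)"
proof -
  have B: "\<exists>B. \<forall>x. norm x ^ j * norm (\<phi> x) \<le> B" for j
  proof -
    have "bounded (range (\<lambda>x. norm x ^ j *\<^sub>R partial_derivs [] \<phi> x))"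
      using assms unfolding schwartz_space_def by blast
    then show ?thesis by (auto simp: bounded_iff)
  qed
  obtain B0 where B0: "\<And>x. norm (\<phi> x) \<le> B0" using B[of 0] by auto
  obtain B1 where B1: "\<And>x. norm x ^ (2 * k) * norm (\<phi> x) \<le> B1" using B[of "2 * k"] by auto
  have nn: "B0 + B1 \<ge> 0" using order_trans[OF norm_ge_zero B0] order_trans[OF _ B1, of 0 0] by auto
  show ?thesis
  proof (rule that[of "2 ^ k * (B0 + B1)"])
    fix x :: 'a
    have "(1 + (norm x)\<^sup>2) ^ k * norm (\<phi> x) \<le> 2 ^ k * (1 + ((norm x)\<^sup>2) ^ k) * norm (\<phi> x)"
      by (intro mult_right_mono one_plus_power_le) auto
    also have "\<dots> = 2 ^ k * (norm (\<phi> x) + norm x ^ (2 * k) * norm (\<phi> x))"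
      by (simp only: power_mult distrib_left distrib_right mult_1_right mult_1_left mult.assoc)
    also have "\<dots> \<le> 2 ^ k * (B0 + B1)"
      by (intro mult_left_mono add_mono B0 B1) auto
    finally have *: "(1 + (norm x)\<^sup>2) ^ k * norm (\<phi> x) \<le> 2 ^ k * (B0 + B1)" .
    have pos: "0 < 1 + (norm x)\<^sup>2" by (simp add: add_pos_nonneg)
    have "norm (\<phi> x) = ((1 + (norm x)\<^sup>2) ^ k * norm (\<phi> x)) * (1 + (norm x)\<^sup>2) powr (- real k)"
      using pos by (simp add: powr_minus powr_realpow)
    also have "\<dots> \<le> (2 ^ k * (B0 + B1)) * (1 + (norm x)\<^sup>2) powr (- real k)"
      by (intro mult_right_mono *) auto
    finally show "norm (\<phi> x) \<le> 2 ^ k * (B0 + B1) * (1 + (norm x)\<^sup>2) powr (- real k)" .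
  qed (use nn in auto)
qed

lemma schwartz_measurable: "\<phi> \<in> schwartz_space \<Longrightarrow> \<phi> \<in> borel_measurable borel"
  by (intro borel_measurable_continuous_onI smooth_continuous schwartz_smooth)

lemma powr_decay_bound:
  assumes "j \<ge> 0"
  shows "(norm x) powr j \<le> (1 + (norm x)\<^sup>2) powr (j / 2)"
proof -
  have "(norm x) powr j = ((norm x)\<^sup>2) powr (j / 2)"
    by (cases "x = 0") (auto simp: powr_powr simp flip: powr_numeral)
  also have "\<dots> \<le> (1 + (norm x)\<^sup>2) powr (j / 2)" using assms by (intro powr_mono2) auto
  finally show ?thesis .
qed

text \<open>Stated for rapidly decreasing functions rather than Schwartz functions because it is
  also applied to Fourier transforms, for which only decay is established here. Negative exponents
  \<open>j\<close> are covered by the Riesz bound at the origin.\<close>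

lemma integrable_of_decay:
  fixes f :: "'a::euclidean_space \<Rightarrow> complex"
  assumes f: "f \<in> borel_measurable borel" and d: "\<And>k. \<exists>C\<ge>0. \<forall>x. norm (f x) \<le> C * (1 + (norm x)\<^sup>2) powr (- real k)"
    and j: "j > - real DIM('a)"
  shows "integrable lborel (\<lambda>x. norm x powr j *\<^sub>R f x)"
proof (cases "j \<ge> 0")
  case True
  obtain k :: nat where k: "real k > DIM('a) / 2 + j / 2" using reals_Archimedean2 by blast
  from d[of k] obtain C where C: "C \<ge> 0" "\<And>x. norm (f x) \<le> C * (1 + (norm x)\<^sup>2) powr (- real k)" by auto
  show ?thesis
  proof (rule Bochner_Integration.integrable_bound)
    show "integrable lborel (\<lambda>x::'a. C * (1 + (norm x)\<^sup>2) powr (- (real k - j / 2)))"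
      using k by (intro integrable_mult_right integrable_decay) auto
    show "AE x in lborel. norm (norm x powr j *\<^sub>R f x) \<le> norm (C * (1 + (norm x)\<^sup>2) powr (- (real k - j / 2)))"
    proof (rule AE_I2)
      fix x :: 'a
      have "norm (norm x powr j *\<^sub>R f x) \<le> (1 + (norm x)\<^sup>2) powr (j / 2) * (C * (1 + (norm x)\<^sup>2) powr (- real k))"
        using C powr_decay_bound[OF True, of x] by (auto intro!: mult_mono)
      also have "\<dots> = C * (1 + (norm x)\<^sup>2) powr (- (real k - j / 2))"
      proof -
        have e: "- (real k - j / 2) = j / 2 + - real k" by simp
        show ?thesis by (simp only: e powr_add mult_ac)
      qed
      finally show "norm (norm x powr j *\<^sub>R f x) \<le> norm (C * (1 + (norm x)\<^sup>2) powr (- (real k - j / 2)))"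
        using C(1) by simp
    qed
  qed (use f in measurable)
next
  case False
  obtain k :: nat where k: "real k > DIM('a) / 2" using reals_Archimedean2 by blast
  from d[of k] obtain C where C: "C \<ge> 0" "\<And>x. norm (f x) \<le> C * (1 + (norm x)\<^sup>2) powr (- real k)" by auto
  have bd: "norm (f x) \<le> C" for x
  proof -
    have "(1 + (norm x)\<^sup>2) powr (- real k) \<le> 1 powr (- real k)" by (intro powr_mono2') auto
    then show ?thesis using C(1) C(2)[of x] mult_left_mono[of "(1 + (norm x)\<^sup>2) powr (- real k)" 1 C] by simp
  qed
  have "integrable lborel (\<lambda>x. norm (f x))"
  proof (rule Bochner_Integration.integrable_bound)
    show "integrable lborel (\<lambda>x::'a. C * (1 + (norm x)\<^sup>2) powr (- real k))"
      using k by (intro integrable_mult_right integrable_decay) auto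
  qed (use f C in \<open>auto\<close>)
  then have "integrable lborel (\<lambda>x. norm (0 - x) powr (- (- j)) * norm (f x))"
    using False j bd by (intro riesz_bound(1)[of "- j" _ C]) auto
  then show ?thesis
    by (rule Bochner_Integration.integrable_bound) (use f in \<open>auto simp: abs_mult\<close>)
qed

lemma schwartz_decay': "\<phi> \<in> schwartz_space \<Longrightarrow> \<exists>C\<ge>0. \<forall>x. norm (\<phi> x) \<le> C * (1 + (norm x)\<^sup>2) powr (- real k)"
  by (metis schwartz_decay)

lemma schwartz_integrable:
  fixes \<phi> :: "'a::euclidean_space \<Rightarrow> complex"
  assumes "\<phi> \<in> schwartz_space"
  shows "integrable lborel \<phi>"
proof -
  have 1: "integrable lborel (\<lambda>x. norm x powr 0 *\<^sub>R \<phi> x)"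
    by (intro integrable_of_decay schwartz_measurable schwartz_decay' assms) simp
  \<comment> \<open>Equality fails at the origin, where \<open>0 powr 0 = 0\<close>.\<close>
  have 2: "AE x in lborel. norm x powr 0 *\<^sub>R \<phi> x = \<phi> x"
    using AE_lborel_singleton[of 0] by eventually_elim simp
  show ?thesis
    by (rule integrable_cong_AE_imp[OF 1 _ 2]) (use schwartz_measurable[OF assms] in simp)
qed

lemma schwartz_bounded:
  assumes "\<phi> \<in> schwartz_space"
  obtains C where "C \<ge> 0" "\<And>x. norm (\<phi> x) \<le> C"
proof -
  obtain C where C: "C \<ge> 0" "\<And>x. norm (\<phi> x) \<le> C * (1 + (norm x)\<^sup>2) powr (- real 0)"
    using schwartz_decay'[OF assms, of 0] by blast
  have "norm (\<phi> x) \<le> C" for x using C(1) C(2)[of x] by (auto split: if_splits)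
  with C(1) show ?thesis by (rule that)
qed

section \<open>Integration by parts\<close>

text \<open>By translation invariance \<open>f (x + b) - f x\<close> has integral 0, and it is the
  integral of \<open>f' (x + s b)\<close> over \<open>s\<close> in \<open>[0, 1]\<close>. Fubini and
  translation invariance again turn this into the integral of \<open>f'\<close>. Integrability of
  \<open>f\<close> and \<open>f'\<close> thus takes the place of vanishing boundary terms.\<close>

lemma integral_derivative_zero:
  fixes f f' :: "'a::euclidean_space \<Rightarrow> complex"
  assumes d: "\<And>x. ((\<lambda>t. f (x + t *\<^sub>R b)) has_vector_derivative f' x) (at 0)"
    and c: "continuous_on UNIV f'" and i: "integrable lborel f" "integrable lborel f'"
  shows "(\<integral>x. f' x \<partial>lborel) = 0"
proof -
  note [measurable] = borel_measurable_continuous_onI[OF c]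
  have d': "((\<lambda>t. f (x + t *\<^sub>R b)) has_vector_derivative f' (x + s *\<^sub>R b)) (at s)" for x s
  proof -
    have "((\<lambda>t. f ((x + s *\<^sub>R b) + (t - s) *\<^sub>R b)) has_vector_derivative (1 *\<^sub>R f' (x + s *\<^sub>R b))) (at s)"
      using d[of "x + s *\<^sub>R b"]
      by (intro vector_diff_chain_at[of "\<lambda>t. t - s" 1 s "\<lambda>t. f ((x + s *\<^sub>R b) + t *\<^sub>R b)", unfolded o_def])
         (auto intro!: derivative_eq_intros simp: has_vector_derivative_def)
    then show ?thesis by (simp add: algebra_simps)
  qed
  have ftc: "has_bochner_integral lborel (\<lambda>s. indicator {0..1} s *\<^sub>R f' (x + s *\<^sub>R b)) (f (x + b) - f x)" for x
  proof -
    have "has_bochner_integral lborel (\<lambda>s. indicator {0..1} s *\<^sub>R f' (x + s *\<^sub>R b)) (f (x + 1 *\<^sub>R b) - f (x + 0 *\<^sub>R b))"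
      by (rule has_bochner_integral_FTC_Icc)
         (auto intro!: has_vector_derivative_at_within d' continuous_on_compose2[OF c] continuous_intros)
    then show ?thesis by simp
  qed
  have *: "(\<integral>x. norm (indicator {0..1::real} s *\<^sub>R f' (x + s *\<^sub>R b)) \<partial>lborel) = indicator {0..1} s * (\<integral>x. norm (f' x) \<partial>lborel)" for s
    using integral_lborel_shift'[of "\<lambda>x. norm (f' x)" "s *\<^sub>R b"] by simp
  have int: "integrable (lborel \<Otimes>\<^sub>M lborel) (\<lambda>(s, x). indicator {0..1::real} s *\<^sub>R f' (x + s *\<^sub>R b))"
    by (rule lborel_pair.Fubini_integrable)
       (auto simp: * i integrable_lborel_shift' simp del: norm_scaleR)
  have "0 = (\<integral>x. f (x + b) - f x \<partial>lborel)"
    using i by (simp add: integral_lborel_shift' integrable_lborel_shift')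
  also have "\<dots> = (\<integral>x. (\<integral>s. indicator {0..1::real} s *\<^sub>R f' (x + s *\<^sub>R b) \<partial>lborel) \<partial>lborel)"
    using ftc by (simp add: has_bochner_integral_iff)
  also have "\<dots> = (\<integral>s. (\<integral>x. indicator {0..1::real} s *\<^sub>R f' (x + s *\<^sub>R b) \<partial>lborel) \<partial>lborel)"
    using lborel_pair.Fubini_integral[OF int] by simp
  also have "\<dots> = (\<integral>s. indicator {0..1::real} s *\<^sub>R (\<integral>x. f' x \<partial>lborel) \<partial>lborel)"
    by (simp add: integral_lborel_shift')
  also have "\<dots> = (\<integral>x. f' x \<partial>lborel)" by simp
  finally show ?thesis by simp
qed

section \<open>The Fourier transform\<close>

lemma fubini_dominated:
  fixes h :: "'a::euclidean_space \<Rightarrow> 'b::euclidean_space \<Rightarrow> 'c::{banach, second_countable_topology}"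
  assumes h: "case_prod h \<in> borel_measurable (borel \<Otimes>\<^sub>M borel)"
    and f: "integrable lborel f" and g: "integrable lborel g"
    and le: "\<And>x y. norm (h x y) \<le> f x * g y"
  shows "(\<integral>y. (\<integral>x. h x y \<partial>lborel) \<partial>lborel) = (\<integral>x. (\<integral>y. h x y \<partial>lborel) \<partial>lborel)"
proof (rule lborel_pair.Fubini_integral)
  have h': "case_prod h \<in> borel_measurable (lborel \<Otimes>\<^sub>M lborel)" using h by simp
  note [measurable] = borel_measurable_integrable[OF f] borel_measurable_integrable[OF g] h'
  have int: "integrable lborel (\<lambda>y. h x y)" for x
    by (rule Bochner_Integration.integrable_bound[of _ "\<lambda>y. f x * g y"])
       (use g le in \<open>auto intro!: AE_I2 order_trans[OF le]\<close>)
  show "integrable (lborel \<Otimes>\<^sub>M lborel) (case_prod h)"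
  proof (rule lborel_pair.Fubini_integrable)
    show "integrable lborel (\<lambda>x. \<integral>y. norm (case_prod h (x, y)) \<partial>lborel)"
    proof (rule Bochner_Integration.integrable_bound)
      show "integrable lborel (\<lambda>x. f x * (\<integral>y. g y \<partial>lborel))" using f by simp
      show "AE x in lborel. norm (\<integral>y. norm (case_prod h (x, y)) \<partial>lborel) \<le> norm (f x * (\<integral>y. g y \<partial>lborel))"
      proof (rule AE_I2)
        fix x
        have "norm (\<integral>y. norm (h x y) \<partial>lborel) = (\<integral>y. norm (h x y) \<partial>lborel)" by simp
        also have "\<dots> \<le> (\<integral>y. f x * g y \<partial>lborel)"
          using int g le by (intro integral_mono) auto
        finally show "norm (\<integral>y. norm (case_prod h (x, y)) \<partial>lborel) \<le> norm (f x * (\<integral>y. g y \<partial>lborel))" by simp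
      qed
    qed measurable
  qed (use h' int in auto)
qed

text \<open>Tonelli's criterion in the form used for all singular kernels below. The hypotheses hold
  only almost everywhere in \<open>x\<close>, since kernels such as \<open>ln |x - y|\<close> have
  one exceptional point.\<close>

lemma fubini_iterated:
  fixes h :: "'a::euclidean_space \<Rightarrow> 'b::euclidean_space \<Rightarrow> 'c::{banach, second_countable_topology}"
  assumes h: "case_prod h \<in> borel_measurable (borel \<Otimes>\<^sub>M borel)"
    and i: "AE x in lborel. integrable lborel (h x)"
    and g: "integrable lborel g" "AE x in lborel. (\<integral>y. norm (h x y) \<partial>lborel) \<le> g x"
  shows "integrable (lborel \<Otimes>\<^sub>M lborel) (case_prod h)"
    and "(\<integral>y. (\<integral>x. h x y \<partial>lborel) \<partial>lborel) = (\<integral>x. (\<integral>y. h x y \<partial>lborel) \<partial>lborel)"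
    and "integrable lborel (\<lambda>x. \<integral>y. h x y \<partial>lborel)"
    and "integrable lborel (\<lambda>y. \<integral>x. h x y \<partial>lborel)"
    and "AE y in lborel. integrable lborel (\<lambda>x. h x y)"
proof -
  have h': "case_prod h \<in> borel_measurable (lborel \<Otimes>\<^sub>M lborel)" using h by simp
  note [measurable] = h'
  show int: "integrable (lborel \<Otimes>\<^sub>M lborel) (case_prod h)"
  proof (rule lborel_pair.Fubini_integrable)
    show "integrable lborel (\<lambda>x. \<integral>y. norm (case_prod h (x, y)) \<partial>lborel)"
    proof (rule Bochner_Integration.integrable_bound[OF g(1)])
      show "AE x in lborel. norm (\<integral>y. norm (case_prod h (x, y)) \<partial>lborel) \<le> norm (g x)"
        using g(2) by eventually_elim (auto intro: order_trans)
    qed measurable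
  qed (use h' i in auto)
  show "(\<integral>y. (\<integral>x. h x y \<partial>lborel) \<partial>lborel) = (\<integral>x. (\<integral>y. h x y \<partial>lborel) \<partial>lborel)"
    by (rule lborel_pair.Fubini_integral[OF int])
  show "integrable lborel (\<lambda>x. \<integral>y. h x y \<partial>lborel)"
    using lborel_pair.integrable_fst[OF int] by simp
  show "integrable lborel (\<lambda>y. \<integral>x. h x y \<partial>lborel)"
    using lborel_pair.integrable_snd[OF int] by simp
  show "AE y in lborel. integrable lborel (\<lambda>x. h x y)"
    using lborel_pair.AE_integrable_snd[OF int] by simp
qed

lemma fourier_transform_lborel:
  assumes "\<phi> \<in> borel_measurable borel"
  shows "fourier_transform \<phi> \<xi> = (\<integral>x. cis (- (x \<bullet> \<xi>)) * \<phi> x \<partial>lborel)"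
proof -
  note [measurable] = assms
  show ?thesis unfolding fourier_transform_def by (rule integral_completion) measurable
qed

lemma integrable_cis_mult:
  fixes f :: "'a::euclidean_space \<Rightarrow> complex"
  assumes "integrable lborel f"
  shows "integrable lborel (\<lambda>x. cis (x \<bullet> y) * f x)" "integrable lborel (\<lambda>x. cis (y \<bullet> x) * f x)"
    "integrable lborel (\<lambda>x. cis (- (x \<bullet> y)) * f x)"
proof -
  note [measurable] = borel_measurable_integrable[OF assms]
  show "integrable lborel (\<lambda>x. cis (x \<bullet> y) * f x)" "integrable lborel (\<lambda>x. cis (y \<bullet> x) * f x)"
    "integrable lborel (\<lambda>x. cis (- (x \<bullet> y)) * f x)"
    by (rule Bochner_Integration.integrable_bound[OF assms]; simp add: norm_mult)+
qed

lemma fourier_transform_measurable [measurable]: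
  assumes "\<phi> \<in> borel_measurable borel"
  shows "fourier_transform \<phi> \<in> borel_measurable borel"
proof -
  note [measurable] = assms
  have "(\<lambda>\<xi>. \<integral>x. cis (- (x \<bullet> \<xi>)) * \<phi> x \<partial>lborel) \<in> borel_measurable borel"
    by measurable
  then show ?thesis by (simp add: fourier_transform_lborel[OF assms, abs_def])
qed

lemma norm_fourier_transform_le:
  assumes "integrable lborel \<phi>"
  shows "norm (fourier_transform \<phi> \<xi>) \<le> (\<integral>x. norm (\<phi> x) \<partial>lborel)"
proof -
  have "norm (\<integral>x. cis (- (x \<bullet> \<xi>)) * \<phi> x \<partial>lborel) \<le> (\<integral>x. norm (cis (- (x \<bullet> \<xi>)) * \<phi> x) \<partial>lborel)"
    by (rule integral_norm_bound)
  then show ?thesis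
    using borel_measurable_integrable[OF assms] by (simp add: fourier_transform_lborel norm_mult)
qed

lemma fourier_transform_partial_deriv:
  assumes \<phi>: "\<phi> \<in> schwartz_space" and b: "b \<in> Basis"
  shows "fourier_transform (partial_deriv b \<phi>) \<xi> = \<i> * (\<xi> \<bullet> b) * fourier_transform \<phi> \<xi>"
proof -
  note \<phi>' = schwartz_partial_deriv[OF \<phi> b]
  note i = schwartz_integrable[OF \<phi>] schwartz_integrable[OF \<phi>']
  define f' where "f' = (\<lambda>x. cis (- (x \<bullet> \<xi>)) * partial_deriv b \<phi> x - \<i> * (\<xi> \<bullet> b) * (cis (- (x \<bullet> \<xi>)) * \<phi> x))"
  have "(\<integral>x. f' x \<partial>lborel) = 0"
  proof (rule integral_derivative_zero)
    fix x :: 'a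
    have 1: "((\<lambda>t. \<phi> (x + t *\<^sub>R b)) has_vector_derivative partial_deriv b \<phi> x) (at 0)"
      using has_vector_derivative_partial[of \<phi> x 0 b] smooth_differentiable[OF schwartz_smooth[OF \<phi>]] by simp
    have 2: "((\<lambda>t. cis (- ((x + t *\<^sub>R b) \<bullet> \<xi>))) has_vector_derivative (- (\<i> * (\<xi> \<bullet> b)) * cis (- (x \<bullet> \<xi>)))) (at 0)"
    proof -
      define \<alpha> \<beta> where "\<alpha> = - (x \<bullet> \<xi>)" and "\<beta> = - (\<xi> \<bullet> b)"
      have "((\<lambda>z. exp (\<i> * (complex_of_real \<alpha> + z * complex_of_real \<beta>))) has_field_derivative
          exp (\<i> * (complex_of_real \<alpha> + complex_of_real 0 * complex_of_real \<beta>)) * (\<i> * complex_of_real \<beta>)) (at (complex_of_real 0))"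
        by (auto intro!: derivative_eq_intros)
      from has_vector_derivative_real_field[OF this]
      have "((\<lambda>t. cis (\<alpha> + t * \<beta>)) has_vector_derivative cis \<alpha> * (\<i> * complex_of_real \<beta>)) (at 0)"
        by (simp add: cis_conv_exp)
      moreover have "\<alpha> + t * \<beta> = - ((x + t *\<^sub>R b) \<bullet> \<xi>)" for t
        unfolding \<alpha>_def \<beta>_def inner_add_left inner_scaleR_left by (simp add: inner_commute)
      ultimately show ?thesis by (simp add: \<alpha>_def \<beta>_def mult_ac)
    qed
    show "((\<lambda>t. cis (- ((x + t *\<^sub>R b) \<bullet> \<xi>)) * \<phi> (x + t *\<^sub>R b)) has_vector_derivative f' x) (at 0)"
      using has_vector_derivative_mult[OF 2 1] by (simp add: f'_def algebra_simps)
  next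
    show "continuous_on UNIV f'" unfolding f'_def
      by (intro continuous_intros smooth_continuous schwartz_smooth \<phi> \<phi>')
  next
    show "integrable lborel (\<lambda>x. cis (- (x \<bullet> \<xi>)) * \<phi> x)" by (rule integrable_cis_mult(3)[OF i(1)])
    show "integrable lborel f'" unfolding f'_def
      by (intro Bochner_Integration.integrable_diff integrable_mult_right integrable_cis_mult(3)[OF i(1)] integrable_cis_mult(3)[OF i(2)])
  qed
  then have "(\<integral>x. cis (- (x \<bullet> \<xi>)) * partial_deriv b \<phi> x \<partial>lborel) - \<i> * (\<xi> \<bullet> b) * (\<integral>x. cis (- (x \<bullet> \<xi>)) * \<phi> x \<partial>lborel) = 0"
    unfolding f'_def using i
    by (subst (asm) Bochner_Integration.integral_diff) (auto intro!: integrable_cis_mult integrable_mult_right)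
  then show ?thesis
    using schwartz_measurable[OF \<phi>] schwartz_measurable[OF \<phi>'] by (simp add: fourier_transform_lborel)
qed

lemma fourier_transform_nlap:
  assumes \<phi>: "\<phi> \<in> schwartz_space"
  shows "fourier_transform (\<lambda>x. - laplacian \<phi> x) \<xi> = (norm \<xi>)\<^sup>2 * fourier_transform \<phi> \<xi>"
proof -
  let ?D = "\<lambda>b. partial_deriv b (partial_deriv b \<phi>)"
  have D: "?D b \<in> schwartz_space" if "b \<in> Basis" for b
    by (intro schwartz_partial_deriv \<phi> that)
  have "fourier_transform (\<lambda>x. - laplacian \<phi> x) \<xi> = (\<integral>x. - (\<Sum>b\<in>Basis. cis (- (x \<bullet> \<xi>)) * ?D b x) \<partial>lborel)"
    using schwartz_measurable[OF schwartz_nlap[OF \<phi>]]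
    by (simp add: fourier_transform_lborel laplacian_def sum_distrib_left)
  also have "\<dots> = - (\<Sum>b\<in>Basis. \<integral>x. cis (- (x \<bullet> \<xi>)) * ?D b x \<partial>lborel)"
    by (simp only: integral_minus)
       (subst Bochner_Integration.integral_sum, rule integrable_cis_mult(3)[OF schwartz_integrable[OF D]], simp_all)
  also have "\<dots> = - (\<Sum>b\<in>Basis. fourier_transform (?D b) \<xi>)"
    by (simp add: fourier_transform_lborel[OF schwartz_measurable[OF D]])
  also have "\<dots> = - (\<Sum>b\<in>Basis. (\<i> * (\<xi> \<bullet> b))\<^sup>2 * fourier_transform \<phi> \<xi>)"
    using \<phi> by (simp add: fourier_transform_partial_deriv schwartz_partial_deriv power2_eq_square mult.assoc)
  also have "\<dots> = (norm \<xi>)\<^sup>2 * fourier_transform \<phi> \<xi>"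
    by (simp add: power_mult_distrib sum_negf sum_distrib_right[symmetric] norm_sq_sum_Basis)
  finally show ?thesis .
qed

lemma fourier_transform_nlap_power:
  assumes \<phi>: "\<phi> \<in> schwartz_space"
  shows "fourier_transform (((\<lambda>\<psi> x. - laplacian \<psi> x) ^^ m) \<phi>) \<xi> = norm \<xi> ^ (2 * m) * fourier_transform \<phi> \<xi>"
proof (induction m)
  case (Suc m)
  show ?case
    using fourier_transform_nlap[OF schwartz_nlap_power[OF \<phi>, of m], of \<xi>] Suc
    by (simp add: power2_eq_square mult.assoc)
qed simp

lemma fourier_transform_add:
  assumes "integrable lborel f" "integrable lborel g"
  shows "fourier_transform (\<lambda>x. f x + g x) \<xi> = fourier_transform f \<xi> + fourier_transform g \<xi>"
  using assms borel_measurable_integrable[OF assms(1)] borel_measurable_integrable[OF assms(2)]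
  by (simp add: fourier_transform_lborel distrib_left integrable_cis_mult)

text \<open>The operator \<open>\<phi> \<mapsto> \<phi> - \<Delta>\<phi>\<close> has symbol \<open>1 + |\<xi>|\<^sup>2\<close>, so its powers give decay of every order.\<close>

lemma fourier_transform_decay:
  assumes \<phi>: "\<phi> \<in> schwartz_space"
  shows "\<exists>C\<ge>0. \<forall>\<xi>. norm (fourier_transform \<phi> \<xi>) \<le> C * (1 + (norm \<xi>)\<^sup>2) powr (- real k)"
  using \<phi>
proof (induction k arbitrary: \<phi>)
  case 0
  show ?case
  proof (intro exI conjI allI)
    fix \<xi> :: 'a
    have "(1 + (norm \<xi>)\<^sup>2) powr (- real 0) = 1" by (simp add: add_pos_nonneg less_imp_neq[symmetric])
    then show "norm (fourier_transform \<phi> \<xi>) \<le> (\<integral>x. norm (\<phi> x) \<partial>lborel) * (1 + (norm \<xi>)\<^sup>2) powr (- real 0)"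
      using norm_fourier_transform_le[OF schwartz_integrable[OF 0]] by simp
  qed simp
next
  case (Suc k)
  let ?\<psi> = "\<lambda>x. \<phi> x + - laplacian \<phi> x"
  have "?\<psi> \<in> schwartz_space" by (intro schwartz_add schwartz_nlap Suc.prems)
  from Suc.IH[OF this] obtain C where C: "C \<ge> 0"
    "\<And>\<xi>. norm (fourier_transform ?\<psi> \<xi>) \<le> C * (1 + (norm \<xi>)\<^sup>2) powr (- real k)" by auto
  show ?case
  proof (intro exI[of _ C] conjI allI C(1))
    fix \<xi> :: 'a
    have pos: "0 < 1 + (norm \<xi>)\<^sup>2" by (simp add: add_pos_nonneg)
    have "fourier_transform ?\<psi> \<xi> = complex_of_real (1 + (norm \<xi>)\<^sup>2) * fourier_transform \<phi> \<xi>"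
      by (simp only: fourier_transform_add[OF schwartz_integrable[OF Suc.prems] schwartz_integrable[OF schwartz_nlap[OF Suc.prems]]]
          fourier_transform_nlap[OF Suc.prems] distrib_right of_real_add of_real_1 mult_1_left)
    then have "(1 + (norm \<xi>)\<^sup>2) * norm (fourier_transform \<phi> \<xi>) \<le> C * (1 + (norm \<xi>)\<^sup>2) powr (- real k)"
      using C(2)[of \<xi>] pos by (simp only: norm_mult norm_of_real abs_of_pos)
    then have "norm (fourier_transform \<phi> \<xi>) \<le> C * (1 + (norm \<xi>)\<^sup>2) powr (- real k) / (1 + (norm \<xi>)\<^sup>2)"
      using pos by (simp only: pos_le_divide_eq mult.commute)
    also have "\<dots> = C * (1 + (norm \<xi>)\<^sup>2) powr (- real (Suc k))"
    proof -
      have e: "- real (Suc k) = - real k - 1" by simp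
      show ?thesis using pos by (simp only: e powr_diff powr_one times_divide_eq_right)
    qed
    finally show "norm (fourier_transform \<phi> \<xi>) \<le> C * (1 + (norm \<xi>)\<^sup>2) powr (- real (Suc k))" .
  qed
qed

lemma integrable_powr_fourier_transform:
  assumes "\<phi> \<in> schwartz_space" "j > - real DIM('a)"
  shows "integrable lborel (\<lambda>\<xi>::'a::euclidean_space. norm \<xi> powr j *\<^sub>R fourier_transform \<phi> \<xi>)"
  by (intro integrable_of_decay fourier_transform_measurable schwartz_measurable fourier_transform_decay assms)

lemma integrable_fourier_transform:
  assumes "\<phi> \<in> schwartz_space"
  shows "integrable lborel (fourier_transform \<phi>)"
proof -
  have 1: "integrable lborel (\<lambda>\<xi>. norm \<xi> powr 0 *\<^sub>R fourier_transform \<phi> \<xi>)"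
    by (intro integrable_powr_fourier_transform assms) simp
  have 2: "AE \<xi> in lborel. norm \<xi> powr 0 *\<^sub>R fourier_transform \<phi> \<xi> = fourier_transform \<phi> \<xi>"
    using AE_lborel_singleton[of 0] by eventually_elim simp
  show ?thesis
    by (rule integrable_cong_AE_imp[OF 1 _ 2]) (use fourier_transform_measurable[OF schwartz_measurable[OF assms]] in simp)
qed

section \<open>Heat kernel and Fourier inversion\<close>

definition heat :: "real \<Rightarrow> 'a::euclidean_space \<Rightarrow> real" where
  "heat s z = (4 * pi * s) powr (- (DIM('a) / 2)) * exp (- ((norm z)\<^sup>2 / (4 * s)))"

definition inv_fourier :: "('a::euclidean_space \<Rightarrow> complex) \<Rightarrow> 'a \<Rightarrow> complex" where
  "inv_fourier g x = (\<integral>\<xi>. cis (x \<bullet> \<xi>) * g \<xi> \<partial>lborel) / (2 * pi) ^ DIM('a)"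

lemma heat_nonneg [simp]: "heat s z \<ge> 0"
  by (simp add: heat_def)

lemma heat_measurable [measurable]: "heat s \<in> borel_measurable borel"
  unfolding heat_def[abs_def] by measurable

lemma heat_minus_commute: "heat s (x - y) = heat s (y - x)"
  by (simp add: heat_def norm_minus_commute)

lemma heat_fourier:
  assumes "s > 0"
  shows "integrable lborel (\<lambda>z::'a::euclidean_space. heat s z)"
    and "(\<integral>z. heat s (z::'a) \<partial>lborel) = 1"
    and "(\<integral>z. cis (z \<bullet> \<xi>) * heat s (z::'a) \<partial>lborel) = exp (- (s * (norm \<xi>)\<^sup>2))"
    and "(\<integral>\<xi>. cis (\<xi> \<bullet> x) * exp (- (s * (norm (\<xi>::'a))\<^sup>2)) \<partial>lborel) = (2 * pi) ^ DIM('a) * heat s x"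
proof -
  let ?a = "1 / (4 * s)" and ?n = "real DIM('a)"
  have a: "?a > 0" using assms by simp
  have h: "heat s z = (4 * pi * s) powr (- (?n / 2)) * exp (- (?a * (norm z)\<^sup>2))" for z :: 'a
    by (simp add: heat_def)
  have pa: "pi / ?a = 4 * pi * s" by simp
  show "integrable lborel (\<lambda>z::'a. heat s z)"
    unfolding h by (intro integrable_mult_right gaussian_integral a)
  have c: "(4 * pi * s) powr (- (?n / 2)) * (4 * pi * s) powr (?n / 2) = 1"
    using assms by (simp add: powr_minus)
  show "(\<integral>z. heat s (z::'a) \<partial>lborel) = 1"
    unfolding h by (subst integral_mult_right_zero) (simp only: gaussian_integral(2)[OF a] pa c)
  have "(\<integral>z. cis (z \<bullet> \<xi>) * heat s (z::'a) \<partial>lborel)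
      = (\<integral>z. complex_of_real ((4 * pi * s) powr (- (?n / 2))) * (cis (z \<bullet> \<xi>) * exp (- (?a * (norm z)\<^sup>2))) \<partial>lborel)"
    unfolding h by (intro Bochner_Integration.integral_cong) (simp_all only: of_real_mult mult_ac)
  also have "\<dots> = complex_of_real ((4 * pi * s) powr (- (?n / 2)) * (4 * pi * s) powr (?n / 2) * exp (- ((norm \<xi>)\<^sup>2 / (4 * ?a))))"
    by (subst integral_mult_right_zero) (simp only: gaussian_fourier(2)[OF a] pa of_real_mult mult.assoc)
  also have "\<dots> = exp (- (s * (norm \<xi>)\<^sup>2))" unfolding c using assms by (simp add: mult.commute)
  finally show "(\<integral>z. cis (z \<bullet> \<xi>) * heat s (z::'a) \<partial>lborel) = exp (- (s * (norm \<xi>)\<^sup>2))" .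
  have "(pi / s) powr (?n / 2) = (2 * pi) ^ DIM('a) * (4 * pi * s) powr (- (?n / 2))"
  proof -
    have "(2 * pi) ^ DIM('a) = (4 * pi\<^sup>2) powr (?n / 2)"
    proof -
      have "4 * pi\<^sup>2 = (2 * pi) powr 2" by (simp add: power_mult_distrib)
      then have "(4 * pi\<^sup>2) powr (?n / 2) = ((2 * pi) powr 2) powr (?n / 2)" by (simp only:)
      also have "\<dots> = (2 * pi) powr ?n" by (simp only: powr_powr) simp
      also have "\<dots> = (2 * pi) ^ DIM('a)" by (rule powr_realpow) simp
      finally show ?thesis by simp
    qed
    moreover have "(4 * pi * s) powr (- (?n / 2)) = (1 / (4 * pi * s)) powr (?n / 2)"
      using assms by (simp add: powr_minus powr_divide inverse_eq_divide)
    moreover have "(4 * pi\<^sup>2) powr (?n / 2) * (1 / (4 * pi * s)) powr (?n / 2) = (4 * pi\<^sup>2 * (1 / (4 * pi * s))) powr (?n / 2)"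
      using assms by (intro powr_mult[symmetric])
    moreover have "4 * pi\<^sup>2 * (1 / (4 * pi * s)) = pi / s" by (simp add: power2_eq_square)
    ultimately show ?thesis by simp
  qed
  then show "(\<integral>\<xi>. cis (\<xi> \<bullet> x) * exp (- (s * (norm (\<xi>::'a))\<^sup>2)) \<partial>lborel) = (2 * pi) ^ DIM('a) * heat s x"
    by (subst gaussian_fourier(2)[OF assms]) (simp add: heat_def)
qed

lemma heat_bounded:
  assumes "s > 0"
  shows "heat s (z::'a::euclidean_space) \<le> (4 * pi * s) powr (- (DIM('a) / 2))"
  using assms by (simp add: heat_def mult_left_le)

text \<open>The Gaussian factor makes the double integral absolutely convergent for every integrable
  \<open>f\<close>, and its inverse transform is the heat kernel. This is the heat semigroup seen
  from both sides; it yields the inversion theorem and every kernel representation that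
  follows.\<close>

lemma inv_fourier_gauss_fourier_transform:
  fixes f :: "'a::euclidean_space \<Rightarrow> complex"
  assumes f: "integrable lborel f" and s: "s > 0"
  shows "inv_fourier (\<lambda>\<xi>. exp (- (s * (norm \<xi>)\<^sup>2)) * fourier_transform f \<xi>) y = (\<integral>x. heat s (x - y) * f x \<partial>lborel)"
proof -
  note [measurable] = borel_measurable_integrable[OF f]
  let ?g = "\<lambda>\<xi>::'a. exp (- (s * (norm \<xi>)\<^sup>2))"
  have g: "integrable lborel ?g" by (rule gaussian_integral(1)[OF s])
  have eq: "cis (y \<bullet> \<xi>) * (complex_of_real (?g \<xi>) * (cis (- (x \<bullet> \<xi>)) * f x)) = f x * (cis (\<xi> \<bullet> (y - x)) * complex_of_real (?g \<xi>))"
    for x \<xi>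
    by (simp add: inner_diff_right inner_commute cis_mult[symmetric] cis_divide[symmetric] divide_inverse cis_inverse mult_ac
        del: cis_mult)
  have "(\<integral>\<xi>. cis (y \<bullet> \<xi>) * (?g \<xi> * fourier_transform f \<xi>) \<partial>lborel)
      = (\<integral>\<xi>. (\<integral>x. cis (y \<bullet> \<xi>) * (complex_of_real (?g \<xi>) * (cis (- (x \<bullet> \<xi>)) * f x)) \<partial>lborel) \<partial>lborel)"
    by (simp add: fourier_transform_lborel)
  also have "\<dots> = (\<integral>x. (\<integral>\<xi>. cis (y \<bullet> \<xi>) * (complex_of_real (?g \<xi>) * (cis (- (x \<bullet> \<xi>)) * f x)) \<partial>lborel) \<partial>lborel)"
    using g f by (intro fubini_dominated[symmetric, where f="?g" and g="\<lambda>x. norm (f x)"]) (auto simp: norm_mult)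
  also have "\<dots> = (\<integral>x. f x * ((2 * pi) ^ DIM('a) * heat s (y - x)) \<partial>lborel)"
    unfolding eq by (simp add: heat_fourier(4)[OF s])
  also have "\<dots> = (\<integral>x. (2 * pi) ^ DIM('a) * (heat s (x - y) * f x) \<partial>lborel)"
    by (simp add: heat_minus_commute[of s y] mult_ac)
  finally show ?thesis by (simp add: inv_fourier_def)
qed

text \<open>The companion statement for a function given by an integrable transform. It is needed
  for \<open>half_laplacian \<phi>\<close>, which is known through its Fourier side and need not be
  a Schwartz function.\<close>

lemma integral_heat_inv_fourier:
  fixes g :: "'a::euclidean_space \<Rightarrow> complex"
  assumes g: "integrable lborel g" and s: "s > 0"
  shows "(\<integral>x. heat s (x - y) * inv_fourier g x \<partial>lborel) = inv_fourier (\<lambda>\<xi>. exp (- (s * (norm \<xi>)\<^sup>2)) * g \<xi>) y"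
proof -
  note [measurable] = borel_measurable_integrable[OF g]
  have h: "integrable lborel (\<lambda>x::'a. heat s (x - y))"
    using heat_fourier(1)[OF s] by (simp add: integrable_lborel_shift)
  have "(\<integral>x. heat s (x - y) * inv_fourier g x \<partial>lborel)
      = (\<integral>x. (\<integral>\<xi>. complex_of_real (heat s (x - y)) * (cis (x \<bullet> \<xi>) * g \<xi>) \<partial>lborel) \<partial>lborel) / (2 * pi) ^ DIM('a)"
    by (simp add: inv_fourier_def)
  also have "(\<integral>x. (\<integral>\<xi>. complex_of_real (heat s (x - y)) * (cis (x \<bullet> \<xi>) * g \<xi>) \<partial>lborel) \<partial>lborel)
      = (\<integral>\<xi>. (\<integral>x. complex_of_real (heat s (x - y)) * (cis (x \<bullet> \<xi>) * g \<xi>) \<partial>lborel) \<partial>lborel)"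
    using g h by (intro fubini_dominated[symmetric, where f="\<lambda>x. heat s (x - y)" and g="\<lambda>x. norm (g x)"]) (auto simp: norm_mult)
  also have "\<dots> = (\<integral>\<xi>. cis (y \<bullet> \<xi>) * (exp (- (s * (norm \<xi>)\<^sup>2)) * g \<xi>) \<partial>lborel)"
  proof (rule Bochner_Integration.integral_cong)
    fix \<xi> :: 'a
    have "(\<integral>x. complex_of_real (heat s (x - y)) * (cis (x \<bullet> \<xi>) * g \<xi>) \<partial>lborel)
       = (\<integral>x. (cis (y \<bullet> \<xi>) * g \<xi>) * (cis ((x - y) \<bullet> \<xi>) * complex_of_real (heat s (x - y))) \<partial>lborel)"
      by (intro Bochner_Integration.integral_cong) (auto simp: inner_diff_left cis_divide[symmetric])
    also have "\<dots> = (cis (y \<bullet> \<xi>) * g \<xi>) * (\<integral>x. cis (x \<bullet> \<xi>) * complex_of_real (heat s x) \<partial>lborel)"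
      using integral_lborel_shift[of "\<lambda>x. cis (x \<bullet> \<xi>) * complex_of_real (heat s x)" y] by simp
    finally show "(\<integral>x. complex_of_real (heat s (x - y)) * (cis (x \<bullet> \<xi>) * g \<xi>) \<partial>lborel)
        = cis (y \<bullet> \<xi>) * (exp (- (s * (norm \<xi>)\<^sup>2)) * g \<xi>)"
      by (simp add: heat_fourier(3)[OF s])
  qed simp
  finally show ?thesis by (simp add: inv_fourier_def)
qed

lemma integral_lborel_scale:
  fixes f :: "'a::euclidean_space \<Rightarrow> complex"
  assumes f: "f \<in> borel_measurable borel" and c: "c > 0"
  shows "(\<integral>x. f x \<partial>lborel) = (\<integral>z. c ^ DIM('a) *\<^sub>R f (y + c *\<^sub>R z) \<partial>lborel)"
proof -
  note [measurable] = f
  have "(\<integral>x. f x \<partial>lborel) = (\<integral>x. f x \<partial>density (distr lborel borel (\<lambda>z. y + c *\<^sub>R z)) (\<lambda>_. ennreal (c ^ DIM('a))))"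
    using lborel_affine[of c y] c by simp
  also have "\<dots> = (\<integral>z. c ^ DIM('a) *\<^sub>R f (y + c *\<^sub>R z) \<partial>lborel)"
    using c by (subst integral_density) (auto simp: integral_distr)
  finally show ?thesis .
qed

text \<open>The inverse transform regularised by \<open>exp (- s |\<xi>|^2)\<close> is followed as
  \<open>s\<close> tends to 0 in two ways. On the Fourier side dominated convergence gives the
  unregularised transform; in space it is the average of \<open>\<phi> (y + sqrt s z)\<close>
  against the fixed probability density \<open>heat 1\<close>, which tends to
  \<open>\<phi> y\<close>.\<close>

lemma fourier_inversion:
  fixes \<phi> :: "'a::euclidean_space \<Rightarrow> complex"
  assumes \<phi>: "\<phi> \<in> schwartz_space"
  shows "inv_fourier (fourier_transform \<phi>) y = \<phi> y"
proof -
  note [measurable] = schwartz_measurable[OF \<phi>]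
  define s where "s = (\<lambda>k::nat. inverse (real (Suc k)))"
  have s: "s k > 0" for k by (simp add: s_def)
  have s0: "s \<longlonglongrightarrow> 0" unfolding s_def by (rule LIMSEQ_inverse_real_of_nat)
  have F: "integrable lborel (\<lambda>\<xi>. norm (fourier_transform \<phi> \<xi>))"
    by (intro integrable_norm integrable_fourier_transform \<phi>)
  have "(\<lambda>k. \<integral>\<xi>. cis (y \<bullet> \<xi>) * (exp (- (s k * (norm \<xi>)\<^sup>2)) * fourier_transform \<phi> \<xi>) \<partial>lborel)
      \<longlonglongrightarrow> (\<integral>\<xi>. cis (y \<bullet> \<xi>) * fourier_transform \<phi> \<xi> \<partial>lborel)"
  proof (rule integral_dominated_convergence[OF _ _ F])
    show "AE \<xi> in lborel. (\<lambda>k. cis (y \<bullet> \<xi>) * (exp (- (s k * (norm \<xi>)\<^sup>2)) * fourier_transform \<phi> \<xi>)) \<longlonglongrightarrow> cis (y \<bullet> \<xi>) * fourier_transform \<phi> \<xi>"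
    proof (rule AE_I2)
      fix \<xi> :: 'a
      have "(\<lambda>k. cis (y \<bullet> \<xi>) * (complex_of_real (exp (- (s k * (norm \<xi>)\<^sup>2))) * fourier_transform \<phi> \<xi>))
          \<longlonglongrightarrow> cis (y \<bullet> \<xi>) * (complex_of_real (exp (- (0 * (norm \<xi>)\<^sup>2))) * fourier_transform \<phi> \<xi>)"
        by (intro tendsto_intros s0)
      then show "(\<lambda>k. cis (y \<bullet> \<xi>) * (exp (- (s k * (norm \<xi>)\<^sup>2)) * fourier_transform \<phi> \<xi>)) \<longlonglongrightarrow> cis (y \<bullet> \<xi>) * fourier_transform \<phi> \<xi>" by simp
    qed
    show "AE \<xi> in lborel. norm (cis (y \<bullet> \<xi>) * (exp (- (s k * (norm \<xi>)\<^sup>2)) * fourier_transform \<phi> \<xi>)) \<le> norm (fourier_transform \<phi> \<xi>)" for k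
      using s[of k] by (intro AE_I2) (simp add: norm_mult mult_left_le_one_le less_imp_le)
  qed measurable
  then have L: "(\<lambda>k. inv_fourier (\<lambda>\<xi>. exp (- (s k * (norm \<xi>)\<^sup>2)) * fourier_transform \<phi> \<xi>) y) \<longlonglongrightarrow> inv_fourier (fourier_transform \<phi>) y"
    unfolding inv_fourier_def by (intro tendsto_intros) simp_all
  have eq: "inv_fourier (\<lambda>\<xi>. exp (- (s k * (norm \<xi>)\<^sup>2)) * fourier_transform \<phi> \<xi>) y
      = (\<integral>z. heat 1 z * \<phi> (y + sqrt (s k) *\<^sub>R z) \<partial>lborel)" for k
  proof -
    have h: "sqrt (s k) ^ DIM('a) * heat (s k) (sqrt (s k) *\<^sub>R z) = heat 1 z" for z :: 'a
    proof -
      have "sqrt (s k) ^ DIM('a) = s k powr (DIM('a) / 2)"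
        using s[of k] by (simp add: powr_half_sqrt[symmetric] powr_powr powr_realpow[symmetric])
      then show ?thesis using s[of k]
        by (simp add: heat_def powr_mult powr_minus power_mult_distrib)
    qed
    have "inv_fourier (\<lambda>\<xi>. exp (- (s k * (norm \<xi>)\<^sup>2)) * fourier_transform \<phi> \<xi>) y = (\<integral>x. heat (s k) (x - y) * \<phi> x \<partial>lborel)"
      by (intro inv_fourier_gauss_fourier_transform schwartz_integrable \<phi> s)
    also have "\<dots> = (\<integral>z. sqrt (s k) ^ DIM('a) *\<^sub>R (heat (s k) (y + sqrt (s k) *\<^sub>R z - y) * \<phi> (y + sqrt (s k) *\<^sub>R z)) \<partial>lborel)"
      using s[of k] by (intro integral_lborel_scale) auto
    also have "\<dots> = (\<integral>z. heat 1 z * \<phi> (y + sqrt (s k) *\<^sub>R z) \<partial>lborel)"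
      by (simp add: scaleR_conv_of_real mult.assoc[symmetric] h flip: of_real_mult of_real_power)
    finally show ?thesis .
  qed
  obtain C where C: "C \<ge> 0" "\<And>x. norm (\<phi> x) \<le> C" using schwartz_bounded[OF \<phi>] by blast
  have "(\<lambda>k. \<integral>z. heat 1 z * \<phi> (y + sqrt (s k) *\<^sub>R z) \<partial>lborel) \<longlonglongrightarrow> (\<integral>z. heat 1 (z::'a) * \<phi> y \<partial>lborel)"
  proof (rule integral_dominated_convergence[where w="\<lambda>z. C * heat 1 z"])
    show "AE z in lborel. (\<lambda>k. heat 1 z * \<phi> (y + sqrt (s k) *\<^sub>R z)) \<longlonglongrightarrow> heat 1 z * \<phi> y"
    proof (rule AE_I2)
      fix z :: 'a
      have "(\<lambda>k. y + sqrt (s k) *\<^sub>R z) \<longlonglongrightarrow> y + sqrt 0 *\<^sub>R z" by (intro tendsto_intros s0)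
      moreover have "isCont \<phi> (y + sqrt 0 *\<^sub>R z)"
        using smooth_continuous[OF schwartz_smooth[OF \<phi>]] by (simp add: continuous_on_eq_continuous_at)
      ultimately have "(\<lambda>k. \<phi> (y + sqrt (s k) *\<^sub>R z)) \<longlonglongrightarrow> \<phi> (y + sqrt 0 *\<^sub>R z)"
        by (rule isCont_tendsto_compose[rotated])
      then show "(\<lambda>k. heat 1 z * \<phi> (y + sqrt (s k) *\<^sub>R z)) \<longlonglongrightarrow> heat 1 z * \<phi> y"
        by (intro tendsto_intros) simp
    qed
    show "integrable lborel (\<lambda>z::'a. C * heat 1 z)" by (intro integrable_mult_right heat_fourier) simp
    show "AE z in lborel. norm (heat 1 z * \<phi> (y + sqrt (s k) *\<^sub>R z)) \<le> C * heat 1 z" for k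
      using C(2) by (intro AE_I2) (simp add: norm_mult mult.commute[of C] mult_left_mono)
  qed measurable
  also have "(\<integral>z. heat 1 (z::'a) * \<phi> y \<partial>lborel) = \<phi> y"
    using heat_fourier(2)[of 1, where 'a='a] by simp
  finally have "(\<lambda>k. inv_fourier (\<lambda>\<xi>. exp (- (s k * (norm \<xi>)\<^sup>2)) * fourier_transform \<phi> \<xi>) y) \<longlonglongrightarrow> \<phi> y"
    by (simp add: eq)
  with L show ?thesis by (rule LIMSEQ_unique)
qed

section \<open>Logarithmic and Riesz kernels\<close>

text \<open>Separates the growth of \<open>ln\<close> at infinity from its singularity at 0 and
  majorises the latter by a Riesz kernel of order one. At \<open>a = 0\<close> all terms vanish
  through the defaults of \<open>ln\<close> and \<open>powr\<close>.\<close>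

lemma abs_ln_le:
  assumes "0 \<le> (a::real)"
  shows "\<bar>ln a\<bar> \<le> a + a powr (- 1)"
proof (cases "a = 0")
  case False
  then have a: "a > 0" using assms by simp
  have "ln a \<le> a - 1" using a by (rule ln_le_minus_one)
  moreover have "ln (inverse a) \<le> inverse a - 1" using a by (intro ln_le_minus_one) simp
  moreover have "ln (inverse a) = - ln a" "a powr (- 1) = inverse a" "inverse a > 0"
    using a by (simp_all add: ln_inverse powr_minus)
  ultimately show ?thesis using a by linarith
qed simp

lemma integrable_ln_mult:
  fixes f :: "'a::euclidean_space \<Rightarrow> 'b::{banach, second_countable_topology}"
  assumes n: "DIM('a) \<ge> 2" and f: "integrable lborel f" "\<And>x. norm (f x) \<le> B"
    and xf: "integrable lborel (\<lambda>x. norm x * norm (f x))"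
  shows "integrable lborel (\<lambda>x. ln (norm (x - y)) *\<^sub>R f x)"
proof (rule Bochner_Integration.integrable_bound)
  note [measurable] = borel_measurable_integrable[OF f(1)]
  have "integrable lborel (\<lambda>x. norm (y - x) powr (- 1) * norm (f x))"
    using n f by (intro riesz_bound(1)[of 1 _ B]) auto
  then show "integrable lborel (\<lambda>x. norm x * norm (f x) + norm y * norm (f x) + norm (y - x) powr (- 1) * norm (f x))"
    using f(1) xf by auto
  show "AE x in lborel. norm (ln (norm (x - y)) *\<^sub>R f x)
      \<le> norm (norm x * norm (f x) + norm y * norm (f x) + norm (y - x) powr (- 1) * norm (f x))"
  proof (rule AE_I2)
    fix x
    have "\<bar>ln (norm (x - y))\<bar> \<le> norm x + norm y + norm (y - x) powr (- 1)"
      using abs_ln_le[of "norm (x - y)"] norm_triangle_ineq4[of x y] by (simp add: norm_minus_commute)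
    from mult_right_mono[OF this norm_ge_zero[of "f x"]]
    show "norm (ln (norm (x - y)) *\<^sub>R f x)
      \<le> norm (norm x * norm (f x) + norm y * norm (f x) + norm (y - x) powr (- 1) * norm (f x))"
      by (simp add: distrib_right)
  qed
  show "(\<lambda>x. ln (norm (x - y)) *\<^sub>R f x) \<in> borel_measurable lborel" by measurable
qed

lemma log_exp_integral:
  fixes z :: "'a::euclidean_space"
  assumes "z \<noteq> 0"
  shows "has_bochner_integral lborel (\<lambda>r::real. exp (- ((norm z)\<^sup>2 * exp r)) - exp (- exp r)) (- 2 * ln (norm z))"
    and "has_bochner_integral lborel (\<lambda>r::real. \<bar>exp (- ((norm z)\<^sup>2 * exp r)) - exp (- exp r)\<bar>) (2 * \<bar>ln (norm z)\<bar>)"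
  using frullani[of "(norm z)\<^sup>2"] assms by (simp_all add: ln_realpow abs_mult)

text \<open>Subordination: by the Gamma integral the heat symbols
  \<open>exp (- exp r |\<xi>|^2)\<close> with weight \<open>exp (k r)\<close> add up to
  \<open>Gamma k\<close> times \<open>|\<xi>|^(-2k)\<close>. It is used with \<open>k = n/2\<close>
  for the logarithm and with \<open>k = 1/2\<close> for the Riesz kernel.\<close>

lemma exp_inv_fourier_integral:
  fixes g :: "'a::euclidean_space \<Rightarrow> complex"
  assumes k: "k > (0::real)" and g: "g \<in> borel_measurable borel"
    and i: "integrable lborel (\<lambda>\<xi>. norm \<xi> powr (- 2 * k) *\<^sub>R g \<xi>)"
  shows "has_bochner_integral lborel (\<lambda>r. complex_of_real (exp (k * r)) * inv_fourier (\<lambda>\<xi>. exp (- (exp r * (norm \<xi>)\<^sup>2)) * g \<xi>) y)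
    (complex_of_real (Gamma k) * inv_fourier (\<lambda>\<xi>. norm \<xi> powr (- 2 * k) *\<^sub>R g \<xi>) y)"
proof -
  note [measurable] = g
  define h where "h = (\<lambda>\<xi> r. complex_of_real (exp (k * r) * exp (- ((norm \<xi>)\<^sup>2 * exp r))) * (cis (y \<bullet> \<xi>) * g \<xi>))"
  have G: "has_bochner_integral lborel (\<lambda>r. exp (k * r) * exp (- ((norm \<xi>)\<^sup>2 * exp r))) (Gamma k * norm \<xi> powr (- 2 * k))"
    if "\<xi> \<noteq> 0" for \<xi> :: 'a
  proof -
    have "((norm \<xi>)\<^sup>2) powr (- k) = norm \<xi> powr (- 2 * k)"
      using that by (simp add: powr_powr flip: powr_numeral)
    then show ?thesis
      using Gamma_exp_integral[OF k, of "(norm \<xi>)\<^sup>2"] that by (simp add: has_bochner_integral_iff)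
  qed
  have ae: "AE \<xi> in lborel. \<xi> \<noteq> (0::'a)" by (rule AE_lborel_singleton)
  have norm_h: "norm (h \<xi> r) = exp (k * r) * exp (- ((norm \<xi>)\<^sup>2 * exp r)) * norm (g \<xi>)" for \<xi> r
    by (simp add: h_def norm_mult)
  have h1: "has_bochner_integral lborel (h \<xi>) (complex_of_real (Gamma k * norm \<xi> powr (- 2 * k)) * (cis (y \<bullet> \<xi>) * g \<xi>))"
    if "\<xi> \<noteq> 0" for \<xi>
    unfolding h_def using has_bochner_integral_mult_left[OF has_bochner_integral_of_real[OF G[OF that]]] by blast
  have h2: "(\<integral>r. norm (h \<xi> r) \<partial>lborel) = Gamma k * norm (norm \<xi> powr (- 2 * k) *\<^sub>R g \<xi>)" if "\<xi> \<noteq> 0" for \<xi>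
    using has_bochner_integral_mult_left[OF G[OF that], of "norm (g \<xi>)"]
    by (simp add: norm_h has_bochner_integral_iff mult.assoc)
  have m: "case_prod h \<in> borel_measurable (borel \<Otimes>\<^sub>M borel)"
    unfolding h_def by measurable
  have A: "AE \<xi> in lborel. integrable lborel (h \<xi>)"
    using ae by eventually_elim (use h1 in \<open>auto simp: has_bochner_integral_iff\<close>)
  have B: "integrable lborel (\<lambda>\<xi>. Gamma k * norm (norm \<xi> powr (- 2 * k) *\<^sub>R g \<xi>))"
    by (intro integrable_mult_right integrable_norm i)
  have C: "AE \<xi> in lborel. (\<integral>r. norm (h \<xi> r) \<partial>lborel) \<le> Gamma k * norm (norm \<xi> powr (- 2 * k) *\<^sub>R g \<xi>)"
    using ae by eventually_elim (rule order_eq_refl, rule h2)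
  note F = fubini_iterated[OF m A B C]
  have "(\<integral>r. (\<integral>\<xi>. h \<xi> r \<partial>lborel) \<partial>lborel) = (\<integral>\<xi>. (\<integral>r. h \<xi> r \<partial>lborel) \<partial>lborel)" by (rule F(2))
  also have "\<dots> = (\<integral>\<xi>. complex_of_real (Gamma k) * (cis (y \<bullet> \<xi>) * (norm \<xi> powr (- 2 * k) *\<^sub>R g \<xi>)) \<partial>lborel)"
  proof (rule integral_cong_AE)
    show "AE \<xi> in lborel. (\<integral>r. h \<xi> r \<partial>lborel) = complex_of_real (Gamma k) * (cis (y \<bullet> \<xi>) * (norm \<xi> powr (- 2 * k) *\<^sub>R g \<xi>))"
      using ae by eventually_elim
        (use h1 in \<open>simp add: has_bochner_integral_iff scaleR_conv_of_real mult_ac\<close>)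
  qed (use borel_measurable_integrable[OF F(3)] in measurable)
  finally have "has_bochner_integral lborel (\<lambda>r. \<integral>\<xi>. h \<xi> r \<partial>lborel)
      (complex_of_real (Gamma k) * (\<integral>\<xi>. cis (y \<bullet> \<xi>) * (norm \<xi> powr (- 2 * k) *\<^sub>R g \<xi>) \<partial>lborel))"
    using F(4) by (simp only: has_bochner_integral_iff integral_mult_right_zero simp_thms)
  from has_bochner_integral_divide_zero[OF this, of "(2 * pi) ^ DIM('a)"]
  have "has_bochner_integral lborel (\<lambda>r. (\<integral>\<xi>. h \<xi> r \<partial>lborel) / (2 * pi) ^ DIM('a))
      (complex_of_real (Gamma k) * inv_fourier (\<lambda>\<xi>. norm \<xi> powr (- 2 * k) *\<^sub>R g \<xi>) y)"
    by (simp add: inv_fourier_def)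
  moreover have "(\<integral>\<xi>. h \<xi> r \<partial>lborel) / (2 * pi) ^ DIM('a)
      = complex_of_real (exp (k * r)) * inv_fourier (\<lambda>\<xi>. exp (- (exp r * (norm \<xi>)\<^sup>2)) * g \<xi>) y" for r
  proof -
    have "h \<xi> r = complex_of_real (exp (k * r)) * (cis (y \<bullet> \<xi>) * (complex_of_real (exp (- (exp r * (norm \<xi>)\<^sup>2))) * g \<xi>))" for \<xi>
      by (simp add: h_def mult_ac)
    then show ?thesis by (simp add: inv_fourier_def)
  qed
  ultimately show ?thesis by simp
qed

lemma inv_fourier_cong_AE:
  assumes "f \<in> borel_measurable borel" "g \<in> borel_measurable borel" "\<And>\<xi>. \<xi> \<noteq> 0 \<Longrightarrow> f \<xi> = g \<xi>"
  shows "inv_fourier f y = inv_fourier g (y::'a::euclidean_space)"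
proof -
  note [measurable] = assms(1,2)
  have "AE \<xi> in lborel. cis (y \<bullet> \<xi>) * f \<xi> = cis (y \<bullet> \<xi>) * g \<xi>"
    using AE_lborel_singleton[of "0::'a"] by eventually_elim (simp add: assms(3))
  then show ?thesis unfolding inv_fourier_def by (subst integral_cong_AE[of _ lborel]) auto
qed

text \<open>Half of \<open>Lambda1\<close>, written in the form in which the heat kernel computation
  produces it; the two are identified in \<open>Lambda1_gam\<close>.\<close>

definition gam :: "'a::euclidean_space itself \<Rightarrow> real" where
  "gam _ = (4 * pi) powr (DIM('a) / 2) * Gamma (DIM('a) / 2) / 2"

lemma gam_pos: "gam TYPE('a::euclidean_space) > 0"
  by (simp add: gam_def Gamma_real_pos)

lemma schwartz_norm_mult_integrable:
  assumes "\<phi> \<in> schwartz_space"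
  shows "integrable lborel (\<lambda>x::'a::euclidean_space. norm x * norm (\<phi> x))"
proof -
  have 1: "integrable lborel (\<lambda>x. norm (norm x powr 1 *\<^sub>R \<phi> x))"
    by (intro integrable_norm integrable_of_decay schwartz_measurable schwartz_decay' assms) simp
  then show ?thesis by simp
qed

text \<open>Up to a constant the logarithm has the symbol \<open>|\<xi>|^(-n)\<close>. By Frullani
  \<open>-2 ln |z|\<close> is an integral over \<open>r\<close> of Gaussians minus a counterterm
  independent of \<open>z\<close>. Since \<open>m \<ge> 1\<close>, \<open>\<psi>\<close> has
  integral 0 and the counterterm drops out; the Gaussians are multiples of heat kernels, which
  subordination with \<open>k = n/2\<close> sums up.\<close>

lemma integral_ln_schwartz:
  fixes \<phi> :: "'a::euclidean_space \<Rightarrow> complex"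
  assumes n: "DIM('a) \<ge> 2" and \<phi>: "\<phi> \<in> schwartz_space" and m: "m \<ge> 1"
  defines "\<psi> \<equiv> ((\<lambda>\<psi> x. - laplacian \<psi> x) ^^ m) \<phi>"
  shows "(\<integral>x. ln (norm (x - y)) *\<^sub>R \<psi> x \<partial>lborel)
      = - complex_of_real (gam TYPE('a)) * inv_fourier (\<lambda>\<xi>. norm \<xi> powr (2 * m - real DIM('a)) *\<^sub>R fourier_transform \<phi> \<xi>) y"
proof -
  let ?n = "real DIM('a)"
  have \<psi>: "\<psi> \<in> schwartz_space" unfolding \<psi>_def by (rule schwartz_nlap_power[OF \<phi>])
  note [measurable] = schwartz_measurable[OF \<psi>] schwartz_measurable[OF \<phi>]
  have F\<psi>: "fourier_transform \<psi> \<xi> = norm \<xi> ^ (2 * m) * fourier_transform \<phi> \<xi>" for \<xi>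
    unfolding \<psi>_def by (rule fourier_transform_nlap_power[OF \<phi>])
  have \<psi>0: "(\<integral>x. \<psi> x \<partial>lborel) = 0"
    using F\<psi>[of 0] m by (simp add: fourier_transform_lborel)
  obtain B where B: "\<And>x. norm (\<psi> x) \<le> B" using schwartz_bounded[OF \<psi>] by blast
  have lnint: "integrable lborel (\<lambda>x. ln (norm (x - y)) *\<^sub>R \<psi> x)"
    by (rule integrable_ln_mult[OF n schwartz_integrable[OF \<psi>] B schwartz_norm_mult_integrable[OF \<psi>]])
  define h where "h = (\<lambda>x r. (exp (- ((norm (x - y))\<^sup>2 * exp r)) - exp (- exp (r::real))) *\<^sub>R \<psi> x)"
  have mh: "case_prod h \<in> borel_measurable (borel \<Otimes>\<^sub>M borel)" unfolding h_def by measurable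
  have ae: "AE x in lborel. x \<noteq> y" by (rule AE_lborel_singleton)
  have h1: "has_bochner_integral lborel (h x) ((- 2 * ln (norm (x - y))) *\<^sub>R \<psi> x)" if "x \<noteq> y" for x
    unfolding h_def using that by (intro has_bochner_integral_scaleR_left log_exp_integral) auto
  have h2: "(\<integral>r. norm (h x r) \<partial>lborel) = 2 * norm (ln (norm (x - y)) *\<^sub>R \<psi> x)" if "x \<noteq> y" for x
    using has_bochner_integral_mult_left[OF log_exp_integral(2)[of "x - y"], of "norm (\<psi> x)"] that
    by (simp add: h_def has_bochner_integral_iff)
  have A: "AE x in lborel. integrable lborel (h x)"
    using ae by eventually_elim (use h1 in \<open>auto simp: has_bochner_integral_iff\<close>)
  have B: "integrable lborel (\<lambda>x. 2 * norm (ln (norm (x - y)) *\<^sub>R \<psi> x))"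
    by (intro integrable_mult_right integrable_norm lnint)
  have C: "AE x in lborel. (\<integral>r. norm (h x r) \<partial>lborel) \<le> 2 * norm (ln (norm (x - y)) *\<^sub>R \<psi> x)"
    using ae by eventually_elim (rule order_eq_refl, rule h2)
  note F = fubini_iterated[OF mh A B C]
  define G where "G = (\<lambda>r. complex_of_real (exp (?n / 2 * r)) * inv_fourier (\<lambda>\<xi>. exp (- (exp r * (norm \<xi>)\<^sup>2)) * fourier_transform \<psi> \<xi>) y)"
  \<comment> \<open>The factor \<open>|\<xi>|^(2m)\<close> contributed by \<open>\<psi>\<close>
    tames \<open>|\<xi>|^(-n)\<close>: the combined exponent exceeds \<open>-n\<close> because
    \<open>m \<ge> 1\<close>, so the product with the transform of \<open>\<phi>\<close> is
    integrable.\<close>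
  have pw: "norm \<xi> powr (- 2 * (?n / 2)) *\<^sub>R fourier_transform \<psi> \<xi> = norm \<xi> powr (2 * m - ?n) *\<^sub>R fourier_transform \<phi> \<xi>" for \<xi>
  proof (cases "\<xi> = 0")
    case False
    then have "norm \<xi> powr (2 * m - ?n) = norm \<xi> powr (- 2 * (?n / 2)) * norm \<xi> ^ (2 * m)"
      using powr_add[of "norm \<xi>" "- 2 * (?n / 2)" "real (2 * m)"] powr_realpow[of "norm \<xi>" "2 * m"] by simp
    then show ?thesis by (simp add: F\<psi> scaleR_conv_of_real mult.assoc)
  qed (simp add: F\<psi>)
  have "has_bochner_integral lborel G (complex_of_real (Gamma (?n / 2)) * inv_fourier (\<lambda>\<xi>. norm \<xi> powr (- 2 * (?n / 2)) *\<^sub>R fourier_transform \<psi> \<xi>) y)"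
    unfolding G_def
  proof (rule exp_inv_fourier_integral)
    show "integrable lborel (\<lambda>\<xi>. norm \<xi> powr (- 2 * (?n / 2)) *\<^sub>R fourier_transform \<psi> \<xi>)"
      unfolding pw using m by (intro integrable_powr_fourier_transform \<phi>) simp
  qed auto
  then have G: "has_bochner_integral lborel G (complex_of_real (Gamma (?n / 2)) * inv_fourier (\<lambda>\<xi>. norm \<xi> powr (2 * m - ?n) *\<^sub>R fourier_transform \<phi> \<xi>) y)"
    unfolding pw .
  \<comment> \<open>The Gaussian \<open>exp (- |z|^2 exp r)\<close> belongs to the heat kernel at
    time \<open>exp (- r) / 4 = exp (- ln 4 - r)\<close>, hence this reflection of the line.\<close>
  have "has_bochner_integral lborel (\<lambda>r. G (- ln 4 + (- 1) * r))
      (complex_of_real (Gamma (?n / 2)) * inv_fourier (\<lambda>\<xi>. norm \<xi> powr (2 * m - ?n) *\<^sub>R fourier_transform \<phi> \<xi>) y /\<^sub>R \<bar>- 1\<bar>)"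
    by (rule iffD1[OF lborel_has_bochner_integral_real_affine_iff G]) simp
  then have G': "(\<integral>r. G (- ln 4 - r) \<partial>lborel) = complex_of_real (Gamma (?n / 2)) * inv_fourier (\<lambda>\<xi>. norm \<xi> powr (2 * m - ?n) *\<^sub>R fourier_transform \<phi> \<xi>) y"
    by (simp add: has_bochner_integral_iff)
  have hG: "(\<integral>x. h x r \<partial>lborel) = complex_of_real ((4 * pi) powr (?n / 2)) * G (- ln 4 - r)" for r
  proof -
    define s where "s = exp (- r) / 4"
    have s: "s > 0" by (simp add: s_def)
    have e4: "exp (- ln 4 - r) = s" by (simp add: s_def exp_diff exp_minus field_simps)
    have hs: "exp (- ((norm z)\<^sup>2 * exp r)) = (4 * pi * s) powr (?n / 2) * heat s z" for z :: 'a
    proof -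
      have "(norm z)\<^sup>2 / (4 * s) = (norm z)\<^sup>2 * exp r" by (simp add: s_def exp_minus field_simps)
      moreover have "(4 * pi * s) powr (?n / 2) * (4 * pi * s) powr (- (?n / 2)) = 1"
        using s by (simp add: powr_minus)
      ultimately show ?thesis by (simp add: heat_def mult.assoc[symmetric])
    qed
    have ih: "integrable lborel (\<lambda>x. heat s (x - y) *\<^sub>R \<psi> x)"
      by (rule Bochner_Integration.integrable_bound[of _ "\<lambda>x. (4 * pi * s) powr (- (?n / 2)) *\<^sub>R \<psi> x"])
         (use s schwartz_integrable[OF \<psi>] heat_bounded[OF s, where 'a='a] in \<open>auto intro!: mult_right_mono\<close>)
    have "(\<integral>x. h x r \<partial>lborel) = (\<integral>x. (4 * pi * s) powr (?n / 2) *\<^sub>R (heat s (x - y) *\<^sub>R \<psi> x) - exp (- exp r) *\<^sub>R \<psi> x \<partial>lborel)"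
      unfolding h_def hs by (simp add: scaleR_diff_left)
    also have "\<dots> = (4 * pi * s) powr (?n / 2) *\<^sub>R (\<integral>x. heat s (x - y) *\<^sub>R \<psi> x \<partial>lborel)"
    proof -
      have "integrable lborel (\<lambda>x. (4 * pi * s) powr (?n / 2) *\<^sub>R (heat s (x - y) *\<^sub>R \<psi> x))"
          "integrable lborel (\<lambda>x. exp (- exp r) *\<^sub>R \<psi> x)"
        by (intro integrable_scaleR_right ih, intro integrable_scaleR_right schwartz_integrable \<psi>)
      then show ?thesis
        by (simp only: Bochner_Integration.integral_diff integral_scaleR_right \<psi>0 scaleR_zero_right diff_zero)
    qed
    also have "(\<integral>x. heat s (x - y) *\<^sub>R \<psi> x \<partial>lborel) = inv_fourier (\<lambda>\<xi>. exp (- (s * (norm \<xi>)\<^sup>2)) * fourier_transform \<psi> \<xi>) y"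
      by (subst inv_fourier_gauss_fourier_transform[OF schwartz_integrable[OF \<psi>] s]) (simp add: scaleR_conv_of_real)
    also have "(4 * pi * s) powr (?n / 2) = (4 * pi) powr (?n / 2) * exp (?n / 2 * (- ln 4 - r))"
    proof -
      have "s powr (?n / 2) = exp (?n / 2 * (- ln 4 - r))"
        by (simp only: e4[symmetric] exp_powr_real mult.commute)
      then show ?thesis using s by (simp add: powr_mult)
    qed
    finally show ?thesis by (simp add: G_def e4 scaleR_conv_of_real mult.assoc)
  qed
  have "(\<integral>x. (- 2 * ln (norm (x - y))) *\<^sub>R \<psi> x \<partial>lborel) = (\<integral>x. (\<integral>r. h x r \<partial>lborel) \<partial>lborel)"
  proof (rule integral_cong_AE)
    show "AE x in lborel. (- 2 * ln (norm (x - y))) *\<^sub>R \<psi> x = (\<integral>r. h x r \<partial>lborel)"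
      using ae by eventually_elim (use h1 in \<open>simp add: has_bochner_integral_iff\<close>)
  qed (use borel_measurable_integrable[OF F(3)] in measurable)
  also have "\<dots> = (\<integral>r. (\<integral>x. h x r \<partial>lborel) \<partial>lborel)" using F(2) by simp
  also have "\<dots> = complex_of_real ((4 * pi) powr (?n / 2)) * (complex_of_real (Gamma (?n / 2)) * inv_fourier (\<lambda>\<xi>. norm \<xi> powr (2 * m - ?n) *\<^sub>R fourier_transform \<phi> \<xi>) y)"
    by (simp only: hG integral_mult_right_zero G')
  also have "(\<integral>x. (- 2 * ln (norm (x - y))) *\<^sub>R \<psi> x \<partial>lborel) = (- 2) *\<^sub>R (\<integral>x. ln (norm (x - y)) *\<^sub>R \<psi> x \<partial>lborel)"
    by (simp only: scaleR_scaleR[symmetric] integral_scaleR_right)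
  finally have e: "(- 2) *\<^sub>R (\<integral>x. ln (norm (x - y)) *\<^sub>R \<psi> x \<partial>lborel)
     = complex_of_real ((4 * pi) powr (?n / 2)) * (complex_of_real (Gamma (?n / 2)) * inv_fourier (\<lambda>\<xi>. norm \<xi> powr (2 * m - ?n) *\<^sub>R fourier_transform \<phi> \<xi>) y)" .
  have sc: "z = - (c * (d * w)) / 2" if "(- 2) *\<^sub>R z = c * (d * w)" for z c d w :: complex
    using that by (simp add: scaleR_conv_of_real) (metis minus_minus nonzero_mult_div_cancel_left zero_neq_numeral minus_divide_left)
  show ?thesis by (subst sc[OF e]) (simp add: gam_def)
qed

lemma integral_ln_nlap_even:
  fixes \<phi> :: "'a::euclidean_space \<Rightarrow> complex"
  assumes n: "DIM('a) \<ge> 2" "DIM('a) = 2 * m" and \<phi>: "\<phi> \<in> schwartz_space"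
  shows "(\<integral>x. ln (norm (x - y)) *\<^sub>R ((\<lambda>\<psi> x. - laplacian \<psi> x) ^^ m) \<phi> x \<partial>lborel) = - complex_of_real (gam TYPE('a)) * \<phi> y"
proof -
  note [measurable] = schwartz_measurable[OF \<phi>]
  have "inv_fourier (\<lambda>\<xi>. norm \<xi> powr (2 * m - real DIM('a)) *\<^sub>R fourier_transform \<phi> \<xi>) y = inv_fourier (fourier_transform \<phi>) y"
    using n by (intro inv_fourier_cong_AE) auto
  then show ?thesis
    using integral_ln_schwartz[OF n(1) \<phi>, of m y] n by (simp add: fourier_inversion[OF \<phi>])
qed

section \<open>Heat convolutions of integrable functions\<close>

lemma heat_measurable2 [measurable]:
  fixes g :: "_ \<Rightarrow> 'a::euclidean_space"
  assumes [measurable]: "f \<in> borel_measurable M" "g \<in> borel_measurable M"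
  shows "(\<lambda>x. heat (f x) (g x)) \<in> borel_measurable M"
  unfolding heat_def by measurable

lemma heat_convolution:
  fixes f :: "'a::euclidean_space \<Rightarrow> complex"
  assumes f: "integrable lborel f" and s: "s > 0"
  shows "integrable lborel (\<lambda>x. \<integral>z. heat s (z - x) * f z \<partial>lborel)"
    and "(\<integral>x. (\<integral>z. heat s (z - x) * f z \<partial>lborel) \<partial>lborel) = (\<integral>z. f z \<partial>lborel)"
    and "(\<integral>x. norm (\<integral>z. heat s (z - x) * f z \<partial>lborel) \<partial>lborel) \<le> (\<integral>z. norm (f z) \<partial>lborel)"
proof -
  note [measurable] = borel_measurable_integrable[OF f]
  define h where "h = (\<lambda>z x. complex_of_real (heat s (z - x)) * f z)"
  have m: "case_prod h \<in> borel_measurable (borel \<Otimes>\<^sub>M borel)" unfolding h_def by measurable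
  have hi: "integrable lborel (\<lambda>x::'a. heat s (z - x))" "(\<integral>x. heat s (z - x) \<partial>lborel) = 1" for z :: 'a
    using heat_fourier(1,2)[OF s, where 'a='a]
    by (simp_all add: integrable_lborel_reflect integral_lborel_reflect)
  have i: "integrable lborel (h z)" for z
    unfolding h_def using hi by simp
  have nh: "(\<integral>x. norm (h z x) \<partial>lborel) = norm (f z)" for z
    unfolding h_def using hi by (simp add: norm_mult)
  have "AE z in lborel. integrable lborel (h z)" "AE z in lborel. (\<integral>x. norm (h z x) \<partial>lborel) \<le> norm (f z)"
    using i nh by auto
  note F = fubini_iterated[OF m this(1) integrable_norm[OF f] this(2)]
  show "integrable lborel (\<lambda>x. \<integral>z. heat s (z - x) * f z \<partial>lborel)"
    using F(4) by (simp add: h_def)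
  have eqz: "(\<integral>x. h z x \<partial>lborel) = f z" for z
    unfolding h_def using hi by (simp add: integral_complex_of_real)
  show "(\<integral>x. (\<integral>z. heat s (z - x) * f z \<partial>lborel) \<partial>lborel) = (\<integral>z. f z \<partial>lborel)"
    using F(2) unfolding eqz by (simp add: h_def)
  have mn: "case_prod (\<lambda>z x. norm (h z x)) \<in> borel_measurable (borel \<Otimes>\<^sub>M borel)" unfolding h_def by measurable
  have "AE z in lborel. integrable lborel (\<lambda>x. norm (h z x))" "AE z in lborel. (\<integral>x. norm (norm (h z x)) \<partial>lborel) \<le> norm (f z)"
    using i nh by auto
  note Fn = fubini_iterated[OF mn this(1) integrable_norm[OF f] this(2)]
  have "(\<integral>x. norm (\<integral>z. h z x \<partial>lborel) \<partial>lborel) \<le> (\<integral>x. (\<integral>z. norm (h z x) \<partial>lborel) \<partial>lborel)"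
    by (intro integral_mono integrable_norm F(4) Fn(4) integral_norm_bound)
  also have "\<dots> = (\<integral>z. norm (f z) \<partial>lborel)" using Fn(2) by (simp add: nh)
  finally show "(\<integral>x. norm (\<integral>z. heat s (z - x) * f z \<partial>lborel) \<partial>lborel) \<le> (\<integral>z. norm (f z) \<partial>lborel)"
    by (simp add: h_def)
qed

text \<open>Each heat convolution is an \<open>L1\<close> contraction preserving the integral, so
  averaging over times with an integrable weight keeps integrability and multiplies the integral by
  that of the weight. Applied to the weights \<open>w0\<close> and \<open>w1\<close> below.\<close>

lemma heat_mixture:
  fixes f :: "'a::euclidean_space \<Rightarrow> complex" and w :: "real \<Rightarrow> real"
  assumes f: "integrable lborel f" and w: "integrable lborel w"
  defines "U \<equiv> \<lambda>x. \<integral>r. w r * (\<integral>z. heat (exp r) (z - x) * f z \<partial>lborel) \<partial>lborel"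
  shows "integrable lborel U" "(\<integral>x. U x \<partial>lborel) = complex_of_real (\<integral>r. w r \<partial>lborel) * (\<integral>z. f z \<partial>lborel)"
proof -
  note [measurable] = borel_measurable_integrable[OF f] borel_measurable_integrable[OF w]
  define h where "h = (\<lambda>r x. complex_of_real (w r) * (\<integral>z. heat (exp r) (z - x) * f z \<partial>lborel))"
  have m: "case_prod h \<in> borel_measurable (borel \<Otimes>\<^sub>M borel)" unfolding h_def by measurable
  have i: "integrable lborel (h r)" for r
    unfolding h_def by (intro integrable_mult_right heat_convolution f) simp
  have nh: "(\<integral>x. norm (h r x) \<partial>lborel) \<le> norm (w r) * (\<integral>z. norm (f z) \<partial>lborel)" for r
    unfolding h_def norm_mult using heat_convolution(3)[OF f, of "exp r"] by (auto intro!: mult_left_mono)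
  have "AE r in lborel. integrable lborel (h r)"
      "AE r in lborel. (\<integral>x. norm (h r x) \<partial>lborel) \<le> norm (w r) * (\<integral>z. norm (f z) \<partial>lborel)"
    using i nh by auto
  note F = fubini_iterated[OF m this(1) integrable_mult_left[OF integrable_norm[OF w]] this(2)]
  show "integrable lborel U" using F(4) by (simp add: U_def h_def)
  have "(\<integral>x. U x \<partial>lborel) = (\<integral>r. complex_of_real (w r) * (\<integral>z. f z \<partial>lborel) \<partial>lborel)"
    using F(2) by (simp add: U_def h_def heat_convolution(2)[OF f])
  also have "\<dots> = complex_of_real (\<integral>r. w r \<partial>lborel) * (\<integral>z. f z \<partial>lborel)"
    using w by simp
  finally show "(\<integral>x. U x \<partial>lborel) = complex_of_real (\<integral>r. w r \<partial>lborel) * (\<integral>z. f z \<partial>lborel)" .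
qed

section \<open>The half-Laplacian\<close>

lemma half_laplacian_inv_fourier:
  assumes "\<phi> \<in> schwartz_space"
  shows "half_laplacian \<phi> = inv_fourier (\<lambda>\<xi>. norm \<xi> *\<^sub>R fourier_transform \<phi> \<xi>)"
proof
  fix x :: 'a
  note [measurable] = schwartz_measurable[OF assms]
  show "half_laplacian \<phi> x = inv_fourier (\<lambda>\<xi>. norm \<xi> *\<^sub>R fourier_transform \<phi> \<xi>) x"
    unfolding half_laplacian_def inv_fourier_def by (subst integral_completion) measurable
qed

text \<open>Integrating by parts on \<open>r \<ge> 0\<close> in \<open>\<surd>(\<pi>q) = \<integral> e\<^sup>r\<^sup>/\<^sup>2 q e\<^sup>-\<^sup>q\<^sup>e\<^sup>x\<^sup>p\<^sup> \<^sup>r dr\<close> leaves only heat semigroup terms with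
  integrable weights.\<close>

definition w0 :: "real \<Rightarrow> real" where "w0 r = indicator {..<0} r * exp (r / 2)"
definition w1 :: "real \<Rightarrow> real" where "w1 r = indicator {0..} r * exp (- r / 2) / 2"

lemma w0_integrable: "integrable lborel w0"
  by (rule Bochner_Integration.integrable_bound[OF integrable_exp_neg_abs[of "1/2"]])
     (auto simp: w0_def[abs_def] indicator_def)

lemma w1_has_integral: "has_bochner_integral lborel w1 1"
proof (rule has_bochner_integral_nn_integral)
  have "(\<integral>\<^sup>+r. ennreal (exp (- r / 2) / 2) * indicator {0..} r \<partial>lborel) = ennreal (0 - (- exp (- 0 / 2)))"
  proof (rule nn_integral_FTC_atLeast)
    show "((\<lambda>r::real. - exp (- r / 2)) \<longlongrightarrow> 0) at_top" by real_asymp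
  qed (auto intro!: derivative_eq_intros)
  also have "(\<integral>\<^sup>+r. ennreal (exp (- r / 2) / 2) * indicator {0..} r \<partial>lborel) = (\<integral>\<^sup>+r. ennreal (w1 r) \<partial>lborel)"
    by (intro nn_integral_cong) (auto simp: w1_def indicator_def)
  finally show "(\<integral>\<^sup>+r. ennreal (w1 r) \<partial>lborel) = ennreal 1" by simp
qed (auto simp: w1_def[abs_def])

lemma sqrt_exp_integral:
  assumes q: "q > (0::real)"
  shows "has_bochner_integral lborel (\<lambda>r. w0 r * (q * exp (- (exp r * q))) - w1 r * exp (- (exp r * q)))
    (sqrt pi * sqrt q - exp (- q))"
proof -
  let ?f = "\<lambda>r. exp (r / 2) * (q * exp (- (exp r * q)))"
  have G: "has_bochner_integral lborel ?f (sqrt pi * sqrt q)"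
  proof -
    have "has_bochner_integral lborel (\<lambda>r. exp (1 / 2 * r) * exp (- (q * exp r))) (Gamma (1/2) * q powr (- (1/2)))"
      using Gamma_exp_integral[of "1/2" q] q by (simp add: has_bochner_integral_iff)
    from has_bochner_integral_mult_right[OF this, of q]
    have "has_bochner_integral lborel ?f (q * (Gamma (1/2) * q powr (- (1/2))))" by (simp add: mult_ac)
    moreover have "q * (Gamma (1/2) * q powr (- (1/2))) = sqrt pi * sqrt q"
    proof -
      have "q powr (- (1/2)) = inverse (sqrt q)"
        using q by (simp only: powr_minus powr_half_sqrt less_imp_le)
      moreover have "q * inverse (sqrt q) = sqrt q"
        using real_div_sqrt[of q] q by (simp only: divide_inverse less_imp_le)
      ultimately have "q * q powr (- (1/2)) = sqrt q" by (simp only:)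
      then show ?thesis by (simp only: Gamma_one_half_real mult.left_commute[of q])
    qed
    ultimately show ?thesis by (simp only:)
  qed
  let ?g = "\<lambda>r. indicator {0..} r * (?f r + exp (- r / 2) / 2 * exp (- (exp r * q)))"
  have H: "has_bochner_integral lborel ?g (exp (- q))"
  proof (rule has_bochner_integral_nn_integral)
    \<comment> \<open>The primitive for \<open>r \<ge> 0\<close>: differentiating the inner
      exponential gives the Gamma integrand, differentiating \<open>exp (- r / 2)\<close> gives the
      \<open>w1\<close> term. Its value at \<open>r = 0\<close> produces
      \<open>exp (- q)\<close>.\<close>
    let ?F = "\<lambda>r. - (exp (- r / 2) * exp (- (exp r * q)))"
    have "(\<integral>\<^sup>+r. ennreal (?f r + exp (- r / 2) / 2 * exp (- (exp r * q))) * indicator {0..} r \<partial>lborel) = ennreal (0 - ?F 0)"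
    proof (rule nn_integral_FTC_atLeast)
      show "(?F \<longlongrightarrow> 0) at_top" using q by real_asymp
      fix r :: real
      have "exp (- r / 2) * exp r = exp (r / 2)" by (simp add: mult_exp_exp)
      then show "(?F has_real_derivative (?f r + exp (- r / 2) / 2 * exp (- (exp r * q)))) (at r)"
        by (auto intro!: derivative_eq_intros simp: algebra_simps)
    qed (use q in auto)
    also have "(\<integral>\<^sup>+r. ennreal (?f r + exp (- r / 2) / 2 * exp (- (exp r * q))) * indicator {0..} r \<partial>lborel) = (\<integral>\<^sup>+r. ennreal (?g r) \<partial>lborel)"
      by (intro nn_integral_cong) (auto simp: indicator_def)
    finally show "(\<integral>\<^sup>+r. ennreal (?g r) \<partial>lborel) = ennreal (exp (- q))" by simp
  qed (use q in \<open>auto intro!: AE_I2 mult_nonneg_nonneg add_nonneg_nonneg\<close>)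
  have "(\<lambda>r. ?f r - ?g r) = (\<lambda>r. w0 r * (q * exp (- (exp r * q))) - w1 r * exp (- (exp r * q)))"
    by (auto simp: fun_eq_iff w0_def w1_def indicator_def)
  with has_bochner_integral_diff[OF G H] show ?thesis by simp
qed

text \<open>The symbol \<open>|\<xi>|\<close> is not smooth at 0, so integrability of
  \<open>half_laplacian \<phi>\<close> cannot be read off its definition. Applied with
  \<open>q = |\<xi>|^2\<close>, the scalar identity expresses it by heat convolutions of integrable
  functions: for small times the factor \<open>q\<close> is spent on \<open>\<phi>\<close>, giving
  \<open>\<psi>\<close>, and for large times it has been integrated away.\<close>

lemma half_laplacian_heat:
  fixes \<phi> \<psi> :: "'a::euclidean_space \<Rightarrow> complex"
  assumes \<phi>: "\<phi> \<in> schwartz_space"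
  defines "\<psi> \<equiv> \<lambda>x. - laplacian \<phi> x"
  shows "sqrt pi * half_laplacian \<phi> x =
     (\<integral>r. w0 r * (\<integral>z. heat (exp r) (z - x) * \<psi> z \<partial>lborel) \<partial>lborel)
     - (\<integral>r. w1 r * (\<integral>z. heat (exp r) (z - x) * \<phi> z \<partial>lborel) \<partial>lborel)
     + (\<integral>z. heat 1 (z - x) * \<phi> z \<partial>lborel)"
proof -
  have \<psi>: "\<psi> \<in> schwartz_space" unfolding \<psi>_def by (rule schwartz_nlap[OF \<phi>])
  note [measurable] = schwartz_measurable[OF \<psi>] schwartz_measurable[OF \<phi>]
    borel_measurable_integrable[OF w0_integrable] borel_measurable_has_bochner_integral[OF w1_has_integral]
  define c where "c = complex_of_real ((2 * pi) ^ DIM('a))"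
  have F\<psi>: "fourier_transform \<psi> \<xi> = (norm \<xi>)\<^sup>2 * fourier_transform \<phi> \<xi>" for \<xi>
    unfolding \<psi>_def by (rule fourier_transform_nlap[OF \<phi>])
  let ?F = "fourier_transform \<phi>"
  have iF: "integrable lborel ?F" by (rule integrable_fourier_transform[OF \<phi>])
  have iF\<psi>: "integrable lborel (fourier_transform \<psi>)" by (rule integrable_fourier_transform[OF \<psi>])
  have swap: "has_bochner_integral lborel (\<lambda>\<xi>. \<integral>r. complex_of_real (w r) * (cis (x \<bullet> \<xi>) * (exp (- (exp r * (norm \<xi>)\<^sup>2)) * g \<xi>)) \<partial>lborel)
     (\<integral>r. w r * (c * inv_fourier (\<lambda>\<xi>. exp (- (exp r * (norm \<xi>)\<^sup>2)) * g \<xi>) x) \<partial>lborel)"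
    if w: "integrable lborel w" and g: "integrable lborel g" for w :: "real \<Rightarrow> real" and g :: "'a \<Rightarrow> complex"
  proof -
    note [measurable] = borel_measurable_integrable[OF w] borel_measurable_integrable[OF g]
    define h where "h = (\<lambda>\<xi> r. complex_of_real (w r) * (cis (x \<bullet> \<xi>) * (exp (- (exp r * (norm \<xi>)\<^sup>2)) * g \<xi>)))"
    have m: "case_prod h \<in> borel_measurable (borel \<Otimes>\<^sub>M borel)" unfolding h_def by measurable
    have nh: "norm (h \<xi> r) \<le> norm (g \<xi>) * norm (w r)" for \<xi> r
    proof -
      have "norm (h \<xi> r) = norm (g \<xi>) * norm (w r) * exp (- (exp r * (norm \<xi>)\<^sup>2))" by (simp add: h_def norm_mult)
      also have "\<dots> \<le> norm (g \<xi>) * norm (w r) * 1" by (intro mult_left_mono) auto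
      finally show ?thesis by simp
    qed
    have ih: "integrable lborel (h \<xi>)" for \<xi>
      by (rule Bochner_Integration.integrable_bound[of _ "\<lambda>r. norm (g \<xi>) * norm (w r)"])
         (use w nh in \<open>auto simp: h_def\<close>)
    have inh: "(\<integral>r. norm (h \<xi> r) \<partial>lborel) \<le> norm (g \<xi>) * (\<integral>r. norm (w r) \<partial>lborel)" for \<xi>
    proof -
      have "(\<integral>r. norm (h \<xi> r) \<partial>lborel) \<le> (\<integral>r. norm (g \<xi>) * norm (w r) \<partial>lborel)"
        using w by (intro integral_mono integrable_norm ih integrable_mult_right nh)
      then show ?thesis by simp
    qed
    have "AE \<xi> in lborel. integrable lborel (h \<xi>)"
      "AE \<xi> in lborel. (\<integral>r. norm (h \<xi> r) \<partial>lborel) \<le> norm (g \<xi>) * (\<integral>r. norm (w r) \<partial>lborel)"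
      using ih inh by auto
    note F = fubini_iterated[OF m this(1) integrable_mult_left[OF integrable_norm[OF g]] this(2)]
    have eqr: "(\<integral>\<xi>. h \<xi> r \<partial>lborel) = w r * (c * inv_fourier (\<lambda>\<xi>. exp (- (exp r * (norm \<xi>)\<^sup>2)) * g \<xi>) x)" for r
      by (simp add: h_def inv_fourier_def c_def)
    have "has_bochner_integral lborel (\<lambda>\<xi>. \<integral>r. h \<xi> r \<partial>lborel)
        (\<integral>r. w r * (c * inv_fourier (\<lambda>\<xi>. exp (- (exp r * (norm \<xi>)\<^sup>2)) * g \<xi>) x) \<partial>lborel)"
      using F(2)[unfolded eqr, symmetric] F(3) by (simp only: has_bochner_integral_iff simp_thms)
    then show ?thesis unfolding h_def .
  qed
  have 0: "has_bochner_integral lborel (\<lambda>\<xi>. cis (x \<bullet> \<xi>) * (exp (- (1 * (norm \<xi>)\<^sup>2)) * ?F \<xi>))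
      (c * inv_fourier (\<lambda>\<xi>. exp (- (1 * (norm \<xi>)\<^sup>2)) * ?F \<xi>) x)"
  proof -
    have "integrable lborel (\<lambda>\<xi>. cis (x \<bullet> \<xi>) * (exp (- (1 * (norm \<xi>)\<^sup>2)) * ?F \<xi>))"
      by (rule Bochner_Integration.integrable_bound[OF iF]) (auto simp: norm_mult intro!: AE_I2 mult_left_le_one_le)
    then show ?thesis by (simp add: has_bochner_integral_iff inv_fourier_def c_def)
  qed
  let ?A = "\<lambda>\<xi>. \<integral>r. complex_of_real (w0 r) * (cis (x \<bullet> \<xi>) * (exp (- (exp r * (norm \<xi>)\<^sup>2)) * fourier_transform \<psi> \<xi>)) \<partial>lborel"
  let ?B = "\<lambda>\<xi>. \<integral>r. complex_of_real (w1 r) * (cis (x \<bullet> \<xi>) * (exp (- (exp r * (norm \<xi>)\<^sup>2)) * ?F \<xi>)) \<partial>lborel"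
  let ?C = "\<lambda>\<xi>. cis (x \<bullet> \<xi>) * (exp (- (1 * (norm \<xi>)\<^sup>2)) * ?F \<xi>)"
  have w1i: "integrable lborel w1" using w1_has_integral by (simp add: has_bochner_integral_iff)
  have eq: "?A \<xi> - ?B \<xi> + ?C \<xi> = sqrt pi * (cis (x \<bullet> \<xi>) * (norm \<xi> *\<^sub>R ?F \<xi>))" if "\<xi> \<noteq> 0" for \<xi>
  proof -
    define q where "q = (norm \<xi>)\<^sup>2"
    have q: "q > 0" using that by (simp add: q_def)
    define d where "d = cis (x \<bullet> \<xi>) * ?F \<xi>"
    note S = sqrt_exp_integral[OF q]
    have b: "integrable lborel (\<lambda>r. w r * exp (- (exp r * q)))" if "integrable lborel w" for w :: "real \<Rightarrow> real"
      by (rule Bochner_Integration.integrable_bound[OF that])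
         (use q borel_measurable_integrable[OF that] in \<open>auto simp: abs_mult intro!: AE_I2 mult_left_le\<close>)
    have "?A \<xi> = (\<integral>r. complex_of_real (w0 r * (q * exp (- (exp r * q)))) * d \<partial>lborel)"
      by (intro Bochner_Integration.integral_cong) (auto simp: F\<psi> d_def q_def mult_ac)
    also have "\<dots> = complex_of_real (\<integral>r. w0 r * (q * exp (- (exp r * q))) \<partial>lborel) * d"
      by (simp only: integral_mult_left_zero integral_complex_of_real)
    finally have A: "?A \<xi> = complex_of_real (\<integral>r. w0 r * (q * exp (- (exp r * q))) \<partial>lborel) * d" .
    have "?B \<xi> = (\<integral>r. complex_of_real (w1 r * exp (- (exp r * q))) * d \<partial>lborel)"
      by (intro Bochner_Integration.integral_cong) (auto simp: d_def q_def mult_ac)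
    also have "\<dots> = complex_of_real (\<integral>r. w1 r * exp (- (exp r * q)) \<partial>lborel) * d"
      by (simp only: integral_mult_left_zero integral_complex_of_real)
    finally have B: "?B \<xi> = complex_of_real (\<integral>r. w1 r * exp (- (exp r * q)) \<partial>lborel) * d" .
    have "(\<integral>r. w0 r * (q * exp (- (exp r * q))) \<partial>lborel) - (\<integral>r. w1 r * exp (- (exp r * q)) \<partial>lborel)
       = (\<integral>r. w0 r * (q * exp (- (exp r * q))) - w1 r * exp (- (exp r * q)) \<partial>lborel)"
      using b[OF w0_integrable] b[OF w1i]
      by (subst Bochner_Integration.integral_diff) (auto simp: mult.left_commute[of _ q])
    also have "\<dots> = sqrt pi * sqrt q - exp (- q)" using S by (simp add: has_bochner_integral_iff)
    finally have AB: "?A \<xi> - ?B \<xi> = complex_of_real (sqrt pi * sqrt q - exp (- q)) * d"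
      unfolding A B by (simp only: of_real_diff[symmetric] left_diff_distrib[symmetric])
    have C: "?C \<xi> = complex_of_real (exp (- q)) * d" by (simp add: q_def d_def mult_ac)
    have "?A \<xi> - ?B \<xi> + ?C \<xi> = complex_of_real (sqrt pi * sqrt q) * d"
      unfolding AB C by (simp only: distrib_right[symmetric] of_real_add[symmetric]) simp
    then show ?thesis by (simp add: q_def d_def scaleR_conv_of_real mult_ac)
  qed
  note W = has_bochner_integral_add[OF has_bochner_integral_diff[OF swap[OF w0_integrable iF\<psi>] swap[OF w1i iF]] 0]
  have "(\<integral>\<xi>. ?A \<xi> - ?B \<xi> + ?C \<xi> \<partial>lborel) = (\<integral>\<xi>. sqrt pi * (cis (x \<bullet> \<xi>) * (norm \<xi> *\<^sub>R ?F \<xi>)) \<partial>lborel)"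
  proof (rule integral_cong_AE)
    show "AE \<xi> in lborel. ?A \<xi> - ?B \<xi> + ?C \<xi> = sqrt pi * (cis (x \<bullet> \<xi>) * (norm \<xi> *\<^sub>R ?F \<xi>))"
      using AE_lborel_singleton[of "0::'a"] by eventually_elim (rule eq)
  qed (use borel_measurable_has_bochner_integral[OF W] in measurable)
  also have "\<dots> = c * (sqrt pi * half_laplacian \<phi> x)"
    by (simp only: half_laplacian_inv_fourier[OF \<phi>] inv_fourier_def c_def integral_mult_right_zero) simp
  finally have "c * (sqrt pi * half_laplacian \<phi> x) = (\<integral>r. w0 r * (c * inv_fourier (\<lambda>\<xi>. exp (- (exp r * (norm \<xi>)\<^sup>2)) * fourier_transform \<psi> \<xi>) x) \<partial>lborel)
     - (\<integral>r. w1 r * (c * inv_fourier (\<lambda>\<xi>. exp (- (exp r * (norm \<xi>)\<^sup>2)) * ?F \<xi>) x) \<partial>lborel)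
     + c * inv_fourier (\<lambda>\<xi>. exp (- (1 * (norm \<xi>)\<^sup>2)) * ?F \<xi>) x"
    using has_bochner_integral_integral_eq[OF W] by simp
  also have "\<dots> = c * ((\<integral>r. w0 r * (\<integral>z. heat (exp r) (z - x) * \<psi> z \<partial>lborel) \<partial>lborel)
     - (\<integral>r. w1 r * (\<integral>z. heat (exp r) (z - x) * \<phi> z \<partial>lborel) \<partial>lborel)
     + (\<integral>z. heat 1 (z - x) * \<phi> z \<partial>lborel))"
    by (simp only: inv_fourier_gauss_fourier_transform[OF schwartz_integrable[OF \<psi>] exp_gt_zero]
        inv_fourier_gauss_fourier_transform[OF schwartz_integrable[OF \<phi>] exp_gt_zero]
        inv_fourier_gauss_fourier_transform[OF schwartz_integrable[OF \<phi>] zero_less_one]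
        mult.left_commute[of _ c] integral_mult_right_zero right_diff_distrib distrib_left)
  finally show ?thesis
    by (simp add: c_def)
qed

text \<open>The \<open>w0\<close> term has integral 0 because \<open>- \<Delta>\<phi>\<close> has,
  and the other two terms cancel because \<open>w1\<close> has integral 1. In odd dimensions this
  removes the constant that the polynomial part of the solution leaves behind.\<close>

lemma half_laplacian_integrable:
  fixes \<phi> :: "'a::euclidean_space \<Rightarrow> complex"
  assumes \<phi>: "\<phi> \<in> schwartz_space"
  shows "integrable lborel (half_laplacian \<phi>)" "(\<integral>x. half_laplacian \<phi> x \<partial>lborel) = 0"
proof -
  let ?\<psi> = "\<lambda>x. - laplacian \<phi> x"
  have \<psi>: "?\<psi> \<in> schwartz_space" by (rule schwartz_nlap[OF \<phi>])
  have \<psi>0: "(\<integral>x. ?\<psi> x \<partial>lborel) = 0"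
    using fourier_transform_nlap[OF \<phi>, of 0] fourier_transform_lborel[OF schwartz_measurable[OF \<psi>], of 0] by simp
  have w1i: "integrable lborel w1" "(\<integral>r. w1 r \<partial>lborel) = 1" using w1_has_integral by (simp_all add: has_bochner_integral_iff)
  let ?R = "\<lambda>x. (\<integral>r. w0 r * (\<integral>z. heat (exp r) (z - x) * ?\<psi> z \<partial>lborel) \<partial>lborel)
     - (\<integral>r. w1 r * (\<integral>z. heat (exp r) (z - x) * \<phi> z \<partial>lborel) \<partial>lborel)
     + (\<integral>z. heat 1 (z - x) * \<phi> z \<partial>lborel)"
  note I = heat_mixture[OF schwartz_integrable[OF \<psi>] w0_integrable] heat_mixture[OF schwartz_integrable[OF \<phi>] w1i(1)]
    heat_convolution(1,2)[OF schwartz_integrable[OF \<phi>] zero_less_one]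
  have eq: "half_laplacian \<phi> = (\<lambda>x. ?R x / sqrt pi)"
    using half_laplacian_heat[OF \<phi>] by (auto simp: fun_eq_iff field_simps)
  have int: "integrable lborel ?R"
    by (intro Bochner_Integration.integrable_add Bochner_Integration.integrable_diff I)
  show "integrable lborel (half_laplacian \<phi>)"
    unfolding eq by (intro integrable_divide_zero int)
  have "(\<integral>x. ?R x \<partial>lborel) = 0"
    by (subst Bochner_Integration.integral_add[OF Bochner_Integration.integrable_diff[OF I(1) I(3)] I(5)],
        subst Bochner_Integration.integral_diff[OF I(1) I(3)])
       (simp only: I(2) I(4) I(6) \<psi>0 w1i(2), simp)
  then show "(\<integral>x. half_laplacian \<phi> x \<partial>lborel) = 0"
    unfolding eq by simp
qed

section \<open>The Riesz kernel\<close>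

text \<open>With this constant \<open>riesz_kernel\<close> is \<open>sqrt pi\<close> times the
  kernel of the inverse half-Laplacian: the factor \<open>Gamma (1/2)\<close> of the subordination
  formula is left in.\<close>

definition riesz_coeff :: "'a::euclidean_space itself \<Rightarrow> real" where
  "riesz_coeff _ = (4 * pi) powr (- (DIM('a) / 2)) * Gamma ((DIM('a) - 1) / 2) * 4 powr ((DIM('a) - 1) / 2)"

definition riesz_kernel :: "'a::euclidean_space \<Rightarrow> real" where
  "riesz_kernel z = riesz_coeff TYPE('a) * norm z powr (- (real DIM('a) - 1))"

lemma riesz_kernel_measurable [measurable]: "riesz_kernel \<in> borel_measurable borel"
  unfolding riesz_kernel_def by measurable

lemma riesz_kernel_nonneg:
  assumes "DIM('a::euclidean_space) \<ge> 2"
  shows "riesz_kernel (z::'a) \<ge> 0"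
  using assms Gamma_real_pos[of "(DIM('a) - 1) / 2"] by (simp add: riesz_kernel_def riesz_coeff_def)

lemma riesz_kernel_heat:
  assumes n: "DIM('a::euclidean_space) \<ge> 2" and z: "(z::'a) \<noteq> 0"
  shows "has_bochner_integral lborel (\<lambda>r. exp (r / 2) * heat (exp r) z) (riesz_kernel z)"
proof -
  let ?n = "real DIM('a)"
  define k where "k = (?n - 1) / 2"
  define a where "a = (norm z)\<^sup>2 / 4"
  have k: "k > 0" using n by (simp add: k_def)
  have a: "a > 0" using z by (simp add: a_def)
  have "has_bochner_integral lborel (\<lambda>r. exp (k * r) * exp (- (a * exp r))) (Gamma k * a powr (- k))"
    using Gamma_exp_integral[OF k a] by (simp add: has_bochner_integral_iff)
  from iffD1[OF lborel_has_bochner_integral_real_affine_iff[of "-1" _ _ 0] this]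
  have "has_bochner_integral lborel (\<lambda>r. exp (- (k * r)) * exp (- (a * exp (- r)))) (Gamma k * a powr (- k))" by simp
  from has_bochner_integral_mult_right[OF this, of "(4 * pi) powr (- (?n / 2))"]
  have H: "has_bochner_integral lborel (\<lambda>r. (4 * pi) powr (- (?n / 2)) * (exp (- (k * r)) * exp (- (a * exp (- r)))))
     ((4 * pi) powr (- (?n / 2)) * (Gamma k * a powr (- k)))" by simp
  have "(\<lambda>r. (4 * pi) powr (- (?n / 2)) * (exp (- (k * r)) * exp (- (a * exp (- r))))) = (\<lambda>r. exp (r / 2) * heat (exp r) z)"
  proof
    fix r :: real
    have e1: "(4 * pi * exp r) powr (- (?n / 2)) = (4 * pi) powr (- (?n / 2)) * exp (- (?n / 2) * r)"
      by (simp add: powr_mult exp_powr_real mult.commute)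
    have e2: "(norm z)\<^sup>2 / (4 * exp r) = a * exp (- r)" by (simp add: a_def exp_minus inverse_eq_divide)
    have e3: "exp (- (k * r)) = exp (r / 2) * exp (- (?n / 2) * r)"
      by (simp add: mult_exp_exp k_def algebra_simps diff_divide_distrib)
    show "(4 * pi) powr (- (?n / 2)) * (exp (- (k * r)) * exp (- (a * exp (- r)))) = exp (r / 2) * heat (exp r) z"
      unfolding heat_def e1 e2 e3 by (simp only: mult_ac)
  qed
  moreover have "(4 * pi) powr (- (?n / 2)) * (Gamma k * a powr (- k)) = riesz_kernel z"
  proof -
    have "a powr (- k) = norm z powr (- (?n - 1)) * 4 powr k"
    proof -
      have "(norm z)\<^sup>2 = norm z powr 2" using z by simp
      then have "((norm z)\<^sup>2) powr (- k) = norm z powr (2 * (- k))" by (simp only: powr_powr)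
      also have "2 * (- k) = - (?n - 1)" by (simp add: k_def del: minus_diff_eq)
      finally have "((norm z)\<^sup>2) powr (- k) = norm z powr (- (?n - 1))" .
      moreover have "((norm z)\<^sup>2 / 4) powr (- k) = ((norm z)\<^sup>2) powr (- k) / 4 powr (- k)" by (rule powr_divide)
      ultimately show ?thesis by (simp add: a_def divide_powr_uminus)
    qed
    moreover have "real (DIM('a) - 1) = ?n - 1" using n by simp
    ultimately show ?thesis by (simp add: riesz_kernel_def riesz_coeff_def k_def mult_ac)
  qed
  ultimately show ?thesis using H by simp
qed

text \<open>Formulated for bounded integrable \<open>f\<close> so as to apply both to a Schwartz
  function and to its half-Laplacian. Nonnegativity of the kernel makes the absolute integral over
  \<open>r\<close> equal to the kernel itself, which justifies Fubini.\<close>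

lemma riesz_kernel_integral:
  fixes f :: "'a::euclidean_space \<Rightarrow> complex"
  assumes n: "DIM('a) \<ge> 2" and f: "integrable lborel f" "\<And>x. norm (f x) \<le> B"
  shows "integrable lborel (\<lambda>x. riesz_kernel (x - y) *\<^sub>R f x)"
    and "(\<integral>x. riesz_kernel (x - y) *\<^sub>R f x \<partial>lborel)
      = (\<integral>r. complex_of_real (exp (1 / 2 * r)) * (\<integral>x. heat (exp r) (x - y) * f x \<partial>lborel) \<partial>lborel)"
proof -
  note [measurable] = borel_measurable_integrable[OF f(1)]
  have "integrable lborel (\<lambda>x. norm (y - x) powr (- (real DIM('a) - 1)) * norm (f x))"
    using n f by (intro riesz_bound(1)[of _ _ B]) auto
  from integrable_mult_right[OF this, of "riesz_coeff TYPE('a)"]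
  have "integrable lborel (\<lambda>x. norm (riesz_kernel (x - y) *\<^sub>R f x))"
    unfolding norm_scaleR abs_of_nonneg[OF riesz_kernel_nonneg[OF n]] real_norm_def
    by (simp only: riesz_kernel_def norm_minus_commute[of _ y] mult.assoc)
  then show i: "integrable lborel (\<lambda>x. riesz_kernel (x - y) *\<^sub>R f x)"
    by (rule integrable_norm_iff[THEN iffD1, rotated]) measurable
  define h where "h = (\<lambda>x r. (exp (1 / 2 * r) * heat (exp r) (x - y)) *\<^sub>R f x)"
  have m: "case_prod h \<in> borel_measurable (borel \<Otimes>\<^sub>M borel)" unfolding h_def by measurable
  have ae: "AE x in lborel. x \<noteq> y" by (rule AE_lborel_singleton)
  have rk: "has_bochner_integral lborel (\<lambda>r. exp (1 / 2 * r) * heat (exp r) (x - y)) (riesz_kernel (x - y))" if "x \<noteq> y" for x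
    using riesz_kernel_heat[OF n, of "x - y"] that by simp
  have h1: "has_bochner_integral lborel (h x) (riesz_kernel (x - y) *\<^sub>R f x)" if "x \<noteq> y" for x
    unfolding h_def by (intro has_bochner_integral_scaleR_left rk that)
  have h2: "(\<integral>r. norm (h x r) \<partial>lborel) = norm (riesz_kernel (x - y) *\<^sub>R f x)" if "x \<noteq> y" for x
    using has_bochner_integral_mult_left[OF rk[OF that], of "norm (f x)"] riesz_kernel_nonneg[OF n, of "x - y"]
    by (simp add: h_def has_bochner_integral_iff)
  have A: "AE x in lborel. integrable lborel (h x)"
    using ae by eventually_elim (use h1 in \<open>auto simp: has_bochner_integral_iff\<close>)
  have C: "AE x in lborel. (\<integral>r. norm (h x r) \<partial>lborel) \<le> norm (riesz_kernel (x - y) *\<^sub>R f x)"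
    using ae by eventually_elim (rule order_eq_refl, rule h2)
  note F = fubini_iterated[OF m A integrable_norm[OF i] C]
  have "(\<integral>x. riesz_kernel (x - y) *\<^sub>R f x \<partial>lborel) = (\<integral>x. (\<integral>r. h x r \<partial>lborel) \<partial>lborel)"
  proof (rule integral_cong_AE)
    show "AE x in lborel. riesz_kernel (x - y) *\<^sub>R f x = (\<integral>r. h x r \<partial>lborel)"
      using ae by eventually_elim (use h1 in \<open>simp add: has_bochner_integral_iff\<close>)
  qed (use borel_measurable_integrable[OF i] borel_measurable_integrable[OF F(3)] in auto)
  also have "\<dots> = (\<integral>r. (\<integral>x. h x r \<partial>lborel) \<partial>lborel)" using F(2) by simp
  also have "\<dots> = (\<integral>r. complex_of_real (exp (1 / 2 * r)) * (\<integral>x. heat (exp r) (x - y) * f x \<partial>lborel) \<partial>lborel)"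
    by (simp add: h_def scaleR_conv_of_real mult.assoc)
  finally show "(\<integral>x. riesz_kernel (x - y) *\<^sub>R f x \<partial>lborel)
      = (\<integral>r. complex_of_real (exp (1 / 2 * r)) * (\<integral>x. heat (exp r) (x - y) * f x \<partial>lborel) \<partial>lborel)" .
qed

lemma riesz_kernel_schwartz:
  fixes \<phi> :: "'a::euclidean_space \<Rightarrow> complex"
  assumes n: "DIM('a) \<ge> 2" and \<phi>: "\<phi> \<in> schwartz_space"
  shows "(\<integral>x. riesz_kernel (x - y) *\<^sub>R \<phi> x \<partial>lborel)
     = complex_of_real (sqrt pi) * inv_fourier (\<lambda>\<xi>. norm \<xi> powr (- 1) *\<^sub>R fourier_transform \<phi> \<xi>) y"
proof -
  note [measurable] = schwartz_measurable[OF \<phi>]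
  obtain B where B: "\<And>x. norm (\<phi> x) \<le> B" using schwartz_bounded[OF \<phi>] by blast
  have "integrable lborel (\<lambda>\<xi>. norm \<xi> powr (- 1) *\<^sub>R fourier_transform \<phi> \<xi>)"
    using n by (intro integrable_powr_fourier_transform \<phi>) simp
  then have H: "has_bochner_integral lborel (\<lambda>r. complex_of_real (exp (1 / 2 * r)) * inv_fourier (\<lambda>\<xi>. exp (- (exp r * (norm \<xi>)\<^sup>2)) * fourier_transform \<phi> \<xi>) y)
    (complex_of_real (Gamma (1 / 2)) * inv_fourier (\<lambda>\<xi>. norm \<xi> powr (- 2 * (1 / 2)) *\<^sub>R fourier_transform \<phi> \<xi>) y)"
    by (intro exp_inv_fourier_integral) auto
  show ?thesis
    unfolding riesz_kernel_integral(2)[OF n schwartz_integrable[OF \<phi>] B]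
      inv_fourier_gauss_fourier_transform[OF schwartz_integrable[OF \<phi>] exp_gt_zero, symmetric]
    using has_bochner_integral_integral_eq[OF H] by (simp add: Gamma_one_half_real)
qed

lemma inv_fourier_bounded:
  "norm (inv_fourier g (x::'a::euclidean_space)) \<le> (\<integral>\<xi>. norm (g \<xi>) \<partial>lborel) / (2 * pi) ^ DIM('a)"
proof -
  have "norm (\<integral>\<xi>. cis (x \<bullet> \<xi>) * g \<xi> \<partial>lborel) \<le> (\<integral>\<xi>. norm (cis (x \<bullet> \<xi>) * g \<xi>) \<partial>lborel)" by (rule integral_norm_bound)
  then show ?thesis by (simp add: inv_fourier_def norm_divide norm_power norm_mult divide_right_mono)
qed

lemma integrable_norm_fourier_transform:
  assumes "\<phi> \<in> schwartz_space"
  shows "integrable lborel (\<lambda>\<xi>. norm \<xi> *\<^sub>R fourier_transform \<phi> \<xi>)"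
proof -
  have "integrable lborel (\<lambda>\<xi>. norm \<xi> powr 1 *\<^sub>R fourier_transform \<phi> \<xi>)"
    by (intro integrable_powr_fourier_transform assms) simp
  then show ?thesis by simp
qed

lemma half_laplacian_bounded:
  assumes "\<phi> \<in> schwartz_space"
  obtains B where "\<And>x. norm (half_laplacian \<phi> x) \<le> B"
  unfolding half_laplacian_inv_fourier[OF assms] using inv_fourier_bounded by blast

text \<open>Off the origin the symbols \<open>|\<xi>|^-1\<close> and \<open>|\<xi>|\<close> cancel,
  and Fourier inversion returns \<open>\<phi>\<close>; \<open>sqrt pi\<close> is the
  \<open>Gamma (1/2)\<close> kept in the kernel.\<close>

lemma riesz_kernel_half_laplacian:
  fixes \<phi> :: "'a::euclidean_space \<Rightarrow> complex"
  assumes n: "DIM('a) \<ge> 2" and \<phi>: "\<phi> \<in> schwartz_space"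
  shows "(\<integral>x. riesz_kernel (x - y) *\<^sub>R half_laplacian \<phi> x \<partial>lborel) = complex_of_real (sqrt pi) * \<phi> y"
proof -
  note [measurable] = schwartz_measurable[OF \<phi>]
  obtain B where B: "\<And>x. norm (half_laplacian \<phi> x) \<le> B" using half_laplacian_bounded[OF \<phi>] by blast
  let ?g = "\<lambda>\<xi>. norm \<xi> *\<^sub>R fourier_transform \<phi> \<xi>"
  note gi = integrable_norm_fourier_transform[OF \<phi>]
  have eq: "norm \<xi> powr (- 2 * (1 / 2)) *\<^sub>R ?g \<xi> = fourier_transform \<phi> \<xi>" if "\<xi> \<noteq> 0" for \<xi>
    using that by (simp add: powr_minus)
  have "integrable lborel (\<lambda>\<xi>. norm \<xi> powr (- 2 * (1 / 2)) *\<^sub>R ?g \<xi>)"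
  proof (rule integrable_cong_AE_imp[OF integrable_fourier_transform[OF \<phi>]])
    show "AE \<xi> in lborel. fourier_transform \<phi> \<xi> = norm \<xi> powr (- 2 * (1 / 2)) *\<^sub>R ?g \<xi>"
      using AE_lborel_singleton[of "0::'a"] by eventually_elim (rule eq[symmetric])
  qed measurable
  then have H: "has_bochner_integral lborel (\<lambda>r. complex_of_real (exp (1 / 2 * r)) * inv_fourier (\<lambda>\<xi>. exp (- (exp r * (norm \<xi>)\<^sup>2)) * ?g \<xi>) y)
    (complex_of_real (Gamma (1 / 2)) * inv_fourier (\<lambda>\<xi>. norm \<xi> powr (- 2 * (1 / 2)) *\<^sub>R ?g \<xi>) y)"
    by (intro exp_inv_fourier_integral) auto
  have "inv_fourier (\<lambda>\<xi>. norm \<xi> powr (- 2 * (1 / 2)) *\<^sub>R ?g \<xi>) y = inv_fourier (fourier_transform \<phi>) y"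
    by (rule inv_fourier_cong_AE[OF _ _ eq]) measurable
  also have "\<dots> = \<phi> y" by (rule fourier_inversion[OF \<phi>])
  finally have I: "inv_fourier (\<lambda>\<xi>. norm \<xi> powr (- 2 * (1 / 2)) *\<^sub>R ?g \<xi>) y = \<phi> y" .
  have "(\<integral>x. riesz_kernel (x - y) *\<^sub>R half_laplacian \<phi> x \<partial>lborel)
     = (\<integral>r. complex_of_real (exp (1 / 2 * r)) * inv_fourier (\<lambda>\<xi>. exp (- (exp r * (norm \<xi>)\<^sup>2)) * ?g \<xi>) y \<partial>lborel)"
    unfolding riesz_kernel_integral(2)[OF n half_laplacian_integrable(1)[OF \<phi>] B]
    unfolding half_laplacian_inv_fourier[OF \<phi>] integral_heat_inv_fourier[OF gi exp_gt_zero] ..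
  also have "\<dots> = complex_of_real (Gamma (1 / 2)) * inv_fourier (\<lambda>\<xi>. norm \<xi> powr (- 2 * (1 / 2)) *\<^sub>R ?g \<xi>) y"
    by (rule has_bochner_integral_integral_eq[OF H])
  finally show ?thesis by (simp only: I Gamma_one_half_real)
qed

text \<open>For \<open>n = 2 m + 1\<close> the symbol \<open>|\<xi>|^(2m - n)\<close> is
  \<open>|\<xi>|^-1\<close>, that of the Riesz kernel. So \<open>m\<close> Laplacians take the
  logarithm to within half a Laplacian of a point mass.\<close>

lemma integral_ln_nlap_odd:
  fixes \<phi> :: "'a::euclidean_space \<Rightarrow> complex"
  assumes n: "DIM('a) \<ge> 3" "DIM('a) = 2 * m + 1" and \<phi>: "\<phi> \<in> schwartz_space"
  shows "(\<integral>x. ln (norm (x - y)) *\<^sub>R ((\<lambda>\<psi> x. - laplacian \<psi> x) ^^ m) \<phi> x \<partial>lborel)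
    = - complex_of_real (gam TYPE('a) / sqrt pi) * (\<integral>x. riesz_kernel (x - y) *\<^sub>R \<phi> x \<partial>lborel)"
proof -
  have "2 * real m - real DIM('a) = - 1" using n by simp
  then show ?thesis
    using integral_ln_schwartz[of \<phi> m y] riesz_kernel_schwartz[of \<phi> y] n \<phi> by simp
qed

section \<open>Test functions and weak derivatives\<close>

lemma partial_deriv_zero_open:
  assumes "open U" "x \<in> U" "\<And>y. y \<in> U \<Longrightarrow> f y = 0"
  shows "partial_deriv b f x = 0"
proof -
  have "(f has_derivative (\<lambda>h. 0)) (at x)"
    by (rule has_derivative_transform_within_open[OF _ assms(1,2)]) (use assms(3) in auto)
  from partial_deriv_eq[OF this] show ?thesis by simp
qed

lemma partial_derivs_zero_open:
  assumes "open U" "\<And>y. y \<in> U \<Longrightarrow> f y = 0" "x \<in> U"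
  shows "partial_derivs bs f x = 0"
  using assms(3)
proof (induction bs arbitrary: x)
  case (Cons b bs)
  then show ?case by (auto intro!: partial_deriv_zero_open[OF assms(1)])
qed (use assms in auto)

lemma test_functionsI:
  assumes "smooth \<phi>" "compact K" "\<And>x. x \<notin> K \<Longrightarrow> \<phi> x = 0"
  shows "\<phi> \<in> test_functions"
proof -
  have "closure {x. \<phi> x \<noteq> 0} \<subseteq> K"
    using assms by (intro closure_minimal compact_imp_closed) auto
  then have "compact (closure {x. \<phi> x \<noteq> 0})"
    using assms(2) by (metis closed_closure compact_Int_closed inf.absorb2)
  then show ?thesis using assms(1) by (simp add: test_functions_def)
qed

lemma test_functionsE:
  assumes "\<phi> \<in> test_functions"
  obtains K where "compact K" "\<And>x bs. x \<notin> K \<Longrightarrow> partial_derivs bs \<phi> x = 0" "smooth \<phi>"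
proof (rule that[of "closure {x. \<phi> x \<noteq> 0}"])
  show "partial_derivs bs \<phi> x = 0" if "x \<notin> closure {x. \<phi> x \<noteq> 0}" for x bs
    by (rule partial_derivs_zero_open[of "- closure {x. \<phi> x \<noteq> 0}"])
       (use that closure_subset[of "{x. \<phi> x \<noteq> 0}"] in auto)
qed (use assms in \<open>auto simp: test_functions_def\<close>)

lemma test_partial_derivs:
  assumes "\<phi> \<in> test_functions" "bs \<in> lists Basis"
  shows "partial_derivs bs \<phi> \<in> test_functions"
proof -
  obtain K where K: "compact K" "\<And>x bs. x \<notin> K \<Longrightarrow> partial_derivs bs \<phi> x = 0" "smooth \<phi>"
    using test_functionsE[OF assms(1)] by blast
  show ?thesis
    by (rule test_functionsI[OF smooth_partial_derivs[OF K(3) assms(2)] K(1,2)])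
qed

lemma smooth_nlap:
  fixes \<phi> :: "'a::euclidean_space \<Rightarrow> complex"
  assumes "smooth \<phi>"
  shows "smooth (laplacian \<phi>)"
proof -
  have z: "smooth (\<lambda>x::'a. 0::complex)"
    using schwartz_zero schwartz_smooth by blast
  have "smooth (\<lambda>x. \<Sum>b\<in>A. partial_deriv b (partial_deriv b \<phi>) x)" if "A \<subseteq> Basis" "finite A" for A
    using that(2,1)
  proof (induction A rule: finite_induct)
    case (insert b A)
    then show ?case using assms by (auto intro!: smooth_add smooth_partial_deriv)
  qed (use z in simp)
  then show ?thesis unfolding laplacian_def[abs_def] by simp
qed

lemma test_laplacian:
  assumes "\<phi> \<in> test_functions"
  shows "laplacian \<phi> \<in> test_functions"
proof -
  obtain K where K: "compact K" "\<And>x bs. x \<notin> K \<Longrightarrow> partial_derivs bs \<phi> x = 0" "smooth \<phi>"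
    using test_functionsE[OF assms(1)] by blast
  have "laplacian \<phi> x = 0" if "x \<notin> K" for x
    unfolding laplacian_def using K(2)[OF that, of "[b, b]" for b] by simp
  with K show ?thesis by (intro test_functionsI[of _ K] smooth_nlap) auto
qed

lemma test_laplacian_power: "\<phi> \<in> test_functions \<Longrightarrow> (laplacian ^^ m) \<phi> \<in> test_functions"
  by (induction m) (auto intro: test_laplacian)

lemma integrable_compact_support:
  fixes f :: "'a::euclidean_space \<Rightarrow> 'b::euclidean_space"
  assumes "continuous_on UNIV f" "compact K" "\<And>x. x \<notin> K \<Longrightarrow> f x = 0"
  shows "integrable lborel f"
proof -
  have "integrable lborel (\<lambda>x. indicator K x *\<^sub>R f x)"
    using assms by (intro borel_integrable_compact continuous_on_subset[OF assms(1)]) auto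
  also have "(\<lambda>x. indicator K x *\<^sub>R f x) = f" using assms(3) by (auto simp: fun_eq_iff indicator_def)
  finally show ?thesis .
qed

lemma test_in_schwartz:
  assumes "\<phi> \<in> test_functions"
  shows "\<phi> \<in> schwartz_space"
proof -
  obtain K where K: "compact K" "\<And>x bs. x \<notin> K \<Longrightarrow> partial_derivs bs \<phi> x = 0" "smooth \<phi>"
    using test_functionsE[OF assms] by blast
  have "bounded (range (\<lambda>x. norm x ^ k *\<^sub>R partial_derivs bs \<phi> x))" if bs: "bs \<in> lists Basis" for k bs
  proof -
    let ?f = "\<lambda>x. norm x ^ k *\<^sub>R partial_derivs bs \<phi> x"
    have c: "continuous_on UNIV ?f"
      by (intro continuous_intros smooth_continuous smooth_partial_derivs K bs)
    have "compact (?f ` K)"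
      by (rule compact_continuous_image[OF continuous_on_subset[OF c subset_UNIV] K(1)])
    then have "bounded (?f ` K)" by (rule compact_imp_bounded)
    then have "bounded (insert 0 (?f ` K))" by simp
    moreover have "range ?f \<subseteq> insert 0 (?f ` K)"
    proof
      fix y assume "y \<in> range ?f"
      then obtain x where "y = ?f x" by auto
      then show "y \<in> insert 0 (?f ` K)" using K(2)[of x bs] by (cases "x \<in> K") auto
    qed
    ultimately show ?thesis by (rule bounded_subset)
  qed
  then show ?thesis using K(3) by (simp add: schwartz_space_def)
qed

lemma integral_by_parts:
  fixes u :: "'a::euclidean_space \<Rightarrow> real"
  assumes \<phi>: "\<phi> \<in> test_functions" and b: "b \<in> Basis"
    and u: "\<And>x. u differentiable (at x)" "continuous_on UNIV (partial_deriv b u)"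
  shows "(\<integral>x. u x *\<^sub>R partial_deriv b \<phi> x \<partial>lborel) = - (\<integral>x. partial_deriv b u x *\<^sub>R \<phi> x \<partial>lborel)"
proof -
  obtain K where K: "compact K" "\<And>x bs. x \<notin> K \<Longrightarrow> partial_derivs bs \<phi> x = 0" "smooth \<phi>"
    using test_functionsE[OF \<phi>] by blast
  have K': "\<phi> x = 0" "partial_deriv b \<phi> x = 0" if "x \<notin> K" for x
    using K(2)[OF that, of "[]"] K(2)[OF that, of "[b]"] by auto
  have cu: "continuous_on UNIV u"
    using u(1) by (metis continuous_at_imp_continuous_on differentiable_imp_continuous_within)
  have c\<phi>: "continuous_on UNIV \<phi>" "continuous_on UNIV (partial_deriv b \<phi>)"
    using K(3) b by (auto intro: smooth_continuous smooth_partial_deriv)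
  have i: "integrable lborel (\<lambda>x. u x *\<^sub>R partial_deriv b \<phi> x)" "integrable lborel (\<lambda>x. partial_deriv b u x *\<^sub>R \<phi> x)"
    using K' by (auto intro!: integrable_compact_support[OF _ K(1)] continuous_intros cu c\<phi> u)
  have "(\<integral>x. u x *\<^sub>R partial_deriv b \<phi> x + partial_deriv b u x *\<^sub>R \<phi> x \<partial>lborel) = 0"
  proof (rule integral_derivative_zero)
    fix x
    have 1: "((\<lambda>t. u (x + t *\<^sub>R b)) has_vector_derivative partial_deriv b u x) (at 0)"
      using has_vector_derivative_partial[of u x 0 b] u(1) by simp
    have 2: "((\<lambda>t. \<phi> (x + t *\<^sub>R b)) has_vector_derivative partial_deriv b \<phi> x) (at 0)"
      using has_vector_derivative_partial[of \<phi> x 0 b] smooth_differentiable[OF K(3)] by simp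
    show "((\<lambda>t. u (x + t *\<^sub>R b) *\<^sub>R \<phi> (x + t *\<^sub>R b)) has_vector_derivative
        u x *\<^sub>R partial_deriv b \<phi> x + partial_deriv b u x *\<^sub>R \<phi> x) (at 0)"
      using has_vector_derivative_scaleR[OF 1[unfolded has_real_derivative_iff_has_vector_derivative[symmetric]] 2] by simp
  next
    show "integrable lborel (\<lambda>x. u x *\<^sub>R \<phi> x)"
      using K' by (auto intro!: integrable_compact_support[OF _ K(1)] continuous_intros cu c\<phi>)
    show "integrable lborel (\<lambda>x. u x *\<^sub>R partial_deriv b \<phi> x + partial_deriv b u x *\<^sub>R \<phi> x)"
      using i by simp
  qed (intro continuous_intros cu c\<phi> u)
  then show ?thesis using i by (simp add: add_eq_0_iff2)
qed

text \<open>Derivatives are indexed by lists, and the order of differentiation is kept, so that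
  symmetry of mixed partial derivatives never enters.\<close>

definition Ck :: "nat \<Rightarrow> ('a::euclidean_space \<Rightarrow> real) \<Rightarrow> bool" where
  "Ck k u \<longleftrightarrow> (\<forall>bs\<in>lists Basis.
     (length bs < k \<longrightarrow> (\<forall>x. partial_derivs bs u differentiable (at x))) \<and>
     (length bs \<le> k \<longrightarrow> continuous_on UNIV (partial_derivs bs u)))"

lemma CkD:
  assumes "Ck k u" "bs \<in> lists Basis"
  shows "length bs < k \<Longrightarrow> partial_derivs bs u differentiable (at x)"
    and "length bs \<le> k \<Longrightarrow> continuous_on UNIV (partial_derivs bs u)"
  using assms by (auto simp: Ck_def)

lemma Ck_partial_deriv: "Ck (Suc k) u \<Longrightarrow> b \<in> Basis \<Longrightarrow> Ck k (partial_deriv b u)"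
  unfolding Ck_def[of k]
proof (intro ballI conjI impI allI)
  fix bs :: "'a list" and x assume *: "Ck (Suc k) u" "b \<in> Basis" "bs \<in> lists Basis"
  have **: "partial_derivs bs (partial_deriv b u) = partial_derivs (bs @ [b]) u"
    by (simp add: partial_derivs_append)
  show "length bs < k \<Longrightarrow> partial_derivs bs (partial_deriv b u) differentiable (at x)"
    unfolding ** using * by (intro CkD(1)[of "Suc k"]) auto
  show "length bs \<le> k \<Longrightarrow> continuous_on UNIV (partial_derivs bs (partial_deriv b u))"
    unfolding ** using * by (intro CkD(2)[of "Suc k"]) auto
qed

lemma Ck_continuous: "Ck k u \<Longrightarrow> continuous_on UNIV u"
  using CkD(2)[of k u "[]"] by simp

lemma Ck_differentiable: "Ck (Suc k) u \<Longrightarrow> u differentiable (at x)"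
  using CkD(1)[of "Suc k" u "[]"] by simp

lemma Ck_mono: "Ck k u \<Longrightarrow> j \<le> k \<Longrightarrow> Ck j u"
  by (auto simp: Ck_def)

lemma Ck_partial_derivs_add:
  assumes "Ck k u" "Ck k v" "bs \<in> lists Basis" "length bs \<le> k"
  shows "partial_derivs bs (\<lambda>x. u x + v x) = (\<lambda>x. partial_derivs bs u x + partial_derivs bs v x)"
  using assms(3,4)
proof (induction bs)
  case (Cons b bs)
  then have IH: "partial_derivs bs (\<lambda>x. u x + v x) = (\<lambda>x. partial_derivs bs u x + partial_derivs bs v x)"
    and bs: "bs \<in> lists Basis" "length bs < k" by auto
  show ?case
    unfolding partial_derivs.simps IH
    by (rule ext, rule partial_deriv_add) (use CkD(1) assms bs in blast)+
qed simp

lemma Ck_partial_derivs_cmult: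
  assumes "Ck k u" "bs \<in> lists Basis" "length bs \<le> k"
  shows "partial_derivs bs (\<lambda>x. c * u x) = (\<lambda>x. c * partial_derivs bs u x)"
  using assms(2,3)
proof (induction bs)
  case (Cons b bs)
  then have IH: "partial_derivs bs (\<lambda>x. c * u x) = (\<lambda>x. c * partial_derivs bs u x)"
    and bs: "bs \<in> lists Basis" "length bs < k" by auto
  show ?case
    unfolding partial_derivs.simps IH
    using partial_deriv_scaleR[OF CkD(1)[OF assms(1) bs], of b c] by (auto simp: fun_eq_iff)
qed simp

lemma Ck_add: "Ck k u \<Longrightarrow> Ck k v \<Longrightarrow> Ck k (\<lambda>x. u x + v x)"
  unfolding Ck_def[of k "\<lambda>x. u x + v x"]
  by (auto simp: Ck_partial_derivs_add intro!: differentiable_add continuous_intros dest: CkD)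

lemma Ck_cmult: "Ck k u \<Longrightarrow> Ck k (\<lambda>x. c * u x)"
  unfolding Ck_def[of k "\<lambda>x. c * u x"]
  by (auto simp: Ck_partial_derivs_cmult intro!: differentiable_mult continuous_intros dest: CkD)

text \<open>The outermost derivative of \<open>\<phi>\<close> is moved first and becomes the
  innermost one of \<open>u\<close>, hence the reversed list.\<close>

lemma Ck_integral_by_parts:
  assumes "Ck k u" "bs \<in> lists Basis" "length bs \<le> k" "\<phi> \<in> test_functions"
  shows "(\<integral>x. u x *\<^sub>R partial_derivs bs \<phi> x \<partial>lborel)
    = (- 1) ^ length bs * (\<integral>x. partial_derivs (rev bs) u x *\<^sub>R \<phi> x \<partial>lborel)"
  using assms(1-3)
proof (induction bs arbitrary: u k)
  case (Cons b bs)
  then obtain j where j: "k = Suc j" by (cases k) auto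
  have u: "Ck (Suc j) u" and b: "b \<in> Basis" and bs: "bs \<in> lists Basis" "length bs \<le> j"
    using Cons.prems j by auto
  note u' = Ck_partial_deriv[OF u b]
  have "(\<integral>x. u x *\<^sub>R partial_derivs (b # bs) \<phi> x \<partial>lborel) = - (\<integral>x. partial_deriv b u x *\<^sub>R partial_derivs bs \<phi> x \<partial>lborel)"
    unfolding partial_derivs.simps
    by (rule integral_by_parts[OF test_partial_derivs[OF assms(4) bs(1)] b Ck_differentiable[OF u] Ck_continuous[OF u']])
  also have "\<dots> = - ((- 1) ^ length bs * (\<integral>x. partial_derivs (rev bs) (partial_deriv b u) x *\<^sub>R \<phi> x \<partial>lborel))"
    by (simp only: Cons.IH[OF u' bs])
  also have "partial_derivs (rev bs) (partial_deriv b u) = partial_derivs (rev (b # bs)) u"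
    by (simp add: partial_derivs_append)
  finally show ?case by simp
qed simp

lemma L1_loc_continuous:
  assumes "continuous_on UNIV u"
  shows "L1_loc u"
  unfolding L1_loc_def
proof (intro allI impI)
  fix K :: "'a set" assume "compact K"
  then have i: "integrable lborel (\<lambda>x. indicator K x *\<^sub>R u x)"
    by (intro borel_integrable_compact continuous_on_subset[OF assms]) auto
  then show "set_integrable lebesgue K u"
    unfolding set_integrable_def by (simp only: integrable_completion[OF borel_measurable_integrable[OF i]])
qed

lemma integral_lebesgue_lborel:
  fixes f :: "'a::euclidean_space \<Rightarrow> 'b::{banach, second_countable_topology}"
  assumes "f \<in> borel_measurable borel"
  shows "(\<integral>x. f x \<partial>lebesgue) = (\<integral>x. f x \<partial>lborel)"
  by (rule integral_completion) (use assms in simp)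

lemma test_measurable: "\<phi> \<in> test_functions \<Longrightarrow> \<phi> \<in> borel_measurable borel"
  by (intro schwartz_measurable test_in_schwartz)

lemma Ck_W1_loc:
  assumes "Ck k u"
  shows "W1_loc k u"
  unfolding W1_loc_def
proof (intro conjI ballI impI)
  show "L1_loc u" by (intro L1_loc_continuous Ck_continuous[OF assms])
  fix bs :: "'a list" assume bs: "bs \<in> lists Basis" "length bs \<le> k"
  have c: "continuous_on UNIV (partial_derivs (rev bs) u)"
    using bs by (intro CkD(2)[OF assms]) auto
  note [measurable] = borel_measurable_continuous_onI[OF c] borel_measurable_continuous_onI[OF Ck_continuous[OF assms]]
  have "weak_partial_derivs bs u (partial_derivs (rev bs) u)"
    unfolding weak_partial_derivs_def
  proof (intro conjI ballI L1_loc_continuous c)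
    fix \<phi> :: "'a \<Rightarrow> complex" assume \<phi>: "\<phi> \<in> test_functions"
    note [measurable] = test_measurable[OF \<phi>] test_measurable[OF test_partial_derivs[OF \<phi> bs(1)]]
    show "(\<integral>x. u x *\<^sub>R partial_derivs bs \<phi> x \<partial>lebesgue)
          = (-1) ^ length bs * (\<integral>x. partial_derivs (rev bs) u x *\<^sub>R \<phi> x \<partial>lebesgue)"
      using Ck_integral_by_parts[OF assms bs \<phi>] by (simp add: integral_lebesgue_lborel)
  qed
  then show "\<exists>g. weak_partial_derivs bs u g" by blast
qed

lemma Ck_integral_laplacian:
  assumes u: "Ck 2 u" and \<phi>: "\<phi> \<in> test_functions"
  shows "(\<integral>x. u x *\<^sub>R laplacian \<phi> x \<partial>lborel) = (\<integral>x. laplacian u x *\<^sub>R \<phi> x \<partial>lborel)"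
proof -
  obtain K where K: "compact K" "\<And>x bs. x \<notin> K \<Longrightarrow> partial_derivs bs \<phi> x = 0" "smooth \<phi>"
    using test_functionsE[OF \<phi>] by blast
  have i1: "integrable lborel (\<lambda>x. u x *\<^sub>R partial_deriv b (partial_deriv b \<phi>) x)" if "b \<in> Basis" for b
    using K(2)[of _ "[b,b]"] that
    by (intro integrable_compact_support[OF _ K(1)] continuous_intros Ck_continuous[OF u] smooth_continuous smooth_partial_deriv K) auto
  have i2: "integrable lborel (\<lambda>x. partial_deriv b (partial_deriv b u) x *\<^sub>R \<phi> x)" if "b \<in> Basis" for b
  proof (rule integrable_compact_support[OF _ K(1)])
    have c: "continuous_on UNIV (partial_deriv b (partial_deriv b u))"
      using that CkD(2)[OF u, of "[b,b]"] by simp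
    show "continuous_on UNIV (\<lambda>x. partial_deriv b (partial_deriv b u) x *\<^sub>R \<phi> x)"
      by (intro continuous_intros c smooth_continuous[OF K(3)])
  qed (use K(2)[of _ "[]"] in simp)
  have "(\<integral>x. u x *\<^sub>R laplacian \<phi> x \<partial>lborel) = (\<Sum>b\<in>Basis. \<integral>x. u x *\<^sub>R partial_deriv b (partial_deriv b \<phi>) x \<partial>lborel)"
    unfolding laplacian_def scaleR_sum_right by (rule Bochner_Integration.integral_sum) (rule i1)
  also have "\<dots> = (\<Sum>b\<in>Basis. \<integral>x. partial_deriv b (partial_deriv b u) x *\<^sub>R \<phi> x \<partial>lborel)"
    using Ck_integral_by_parts[OF u _ _ \<phi>, of "[b,b]" for b] by (intro sum.cong) auto
  also have "\<dots> = (\<integral>x. laplacian u x *\<^sub>R \<phi> x \<partial>lborel)"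
    unfolding laplacian_def scaleR_sum_left by (rule Bochner_Integration.integral_sum[symmetric]) (rule i2)
  finally show ?thesis .
qed

section \<open>Polynomials\<close>

text \<open>Replaces the explicit coefficient sums: differentiation and multiplication are handled
  by rule induction, and \<open>d\<close> is only an upper bound for the degree.\<close>

inductive poly_fun :: "nat \<Rightarrow> ('a::euclidean_space \<Rightarrow> real) \<Rightarrow> bool" where
  const: "poly_fun d (\<lambda>x. c)"
| add: "poly_fun d p \<Longrightarrow> poly_fun d q \<Longrightarrow> poly_fun d (\<lambda>x. p x + q x)"
| mult: "poly_fun d p \<Longrightarrow> poly_fun (Suc d) (\<lambda>x. (x \<bullet> c) * p x)"
| mono: "poly_fun d p \<Longrightarrow> d \<le> e \<Longrightarrow> poly_fun e p"

lemma poly_fun_cmult: "poly_fun d p \<Longrightarrow> poly_fun d (\<lambda>x. a * p x)"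
proof (induction rule: poly_fun.induct)
  case (add d p q)
  from poly_fun.add[OF add.IH] show ?case by (simp add: distrib_left)
next
  case (mult d p c)
  from poly_fun.mult[OF mult.IH, of c] show ?case by (simp add: mult.left_commute)
qed (auto intro: poly_fun.intros)

lemma poly_fun_sum: "(\<And>i. i \<in> I \<Longrightarrow> poly_fun d (p i)) \<Longrightarrow> poly_fun d (\<lambda>x. \<Sum>i\<in>I. p i x)"
  by (induction I rule: infinite_finite_induct) (auto intro: poly_fun.intros)

lemma poly_fun_power: "poly_fun d p \<Longrightarrow> poly_fun (d + k) (\<lambda>x. (x \<bullet> c) ^ k * p x)"
proof (induction k)
  case (Suc k)
  from poly_fun.mult[OF Suc.IH[OF Suc.prems], of c] show ?case by (simp add: mult.assoc)
qed simp

lemma poly_fun_monomial: "finite A \<Longrightarrow> poly_fun (\<Sum>b\<in>A. \<alpha> b) (\<lambda>x. \<Prod>b\<in>A. (x \<bullet> b) ^ \<alpha> b)"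
proof (induction A rule: finite_induct)
  case (insert b A)
  from poly_fun_power[OF insert.IH, of "\<alpha> b" b] insert.hyps show ?case by (simp add: add.commute)
qed (auto intro: poly_fun.const)

lemma polynomial_poly_fun:
  assumes "polynomial_of_degree_le d P"
  shows "poly_fun d P"
proof -
  obtain c where c: "P = (\<lambda>x. \<Sum>\<alpha>\<in>multi_indices d. c \<alpha> * (\<Prod>b\<in>Basis. (x \<bullet> b) ^ \<alpha> b))"
    using assms by (auto simp: polynomial_of_degree_le_def fun_eq_iff)
  show ?thesis unfolding c
    by (intro poly_fun_sum poly_fun_cmult poly_fun.mono[OF poly_fun_monomial]) (auto simp: multi_indices_def)
qed

lemma poly_fun_norm2: "poly_fun 2 (\<lambda>x. (norm x)\<^sup>2)"
  unfolding norm_sq_sum_Basis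
  using poly_fun.mult[OF poly_fun.mult[OF poly_fun.const[of 0 1]]]
  by (intro poly_fun_sum) (simp add: power2_eq_square numeral_2_eq_2)

lemma poly_fun_norm4: "poly_fun 4 (\<lambda>x. norm x ^ 4)"
proof -
  have "poly_fun 4 (\<lambda>x::'a. \<Sum>b\<in>Basis. (x \<bullet> b) * ((x \<bullet> b) * (norm x)\<^sup>2))"
    using poly_fun.mult[OF poly_fun.mult[OF poly_fun_norm2]]
    by (intro poly_fun_sum) (simp add: numeral_eq_Suc)
  also have "(\<lambda>x::'a. \<Sum>b\<in>Basis. (x \<bullet> b) * ((x \<bullet> b) * (norm x)\<^sup>2)) = (\<lambda>x. norm x ^ 4)"
  proof
    fix x :: 'a
    have "(\<Sum>b\<in>Basis. (x \<bullet> b) * ((x \<bullet> b) * (norm x)\<^sup>2)) = (\<Sum>b\<in>Basis. (x \<bullet> b)\<^sup>2) * (norm x)\<^sup>2"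
      by (simp add: sum_distrib_right power2_eq_square mult.assoc)
    also have "\<dots> = norm x ^ 4" by (simp add: norm_sq_sum_Basis[symmetric] flip: power_add)
    finally show "(\<Sum>b\<in>Basis. (x \<bullet> b) * ((x \<bullet> b) * (norm x)\<^sup>2)) = norm x ^ 4" .
  qed
  finally show ?thesis .
qed

text \<open>Since \<open>0 - 1 = 0\<close> for natural numbers, the second claim alone does not say
  that the derivative of a constant vanishes; the third claim carries this through the
  induction.\<close>

lemma poly_fun_deriv:
  assumes "poly_fun d p"
  shows "p differentiable (at x)" "poly_fun (d - 1) (partial_deriv b p)" "d = 0 \<Longrightarrow> partial_deriv b p = (\<lambda>x. 0)"
proof -
  have "(\<forall>x. p differentiable (at x)) \<and> poly_fun (d - 1) (partial_deriv b p) \<and> (d = 0 \<longrightarrow> partial_deriv b p = (\<lambda>x. 0))"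
    using assms
  proof (induction rule: poly_fun.induct)
    case (const d c)
    have "partial_deriv b (\<lambda>x::'a. c) = (\<lambda>x. 0)"
      by (auto simp: partial_deriv_def)
    then show ?case by (simp add: poly_fun.const)
  next
    case (add d p q)
    then have "partial_deriv b (\<lambda>x. p x + q x) = (\<lambda>x. partial_deriv b p x + partial_deriv b q x)"
      by (auto simp: fun_eq_iff intro!: partial_deriv_add)
    with add show ?case by (auto intro: poly_fun.add)
  next
    case (mult d p c)
    have eq: "partial_deriv b (\<lambda>x. (x \<bullet> c) * p x) = (\<lambda>x. (b \<bullet> c) * p x + (x \<bullet> c) * partial_deriv b p x)"
    proof
      fix x
      obtain p' where p': "(p has_derivative p') (at x)" using mult by (auto simp: differentiable_def)
      have "((\<lambda>x. (x \<bullet> c) * p x) has_derivative (\<lambda>h. (x \<bullet> c) * p' h + (h \<bullet> c) * p x)) (at x)"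
        by (auto intro!: derivative_eq_intros p')
      from partial_deriv_eq[OF this, of b] partial_deriv_eq[OF p', of b]
      show "partial_deriv b (\<lambda>x. (x \<bullet> c) * p x) x = (b \<bullet> c) * p x + (x \<bullet> c) * partial_deriv b p x" by simp
    qed
    have "poly_fun d (\<lambda>x. (x \<bullet> c) * partial_deriv b p x)"
    proof (cases d)
      case 0
      then show ?thesis using mult by (simp add: poly_fun.const)
    next
      case (Suc j)
      then show ?thesis using mult poly_fun.mult[of j "partial_deriv b p" c] by simp
    qed
    then show ?case unfolding eq
      using mult by (auto intro!: poly_fun.add poly_fun_cmult differentiable_mult differentiable_inner)
  next
    case (mono d p e)
    then show ?case by (auto intro: poly_fun.mono)
  qed
  then show "p differentiable (at x)" "poly_fun (d - 1) (partial_deriv b p)" "d = 0 \<Longrightarrow> partial_deriv b p = (\<lambda>x. 0)"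
    by auto
qed

lemma poly_fun_partial_derivs: "poly_fun d p \<Longrightarrow> poly_fun (d - length bs) (partial_derivs bs p)"
proof (induction bs)
  case (Cons b bs)
  from poly_fun_deriv(2)[OF Cons.IH[OF Cons.prems], of b] show ?case by simp
qed simp

lemma poly_fun_continuous: "poly_fun d p \<Longrightarrow> continuous_on UNIV p"
  using poly_fun_deriv(1) by (metis continuous_at_imp_continuous_on differentiable_imp_continuous_within)

lemma poly_fun_Ck: "poly_fun d p \<Longrightarrow> Ck k p"
  unfolding Ck_def using poly_fun_partial_derivs poly_fun_deriv(1) poly_fun_continuous by blast

lemma poly_fun_0:
  assumes "poly_fun 0 p"
  shows "\<exists>c. p = (\<lambda>x. c)"
proof -
  have "d = 0 \<longrightarrow> (\<exists>c. p = (\<lambda>x. c))" if "poly_fun d p" for d and p :: "'a \<Rightarrow> real"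
    using that by (induction rule: poly_fun.induct) auto
  with assms show ?thesis by blast
qed

lemma poly_fun_laplacian:
  assumes "poly_fun d p"
  shows "poly_fun (d - 2) (laplacian p)" "d < 2 \<Longrightarrow> laplacian p = (\<lambda>x. 0)"
proof -
  show "poly_fun (d - 2) (laplacian p)"
    unfolding laplacian_def[abs_def]
    using poly_fun_partial_derivs[OF assms, of "[b,b]" for b] by (intro poly_fun_sum) (simp add: numeral_2_eq_2)
  assume "d < 2"
  then have "d - 1 = 0" by simp
  then have "partial_deriv b (partial_deriv b p) = (\<lambda>x. 0)" for b
    by (rule poly_fun_deriv(3)[OF poly_fun_deriv(2)[OF assms]])
  then show "laplacian p = (\<lambda>x. 0)" by (auto simp: laplacian_def[abs_def])
qed

text \<open>Every Laplacian moved onto \<open>p\<close> lowers its degree by two, so only a constant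
  survives when \<open>d \<le> 2 m\<close>, and nothing when \<open>d < 2 m\<close>. For degree
  \<open>n - 1\<close> the strict case is even \<open>n\<close> with \<open>m = n/2\<close>, and the
  borderline case is odd \<open>n\<close> with \<open>m = (n-1)/2\<close>.\<close>

lemma poly_fun_integral_laplacian_power:
  assumes "poly_fun d p" "\<phi> \<in> test_functions" "d \<le> 2 * m"
  shows "\<exists>c. (\<forall>\<phi>\<in>test_functions. (\<integral>x. p x *\<^sub>R (laplacian ^^ m) \<phi> x \<partial>lborel) = c *\<^sub>R (\<integral>x. \<phi> x \<partial>lborel)) \<and> (d < 2 * m \<longrightarrow> c = 0)"
  using assms(1,3)
proof (induction m arbitrary: p d)
  case 0
  then show ?case using poly_fun_0[of p] by auto
next
  case (Suc m)
  have z: "poly_fun 0 (\<lambda>x. 0 :: real)" by (rule poly_fun.const)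
  have step: "(\<integral>x. p x *\<^sub>R (laplacian ^^ Suc m) \<phi> x \<partial>lborel) = (\<integral>x. laplacian p x *\<^sub>R (laplacian ^^ m) \<phi> x \<partial>lborel)"
    if "\<phi> \<in> test_functions" for \<phi>
    using Ck_integral_laplacian[OF poly_fun_Ck[OF Suc.prems(1)] test_laplacian_power[OF that]] by simp
  show ?case
  proof (cases "d < 2")
    case True
    then show ?thesis using poly_fun_laplacian(2)[OF Suc.prems(1)] by (intro exI[of _ 0]) (simp add: step del: funpow.simps)
  next
    case False
    have "d - 2 \<le> 2 * m" using Suc.prems(2) by simp
    from Suc.IH[OF poly_fun_laplacian(1)[OF Suc.prems(1)] this] obtain c where
      "\<forall>\<phi>\<in>test_functions. (\<integral>x. laplacian p x *\<^sub>R (laplacian ^^ m) \<phi> x \<partial>lborel) = c *\<^sub>R (\<integral>x. \<phi> x \<partial>lborel)"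
      "d - 2 < 2 * m \<longrightarrow> c = 0" by blast
    then show ?thesis using False by (intro exI[of _ c]) (auto simp: step simp del: funpow.simps)
  qed
qed

section \<open>Reflection invariance of Lebesgue measure\<close>

text \<open>Translation-invariant measures are proportional by Fubini; comparing on the unit ball fixes the constant.\<close>

lemma distr_lborel_isometry:
  fixes T :: "'a::euclidean_space \<Rightarrow> 'a"
  assumes T: "linear T" "\<And>x. norm (T x) = norm x" "\<And>x. T (T x) = x"
  shows "distr lborel borel T = lborel"
proof -
  have cT: "continuous_on UNIV T" using T(1) by (simp add: linear_continuous_on linear_linear)
  have Tm[measurable]: "T \<in> borel_measurable borel" by (rule borel_measurable_continuous_onI[OF cT])
  define N where "N = distr lborel borel T"
  have sN[simp, measurable_cong]: "sets N = sets borel" by (simp add: N_def)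
  define g where "g = (\<lambda>x::'a. indicator (ball 0 1) x :: ennreal)"
  have g[measurable]: "g \<in> borel_measurable borel" unfolding g_def by (intro borel_measurable_indicator) simp
  have gT: "g (T x) = g x" for x by (simp add: g_def indicator_def T(2))
  have Nint: "(\<integral>\<^sup>+x. h x \<partial>N) = (\<integral>\<^sup>+x. h (T x) \<partial>lborel)" if "h \<in> borel_measurable borel" for h :: "'a \<Rightarrow> ennreal"
    unfolding N_def using that by (subst nn_integral_distr) auto
  have shift: "(\<integral>\<^sup>+x. h (c + x) \<partial>lborel) = (\<integral>\<^sup>+x. h x \<partial>lborel)" "(\<integral>\<^sup>+x. h (c - x) \<partial>lborel) = (\<integral>\<^sup>+x. h x \<partial>lborel)"
    if [measurable]: "h \<in> borel_measurable borel" for h :: "'a \<Rightarrow> ennreal" and c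
  proof -
    have "(\<integral>\<^sup>+x. h x \<partial>lborel) = (\<integral>\<^sup>+x. h x \<partial>distr lborel borel (\<lambda>x. c + 1 *\<^sub>R x))"
      by (subst distr_lborel_affine_unit) auto
    then show "(\<integral>\<^sup>+x. h (c + x) \<partial>lborel) = (\<integral>\<^sup>+x. h x \<partial>lborel)" by (simp add: nn_integral_distr)
    have "(\<integral>\<^sup>+x. h x \<partial>lborel) = (\<integral>\<^sup>+x. h x \<partial>distr lborel borel (\<lambda>x. c + (-1) *\<^sub>R x))"
      by (subst distr_lborel_affine_unit) auto
    then show "(\<integral>\<^sup>+x. h (c - x) \<partial>lborel) = (\<integral>\<^sup>+x. h x \<partial>lborel)" by (simp add: nn_integral_distr)
  qed
  have key: "(\<integral>\<^sup>+x. f (T x) \<partial>lborel) = (\<integral>\<^sup>+x. f x \<partial>lborel)" if f[measurable]: "f \<in> borel_measurable borel" for f :: "'a \<Rightarrow> ennreal"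
  proof -
    have "(\<integral>\<^sup>+x. f (T x) \<partial>lborel) * (\<integral>\<^sup>+y. g y \<partial>lborel) = (\<integral>\<^sup>+x. f (T x) * (\<integral>\<^sup>+y. g y \<partial>lborel) \<partial>lborel)"
      by (subst nn_integral_multc) auto
    also have "\<dots> = (\<integral>\<^sup>+x. (\<integral>\<^sup>+y. f (T x) * g (T x + y) \<partial>lborel) \<partial>lborel)"
      by (intro nn_integral_cong) (simp add: nn_integral_cmult shift)
    also have "\<dots> = (\<integral>\<^sup>+y. (\<integral>\<^sup>+x. f (T x) * g (T x + y) \<partial>lborel) \<partial>lborel)"
      by (intro lborel_pair.Fubini') measurable
    \<comment> \<open>Translating \<open>x\<close> by \<open>- T y\<close> changes
      \<open>T x\<close> by \<open>- y\<close>, because \<open>T\<close> is an involution; the shift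
      by \<open>y\<close> passes from \<open>g\<close> to \<open>f\<close>.\<close>
    also have "\<dots> = (\<integral>\<^sup>+y. (\<integral>\<^sup>+x. f (T x - y) * g (T x) \<partial>lborel) \<partial>lborel)"
    proof (rule nn_integral_cong)
      fix y
      have "(\<integral>\<^sup>+x. f (T x) * g (T x + y) \<partial>lborel) = (\<integral>\<^sup>+x. f (T (- T y + x)) * g (T (- T y + x) + y) \<partial>lborel)"
        by (subst shift(1)[of "\<lambda>x. f (T x) * g (T x + y)" "- T y"]) auto
      also have "\<dots> = (\<integral>\<^sup>+x. f (T x - y) * g (T x) \<partial>lborel)"
        using T by (simp add: linear_add linear_diff linear_neg)
      finally show "(\<integral>\<^sup>+x. f (T x) * g (T x + y) \<partial>lborel) = (\<integral>\<^sup>+x. f (T x - y) * g (T x) \<partial>lborel)" .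
    qed
    also have "\<dots> = (\<integral>\<^sup>+x. (\<integral>\<^sup>+y. f (T x - y) * g x \<partial>lborel) \<partial>lborel)"
      unfolding gT by (intro lborel_pair.Fubini'[symmetric]) measurable
    also have "\<dots> = (\<integral>\<^sup>+x. (\<integral>\<^sup>+y. f y \<partial>lborel) * g x \<partial>lborel)"
      by (intro nn_integral_cong) (simp add: nn_integral_multc shift)
    also have "\<dots> = (\<integral>\<^sup>+y. f y \<partial>lborel) * (\<integral>\<^sup>+x. g x \<partial>lborel)"
      by (subst nn_integral_cmult) auto
    finally have "(\<integral>\<^sup>+x. f (T x) \<partial>lborel) * (\<integral>\<^sup>+y. g y \<partial>lborel) = (\<integral>\<^sup>+y. f y \<partial>lborel) * (\<integral>\<^sup>+x. g x \<partial>lborel)" .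
    moreover have "(\<integral>\<^sup>+y. g y \<partial>lborel) = ennreal (unit_ball_vol DIM('a))"
      unfolding g_def by (subst nn_integral_indicator) (auto simp: emeasure_ball)
    ultimately have "ennreal (unit_ball_vol DIM('a)) * (\<integral>\<^sup>+x. f (T x) \<partial>lborel) = ennreal (unit_ball_vol DIM('a)) * (\<integral>\<^sup>+y. f y \<partial>lborel)"
      by (simp only: mult.commute)
    moreover have "ennreal (unit_ball_vol DIM('a)) \<noteq> 0"
      unfolding ennreal_eq_0_iff not_le by simp
    moreover have "ennreal (unit_ball_vol DIM('a)) \<noteq> top" by simp
    ultimately show ?thesis unfolding ennreal_mult_cancel_left by blast
  qed
  show ?thesis
  proof (rule measure_eqI)
    fix A :: "'a set" assume "A \<in> sets (distr lborel borel T)"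
    then have [measurable]: "A \<in> sets borel" by simp
    have "emeasure (distr lborel borel T) A = (\<integral>\<^sup>+x. indicator A (T x) \<partial>lborel)"
      by (simp add: nn_integral_distr flip: nn_integral_indicator)
    also have "\<dots> = emeasure lborel A" by (subst key) auto
    finally show "emeasure (distr lborel borel T) A = emeasure lborel A" .
  qed simp
qed

text \<open>The Householder reflection in the hyperplane orthogonal to \<open>x - y\<close>. Being
  an involution, it has the form required for invariance of Lebesgue measure.\<close>

lemma reflection_exists:
  fixes x y :: "'a::euclidean_space"
  assumes "norm x = norm y"
  obtains T where "linear T" "\<And>z. norm (T z) = norm z" "\<And>z. T (T z) = z" "T x = y"
proof (cases "x = y")
  case True
  then show ?thesis using that[of "\<lambda>z. z"] by (simp add: linear_id[unfolded id_def])
next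
  case False
  define d where "d = x - y"
  have d: "d \<bullet> d > 0" using False by (simp add: d_def)
  define T where "T = (\<lambda>z. z - (2 * (z \<bullet> d) / (d \<bullet> d)) *\<^sub>R d)"
  show ?thesis
  proof (rule that[of T])
    show "linear T"
      by (rule linearI) (simp_all add: T_def inner_add_left scaleR_add_left scaleR_diff_right algebra_simps add_divide_distrib)
    have "T z \<bullet> T z = z \<bullet> z" for z
      using d by (simp add: T_def inner_diff_left inner_diff_right inner_commute field_simps power2_eq_square)
    then show "norm (T z) = norm z" for z by (simp add: norm_eq_sqrt_inner)
    have "T z \<bullet> d = - (z \<bullet> d)" for z using d by (simp add: T_def inner_diff_left)
    then show "T (T z) = z" for z by (simp add: T_def[of ] T_def)
    have "2 * (x \<bullet> d) = d \<bullet> d"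
      using assms by (simp add: d_def inner_diff_left inner_diff_right norm_eq_sqrt_inner inner_commute)
    then show "T x = y" using d by (simp add: T_def d_def)
  qed
qed

section \<open>Differentiation under the integral sign\<close>

text \<open>The mean value inequality bounds the difference quotients by a multiple of
  \<open>w\<close>, so dominated convergence applies along every sequence of increments. The
  derivative is given through its coordinates \<open>f' b\<close>, so that the partial derivatives
  of the integral can be read off directly.\<close>

lemma has_derivative_integral_dominated:
  fixes f :: "'a::euclidean_space \<Rightarrow> 't \<Rightarrow> real" and f' :: "'a \<Rightarrow> 'a \<Rightarrow> 't \<Rightarrow> real"
  assumes int: "\<And>x. integrable M (f x)"
    and der: "\<And>x t. ((\<lambda>x. f x t) has_derivative (\<lambda>h. \<Sum>b\<in>Basis. (h \<bullet> b) * f' b x t)) (at x)"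
    and bd: "\<And>b x t. b \<in> Basis \<Longrightarrow> \<bar>f' b x t\<bar> \<le> w t" and w: "integrable M w"
    and m: "\<And>b x. b \<in> Basis \<Longrightarrow> f' b x \<in> borel_measurable M"
  shows "((\<lambda>x. \<integral>t. f x t \<partial>M) has_derivative (\<lambda>h. \<Sum>b\<in>Basis. (h \<bullet> b) * (\<integral>t. f' b x t \<partial>M))) (at x)"
proof -
  let ?n = "real DIM('a)"
  have int': "integrable M (f' b x)" if "b \<in> Basis" for b x
    by (rule Bochner_Integration.integrable_bound[OF w m[OF that]])
       (use bd[OF that] in \<open>auto intro!: AE_I2 order_trans[OF bd[OF that]]\<close>)
  have lbd: "\<bar>\<Sum>b\<in>Basis. (h \<bullet> b) * f' b x t\<bar> \<le> ?n * w t * norm h" for h x t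
  proof -
    have "\<bar>\<Sum>b\<in>Basis. (h \<bullet> b) * f' b x t\<bar> \<le> (\<Sum>b\<in>(Basis::'a set). norm h * w t)"
      by (intro order_trans[OF sum_abs] sum_mono) (auto simp: abs_mult intro!: mult_mono bd Basis_le_norm)
    then show ?thesis by (simp add: mult_ac)
  qed
  have lip: "\<bar>f (x + h) t - f x t\<bar> \<le> ?n * w t * norm h" for x h t
  proof -
    have "norm (f (x + h) t - f x t) \<le> ?n * w t * norm (x + h - x)"
    proof (rule differentiable_bound[of UNIV "\<lambda>x. f x t"])
      fix y :: 'a
      have "onorm (\<lambda>h. \<Sum>b\<in>Basis. (h \<bullet> b) * f' b y t) \<le> ?n * w t"
        by (rule onorm_le) (use lbd in \<open>auto simp: mult_ac\<close>)
      then show "onorm (\<lambda>h. \<Sum>b\<in>Basis. (h \<bullet> b) * f' b y t) \<le> ?n * w t" .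
    qed (auto intro: der)
    then show ?thesis by simp
  qed
  define L where "L = (\<lambda>h. \<Sum>b\<in>Basis. (h \<bullet> b) * (\<integral>t. f' b x t \<partial>M))"
  define q where "q = (\<lambda>h t. (f (x + h) t - f x t - (\<Sum>b\<in>Basis. (h \<bullet> b) * f' b x t)) / norm h)"
  have qint: "integrable M (q h)" for h
    unfolding q_def using int int' by (intro integrable_divide_zero Bochner_Integration.integrable_diff Bochner_Integration.integrable_sum integrable_mult_right) auto
  have qI: "(\<integral>t. q h t \<partial>M) = ((\<integral>t. f (x + h) t \<partial>M) - (\<integral>t. f x t \<partial>M) - L h) / norm h" for h
  proof -
    have i: "integrable M (\<lambda>t. \<Sum>b\<in>Basis. (h \<bullet> b) * f' b x t)"
      using int' by (intro Bochner_Integration.integrable_sum integrable_mult_right) auto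
    have "(\<integral>t. (\<Sum>b\<in>Basis. (h \<bullet> b) * f' b x t) \<partial>M) = L h"
      unfolding L_def using int' by (subst Bochner_Integration.integral_sum) auto
    then show ?thesis unfolding q_def using int i by simp
  qed
  have qbd: "\<bar>q h t\<bar> \<le> 2 * ?n * w t" for h t
  proof (cases "h = 0")
    case True
    have "0 \<le> w t" using bd[OF SOME_Basis, of x t] by linarith
    then show ?thesis using True by (simp add: q_def)
  next
    case False
    have "\<bar>f (x + h) t - f x t - (\<Sum>b\<in>Basis. (h \<bullet> b) * f' b x t)\<bar> \<le> 2 * ?n * w t * norm h"
      using lip[of x h t] lbd[of h x t] by linarith
    then show ?thesis using False by (simp add: q_def abs_divide pos_divide_le_eq)
  qed
  have "((\<lambda>h. \<integral>t. q h t \<partial>M) \<longlongrightarrow> 0) (at 0)"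
    unfolding tendsto_at_iff_sequentially o_def
  proof (intro allI impI)
    fix X :: "nat \<Rightarrow> 'a" assume X: "\<forall>i. X i \<in> UNIV - {0}" "X \<longlonglongrightarrow> 0"
    have "(\<lambda>i. \<integral>t. q (X i) t \<partial>M) \<longlonglongrightarrow> (\<integral>t. 0 \<partial>M)"
    proof (rule integral_dominated_convergence[where w="\<lambda>t. 2 * ?n * w t"])
      show "AE t in M. (\<lambda>i. q (X i) t) \<longlonglongrightarrow> 0"
      proof (rule AE_I2)
        fix t
        have "((\<lambda>h. norm (f (x + h) t - f x t - (\<Sum>b\<in>Basis. (h \<bullet> b) * f' b x t)) / norm h) \<longlongrightarrow> 0) (at 0)"
          using der[where x=x and t=t] by (simp add: has_derivative_at)
        then have "((\<lambda>h. \<bar>q h t\<bar>) \<longlongrightarrow> 0) (at 0)" by (simp add: q_def abs_divide)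
        then have "((\<lambda>h. q h t) \<longlongrightarrow> 0) (at 0)" by (rule tendsto_rabs_zero_cancel)
        then show "(\<lambda>i. q (X i) t) \<longlonglongrightarrow> 0"
          using X unfolding tendsto_at_iff_sequentially o_def by blast
      qed
    qed (use w qbd qint in \<open>auto dest: borel_measurable_integrable\<close>)
    then show "(\<lambda>i. \<integral>t. q (X i) t \<partial>M) \<longlonglongrightarrow> 0" by simp
  qed
  then have "((\<lambda>h. norm ((\<integral>t. f (x + h) t \<partial>M) - (\<integral>t. f x t \<partial>M) - L h) / norm h) \<longlongrightarrow> 0) (at 0)"
    unfolding qI by (auto dest: tendsto_rabs_zero simp: abs_divide)
  moreover have "bounded_linear L"
    unfolding L_def by (intro bounded_linear_sum bounded_linear_mult_left[THEN bounded_linear_compose] bounded_linear_inner_left)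
  ultimately show ?thesis unfolding L_def by (simp add: has_derivative_at)
qed

lemma continuous_integral_dominated:
  fixes f :: "'a::euclidean_space \<Rightarrow> 't \<Rightarrow> real"
  assumes m: "\<And>x. f x \<in> borel_measurable M"
    and c: "\<And>t. continuous_on UNIV (\<lambda>x. f x t)"
    and bd: "\<And>x t. \<bar>f x t\<bar> \<le> w t" and w: "integrable M w"
  shows "continuous_on UNIV (\<lambda>x. \<integral>t. f x t \<partial>M)"
  unfolding continuous_on_sequentially
proof (intro ballI allI impI)
  fix a and X :: "nat \<Rightarrow> 'a" assume X: "(\<forall>n. X n \<in> UNIV) \<and> X \<longlonglongrightarrow> a"
  have "(\<lambda>n. \<integral>t. f (X n) t \<partial>M) \<longlonglongrightarrow> (\<integral>t. f a t \<partial>M)"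
  proof (rule integral_dominated_convergence[where w=w])
    show "AE t in M. (\<lambda>n. f (X n) t) \<longlonglongrightarrow> f a t"
    proof (rule AE_I2)
      fix t
      show "(\<lambda>n. f (X n) t) \<longlonglongrightarrow> f a t"
        using c[of t] X by (auto simp: continuous_on_sequentially o_def)
    qed
  qed (use m bd w in auto)
  then show "((\<lambda>x. \<integral>t. f x t \<partial>M) \<circ> X) \<longlonglongrightarrow> (\<integral>t. f a t \<partial>M)" by (simp add: o_def)
qed

section \<open>Derivatives of Gaussians\<close>

text \<open>A class containing the Gaussian and closed under taking derivatives in \<open>z\<close>.
  The index is the parabolic order: \<open>gk k\<close> scales like \<open>t^(k/2)\<close>, where a
  factor \<open>t\<close> counts 2 and a factor \<open>t z\<close> counts 1 because
  \<open>|z|\<close> is of size \<open>t^(-1/2)\<close> under the Gaussian.\<close>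

inductive gk :: "nat \<Rightarrow> (real \<Rightarrow> 'a::euclidean_space \<Rightarrow> real) \<Rightarrow> bool" where
  base: "gk 0 (\<lambda>t z. exp (- (t * (norm z)\<^sup>2)))"
| mult: "gk k g \<Longrightarrow> gk (Suc k) (\<lambda>t z. (t * (z \<bullet> c)) * g t z)"
| tmult: "gk k g \<Longrightarrow> gk (k + 2) (\<lambda>t z. t * g t z)"
| add: "gk k g \<Longrightarrow> gk k h \<Longrightarrow> gk k (\<lambda>t z. g t z + h t z)"
| cmult: "gk k g \<Longrightarrow> gk k (\<lambda>t z. a * g t z)"

lemma gk_measurable:
  assumes "gk k g"
  shows "(\<lambda>p. g (fst p) (snd p)) \<in> borel_measurable (borel \<Otimes>\<^sub>M borel)"
  using assms
proof induction
  case (mult k g c)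
  note [measurable] = mult.IH
  show ?case by measurable
next
  case (tmult k g)
  note [measurable] = tmult.IH
  show ?case by measurable
next
  case (add k g h)
  note [measurable] = add.IH
  show ?case by measurable
next
  case (cmult k g a)
  note [measurable] = cmult.IH
  show ?case by measurable
qed measurable

lemma gk_measurable2 [measurable (raw)]:
  assumes "gk k g" "f \<in> borel_measurable M" "h \<in> borel_measurable M"
  shows "(\<lambda>x. g (f x) (h x)) \<in> borel_measurable M"
proof -
  have "(\<lambda>x. (f x, h x)) \<in> M \<rightarrow>\<^sub>M borel \<Otimes>\<^sub>M borel" using assms(2,3) by measurable
  from measurable_compose[OF this gk_measurable[OF assms(1)]] show ?thesis by simp
qed

lemma gk_continuous: "gk k g \<Longrightarrow> continuous_on UNIV (g t)"
  by (induction rule: gk.induct) (auto intro!: continuous_intros)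

text \<open>A factor \<open>sqrt t |z|\<close> is paid for with a part of the Gaussian exponent.
  Therefore \<open>\<theta>\<close> stays arbitrary below 1 during the induction.\<close>

lemma gk_bound:
  assumes "gk k g"
  shows "0 < \<theta> \<Longrightarrow> \<theta> < 1 \<Longrightarrow> \<exists>C\<ge>0. \<forall>t>0. \<forall>z. \<bar>g t z\<bar> \<le> C * (t powr (k / 2) * exp (- (\<theta> * t * (norm z)\<^sup>2)))"
  using assms
proof (induction arbitrary: \<theta>)
  case base
  show ?case
  proof (intro exI[of _ 1] conjI allI impI)
    fix t :: real and z :: 'a assume "t > 0"
    then have "\<theta> * (t * (norm z)\<^sup>2) \<le> 1 * (t * (norm z)\<^sup>2)" using base by (intro mult_right_mono) auto
    then show "\<bar>exp (- (t * (norm z)\<^sup>2))\<bar> \<le> 1 * (t powr (real 0 / 2) * exp (- (\<theta> * t * (norm z)\<^sup>2)))"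
      using \<open>t > 0\<close> by (simp add: mult.assoc)
  qed simp
next
  case (mult k g c)
  \<comment> \<open>Any value strictly between \<open>\<theta>\<close> and 1 would do; the gap
    \<open>d\<close> is the part of the exponent that absorbs the linear factor.\<close>
  define \<theta>' where "\<theta>' = (1 + \<theta>) / 2"
  define d where "d = \<theta>' - \<theta>"
  have \<theta>': "0 < \<theta>'" "\<theta>' < 1" and d: "d > 0" using mult.prems by (auto simp: \<theta>'_def d_def)
  obtain C where C: "C \<ge> 0" "\<And>t z. t > 0 \<Longrightarrow> \<bar>g t z\<bar> \<le> C * (t powr (k / 2) * exp (- (\<theta>' * t * (norm z)\<^sup>2)))"
    using mult.IH[OF \<theta>'] by blast
  show ?case
  proof (intro exI[of _ "norm c * (1 + 1 / d) * C"] conjI allI impI)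
    fix t :: real and z :: 'a assume t: "t > 0"
    define s where "s = sqrt t * norm z"
    have s: "s \<ge> 0" "s\<^sup>2 = t * (norm z)\<^sup>2" using t by (auto simp: s_def power_mult_distrib)
    have "0 \<le> (s - 1 / 2)\<^sup>2" by simp
    then have "s \<le> 1 + s\<^sup>2" by (simp add: power2_eq_square algebra_simps)
    also have "\<dots> \<le> (1 + 1 / d) * (1 + d * s\<^sup>2)"
    proof -
      have "(1 + 1 / d) * (1 + d * s\<^sup>2) = 1 + s\<^sup>2 + (d * s\<^sup>2 + 1 / d)"
        using d by (simp add: distrib_left distrib_right)
      moreover have "0 \<le> d * s\<^sup>2 + 1 / d" using d by simp
      ultimately show ?thesis by linarith
    qed
    also have "\<dots> \<le> (1 + 1 / d) * exp (d * s\<^sup>2)" using d by (intro mult_left_mono exp_ge_add_one_self) auto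
    finally have sb: "s * exp (- (d * s\<^sup>2)) \<le> 1 + 1 / d" by (simp add: exp_minus divide_inverse[symmetric] pos_divide_le_eq)
    have "\<bar>t * (z \<bullet> c)\<bar> \<le> sqrt t * norm c * s"
    proof -
      have "\<bar>z \<bullet> c\<bar> \<le> norm z * norm c" by (rule Cauchy_Schwarz_ineq2)
      then have "\<bar>t * (z \<bullet> c)\<bar> \<le> t * (norm z * norm c)" using t by (simp add: abs_mult)
      also have "\<dots> = (sqrt t * sqrt t) * (norm z * norm c)" using t by simp
      also have "\<dots> = sqrt t * norm c * s" by (simp only: s_def mult_ac)
      finally show ?thesis .
    qed
    then have "\<bar>t * (z \<bullet> c) * g t z\<bar> \<le> (sqrt t * norm c * s) * (C * (t powr (k / 2) * exp (- (\<theta>' * t * (norm z)\<^sup>2))))"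
      unfolding abs_mult[of "t * (z \<bullet> c)"] using C(2)[OF t, of z] by (intro mult_mono) (use s t in auto)
    also have "exp (- (\<theta>' * t * (norm z)\<^sup>2)) = exp (- (\<theta> * t * (norm z)\<^sup>2)) * exp (- (d * s\<^sup>2))"
      unfolding s(2) by (simp add: mult_exp_exp d_def algebra_simps)
    also have "(sqrt t * norm c * s) * (C * (t powr (k / 2) * (exp (- (\<theta> * t * (norm z)\<^sup>2)) * exp (- (d * s\<^sup>2)))))
       = (s * exp (- (d * s\<^sup>2))) * (norm c * C * (t powr (k / 2) * sqrt t * exp (- (\<theta> * t * (norm z)\<^sup>2))))"
      by (simp only: mult_ac)
    also have "\<dots> \<le> (1 + 1 / d) * (norm c * C * (t powr (k / 2) * sqrt t * exp (- (\<theta> * t * (norm z)\<^sup>2))))"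
      using C(1) t by (intro mult_right_mono sb) auto
    also have "t powr (k / 2) * sqrt t = t powr (Suc k / 2)"
      using t by (simp add: powr_half_sqrt[symmetric] powr_add[symmetric] add_divide_distrib add.commute)
    finally show "\<bar>t * (z \<bullet> c) * g t z\<bar> \<le> norm c * (1 + 1 / d) * C * (t powr (real (Suc k) / 2) * exp (- (\<theta> * t * (norm z)\<^sup>2)))"
      by (simp only: mult_ac)
  qed (use C(1) d(1) in \<open>simp add: add_nonneg_nonneg\<close>)
next
  case (tmult k g)
  obtain C where C: "C \<ge> 0" "\<And>t z. t > 0 \<Longrightarrow> \<bar>g t z\<bar> \<le> C * (t powr (k / 2) * exp (- (\<theta> * t * (norm z)\<^sup>2)))"
    using tmult.IH[OF tmult.prems] by blast
  show ?case
  proof (intro exI[of _ C] conjI allI impI C(1))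
    fix t :: real and z :: 'a assume t: "t > 0"
    have "\<bar>t * g t z\<bar> \<le> t * (C * (t powr (k / 2) * exp (- (\<theta> * t * (norm z)\<^sup>2))))"
      using C(2)[OF t, of z] t by (simp add: abs_mult)
    also have "\<dots> = C * ((t powr (k / 2) * t) * exp (- (\<theta> * t * (norm z)\<^sup>2)))" by (simp only: mult_ac)
    also have "t powr (k / 2) * t = t powr (real (k + 2) / 2)"
      using t powr_add[of t "k / 2" 1] by (simp add: add_divide_distrib add.commute)
    finally show "\<bar>t * g t z\<bar> \<le> C * (t powr (real (k + 2) / 2) * exp (- (\<theta> * t * (norm z)\<^sup>2)))" .
  qed
next
  case (add k g h)
  obtain C where C: "C \<ge> 0" "\<And>t z. t > 0 \<Longrightarrow> \<bar>g t z\<bar> \<le> C * (t powr (k / 2) * exp (- (\<theta> * t * (norm z)\<^sup>2)))"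
    using add.IH(1)[OF add.prems] by blast
  obtain D where D: "D \<ge> 0" "\<And>t z. t > 0 \<Longrightarrow> \<bar>h t z\<bar> \<le> D * (t powr (k / 2) * exp (- (\<theta> * t * (norm z)\<^sup>2)))"
    using add.IH(2)[OF add.prems] by blast
  show ?case
  proof (intro exI[of _ "C + D"] conjI allI impI)
    fix t :: real and z :: 'a assume t: "t > 0"
    show "\<bar>g t z + h t z\<bar> \<le> (C + D) * (t powr (k / 2) * exp (- (\<theta> * t * (norm z)\<^sup>2)))"
      using C(2)[OF t, of z] D(2)[OF t, of z] abs_triangle_ineq[of "g t z" "h t z"] by (simp only: distrib_right)
  qed (use C(1) D(1) in simp)
next
  case (cmult k g a)
  obtain C where C: "C \<ge> 0" "\<And>t z. t > 0 \<Longrightarrow> \<bar>g t z\<bar> \<le> C * (t powr (k / 2) * exp (- (\<theta> * t * (norm z)\<^sup>2)))"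
    using cmult.IH[OF cmult.prems] by blast
  show ?case
  proof (intro exI[of _ "\<bar>a\<bar> * C"] conjI allI impI)
    fix t :: real and z :: 'a assume t: "t > 0"
    show "\<bar>a * g t z\<bar> \<le> \<bar>a\<bar> * C * (t powr (k / 2) * exp (- (\<theta> * t * (norm z)\<^sup>2)))"
      unfolding abs_mult mult.assoc[of "\<bar>a\<bar>" C] using C(2)[OF t, of z] by (intro mult_left_mono) auto
  qed (use C(1) in simp)
qed

definition gderiv :: "(real \<Rightarrow> 'a::euclidean_space \<Rightarrow> real) \<Rightarrow> ('a \<Rightarrow> real \<Rightarrow> 'a \<Rightarrow> real) \<Rightarrow> bool" where
  "gderiv g g' \<longleftrightarrow> (\<forall>t z. (g t has_derivative (\<lambda>h. \<Sum>b\<in>Basis. (h \<bullet> b) * g' b t z)) (at z))"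

lemma gderiv_base:
  "gderiv (\<lambda>t z. exp (- (t * (norm z)\<^sup>2))) (\<lambda>b t z. - 2 * ((t * (z \<bullet> b)) * exp (- (t * (norm z)\<^sup>2))))"
  unfolding gderiv_def
proof (intro allI)
  fix t :: real and z :: 'a
  have "((\<lambda>z. exp (- (t * (z \<bullet> z)))) has_derivative (\<lambda>h. - (t * (z \<bullet> h + h \<bullet> z)) * exp (- (t * (z \<bullet> z))))) (at z)"
    by (auto intro!: derivative_eq_intros simp: fun_eq_iff algebra_simps)
  also have "(\<lambda>h. - (t * (z \<bullet> h + h \<bullet> z)) * exp (- (t * (z \<bullet> z)))) = (\<lambda>h. \<Sum>b\<in>Basis. (h \<bullet> b) * (- 2 * ((t * (z \<bullet> b)) * exp (- (t * (norm z)\<^sup>2)))))"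
  proof
    fix h :: 'a
    have "(\<Sum>b\<in>Basis. (h \<bullet> b) * (- 2 * ((t * (z \<bullet> b)) * exp (- (t * (norm z)\<^sup>2)))))
       = (- 2 * t * exp (- (t * (norm z)\<^sup>2))) * (\<Sum>b\<in>Basis. (h \<bullet> b) * (z \<bullet> b))"
      unfolding sum_distrib_left by (intro sum.cong) (auto simp: mult_ac)
    also have "(\<Sum>b\<in>Basis. (h \<bullet> b) * (z \<bullet> b)) = h \<bullet> z" by (rule euclidean_inner[symmetric])
    finally show "- (t * (z \<bullet> h + h \<bullet> z)) * exp (- (t * (z \<bullet> z))) = (\<Sum>b\<in>Basis. (h \<bullet> b) * (- 2 * ((t * (z \<bullet> b)) * exp (- (t * (norm z)\<^sup>2)))))"
      by (simp add: inner_commute power2_norm_eq_inner algebra_simps)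
  qed
  finally show "((\<lambda>z. exp (- (t * (norm z)\<^sup>2))) has_derivative
     (\<lambda>h. \<Sum>b\<in>Basis. (h \<bullet> b) * (- 2 * ((t * (z \<bullet> b)) * exp (- (t * (norm z)\<^sup>2)))))) (at z)"
    by (simp add: power2_norm_eq_inner)
qed

lemma gderiv_mult:
  assumes "gderiv g g'"
  shows "gderiv (\<lambda>t z. (t * (z \<bullet> c)) * g t z) (\<lambda>b t z. (b \<bullet> c) * (t * g t z) + (t * (z \<bullet> c)) * g' b t z)"
  unfolding gderiv_def
proof (intro allI)
  fix t :: real and z :: 'a
  have "(g t has_derivative (\<lambda>h. \<Sum>b\<in>Basis. (h \<bullet> b) * g' b t z)) (at z)" using assms by (simp add: gderiv_def)
  then have "((\<lambda>z. (t * (z \<bullet> c)) * g t z) has_derivative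
      (\<lambda>h. (t * (z \<bullet> c)) * (\<Sum>b\<in>Basis. (h \<bullet> b) * g' b t z) + (t * (h \<bullet> c)) * g t z)) (at z)"
    by (auto intro!: derivative_eq_intros)
  also have "(\<lambda>h. (t * (z \<bullet> c)) * (\<Sum>b\<in>Basis. (h \<bullet> b) * g' b t z) + (t * (h \<bullet> c)) * g t z)
     = (\<lambda>h. \<Sum>b\<in>Basis. (h \<bullet> b) * ((b \<bullet> c) * (t * g t z) + (t * (z \<bullet> c)) * g' b t z))"
  proof
    fix h :: 'a
    have "(t * (h \<bullet> c)) * g t z = (t * g t z) * (\<Sum>b\<in>Basis. (h \<bullet> b) * (b \<bullet> c))"
      by (subst euclidean_inner[of h c]) (simp add: inner_commute mult_ac)
    also have "\<dots> = (\<Sum>b\<in>Basis. (h \<bullet> b) * ((b \<bullet> c) * (t * g t z)))"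
      unfolding sum_distrib_left by (intro sum.cong) (auto simp: mult_ac)
    finally show "(t * (z \<bullet> c)) * (\<Sum>b\<in>Basis. (h \<bullet> b) * g' b t z) + (t * (h \<bullet> c)) * g t z
        = (\<Sum>b\<in>Basis. (h \<bullet> b) * ((b \<bullet> c) * (t * g t z) + (t * (z \<bullet> c)) * g' b t z))"
      by (simp add: sum_distrib_left distrib_left sum.distrib mult.left_commute)
  qed
  finally show "((\<lambda>z. (t * (z \<bullet> c)) * g t z) has_derivative
      (\<lambda>h. \<Sum>b\<in>Basis. (h \<bullet> b) * ((b \<bullet> c) * (t * g t z) + (t * (z \<bullet> c)) * g' b t z))) (at z)" .
qed

lemma gderiv_add: "gderiv g g' \<Longrightarrow> gderiv h h' \<Longrightarrow> gderiv (\<lambda>t z. g t z + h t z) (\<lambda>b t z. g' b t z + h' b t z)"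
  unfolding gderiv_def by (simp add: distrib_left sum.distrib has_derivative_add)

lemma gderiv_cmult:
  assumes "gderiv g g'"
  shows "gderiv (\<lambda>t z. a t * g t z) (\<lambda>b t z. a t * g' b t z)"
proof -
  have "((\<lambda>z. a t * g t z) has_derivative (\<lambda>h. a t * (\<Sum>b\<in>Basis. (h \<bullet> b) * g' b t z))) (at z)" for t z
    using assms by (intro has_derivative_mult_right) (simp add: gderiv_def)
  then show ?thesis unfolding gderiv_def by (simp add: sum_distrib_left mult.left_commute)
qed

lemma gk_gderiv:
  assumes "gk k g"
  shows "\<exists>g'. (\<forall>b. gk (Suc k) (g' b)) \<and> gderiv g g'"
  using assms
proof induction
  case base
  show ?case by (rule exI, rule conjI[OF _ gderiv_base]) (intro allI gk.cmult gk.mult gk.base)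
next
  case (mult k g c)
  then obtain g' where g': "\<And>b. gk (Suc k) (g' b)" "gderiv g g'" by blast
  have "gk (Suc (Suc k)) (\<lambda>t z. (b \<bullet> c) * (t * g t z) + (t * (z \<bullet> c)) * g' b t z)" for b
    using gk.cmult[OF gk.tmult[OF mult.hyps], of "b \<bullet> c"] gk.mult[OF g'(1), of c b] by (intro gk.add) auto
  then show ?case using gderiv_mult[OF g'(2), of c]
    by (intro exI[of _ "\<lambda>b t z. (b \<bullet> c) * (t * g t z) + (t * (z \<bullet> c)) * g' b t z"]) simp
next
  case (tmult k g)
  then obtain g' where g': "\<And>b. gk (Suc k) (g' b)" "gderiv g g'" by blast
  have "gk (Suc (k + 2)) (\<lambda>t z. t * g' b t z)" for b
    using gk.tmult[OF g'(1)] by simp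
  then show ?case using gderiv_cmult[OF g'(2), of "\<lambda>t. t"] by (intro exI[of _ "\<lambda>b t z. t * g' b t z"]) simp
next
  case (add k g h)
  obtain g' where g': "\<And>b. gk (Suc k) (g' b)" "gderiv g g'" using add.IH(1) by blast
  obtain h' where h': "\<And>b. gk (Suc k) (h' b)" "gderiv h h'" using add.IH(2) by blast
  show ?case using gderiv_add[OF g'(2) h'(2)] gk.add[OF g'(1) h'(1)] by (intro exI[of _ "\<lambda>b t z. g' b t z + h' b t z"]) simp
next
  case (cmult k g a)
  obtain g' where g': "\<And>b. gk (Suc k) (g' b)" "gderiv g g'" using cmult.IH by blast
  show ?case using gderiv_cmult[OF g'(2), of "\<lambda>t. a"] gk.cmult[OF g'(1), where a=a] by (intro exI[of _ "\<lambda>b t z. a * g' b t z"]) simp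
qed

section \<open>The logarithmic potential\<close>

definition lnpot :: "('a::euclidean_space \<Rightarrow> real) \<Rightarrow> 'a \<Rightarrow> real" where
  "lnpot \<rho> x = - (\<integral>y. ln (norm (x - y)) * \<rho> y \<partial>lborel)"

text \<open>The densities the fixed point map works with: a bounded function times a Gaussian. The
  constants in the estimates of this locale involve \<open>\<rho>\<close> only through
  \<open>B\<close>, the mass and moments, so they can be made uniform over a set of
  densities.\<close>

locale gauss_density =
  fixes \<rho> :: "'a::euclidean_space \<Rightarrow> real" and B :: real
  assumes dim: "DIM('a) \<ge> 5"
    and meas [measurable]: "\<rho> \<in> borel_measurable borel"
    and nonneg: "\<rho> y \<ge> 0"
    and bound: "\<rho> y \<le> B * exp (- (norm y)\<^sup>2)"
begin

lemma B_nonneg: "B \<ge> 0"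
  using nonneg[of 0] bound[of 0] by simp

lemma bound': "\<bar>\<rho> y\<bar> \<le> B"
proof -
  have "\<rho> y \<le> B * 1" using B_nonneg by (intro order_trans[OF bound] mult_left_mono) auto
  then show ?thesis using nonneg[of y] by simp
qed

lemma integrable: "integrable lborel \<rho>"
proof (rule Bochner_Integration.integrable_bound)
  show "integrable lborel (\<lambda>y::'a. B * exp (- (1 * (norm y)\<^sup>2)))"
    by (intro integrable_mult_right gaussian_integral) simp
qed (use nonneg bound B_nonneg in auto)

definition mass :: real where "mass = (\<integral>y. \<rho> y \<partial>lborel)"

lemma mass_nonneg: "mass \<ge> 0"
  unfolding mass_def using nonneg by (intro integral_nonneg_AE) auto

lemma sq_bound: "(norm y)\<^sup>2 * \<rho> y \<le> 2 * B * exp (- (1 / 2 * (norm y)\<^sup>2))"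
proof -
  have "(norm y)\<^sup>2 / 2 \<le> exp ((norm y)\<^sup>2 / 2)" using exp_ge_add_one_self[of "(norm y)\<^sup>2 / 2"] by linarith
  then have "(norm y)\<^sup>2 * exp (- (norm y)\<^sup>2) \<le> (2 * exp ((norm y)\<^sup>2 / 2)) * exp (- (norm y)\<^sup>2)"
    by (intro mult_right_mono) auto
  also have "\<dots> = 2 * exp (- (1 / 2 * (norm y)\<^sup>2))" by (simp add: mult_exp_exp)
  finally have *: "(norm y)\<^sup>2 * exp (- (norm y)\<^sup>2) \<le> 2 * exp (- (1 / 2 * (norm y)\<^sup>2))" .
  have "(norm y)\<^sup>2 * \<rho> y \<le> (norm y)\<^sup>2 * (B * exp (- (norm y)\<^sup>2))" by (intro mult_left_mono bound) auto
  also have "\<dots> \<le> B * (2 * exp (- (1 / 2 * (norm y)\<^sup>2)))"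
    using mult_left_mono[OF * B_nonneg] by (simp add: mult_ac)
  finally show ?thesis by simp
qed

lemma integrable_sq: "integrable lborel (\<lambda>y. (norm y)\<^sup>2 * \<rho> y)"
proof (rule Bochner_Integration.integrable_bound)
  show "integrable lborel (\<lambda>y::'a. 2 * B * exp (- (1 / 2 * (norm y)\<^sup>2)))"
    by (intro integrable_mult_right gaussian_integral) simp
qed (use nonneg sq_bound B_nonneg in auto)

lemma integrable_norm_mult: "integrable lborel (\<lambda>y. norm y * \<rho> y)"
proof (rule Bochner_Integration.integrable_bound)
  show "integrable lborel (\<lambda>y. \<rho> y + (norm y)\<^sup>2 * \<rho> y)"
    by (intro Bochner_Integration.integrable_add integrable integrable_sq)
  have "norm y * \<rho> y \<le> \<rho> y + (norm y)\<^sup>2 * \<rho> y" for y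
  proof -
    have "0 \<le> (norm y - 1 / 2)\<^sup>2" by simp
    then have "norm y \<le> 1 + (norm y)\<^sup>2" by (simp add: power2_eq_square algebra_simps)
    from mult_right_mono[OF this nonneg[of y]] show ?thesis by (simp add: distrib_right)
  qed
  then show "AE y in lborel. norm (norm y * \<rho> y) \<le> norm (\<rho> y + (norm y)\<^sup>2 * \<rho> y)"
    using nonneg by (intro AE_I2) (simp add: abs_mult)
qed auto

lemma ln_integrable: "Bochner_Integration.integrable lborel (\<lambda>y. ln (norm (x - y)) * \<rho> y)"
  using integrable_ln_mult[of \<rho> B x] dim integrable bound' integrable_norm_mult nonneg
  by (simp add: norm_minus_commute)

lemma riesz_integrable: "0 < (p::real) \<Longrightarrow> p < DIM('a) \<Longrightarrow> Bochner_Integration.integrable lborel (\<lambda>y. norm (x - y) powr (- p) * \<rho> y)"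
  by (rule riesz_bound(1)[OF _ _ integrable bound'])

lemma riesz_le: "0 < (p::real) \<Longrightarrow> p < DIM('a) \<Longrightarrow> (\<integral>y. norm (x - y) powr (- p) * \<rho> y \<partial>lborel) \<le> riesz_const TYPE('a) p * B + mass"
  using riesz_bound(2)[OF _ _ integrable bound', of p x] nonneg by (simp add: mass_def)

definition F :: "(real \<Rightarrow> 'a \<Rightarrow> real) \<Rightarrow> real \<Rightarrow> 'a \<Rightarrow> real" where
  "F g t x = (\<integral>y. g t (x - y) * \<rho> y \<partial>lborel)"

text \<open>The derivatives of the potential: \<open>lnpot\<close> is half the integral over
  \<open>r\<close> of Gaussian convolutions minus a counterterm, and the counterterm disappears
  after one differentiation.\<close>

definition U :: "(real \<Rightarrow> 'a \<Rightarrow> real) \<Rightarrow> 'a \<Rightarrow> real" where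
  "U g x = (\<integral>r. F g (exp r) x \<partial>lborel) / 2"

abbreviation e0 :: "real \<Rightarrow> 'a \<Rightarrow> real" where "e0 \<equiv> \<lambda>t z. exp (- (t * (norm z)\<^sup>2))"

text \<open>Frullani's formula for \<open>- ln |x - y|\<close>, integrated against
  \<open>\<rho>\<close>. The subtracted term makes the \<open>r\<close>-integral converge and does
  not involve \<open>x\<close>.\<close>

lemma lnpot_heat:
  shows "Bochner_Integration.integrable lborel (\<lambda>r. F e0 (exp r) x - mass * exp (- exp r))"
    and "lnpot \<rho> x = (\<integral>r. F e0 (exp r) x - mass * exp (- exp r) \<partial>lborel) / 2"
proof -
  define h where "h = (\<lambda>y r. (exp (- ((norm (x - y))\<^sup>2 * exp r)) - exp (- exp (r::real))) * \<rho> y)"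
  have m: "case_prod h \<in> borel_measurable (borel \<Otimes>\<^sub>M borel)" unfolding h_def by measurable
  have ae: "AE y in lborel. y \<noteq> x" by (rule AE_lborel_singleton)
  have h1: "has_bochner_integral lborel (h y) ((- 2 * ln (norm (x - y))) * \<rho> y)" if "y \<noteq> x" for y
    unfolding h_def using that by (intro has_bochner_integral_mult_left log_exp_integral) auto
  have h2: "(\<integral>r. norm (h y r) \<partial>lborel) = norm (2 * (ln (norm (x - y)) * \<rho> y))" if "y \<noteq> x" for y
    using has_bochner_integral_mult_left[OF log_exp_integral(2)[of "x - y"], of "norm (\<rho> y)"] that
    by (simp add: h_def has_bochner_integral_iff abs_mult)
  have A: "AE y in lborel. Bochner_Integration.integrable lborel (h y)"
    using ae by eventually_elim (use h1 in \<open>auto simp: has_bochner_integral_iff\<close>)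
  have Bi: "Bochner_Integration.integrable lborel (\<lambda>y. norm (2 * (ln (norm (x - y)) * \<rho> y)))"
    by (intro integrable_mult_right integrable_norm ln_integrable)
  have C: "AE y in lborel. (\<integral>r. norm (h y r) \<partial>lborel) \<le> norm (2 * (ln (norm (x - y)) * \<rho> y))"
    using ae by eventually_elim (rule order_eq_refl, rule h2)
  note Fu = fubini_iterated[OF m A Bi C]
  have hr: "(\<integral>y. h y r \<partial>lborel) = F e0 (exp r) x - mass * exp (- exp r)" for r
  proof -
    have i: "Bochner_Integration.integrable lborel (\<lambda>y. exp (- (exp r * (norm (x - y))\<^sup>2)) * \<rho> y)"
      by (rule Bochner_Integration.integrable_bound[OF integrable]) (auto simp: abs_mult mult_left_le_one_le)
    have "(\<integral>y. h y r \<partial>lborel) = (\<integral>y. exp (- (exp r * (norm (x - y))\<^sup>2)) * \<rho> y - exp (- exp r) * \<rho> y \<partial>lborel)"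
      by (simp add: h_def left_diff_distrib mult.commute[of "(norm _)\<^sup>2"])
    also have "\<dots> = F e0 (exp r) x - mass * exp (- exp r)"
      using i integrable by (simp add: F_def mass_def)
    finally show ?thesis .
  qed
  show "Bochner_Integration.integrable lborel (\<lambda>r. F e0 (exp r) x - mass * exp (- exp r))"
    using Fu(4) by (simp only: hr)
  have "(\<integral>r. F e0 (exp r) x - mass * exp (- exp r) \<partial>lborel) = (\<integral>y. (\<integral>r. h y r \<partial>lborel) \<partial>lborel)"
    using Fu(2) by (simp only: hr)
  also have "\<dots> = (\<integral>y. (- 2) * (ln (norm (x - y)) * \<rho> y) \<partial>lborel)"
  proof (rule integral_cong_AE)
    show "AE y in lborel. (\<integral>r. h y r \<partial>lborel) = (- 2) * (ln (norm (x - y)) * \<rho> y)"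
      using ae by eventually_elim (use h1 in \<open>simp add: has_bochner_integral_iff mult_ac\<close>)
  qed (use borel_measurable_integrable[OF Fu(3)] in measurable)
  also have "\<dots> = 2 * lnpot \<rho> x" by (simp add: lnpot_def)
  finally show "lnpot \<rho> x = (\<integral>r. F e0 (exp r) x - mass * exp (- exp r) \<partial>lborel) / 2" by simp
qed

lemma F_measurable: "gk k g \<Longrightarrow> (\<lambda>r. F g (exp r) x) \<in> borel_measurable borel"
  unfolding F_def by measurable

lemma gk_bound_t:
  assumes "gk k g" "t > 0"
  shows "\<exists>C\<ge>0. \<forall>z. \<bar>g t z\<bar> \<le> C"
proof -
  obtain C where C: "C \<ge> 0" "\<And>z. \<bar>g t z\<bar> \<le> C * (t powr (k / 2) * exp (- (1 / 2 * t * (norm z)\<^sup>2)))"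
    using gk_bound[OF assms(1), of "1/2"] assms(2) by force
  have "\<bar>g t z\<bar> \<le> C * (t powr (k / 2) * 1)" for z
    using C(1) assms(2) by (intro order_trans[OF C(2)] mult_left_mono) auto
  moreover have "C * (t powr (k / 2) * 1) \<ge> 0" using C by simp
  ultimately show ?thesis by blast
qed

lemma F_integrable:
  assumes "gk k g" "t > 0"
  shows "Bochner_Integration.integrable lborel (\<lambda>y. g t (x - y) * \<rho> y)"
proof -
  obtain C where C: "C \<ge> 0" "\<And>z. \<bar>g t z\<bar> \<le> C" using gk_bound_t[OF assms] by blast
  note [measurable] = gk_measurable2[OF assms(1)]
  show ?thesis
    by (rule Bochner_Integration.integrable_bound[OF integrable_mult_right[OF integrable, of C]])
       (use C nonneg in \<open>auto simp: abs_mult intro!: AE_I2 mult_right_mono\<close>)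
qed

text \<open>For \<open>r \<le> 0\<close> the mass bounds the convolution and
  \<open>exp (k r / 2)\<close> decays because \<open>k \<ge> 1\<close>. For \<open>r > 0\<close> the
  sup bound on \<open>\<rho>\<close> gains \<open>exp (- n r / 2)\<close>, and \<open>k < n\<close>
  leaves at least half a power of \<open>exp (- r)\<close>. These are the limits on the order of
  differentiation.\<close>

lemma F_bound:
  assumes g: "gk k g" and k: "1 \<le> k" "k < DIM('a)"
  shows "\<exists>C. \<forall>r x. \<bar>F g (exp r) x\<bar> \<le> C * exp (- (1 / 2 * \<bar>r\<bar>))"
proof -
  obtain C where C: "C \<ge> 0" "\<And>t z. t > 0 \<Longrightarrow> \<bar>g t z\<bar> \<le> C * (t powr (k / 2) * exp (- (1 / 2 * t * (norm z)\<^sup>2)))"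
    using gk_bound[OF g, of "1/2"] by auto
  let ?n = "real DIM('a)"
  define D where "D = C * (mass + B * (2 * pi) powr (?n / 2))"
  have "\<bar>F g (exp r) x\<bar> \<le> D * exp (- (1 / 2 * \<bar>r\<bar>))" for r x
  proof -
    let ?e = "\<lambda>y. exp (- (exp r / 2 * (norm (x - y))\<^sup>2))"
    have ei: "Bochner_Integration.integrable lborel ?e"
      using gaussian_integral(1)[of "exp r / 2", where 'a='a] integrable_lborel_reflect[of "\<lambda>z. exp (- (exp r / 2 * (norm z)\<^sup>2))" x] by simp
    have "(\<integral>y. ?e y \<partial>lborel) = (pi / (exp r / 2)) powr (?n / 2)"
      using gaussian_integral(2)[of "exp r / 2", where 'a='a] integral_lborel_reflect[of "\<lambda>z. exp (- (exp r / 2 * (norm z)\<^sup>2))" x]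
      by simp
    also have "pi / (exp r / 2) = (2 * pi) * exp (- r)" by (simp add: exp_minus inverse_eq_divide)
    also have "((2 * pi) * exp (- r)) powr (?n / 2) = (2 * pi) powr (?n / 2) * exp (- (?n / 2 * r))"
      by (subst powr_mult) (auto simp: exp_powr_real mult.commute)
    finally have eI: "(\<integral>y. ?e y \<partial>lborel) = (2 * pi) powr (?n / 2) * exp (- (?n / 2 * r))" .
    have ri: "Bochner_Integration.integrable lborel (\<lambda>y. ?e y * \<rho> y)"
      by (rule Bochner_Integration.integrable_bound[OF integrable]) (auto simp: abs_mult mult_left_le_one_le)
    have 1: "(\<integral>y. ?e y * \<rho> y \<partial>lborel) \<le> mass"
      unfolding mass_def using nonneg by (intro integral_mono ri integrable) (simp add: mult_left_le_one_le)
    have 2: "(\<integral>y. ?e y * \<rho> y \<partial>lborel) \<le> B * ((2 * pi) powr (?n / 2) * exp (- (?n / 2 * r)))"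
    proof -
      have "(\<integral>y. ?e y * \<rho> y \<partial>lborel) \<le> (\<integral>y. B * ?e y \<partial>lborel)"
      proof (rule integral_mono[OF ri integrable_mult_right[OF ei]])
        fix y
        have "\<rho> y \<le> B" using bound'[of y] by simp
        then have "?e y * \<rho> y \<le> ?e y * B" by (rule mult_left_mono) simp
        then show "?e y * \<rho> y \<le> B * ?e y" by (simp only: mult.commute[of B])
      qed
      then show ?thesis unfolding integral_mult_right_zero eI .
    qed
    have "\<bar>F g (exp r) x\<bar> \<le> (\<integral>y. \<bar>g (exp r) (x - y) * \<rho> y\<bar> \<partial>lborel)"
      unfolding F_def by (rule integral_abs_bound)
    also have "\<dots> \<le> (\<integral>y. (C * exp r powr (k / 2)) * (?e y * \<rho> y) \<partial>lborel)"
    proof (rule integral_mono)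
      show "Bochner_Integration.integrable lborel (\<lambda>y. \<bar>g (exp r) (x - y) * \<rho> y\<bar>)"
        by (intro integrable_abs F_integrable[OF g]) simp
      fix y
      have "\<bar>g (exp r) (x - y)\<bar> * \<rho> y \<le> (C * (exp r powr (k / 2) * ?e y)) * \<rho> y"
        using C(2)[of "exp r" "x - y"] nonneg[of y] by (intro mult_right_mono) auto
      then show "\<bar>g (exp r) (x - y) * \<rho> y\<bar> \<le> (C * exp r powr (k / 2)) * (?e y * \<rho> y)"
        using nonneg[of y] by (simp add: abs_mult mult.assoc)
    qed (intro integrable_mult_right ri)
    also have "\<dots> = C * (exp (k / 2 * r) * (\<integral>y. ?e y * \<rho> y \<partial>lborel))"
      by (simp add: powr_def mult.assoc)
    also have "\<dots> \<le> C * ((mass + B * (2 * pi) powr (?n / 2)) * exp (- (1 / 2 * \<bar>r\<bar>)))"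
    proof (rule mult_left_mono[OF _ C(1)])
      have nn: "0 \<le> B * (2 * pi) powr (?n / 2) * exp (- (1 / 2 * \<bar>r\<bar>))" "0 \<le> mass * exp (- (1 / 2 * \<bar>r\<bar>))"
        using B_nonneg mass_nonneg by auto
      show "exp (k / 2 * r) * (\<integral>y. ?e y * \<rho> y \<partial>lborel) \<le> (mass + B * (2 * pi) powr (?n / 2)) * exp (- (1 / 2 * \<bar>r\<bar>))"
      proof (cases "r \<le> 0")
        case True
        have "k / 2 * r \<le> 1 / 2 * r" using True k by (intro mult_right_mono_neg) auto
        then have "exp (k / 2 * r) * (\<integral>y. ?e y * \<rho> y \<partial>lborel) \<le> exp (- (1 / 2 * \<bar>r\<bar>)) * mass"
          using True mass_nonneg nonneg by (intro mult_mono 1 integral_nonneg_AE) auto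
        then have "exp (k / 2 * r) * (\<integral>y. ?e y * \<rho> y \<partial>lborel) \<le> mass * exp (- (1 / 2 * \<bar>r\<bar>))" by (simp only: mult.commute)
        then show ?thesis using nn unfolding distrib_right by linarith
      next
        case False
        have "real k + 1 \<le> ?n" using k by simp
        then have "(k / 2 - ?n / 2) * r \<le> - (1 / 2) * r" using False by (intro mult_right_mono) auto
        then have e: "exp (k / 2 * r) * exp (- (?n / 2 * r)) \<le> exp (- (1 / 2 * \<bar>r\<bar>))"
          using False by (simp add: mult_exp_exp left_diff_distrib)
        have "exp (k / 2 * r) * (\<integral>y. ?e y * \<rho> y \<partial>lborel) \<le> exp (k / 2 * r) * (B * ((2 * pi) powr (?n / 2) * exp (- (?n / 2 * r))))"
          by (intro mult_left_mono 2) auto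
        also have "\<dots> = B * (2 * pi) powr (?n / 2) * (exp (k / 2 * r) * exp (- (?n / 2 * r)))" by (simp only: mult_ac)
        also have "\<dots> \<le> B * (2 * pi) powr (?n / 2) * exp (- (1 / 2 * \<bar>r\<bar>))"
          using B_nonneg by (intro mult_left_mono e) auto
        finally show ?thesis using nn unfolding distrib_right by linarith
      qed
    qed
    finally show ?thesis by (simp add: D_def mult.assoc)
  qed
  then show ?thesis by blast
qed

lemma F_exp_integrable:
  assumes "gk k g" "1 \<le> k" "k < DIM('a)"
  shows "Bochner_Integration.integrable lborel (\<lambda>r. F g (exp r) x)"
proof -
  obtain C where C: "\<And>r x. \<bar>F g (exp r) x\<bar> \<le> C * exp (- (1 / 2 * \<bar>r\<bar>))" using F_bound[OF assms] by blast
  show ?thesis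
    by (rule Bochner_Integration.integrable_bound[OF integrable_mult_right[OF integrable_exp_neg_abs[of "1/2"], of C]])
       (use F_measurable[OF assms(1)] in \<open>auto intro!: AE_I2 order_trans[OF C]\<close>)
qed

lemma F_has_derivative:
  assumes g: "gk k g" "\<And>b. gk (Suc k) (g' b)" "gderiv g g'" and t: "t > 0"
  shows "(F g t has_derivative (\<lambda>h. \<Sum>b\<in>Basis. (h \<bullet> b) * F (g' b) t x)) (at x)"
proof -
  have "\<forall>b. \<exists>C\<ge>0. \<forall>z. \<bar>g' b t z\<bar> \<le> C" using gk_bound_t[OF g(2) t] by blast
  then obtain C where C: "\<And>b. C b \<ge> 0" "\<And>b z. \<bar>g' b t z\<bar> \<le> C b" by metis
  note [measurable] = gk_measurable2[OF g(2)]
  show ?thesis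
    unfolding F_def
  proof (rule has_derivative_integral_dominated[where w="\<lambda>y. sum C Basis * \<rho> y"])
    show "((\<lambda>x. g t (x - y) * \<rho> y) has_derivative (\<lambda>h. \<Sum>b\<in>Basis. (h \<bullet> b) * (g' b t (x - y) * \<rho> y))) (at x)" for x y
    proof -
      have d: "(g t has_derivative (\<lambda>h. \<Sum>b\<in>Basis. (h \<bullet> b) * g' b t (x - y))) (at (x - y))"
        using g(3) by (simp add: gderiv_def)
      have i: "((\<lambda>x. x - y) has_derivative (\<lambda>h. h)) (at x)" by (auto intro!: derivative_eq_intros)
      have "((\<lambda>x. g t (x - y)) has_derivative (\<lambda>h. \<Sum>b\<in>Basis. (h \<bullet> b) * g' b t (x - y))) (at x)"
        using has_derivative_compose[OF i, of "g t", OF d] by simp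
      from has_derivative_mult_left[OF this, of "\<rho> y"] show ?thesis
        by (simp add: sum_distrib_right mult.assoc)
    qed
    show "\<bar>g' b t (x - y) * \<rho> y\<bar> \<le> sum C Basis * \<rho> y" if "b \<in> Basis" for b x y
    proof -
      have "C b \<le> sum C Basis" using C(1) that by (intro member_le_sum) auto
      then have "\<bar>g' b t (x - y)\<bar> \<le> sum C Basis" using C(2)[of b "x - y"] by linarith
      then show ?thesis using nonneg[of y] by (simp add: abs_mult mult_right_mono)
    qed
    show "Bochner_Integration.integrable lborel (\<lambda>y. g t (x - y) * \<rho> y)" for x by (rule F_integrable[OF g(1) t])
    show "(\<lambda>y. g' b t (x - y) * \<rho> y) \<in> borel_measurable lborel" for b x by measurable
  qed (intro integrable_mult_right integrable)
qed

text \<open>The term \<open>c r\<close> is independent of \<open>x\<close>. It is Frullani's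
  counterterm for the first derivative of the potential and 0 for all later ones.\<close>

lemma U_has_derivative:
  assumes g: "gk k g" "\<And>b. gk (Suc k) (g' b)" "gderiv g g'" and k: "Suc k < DIM('a)"
    and c: "\<And>x. Bochner_Integration.integrable lborel (\<lambda>r. F g (exp r) x - c r)"
  shows "((\<lambda>x. (\<integral>r. F g (exp r) x - c r \<partial>lborel) / 2) has_derivative (\<lambda>h. \<Sum>b\<in>Basis. (h \<bullet> b) * U (g' b) x)) (at x)"
proof -
  have "\<forall>b. \<exists>C. \<forall>r x. \<bar>F (g' b) (exp r) x\<bar> \<le> C * exp (- (1 / 2 * \<bar>r\<bar>))"
    using F_bound[OF g(2)] k by auto
  then obtain C where C: "\<And>b r x. \<bar>F (g' b) (exp r) x\<bar> \<le> C b * exp (- (1 / 2 * \<bar>r\<bar>))" by metis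
  have "((\<lambda>x. \<integral>r. F g (exp r) x - c r \<partial>lborel) has_derivative (\<lambda>h. \<Sum>b\<in>Basis. (h \<bullet> b) * (\<integral>r. F (g' b) (exp r) x \<partial>lborel))) (at x)"
  proof (rule has_derivative_integral_dominated[where w="\<lambda>r. (\<Sum>b\<in>Basis. \<bar>C b\<bar>) * exp (- (1 / 2 * \<bar>r\<bar>))"])
    fix x and r :: real
    show "((\<lambda>x. F g (exp r) x - c r) has_derivative (\<lambda>h. \<Sum>b\<in>Basis. (h \<bullet> b) * F (g' b) (exp r) x)) (at x)"
      using has_derivative_diff[OF F_has_derivative[OF g, of "exp r" x] has_derivative_const[of "c r"]] by simp
  next
    fix b x :: 'a and r :: real assume b: "b \<in> Basis"
    have "C b \<le> (\<Sum>b\<in>Basis. \<bar>C b\<bar>)"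
      using member_le_sum[OF b, of "\<lambda>b. \<bar>C b\<bar>"] abs_ge_self[of "C b"] by simp
    then have "C b * exp (- (1 / 2 * \<bar>r\<bar>)) \<le> (\<Sum>b\<in>Basis. \<bar>C b\<bar>) * exp (- (1 / 2 * \<bar>r\<bar>))"
      by (intro mult_right_mono) auto
    then show "\<bar>F (g' b) (exp r) x\<bar> \<le> (\<Sum>b\<in>Basis. \<bar>C b\<bar>) * exp (- (1 / 2 * \<bar>r\<bar>))"
      using C[of b r x] by linarith
  next
    show "Bochner_Integration.integrable lborel (\<lambda>r. (\<Sum>b\<in>Basis. \<bar>C b\<bar>) * exp (- (1 / 2 * \<bar>r\<bar>)))"
      by (intro integrable_mult_right integrable_exp_neg_abs) simp
    show "(\<lambda>r. F (g' b) (exp r) x) \<in> borel_measurable lborel" for b x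
      using F_measurable[OF g(2)] by simp
  qed (rule c)
  from has_derivative_mult_right[OF this, of "1 / 2"]
  show ?thesis by (simp add: U_def sum_distrib_left sum_divide_distrib)
qed

lemma U_continuous:
  assumes g: "gk k g" and k: "1 \<le> k" "k < DIM('a)"
  shows "continuous_on UNIV (U g)"
proof -
  note [measurable] = gk_measurable2[OF g]
  obtain C where C: "\<And>r x. \<bar>F g (exp r) x\<bar> \<le> C * exp (- (1 / 2 * \<bar>r\<bar>))" using F_bound[OF assms] by blast
  have "continuous_on UNIV (\<lambda>x. \<integral>r. F g (exp r) x \<partial>lborel)"
  proof (rule continuous_integral_dominated[OF _ _ C])
    fix r :: real
    obtain D where D: "D \<ge> 0" "\<And>z. \<bar>g (exp r) z\<bar> \<le> D" using gk_bound_t[OF g, of "exp r"] by auto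
    show "continuous_on UNIV (\<lambda>x. F g (exp r) x)" unfolding F_def
    proof (rule continuous_integral_dominated[where w="\<lambda>y. D * \<rho> y"])
      show "continuous_on UNIV (\<lambda>x. g (exp r) (x - y) * \<rho> y)" for y
        by (intro continuous_intros continuous_on_compose2[OF gk_continuous[OF g, of "exp r"]]) auto
      show "\<bar>g (exp r) (x - y) * \<rho> y\<bar> \<le> D * \<rho> y" for x y
        using D nonneg[of y] by (simp add: abs_mult mult_right_mono)
    qed (use integrable in auto)
  qed (use F_measurable[OF g] in \<open>auto intro!: integrable_mult_right integrable_exp_neg_abs[of "1/2", simplified]\<close>)
  then show ?thesis unfolding U_def[abs_def] by (intro continuous_intros) auto
qed

lemma sum_Basis_inner_mult: "b \<in> Basis \<Longrightarrow> (\<Sum>c\<in>Basis. (b \<bullet> c) * f c) = (f b :: real)"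
  by (simp add: inner_Basis if_distrib[of "\<lambda>x. x * _"] sum.delta cong: if_cong)

lemma lnpot_has_derivative:
  assumes "\<And>b. gk (Suc 0) (g' b)" "gderiv e0 g'"
  shows "(lnpot \<rho> has_derivative (\<lambda>h. \<Sum>b\<in>Basis. (h \<bullet> b) * U (g' b) x)) (at x)"
  using U_has_derivative[OF gk.base assms _ lnpot_heat(1), of x] dim
  by (simp add: lnpot_heat(2)[abs_def])

lemma U_has_derivative':
  assumes g: "gk k g" "\<And>b. gk (Suc k) (g' b)" "gderiv g g'" and k: "1 \<le> k" "Suc k < DIM('a)"
  shows "(U g has_derivative (\<lambda>h. \<Sum>b\<in>Basis. (h \<bullet> b) * U (g' b) x)) (at x)"
  using U_has_derivative[OF g k(2), of "\<lambda>_. 0" x] F_exp_integrable[OF g(1) k(1)] k(2)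
  by (simp add: U_def[abs_def])

text \<open>Each derivative raises the Gaussian order by one, and the integral over \<open>r\<close>
  converges up to order \<open>n - 1\<close>. That is exactly the order of the Sobolev space in the
  definition of a solution for odd \<open>n\<close>.\<close>

lemma partial_derivs_lnpot:
  assumes "bs \<in> lists Basis" "bs \<noteq> []" "length bs < DIM('a)"
  shows "\<exists>g. gk (length bs) g \<and> partial_derivs bs (lnpot \<rho>) = U g"
  using assms
proof (induction bs)
  case (Cons b bs)
  have b: "b \<in> Basis" using Cons by simp
  show ?case
  proof (cases "bs = []")
    case True
    obtain g' where g': "\<And>b. gk (Suc 0) (g' b)" "gderiv e0 g'"
      using gk_gderiv[OF gk.base, where ?'a='a] by blast
    have "partial_deriv b (lnpot \<rho>) = U (g' b)"
      using partial_deriv_eq[OF lnpot_has_derivative[OF g'], of b] sum_Basis_inner_mult[OF b] by (auto simp: fun_eq_iff)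
    then show ?thesis using True g' by auto
  next
    case False
    with Cons obtain g where g: "gk (length bs) g" "partial_derivs bs (lnpot \<rho>) = U g" by auto
    obtain g' where g': "\<And>b. gk (Suc (length bs)) (g' b)" "gderiv g g'" using gk_gderiv[OF g(1)] by blast
    have "length bs \<ge> 1" using False by (simp add: Suc_le_eq)
    from partial_deriv_eq[OF U_has_derivative'[OF g(1) g' this]] Cons.prems
    have "partial_deriv b (U g) = U (g' b)" using sum_Basis_inner_mult[OF b] by (auto simp: fun_eq_iff)
    then show ?thesis using g g' by auto
  qed
qed simp

end

section \<open>Regularity, Laplacian and growth of the logarithmic potential\<close>

context gauss_density
begin

lemma lnpot_differentiable: "lnpot \<rho> differentiable (at x)"
proof -
  obtain g' where g': "\<And>b. gk (Suc 0) (g' b)" "gderiv e0 g'" using gk_gderiv[OF gk.base, where ?'a='a] by blast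
  from lnpot_has_derivative[OF g', of x] show ?thesis by (auto simp: differentiable_def)
qed

lemma partial_derivs_lnpot_differentiable:
  assumes "bs \<in> lists Basis" "Suc (length bs) < DIM('a)"
  shows "partial_derivs bs (lnpot \<rho>) differentiable (at x)"
proof (cases "bs = []")
  case True
  then show ?thesis using lnpot_differentiable by simp
next
  case False
  with assms obtain g where g: "gk (length bs) g" "partial_derivs bs (lnpot \<rho>) = U g"
    using partial_derivs_lnpot by (metis Suc_lessD)
  obtain g' where g': "\<And>b. gk (Suc (length bs)) (g' b)" "gderiv g g'" using gk_gderiv[OF g(1)] by blast
  have "length bs \<ge> 1" using False by (simp add: Suc_le_eq)
  from U_has_derivative'[OF g(1) g' this assms(2), of x] show ?thesis
    unfolding g(2) differentiable_def by blast
qed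

lemma partial_derivs_lnpot_continuous:
  assumes "bs \<in> lists Basis" "length bs < DIM('a)"
  shows "continuous_on UNIV (partial_derivs bs (lnpot \<rho>))"
proof (cases "bs = []")
  case True
  then show ?thesis using lnpot_differentiable
    by (metis continuous_at_imp_continuous_on differentiable_imp_continuous_within partial_derivs.simps(1))
next
  case False
  with assms obtain g where g: "gk (length bs) g" "partial_derivs bs (lnpot \<rho>) = U g"
    using partial_derivs_lnpot by blast
  have "length bs \<ge> 1" using False by (simp add: Suc_le_eq)
  from U_continuous[OF g(1) this assms(2)] show ?thesis unfolding g(2) .
qed

text \<open>The pure second derivatives of the Gaussian sum to
  \<open>(4 t^2 |z|^2 - 2 n t) exp (- t |z|^2)\<close>. With \<open>t = exp r\<close> the two parts
  integrate to \<open>4 Gamma 2\<close> and \<open>2 n Gamma 1\<close> times \<open>|z|^-2\<close>,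
  and half the difference is \<open>-(n - 2) |z|^-2\<close>. At \<open>x = 0\<close> this brings in
  the singular moment of \<open>\<rho>\<close>.\<close>

lemma laplacian_lnpot:
  "laplacian (lnpot \<rho>) x = - (real DIM('a) - 2) * (\<integral>y. norm (x - y) powr (- 2) * \<rho> y \<partial>lborel)"
proof -
  let ?n = "real DIM('a)"
  define e1 where "e1 = (\<lambda>b t (z::'a). - 2 * ((t * (z \<bullet> b)) * e0 t z))"
  define e2 where "e2 = (\<lambda>b c t (z::'a). - 2 * ((c \<bullet> b) * (t * e0 t z) + (t * (z \<bullet> b)) * (- 2 * ((t * (z \<bullet> c)) * e0 t z))))"
  have k1: "gk (Suc 0) (e1 b)" for b unfolding e1_def by (intro gk.cmult gk.mult gk.base)
  have d1: "gderiv e0 e1" unfolding e1_def by (rule gderiv_base)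
  have k2: "gk (Suc (Suc 0)) (e2 b c)" for b c
  proof -
    have "gk (0 + 2) (\<lambda>t (z::'a). t * e0 t z)" by (rule gk.tmult[OF gk.base])
    then show ?thesis unfolding e2_def
      by (intro gk.cmult gk.add gk.mult gk.base) (simp add: numeral_2_eq_2)
  qed
  have d2: "gderiv (e1 b) (e2 b)" for b
    unfolding e1_def e2_def by (rule gderiv_cmult[OF gderiv_mult[OF gderiv_base], of "\<lambda>_. - 2"])
  have p1: "partial_deriv b (lnpot \<rho>) = U (e1 b)" if "b \<in> Basis" for b
    using partial_deriv_eq[OF lnpot_has_derivative[OF k1 d1]] that by (auto simp: fun_eq_iff sum_Basis_inner_mult)
  have p2: "partial_deriv b (U (e1 b)) x = U (e2 b b) x" if "b \<in> Basis" for b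
    using partial_deriv_eq[OF U_has_derivative'[OF k1 k2 d2]] dim that by (auto simp: sum_Basis_inner_mult)
  have i2: "Bochner_Integration.integrable lborel (\<lambda>r. F (e2 b b) (exp r) x)" for b
    using dim by (intro F_exp_integrable[OF k2]) auto
  have "laplacian (lnpot \<rho>) x = (\<Sum>b\<in>Basis. U (e2 b b) x)"
    unfolding laplacian_def by (intro sum.cong) (auto simp: p1 p2)
  also have "\<dots> = (\<integral>r. (\<Sum>b\<in>Basis. F (e2 b b) (exp r) x) \<partial>lborel) / 2"
    unfolding U_def sum_divide_distrib[symmetric] using i2 by (subst Bochner_Integration.integral_sum) auto
  also have "(\<lambda>r. \<Sum>b\<in>Basis. F (e2 b b) (exp r) x) = (\<lambda>r. \<integral>y. (4 * (exp r)\<^sup>2 * (norm (x - y))\<^sup>2 - 2 * ?n * exp r) * e0 (exp r) (x - y) * \<rho> y \<partial>lborel)"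
  proof
    fix r :: real
    have "(\<Sum>b\<in>Basis. F (e2 b b) (exp r) x) = (\<integral>y. (\<Sum>b\<in>Basis. e2 b b (exp r) (x - y) * \<rho> y) \<partial>lborel)"
      unfolding F_def by (subst Bochner_Integration.integral_sum) (auto intro: F_integrable[OF k2])
    also have "(\<lambda>y. \<Sum>b\<in>Basis. e2 b b (exp r) (x - y) * \<rho> y) = (\<lambda>y. (4 * (exp r)\<^sup>2 * (norm (x - y))\<^sup>2 - 2 * ?n * exp r) * e0 (exp r) (x - y) * \<rho> y)"
    proof
      fix y
      define z where "z = x - y"
      define t where "t = exp r"
      have "(\<Sum>b\<in>Basis. e2 b b t z) = (\<Sum>b\<in>Basis. (4 * t\<^sup>2 * e0 t z) * (z \<bullet> b)\<^sup>2 - 2 * t * e0 t z)"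
        by (intro sum.cong) (auto simp: e2_def power2_eq_square algebra_simps)
      also have "\<dots> = (4 * t\<^sup>2 * e0 t z) * (norm z)\<^sup>2 - ?n * (2 * t * e0 t z)"
        by (simp only: sum_subtractf sum_distrib_left[symmetric] norm_sq_sum_Basis[symmetric] sum_constant) (simp only: mult_ac)
      finally have "(\<Sum>b\<in>Basis. e2 b b t z) = (4 * t\<^sup>2 * (norm z)\<^sup>2 - 2 * ?n * t) * e0 t z"
        by (simp only: left_diff_distrib) (simp only: mult_ac)
      then show "(\<Sum>b\<in>Basis. e2 b b (exp r) (x - y) * \<rho> y) = (4 * (exp r)\<^sup>2 * (norm (x - y))\<^sup>2 - 2 * ?n * exp r) * e0 (exp r) (x - y) * \<rho> y"
        by (simp only: sum_distrib_right[symmetric] z_def t_def)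
    qed
    finally show "(\<Sum>b\<in>Basis. F (e2 b b) (exp r) x) = (\<integral>y. (4 * (exp r)\<^sup>2 * (norm (x - y))\<^sup>2 - 2 * ?n * exp r) * e0 (exp r) (x - y) * \<rho> y \<partial>lborel)" .
  qed
  also have "(\<integral>r. (\<integral>y. (4 * (exp r)\<^sup>2 * (norm (x - y))\<^sup>2 - 2 * ?n * exp r) * e0 (exp r) (x - y) * \<rho> y \<partial>lborel) \<partial>lborel)
      = - 2 * (?n - 2) * (\<integral>y. norm (x - y) powr (- 2) * \<rho> y \<partial>lborel)"
  proof -
    define h where "h = (\<lambda>y r. (4 * (exp r)\<^sup>2 * (norm (x - y))\<^sup>2 - 2 * ?n * exp r) * e0 (exp r) (x - y) * \<rho> y)"
    have m: "case_prod h \<in> borel_measurable (borel \<Otimes>\<^sub>M borel)" unfolding h_def by measurable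
    have ae: "AE y in lborel. y \<noteq> x" by (rule AE_lborel_singleton)
    have G: "has_bochner_integral lborel (\<lambda>r. 4 * (exp r)\<^sup>2 * (norm z)\<^sup>2 * e0 (exp r) z) (4 * norm z powr (- 2))"
      "has_bochner_integral lborel (\<lambda>r. 2 * ?n * exp r * e0 (exp r) z) (2 * ?n * norm z powr (- 2))" if "z \<noteq> 0" for z :: 'a
    proof -
      define a where "a = (norm z)\<^sup>2"
      have a: "a > 0" using that by (simp add: a_def)
      have ap: "norm z powr (- 2) = 1 / a" using that by (simp add: a_def powr_minus inverse_eq_divide)
      have "has_bochner_integral lborel (\<lambda>r. exp (2 * r) * exp (- (a * exp r))) (Gamma 2 * a powr (- 2))"
        using Gamma_exp_integral[of 2 a] a by (simp add: has_bochner_integral_iff)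
      from has_bochner_integral_mult_right[OF this, of "4 * a"]
      have 1: "has_bochner_integral lborel (\<lambda>r. 4 * a * (exp (2 * r) * exp (- (a * exp r)))) (4 * a * (Gamma 2 * a powr (- 2)))" by simp
      have "Gamma (2::real) = 1" using Gamma_fact[of 1, where ?'a=real] by simp
      moreover have "a powr (- 2) = 1 / (a * a)" using a by (simp add: powr_minus inverse_eq_divide power2_eq_square)
      ultimately have "4 * a * (Gamma 2 * a powr (- 2)) = 4 * norm z powr (- 2)"
        using a by (simp add: ap)
      moreover have "(\<lambda>r. 4 * a * (exp (2 * r) * exp (- (a * exp r)))) = (\<lambda>r. 4 * (exp r)\<^sup>2 * (norm z)\<^sup>2 * e0 (exp r) z)"
      proof
        fix r :: real
        show "4 * a * (exp (2 * r) * exp (- (a * exp r))) = 4 * (exp r)\<^sup>2 * (norm z)\<^sup>2 * e0 (exp r) z"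
          by (simp only: exp_double) (simp only: a_def mult_ac)
      qed
      ultimately show "has_bochner_integral lborel (\<lambda>r. 4 * (exp r)\<^sup>2 * (norm z)\<^sup>2 * e0 (exp r) z) (4 * norm z powr (- 2))"
        using 1 by (simp only:)
      have "has_bochner_integral lborel (\<lambda>r. exp (1 * r) * exp (- (a * exp r))) (Gamma 1 * a powr (- 1))"
        using Gamma_exp_integral[of 1 a] a by (simp add: has_bochner_integral_iff)
      from has_bochner_integral_mult_right[OF this, of "2 * ?n"]
      moreover have e: "2 * ?n * (Gamma 1 * a powr (- 1)) = 2 * ?n * norm z powr (- 2)"
        using that by (simp add: a_def powr_minus inverse_eq_divide)
      ultimately have "has_bochner_integral lborel (\<lambda>r. 2 * ?n * (exp (1 * r) * exp (- (a * exp r)))) (2 * ?n * norm z powr (- 2))"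
        by (simp only:)
      then show "has_bochner_integral lborel (\<lambda>r. 2 * ?n * exp r * e0 (exp r) z) (2 * ?n * norm z powr (- 2))"
        by (simp only: a_def mult_1_left) (simp only: mult_ac)
    qed
    have h1: "has_bochner_integral lborel (h y) ((4 - 2 * ?n) * (norm (x - y) powr (- 2) * \<rho> y))" if "y \<noteq> x" for y
    proof -
      have z: "x - y \<noteq> 0" using that by simp
      from has_bochner_integral_mult_left[OF has_bochner_integral_diff[OF G[OF z]], of "\<rho> y"]
      show ?thesis by (simp only: h_def left_diff_distrib mult.assoc)
    qed
    have h2: "(\<integral>r. norm (h y r) \<partial>lborel) \<le> (4 + 2 * ?n) * (norm (x - y) powr (- 2) * \<rho> y)" if "y \<noteq> x" for y
    proof -
      have z: "x - y \<noteq> 0" using that by simp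
      have s: "has_bochner_integral lborel (\<lambda>r. (4 * (exp r)\<^sup>2 * (norm (x - y))\<^sup>2 * e0 (exp r) (x - y) + 2 * ?n * exp r * e0 (exp r) (x - y)) * \<rho> y)
         ((4 * norm (x - y) powr (- 2) + 2 * ?n * norm (x - y) powr (- 2)) * \<rho> y)"
        using has_bochner_integral_mult_left[OF has_bochner_integral_add[OF G[OF z]], of "\<rho> y"] by simp
      have "(\<integral>r. norm (h y r) \<partial>lborel) \<le> (\<integral>r. (4 * (exp r)\<^sup>2 * (norm (x - y))\<^sup>2 * e0 (exp r) (x - y) + 2 * ?n * exp r * e0 (exp r) (x - y)) * \<rho> y \<partial>lborel)"
      proof (rule integral_mono)
        show "Bochner_Integration.integrable lborel (\<lambda>r. norm (h y r))"
          using h1[OF that] by (intro integrable_norm) (simp add: has_bochner_integral_iff)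
        show "Bochner_Integration.integrable lborel (\<lambda>r. (4 * (exp r)\<^sup>2 * (norm (x - y))\<^sup>2 * e0 (exp r) (x - y) + 2 * ?n * exp r * e0 (exp r) (x - y)) * \<rho> y)"
          using s by (simp only: has_bochner_integral_iff)
        fix r :: real
        define A Bb where "A = 4 * (exp r)\<^sup>2 * (norm (x - y))\<^sup>2 * e0 (exp r) (x - y)" and "Bb = 2 * ?n * exp r * e0 (exp r) (x - y)"
        have "A \<ge> 0" "Bb \<ge> 0" by (auto simp: A_def Bb_def)
        then have "\<bar>A - Bb\<bar> \<le> A + Bb" by linarith
        have hh: "h y r = (A - Bb) * \<rho> y" by (simp only: h_def A_def Bb_def left_diff_distrib)
        from mult_right_mono[OF \<open>\<bar>A - Bb\<bar> \<le> A + Bb\<close> nonneg[of y]]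
        show "norm (h y r) \<le> (4 * (exp r)\<^sup>2 * (norm (x - y))\<^sup>2 * e0 (exp r) (x - y) + 2 * ?n * exp r * e0 (exp r) (x - y)) * \<rho> y"
          unfolding hh real_norm_def abs_mult abs_of_nonneg[OF nonneg[of y]] by (simp only: A_def Bb_def)
      qed
      also have "\<dots> = (4 * norm (x - y) powr (- 2) + 2 * ?n * norm (x - y) powr (- 2)) * \<rho> y"
        by (rule has_bochner_integral_integral_eq[OF s])
      finally show ?thesis by (simp only: distrib_right mult.assoc)
    qed
    have A: "AE y in lborel. Bochner_Integration.integrable lborel (h y)"
      using ae by eventually_elim (use h1 in \<open>auto simp: has_bochner_integral_iff\<close>)
    have Bi: "Bochner_Integration.integrable lborel (\<lambda>y. (4 + 2 * ?n) * (norm (x - y) powr (- 2) * \<rho> y))"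
      using dim by (intro integrable_mult_right riesz_integrable) auto
    have C: "AE y in lborel. (\<integral>r. norm (h y r) \<partial>lborel) \<le> (4 + 2 * ?n) * (norm (x - y) powr (- 2) * \<rho> y)"
      using ae by eventually_elim (rule h2)
    note Fu = fubini_iterated[OF m A Bi C]
    have "(\<integral>r. (\<integral>y. h y r \<partial>lborel) \<partial>lborel) = (\<integral>y. (\<integral>r. h y r \<partial>lborel) \<partial>lborel)" by (rule Fu(2))
    also have "\<dots> = (\<integral>y. (4 - 2 * ?n) * (norm (x - y) powr (- 2) * \<rho> y) \<partial>lborel)"
    proof (rule integral_cong_AE)
      show "AE y in lborel. (\<integral>r. h y r \<partial>lborel) = (4 - 2 * ?n) * (norm (x - y) powr (- 2) * \<rho> y)"
        using ae by eventually_elim (rule has_bochner_integral_integral_eq[OF h1])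
    qed (use borel_measurable_integrable[OF Fu(3)] in auto)
    also have "\<dots> = (4 - 2 * ?n) * (\<integral>y. norm (x - y) powr (- 2) * \<rho> y \<partial>lborel)" by (rule integral_mult_right_zero)
    also have "\<dots> = - 2 * (?n - 2) * (\<integral>y. norm (x - y) powr (- 2) * \<rho> y \<partial>lborel)" by (simp add: algebra_simps)
    finally show ?thesis unfolding h_def .
  qed
  also have "- 2 * (?n - 2) * (\<integral>y. norm (x - y) powr (- 2) * \<rho> y \<partial>lborel) / 2 = - (?n - 2) * (\<integral>y. norm (x - y) powr (- 2) * \<rho> y \<partial>lborel)"
    by (simp add: algebra_simps diff_divide_distrib)
  finally show ?thesis .
qed

text \<open>From \<open>|ln a - ln b| \<le> |a - b| (1/a + 1/b)\<close>: both resulting Riesz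
  potentials of order-one kernels are bounded uniformly in the base point.\<close>

lemma lnpot_lipschitz:
  "\<bar>lnpot \<rho> x - lnpot \<rho> x'\<bar> \<le> 2 * (riesz_const TYPE('a) 1 * B + mass) * dist x x'"
proof -
  have r: "Bochner_Integration.integrable lborel (\<lambda>y. norm (z - y) powr (- 1) * \<rho> y)" for z
    using dim by (intro riesz_integrable) auto
  have ptw: "\<bar>ln (norm (x - y)) * \<rho> y - ln (norm (x' - y)) * \<rho> y\<bar>
      \<le> dist x x' * (norm (x - y) powr (- 1) * \<rho> y + norm (x' - y) powr (- 1) * \<rho> y)" if "y \<noteq> x" "y \<noteq> x'" for y
  proof -
    define a b where "a = norm (x - y)" and "b = norm (x' - y)"
    have ab: "a > 0" "b > 0" using that by (auto simp: a_def b_def)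
    have d: "\<bar>a - b\<bar> \<le> dist x x'"
      using norm_triangle_ineq3[of "x - y" "x' - y"] by (simp add: a_def b_def dist_norm)
    have "ln a - ln b \<le> (a - b) / b" "ln b - ln a \<le> (b - a) / a"
      using ln_le_minus_one[of "a / b"] ln_le_minus_one[of "b / a"] ab by (simp_all add: ln_div diff_divide_distrib)
    moreover have "(a - b) / b \<le> dist x x' * (1 / b)" "(b - a) / a \<le> dist x x' * (1 / a)"
      using d ab by (auto simp: divide_right_mono)
    moreover have "0 \<le> dist x x' * (1 / a)" "0 \<le> dist x x' * (1 / b)" using ab by auto
    ultimately have "\<bar>ln a - ln b\<bar> \<le> dist x x' * (1 / a + 1 / b)" by (simp add: distrib_left abs_le_iff)
    from mult_right_mono[OF this nonneg[of y]] show ?thesis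
      using ab nonneg[of y] by (simp add: abs_mult left_diff_distrib[symmetric] powr_minus divide_inverse a_def[symmetric] b_def[symmetric] distrib_right mult.assoc)
  qed
  have ae: "AE y in lborel. y \<noteq> x \<and> y \<noteq> x'"
    using AE_lborel_singleton[of x] AE_lborel_singleton[of x'] by eventually_elim simp
  have "\<bar>lnpot \<rho> x - lnpot \<rho> x'\<bar> = \<bar>\<integral>y. ln (norm (x - y)) * \<rho> y - ln (norm (x' - y)) * \<rho> y \<partial>lborel\<bar>"
    unfolding lnpot_def using ln_integrable by simp
  also have "\<dots> \<le> (\<integral>y. \<bar>ln (norm (x - y)) * \<rho> y - ln (norm (x' - y)) * \<rho> y\<bar> \<partial>lborel)"
    by (rule integral_abs_bound)
  also have "\<dots> \<le> (\<integral>y. dist x x' * (norm (x - y) powr (- 1) * \<rho> y + norm (x' - y) powr (- 1) * \<rho> y) \<partial>lborel)"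
  proof (rule integral_mono_AE)
    show "AE y in lborel. \<bar>ln (norm (x - y)) * \<rho> y - ln (norm (x' - y)) * \<rho> y\<bar>
      \<le> dist x x' * (norm (x - y) powr (- 1) * \<rho> y + norm (x' - y) powr (- 1) * \<rho> y)"
      using ae by eventually_elim (use ptw in auto)
  qed (intro integrable_abs Bochner_Integration.integrable_diff ln_integrable integrable_mult_right Bochner_Integration.integrable_add r)+
  also have "\<dots> = dist x x' * ((\<integral>y. norm (x - y) powr (- 1) * \<rho> y \<partial>lborel) + (\<integral>y. norm (x' - y) powr (- 1) * \<rho> y \<partial>lborel))"
    using r by simp
  also have "\<dots> \<le> dist x x' * ((riesz_const TYPE('a) 1 * B + mass) + (riesz_const TYPE('a) 1 * B + mass))"
    using dim by (intro mult_left_mono add_mono riesz_le) auto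
  finally show ?thesis by (simp add: mult.commute)
qed

text \<open>The tangent of \<open>ln\<close> at \<open>m\<close> is applied to
  \<open>|x - y|^2 / |y|^2 \<le> 2 |x|^2 |y|^-2 + 2\<close>. A large \<open>m\<close> makes the
  coefficient of \<open>|x|^2\<close> times the singular moment as small as desired; the price
  \<open>ln m\<close> multiplies only the mass, which is under control.\<close>

lemma lnpot_lower:
  assumes m: "m > 0"
  shows "lnpot \<rho> x - lnpot \<rho> 0 \<ge> - ((norm x)\<^sup>2 * (\<integral>y. norm y powr (- 2) * \<rho> y \<partial>lborel) / m + mass * (1 / m + ln m / 2))"
proof -
  have r: "Bochner_Integration.integrable lborel (\<lambda>y. norm y powr (- 2) * \<rho> y)"
    using riesz_integrable[of 2 0] dim by simp
  let ?R = "\<lambda>y. (norm x)\<^sup>2 / m * (norm y powr (- 2) * \<rho> y) + (1 / m + ln m / 2) * \<rho> y"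
  have ptw: "ln (norm (x - y)) * \<rho> y - ln (norm (0 - y)) * \<rho> y \<le> ?R y" if "y \<noteq> x" "y \<noteq> 0" for y
  proof -
    define X where "X = (norm (x - y))\<^sup>2 / (norm y)\<^sup>2"
    have X: "X > 0" using that by (simp add: X_def)
    have "ln (X / m) \<le> X / m - 1" using X m by (intro ln_le_minus_one) simp
    then have 1: "ln X \<le> X / m + ln m" using X m by (simp add: ln_div)
    have "norm (x - y) \<le> norm x + norm y" by (rule norm_triangle_ineq4)
    then have "(norm (x - y))\<^sup>2 \<le> (norm x + norm y)\<^sup>2" by (intro power_mono) auto
    also have "\<dots> \<le> 2 * (norm x)\<^sup>2 + 2 * (norm y)\<^sup>2"
      using sum_squares_bound[of "norm x" "norm y"] by (simp add: power2_sum)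
    finally have "X \<le> (2 * (norm x)\<^sup>2 + 2 * (norm y)\<^sup>2) / (norm y)\<^sup>2"
      unfolding X_def by (intro divide_right_mono) auto
    also have "\<dots> = 2 * (norm x)\<^sup>2 * norm y powr (- 2) + 2"
    proof -
      have "norm y powr (- 2) = 1 / (norm y)\<^sup>2" using that by (simp add: powr_minus inverse_eq_divide)
      then show ?thesis using that by (simp add: add_divide_distrib)
    qed
    finally have "X / m \<le> (2 * (norm x)\<^sup>2 * norm y powr (- 2) + 2) / m" using m by (intro divide_right_mono) auto
    with 1 have "ln X \<le> (2 * (norm x)\<^sup>2 * norm y powr (- 2) + 2) / m + ln m" by linarith
    moreover have "ln X = 2 * (ln (norm (x - y)) - ln (norm y))"
      using that by (simp add: X_def ln_div ln_realpow)
    ultimately have "ln (norm (x - y)) - ln (norm y) \<le> (norm x)\<^sup>2 / m * norm y powr (- 2) + (1 / m + ln m / 2)"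
      by (simp add: add_divide_distrib)
    from mult_right_mono[OF this nonneg[of y]] show ?thesis
      by (simp add: left_diff_distrib distrib_right mult.assoc)
  qed
  have ae: "AE y in lborel. y \<noteq> x \<and> y \<noteq> 0"
    using AE_lborel_singleton[of x] AE_lborel_singleton[of "0::'a"] by eventually_elim simp
  have "lnpot \<rho> 0 - lnpot \<rho> x = (\<integral>y. ln (norm (x - y)) * \<rho> y - ln (norm (0 - y)) * \<rho> y \<partial>lborel)"
    unfolding lnpot_def using ln_integrable[of x] ln_integrable[of 0] by (subst Bochner_Integration.integral_diff) auto
  also have "\<dots> \<le> (\<integral>y. ?R y \<partial>lborel)"
  proof (rule integral_mono_AE)
    show "AE y in lborel. ln (norm (x - y)) * \<rho> y - ln (norm (0 - y)) * \<rho> y \<le> ?R y"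
      using ae by eventually_elim (use ptw in auto)
  qed (intro Bochner_Integration.integrable_diff ln_integrable integrable_mult_right Bochner_Integration.integrable_add r integrable)+
  also have "\<dots> = (norm x)\<^sup>2 / m * (\<integral>y. norm y powr (- 2) * \<rho> y \<partial>lborel) + (1 / m + ln m / 2) * mass"
    using r integrable by (subst Bochner_Integration.integral_add) (auto simp: mass_def)
  finally show ?thesis by (simp add: mult.commute)
qed

text \<open>The potential behaves like that of a point mass at 0. The error
  \<open>ln |x - y| - ln |x|\<close> gains a factor \<open>1 / |x|\<close> at the cost of one more
  power of \<open>|y|\<close>, and the resulting density \<open>|y|^2 \<rho>\<close> is still
  bounded and integrable.\<close>

lemma lnpot_asymptotic:
  assumes x: "x \<noteq> 0"
  shows "\<bar>lnpot \<rho> x + mass * ln (norm x)\<bar> \<le> (2 * (\<integral>y. norm y * \<rho> y \<partial>lborel) + riesz_const TYPE('a) 1 * (2 * B) + (\<integral>y. (norm y)\<^sup>2 * \<rho> y \<partial>lborel)) / norm x"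
proof -
  let ?s = "\<lambda>y. (norm y)\<^sup>2 * \<rho> y"
  have sb: "\<bar>?s y\<bar> \<le> 2 * B" for y
  proof -
    have "?s y \<le> 2 * B * 1" using B_nonneg by (intro order_trans[OF sq_bound] mult_left_mono) auto
    then show ?thesis using nonneg[of y] by simp
  qed
  have si: "Bochner_Integration.integrable lborel (\<lambda>y. norm (x - y) powr (- 1) * ?s y)"
    using dim by (intro riesz_bound(1)[OF _ _ integrable_sq sb]) auto
  have sI: "(\<integral>y. norm (x - y) powr (- 1) * ?s y \<partial>lborel) \<le> riesz_const TYPE('a) 1 * (2 * B) + (\<integral>y. ?s y \<partial>lborel)"
    using riesz_bound(2)[OF _ _ integrable_sq sb, of 1 x] dim nonneg by simp
  let ?R = "\<lambda>y. (2 * (norm y * \<rho> y) + norm (x - y) powr (- 1) * ?s y) / norm x"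
  have nx: "norm x > 0" using x by simp
  have ptw: "\<bar>ln (norm (x - y)) * \<rho> y - ln (norm x) * \<rho> y\<bar> \<le> ?R y" if "y \<noteq> x" for y
  proof -
    define a b where "a = norm (x - y)" and "b = norm x"
    have ab: "a > 0" "b > 0" using that nx by (auto simp: a_def b_def)
    have d: "\<bar>a - b\<bar> \<le> norm y"
      using norm_triangle_ineq3[of "x - y" x] by (simp add: a_def b_def)
    have "ln a - ln b \<le> (a - b) / b" "ln b - ln a \<le> (b - a) / a"
      using ln_le_minus_one[of "a / b"] ln_le_minus_one[of "b / a"] ab by (simp_all add: ln_div diff_divide_distrib)
    moreover have "(a - b) / b \<le> norm y / b" "(b - a) / a \<le> norm y / a"
      using d ab by (auto intro!: divide_right_mono)
    \<comment> \<open>Multiplying \<open>|x| \<le> |x - y| + |y|\<close> by \<open>|y|\<close>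
      trades the singular denominator for \<open>|x|\<close>; the leftover singularity falls on the
      density \<open>|y|^2 \<rho>\<close>.\<close>
    moreover have "norm y / a \<le> (norm y + (norm y)\<^sup>2 * (1 / a)) / b"
    proof -
      have "norm y * b \<le> norm y * (a + norm y)" using d by (intro mult_left_mono) auto
      then show ?thesis using ab by (simp add: pos_divide_le_eq pos_le_divide_eq power2_eq_square distrib_left distrib_right)
    qed
    moreover have "0 \<le> norm y / b" "0 \<le> (norm y + (norm y)\<^sup>2 * (1 / a)) / b" using ab by auto
    ultimately have "\<bar>ln a - ln b\<bar> \<le> norm y / b + (norm y + (norm y)\<^sup>2 * (1 / a)) / b" by linarith
    also have "\<dots> = (2 * norm y + (1 / a) * (norm y)\<^sup>2) / b" by (simp add: add_divide_distrib)
    finally have "\<bar>ln a - ln b\<bar> * \<rho> y \<le> (2 * norm y + (1 / a) * (norm y)\<^sup>2) / b * \<rho> y"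
      using nonneg[of y] by (rule mult_right_mono)
    also have "\<dots> = (2 * (norm y * \<rho> y) + (1 / a) * ((norm y)\<^sup>2 * \<rho> y)) / b"
      by (simp add: distrib_right mult.assoc)
    finally have 1: "\<bar>ln a - ln b\<bar> * \<rho> y \<le> (2 * (norm y * \<rho> y) + (1 / a) * ((norm y)\<^sup>2 * \<rho> y)) / b" .
    have "norm (x - y) powr (- 1) = 1 / a" using ab by (simp add: a_def powr_minus inverse_eq_divide)
    moreover have "\<bar>ln (norm (x - y)) * \<rho> y - ln (norm x) * \<rho> y\<bar> = \<bar>ln a - ln b\<bar> * \<rho> y"
      by (simp only: a_def b_def left_diff_distrib[symmetric] abs_mult abs_of_nonneg[OF nonneg[of y]])
    ultimately show ?thesis using 1 by (simp only: b_def)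
  qed
  have ae: "AE y in lborel. y \<noteq> x" by (rule AE_lborel_singleton)
  have "\<bar>lnpot \<rho> x + mass * ln (norm x)\<bar> = \<bar>\<integral>y. ln (norm (x - y)) * \<rho> y - ln (norm x) * \<rho> y \<partial>lborel\<bar>"
    unfolding lnpot_def mass_def using ln_integrable[of x] integrable
    by (subst Bochner_Integration.integral_diff) (auto simp: abs_minus_commute mult.commute)
  also have "\<dots> \<le> (\<integral>y. \<bar>ln (norm (x - y)) * \<rho> y - ln (norm x) * \<rho> y\<bar> \<partial>lborel)"
    by (rule integral_abs_bound)
  also have "\<dots> \<le> (\<integral>y. ?R y \<partial>lborel)"
  proof (rule integral_mono_AE)
    show "AE y in lborel. \<bar>ln (norm (x - y)) * \<rho> y - ln (norm x) * \<rho> y\<bar> \<le> ?R y"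
      using ae by eventually_elim (rule ptw)
  qed (intro integrable_abs Bochner_Integration.integrable_diff ln_integrable integrable_divide_zero integrable_mult_right Bochner_Integration.integrable_add si integrable integrable_norm_mult)+
  also have "\<dots> = (2 * (\<integral>y. norm y * \<rho> y \<partial>lborel) + (\<integral>y. norm (x - y) powr (- 1) * ?s y \<partial>lborel)) / norm x"
    using si integrable_norm_mult by simp
  also have "\<dots> \<le> (2 * (\<integral>y. norm y * \<rho> y \<partial>lborel) + riesz_const TYPE('a) 1 * (2 * B) + (\<integral>y. ?s y \<partial>lborel)) / norm x"
    using sI nx by (intro divide_right_mono) auto
  finally show ?thesis .
qed

lemma lnpot_radial:
  assumes "radially_symmetric \<rho>"
  shows "radially_symmetric (lnpot \<rho>)"
  unfolding radially_symmetric_def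
proof (intro allI impI)
  fix x y :: 'a assume "norm x = norm y"
  from reflection_exists[OF this] obtain T
    where T: "linear T" "\<And>z. norm (T z) = norm z" "\<And>z. T (T z) = z" "T x = y"
    by blast
  have Tm [measurable]: "T \<in> borel_measurable borel"
    using T(1) by (intro borel_measurable_continuous_onI) (simp add: linear_continuous_on linear_linear)
  have eq: "norm (y - T z) = norm (x - z)" for z
    using T by (metis linear_diff)
  have "(\<integral>z. ln (norm (y - z)) * \<rho> z \<partial>lborel) = (\<integral>z. ln (norm (y - z)) * \<rho> z \<partial>distr lborel borel T)"
    by (simp add: distr_lborel_isometry[OF T(1-3)])
  also have "\<dots> = (\<integral>z. ln (norm (y - T z)) * \<rho> (T z) \<partial>lborel)"
    by (subst integral_distr) measurable
  also have "\<dots> = (\<integral>z. ln (norm (x - z)) * \<rho> z \<partial>lborel)"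
  proof -
    have "\<rho> (T z) = \<rho> z" for z using assms T(2) unfolding radially_symmetric_def by blast
    then show ?thesis by (simp add: eq)
  qed
  finally show "lnpot \<rho> x = lnpot \<rho> y" by (simp add: lnpot_def)
qed

end

text \<open>Minimum principle: at an interior minimum on the ball bounded by the sphere through \<open>x\<close>, the Laplacian of
  \<open>f - \<epsilon>|\<cdot>|\<^sup>2\<close> could not be negative; by symmetry \<open>f\<close> is constant on that sphere.\<close>

lemma radial_superharmonic_le:
  fixes f :: "'a::euclidean_space \<Rightarrow> real"
  assumes rad: "radially_symmetric f" and f: "Ck 2 f" and lap: "\<And>x. laplacian f x \<le> 0"
  shows "f x \<le> f 0"
proof -
  have key: "f x \<le> f 0 + e * (norm x)\<^sup>2" if e: "e > 0" for e
  proof -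
    define g where "g = (\<lambda>z. f z - e * (norm z)\<^sup>2)"
    have q: "Ck 2 (\<lambda>z::'a. (norm z)\<^sup>2)" by (rule poly_fun_Ck[OF poly_fun_norm2])
    have g: "Ck 2 g"
      using Ck_add[OF f Ck_cmult[OF q, of "- e"]] by (simp add: g_def)
    have d1: "g differentiable (at z)" for z using CkD(1)[OF g, of "[]"] by simp
    have d2: "partial_deriv b g differentiable (at z)" if "b \<in> Basis" for b z using CkD(1)[OF g, of "[b]"] that by simp
    have lapq: "partial_deriv b (partial_deriv b (\<lambda>z::'a. (norm z)\<^sup>2)) z = 2" if b: "b \<in> Basis" for b z
    proof -
      have p1: "partial_deriv b (\<lambda>z::'a. (norm z)\<^sup>2) = (\<lambda>z. 2 * (z \<bullet> b))"
      proof
        fix z :: 'a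
        have "((\<lambda>z. z \<bullet> z) has_derivative (\<lambda>h. z \<bullet> h + h \<bullet> z)) (at z)" by (auto intro!: derivative_eq_intros)
        from partial_deriv_eq[OF this, of b] show "partial_deriv b (\<lambda>z::'a. (norm z)\<^sup>2) z = 2 * (z \<bullet> b)"
          by (simp add: power2_norm_eq_inner inner_commute)
      qed
      have "((\<lambda>z. 2 * (z \<bullet> b)) has_derivative (\<lambda>h. 2 * (h \<bullet> b))) (at z)" by (auto intro!: derivative_eq_intros)
      from partial_deriv_eq[OF this, of b] show ?thesis using b by (simp add: p1)
    qed
    have "laplacian g z < 0" for z
    proof -
      have "partial_deriv b (partial_deriv b g) z = partial_deriv b (partial_deriv b f) z - 2 * e" if b: "b \<in> Basis" for b
      proof -
        have "partial_derivs [b, b] (\<lambda>z. f z + (- e) * (norm z)\<^sup>2) z = partial_derivs [b, b] f z + partial_derivs [b, b] (\<lambda>z. (- e) * (norm z)\<^sup>2) z"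
          using b by (subst Ck_partial_derivs_add[OF f Ck_cmult[OF q]]) auto
        also have "partial_derivs [b, b] (\<lambda>z::'a. (- e) * (norm z)\<^sup>2) z = (- e) * partial_derivs [b, b] (\<lambda>z. (norm z)\<^sup>2) z"
          using b by (subst Ck_partial_derivs_cmult[OF q]) auto
        finally show ?thesis using lapq[OF b, of z] by (simp add: g_def)
      qed
      then have "laplacian g z = laplacian f z - 2 * e * real DIM('a)"
        by (simp add: laplacian_def sum_subtractf mult.commute)
      moreover have "2 * e * real DIM('a) > 0" using e by simp
      ultimately show ?thesis using lap[of z] by linarith
    qed
    have cg: "continuous_on (cball 0 (norm x)) g"
      by (rule continuous_on_subset[OF Ck_continuous[OF g]]) simp
    obtain z where z: "z \<in> cball 0 (norm x)" "\<And>y. y \<in> cball 0 (norm x) \<Longrightarrow> g z \<le> g y"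
      using continuous_attains_inf[OF compact_cball _ cg] by (metis cball_eq_empty norm_ge_zero not_less)
    have "norm z = norm x"
    proof (rule ccontr)
      assume "norm z \<noteq> norm x"
      then have "norm z < norm x" using z(1) by simp
      then have "z \<in> ball 0 (norm x)" by simp
      then obtain r where r: "r > 0" "ball z r \<subseteq> ball 0 (norm x)" using open_contains_ball by (metis open_ball)
      \<comment> \<open>Otherwise the derivative along \<open>b\<close>, which vanishes at the
        minimum, would be negative just after it, and the mean value theorem would give a smaller
        value inside the ball.\<close>
      have "partial_deriv b (partial_deriv b g) z \<ge> 0" if b: "b \<in> Basis" for b
      proof (rule ccontr)
        assume neg: "\<not> 0 \<le> partial_deriv b (partial_deriv b g) z"
        define h where "h = (\<lambda>t. g (z + t *\<^sub>R b))"
        define h' where "h' = (\<lambda>t. partial_deriv b g (z + t *\<^sub>R b))"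
        have dh: "(h has_real_derivative h' t) (at t)" for t
          unfolding h_def h'_def has_real_derivative_iff_has_vector_derivative by (rule has_vector_derivative_partial[OF d1])
        have dh': "(h' has_real_derivative partial_deriv b (partial_deriv b g) z) (at 0)"
          unfolding h'_def has_real_derivative_iff_has_vector_derivative
          using has_vector_derivative_partial[where x=z and s=0 and b=b, OF d2[OF b]] by simp
        have hmin: "h 0 \<le> h t" if "\<bar>t\<bar> < r" for t
        proof -
          have "z + t *\<^sub>R b \<in> ball z r" using that b by (simp add: dist_norm)
          then have "z + t *\<^sub>R b \<in> cball 0 (norm x)" using r(2) by (meson ball_subset_cball subsetD)
          then show ?thesis using z(2) by (simp add: h_def)
        qed
        have "h' 0 = 0" using DERIV_local_min[OF dh r(1)] hmin by simp
        obtain d where d: "d > 0" "\<And>t. 0 < t \<Longrightarrow> t < d \<Longrightarrow> h' t < h' 0"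
          using DERIV_neg_dec_right[OF dh'] neg by auto
        define s where "s = min d r / 2"
        have s: "s > 0" "s < d" "s < r" using d r by (auto simp: s_def)
        obtain t where t: "0 < t" "t < s" "h s - h 0 = (s - 0) * h' t"
          using MVT2[OF s(1), of h h'] dh by blast
        have "h' t < 0" using d(2)[of t] t s \<open>h' 0 = 0\<close> by simp
        then have "h s - h 0 < 0" using t s by (simp add: mult_pos_neg)
        then show False using hmin[of s] s by simp
      qed
      then have "laplacian g z \<ge> 0" unfolding laplacian_def by (intro sum_nonneg) auto
      then show False using \<open>\<And>z. laplacian g z < 0\<close>[of z] by simp
    qed
    then have "f z = f x" using rad unfolding radially_symmetric_def by blast
    moreover have "g z \<le> g 0" by (rule z(2)) simp
    ultimately show ?thesis using \<open>norm z = norm x\<close> by (simp add: g_def)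
  qed
  show ?thesis
  proof (rule field_le_epsilon)
    fix e :: real assume e: "e > 0"
    have "f x \<le> f 0 + e / (1 + (norm x)\<^sup>2) * (norm x)\<^sup>2" using e by (intro key) (simp add: add_pos_nonneg)
    also have "e / (1 + (norm x)\<^sup>2) * (norm x)\<^sup>2 \<le> e"
      using e by (simp add: pos_divide_le_eq add_pos_nonneg distrib_left)
    finally show "f x \<le> f 0 + e" by simp
  qed
qed

context gauss_density
begin

lemma lnpot_Ck: "Ck (DIM('a) - 1) (lnpot \<rho>)"
  unfolding Ck_def
proof (intro ballI conjI impI allI)
  fix bs :: "'a list" and x assume bs: "bs \<in> lists Basis"
  show "partial_derivs bs (lnpot \<rho>) differentiable (at x)" if "length bs < DIM('a) - 1"
    using that by (intro partial_derivs_lnpot_differentiable bs) simp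
  show "continuous_on UNIV (partial_derivs bs (lnpot \<rho>))" if "length bs \<le> DIM('a) - 1"
    using that dim by (intro partial_derivs_lnpot_continuous bs) simp
qed

lemma lnpot_le_0:
  assumes "radially_symmetric \<rho>"
  shows "lnpot \<rho> x \<le> lnpot \<rho> 0"
proof (rule radial_superharmonic_le[OF lnpot_radial[OF assms]])
  show "Ck 2 (lnpot \<rho>)" using dim by (intro Ck_mono[OF lnpot_Ck]) auto
  fix x
  have "0 \<le> (\<integral>y. norm (x - y) powr (- 2) * \<rho> y \<partial>lborel)"
    using nonneg by (intro integral_nonneg_AE) auto
  then show "laplacian (lnpot \<rho>) x \<le> 0"
    unfolding laplacian_lnpot using dim by (intro mult_nonpos_nonneg) auto
qed

end

section \<open>The Schauder fixed point theorem\<close>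

lemma tendsto_fun_iff:
  fixes f :: "'c \<Rightarrow> 'd \<Rightarrow> 'b::topological_space"
  shows "(f \<longlongrightarrow> l) F \<longleftrightarrow> (\<forall>i. ((\<lambda>n. f n i) \<longlongrightarrow> l i) F)"
proof -
  have "(f \<longlongrightarrow> l) F \<longleftrightarrow> limitin (product_topology (\<lambda>i::'d. euclidean::'b topology) UNIV) f l F"
    by (simp only: euclidean_product_topology limitin_canonical_iff)
  then show ?thesis by (simp add: limitin_componentwise)
qed

lemma compact_nat_cube:
  "compact {x::nat \<Rightarrow> real. \<forall>i. if i < N then 0 \<le> x i \<and> x i \<le> 1 else x i = 0}"
proof -
  let ?S = "\<lambda>i. if i < N then {0..1} else {0::real}"
  have "compactin (product_topology (\<lambda>i::nat. euclidean) UNIV) (PiE UNIV ?S)"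
    by (subst compactin_PiE) auto
  then have "compact (PiE UNIV ?S)"
    by (simp only: euclidean_product_topology compactin_euclidean_iff)
  also have "PiE UNIV ?S = {x. \<forall>i. if i < N then 0 \<le> x i \<and> x i \<le> 1 else x i = 0}"
    by (auto simp: PiE_iff split: if_splits)
  finally show ?thesis .
qed

text \<open>In Schauder's theorem the dimension is the size of a finite net, hence a number and not
  a type; therefore the cube consists of sequences vanishing from index \<open>N\<close> on. Kuhn's
  labelling lemma on grids of mesh \<open>1 / (p + 1)\<close> gives, for each coordinate, nearby
  points where \<open>f\<close> does not decrease and does not increase it; a limit point is
  fixed.\<close>

theorem brouwer_nat_cube:
  fixes f :: "(nat \<Rightarrow> real) \<Rightarrow> nat \<Rightarrow> real" and N :: nat
  defines "C \<equiv> {x::nat \<Rightarrow> real. \<forall>i. if i < N then 0 \<le> x i \<and> x i \<le> 1 else x i = 0}"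
  assumes contf: "continuous_on C f" and fC: "f ` C \<subseteq> C"
  shows "\<exists>x\<in>C. f x = x"
proof -
  have "\<exists>z\<in>C. \<forall>i<N. \<exists>r\<in>C. \<exists>s\<in>C. (\<forall>j. \<bar>r j - z j\<bar> \<le> 1 / Suc p) \<and> (\<forall>j. \<bar>s j - z j\<bar> \<le> 1 / Suc p) \<and>
        r i \<le> f r i \<and> f s i \<le> s i" for p :: nat
  proof -
    define X where "X = (\<lambda>x i. if i < N then real (x i) / real (Suc p) else 0)"
    \<comment> \<open>Label 0 records that \<open>f\<close> does not decrease the coordinate. The
      exception for \<open>x i = Suc p\<close> forces label 1 on the upper face, as the
      combinatorial lemma demands; there \<open>X x i = 1\<close>, so \<open>f\<close> cannot
      increase the coordinate anyway.\<close>
    define label where "label = (\<lambda>x i. if x i \<noteq> Suc p \<and> X x i \<le> f (X x) i then 0 else (1::nat))"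
    have X: "X x \<in> C" if "\<And>i. i < N \<Longrightarrow> x i \<le> Suc p" for x
      using that by (auto simp: X_def C_def simp del: of_nat_Suc)
    have fX: "0 \<le> f x i \<and> f x i \<le> 1" if "x \<in> C" "i < N" for x i
      using that fC unfolding C_def by fastforce
    obtain q where q: "\<forall>i<N. q i < Suc p" and
      rs: "\<forall>i<N. \<exists>r s. (\<forall>j<N. q j \<le> r j \<and> r j \<le> q j + 1) \<and> (\<forall>j<N. q j \<le> s j \<and> s j \<le> q j + 1) \<and> label r i \<noteq> label s i"
    proof (rule kuhn_lemma[of "Suc p" N label])
      show "\<forall>x. (\<forall>i<N. x i \<le> Suc p) \<longrightarrow> (\<forall>i<N. x i = 0 \<longrightarrow> label x i = 0)"
      proof (intro allI impI)
        fix x i assume x: "\<forall>i<N. x i \<le> Suc p" and i: "i < N" "x i = 0"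
        have "X x \<in> C" using x by (intro X) blast
        then have "0 \<le> f (X x) i" using fX i(1) by blast
        moreover have "X x i = 0" using i by (simp add: X_def)
        ultimately have "X x i \<le> f (X x) i" by linarith
        with i show "label x i = 0" by (simp add: label_def)
      qed
    qed (auto simp: label_def)
    have near: "\<bar>X r j - X q j\<bar> \<le> 1 / Suc p" if "\<forall>j<N. q j \<le> r j \<and> r j \<le> q j + 1" for r j
    proof (cases "j < N")
      case True
      then have "real (r j) \<le> real (q j) + 1" "real (q j) \<le> real (r j)"
        using that by (metis of_nat_1 of_nat_add of_nat_mono)+
      then show ?thesis using True
        by (auto simp: X_def diff_divide_distrib[symmetric] intro!: divide_right_mono)
    qed (auto simp: X_def)
    have XC: "X r \<in> C" if "\<forall>j<N. q j \<le> r j \<and> r j \<le> q j + 1" for r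
      using that q by (intro X) (metis Suc_leI add.commute le_trans plus_1_eq_Suc)
    have "\<exists>r\<in>C. \<exists>s\<in>C. (\<forall>j. \<bar>r j - X q j\<bar> \<le> 1 / Suc p) \<and> (\<forall>j. \<bar>s j - X q j\<bar> \<le> 1 / Suc p) \<and>
        r i \<le> f r i \<and> f s i \<le> s i" if i: "i < N" for i
    proof -
      from rs i obtain r0 s0 where 0: "\<forall>j<N. q j \<le> r0 j \<and> r0 j \<le> q j + 1"
          "\<forall>j<N. q j \<le> s0 j \<and> s0 j \<le> q j + 1" "label r0 i \<noteq> label s0 i" by blast
      obtain r s where 1: "\<forall>j<N. q j \<le> r j \<and> r j \<le> q j + 1"
          "\<forall>j<N. q j \<le> s j \<and> s j \<le> q j + 1" "label r i = 0" "label s i = 1"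
      proof (cases "label r0 i = 0")
        case True
        then have "label s0 i = 1" using 0(3) by (auto simp: label_def split: if_splits)
        with True 0 that show ?thesis by blast
      next
        case False
        then have "label r0 i = 1" "label s0 i = 0" using 0(3) by (auto simp: label_def split: if_splits)
        with 0 that show ?thesis by blast
      qed
      have "X r i \<le> f (X r) i" using 1(3) by (auto simp: label_def split: if_splits)
      moreover have "f (X s) i \<le> X s i"
      proof (cases "s i = Suc p")
        case True
        then have "X s i = 1" using i by (simp add: X_def)
        then show ?thesis using fX[OF XC[OF 1(2)] i] by simp
      qed (use 1(4) in \<open>auto simp: label_def split: if_splits\<close>)
      ultimately show ?thesis using near[OF 1(1)] near[OF 1(2)] XC[OF 1(1)] XC[OF 1(2)] by blast
    qed
    moreover have "X q \<in> C" using q by (intro X) auto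
    ultimately show ?thesis by blast
  qed
  then obtain z where z: "\<And>p. z p \<in> C" and "\<And>p. \<forall>i<N. \<exists>r\<in>C. \<exists>s\<in>C. (\<forall>j. \<bar>r j - z p j\<bar> \<le> 1 / Suc p) \<and> (\<forall>j. \<bar>s j - z p j\<bar> \<le> 1 / Suc p) \<and>
        r i \<le> f r i \<and> f s i \<le> s i"
    by metis
  then obtain r s where rs: "\<And>p i. i < N \<Longrightarrow> r p i \<in> C \<and> s p i \<in> C \<and> (\<forall>j. \<bar>r p i j - z p j\<bar> \<le> 1 / Suc p) \<and>
      (\<forall>j. \<bar>s p i j - z p j\<bar> \<le> 1 / Suc p) \<and> r p i i \<le> f (r p i) i \<and> f (s p i) i \<le> s p i i"
    by metis
  have "seq_compact C" unfolding C_def by (intro compact_imp_seq_compact compact_nat_cube)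
  then obtain l k where l: "l \<in> C" and k: "strict_mono k" "(z \<circ> k) \<longlonglongrightarrow> l"
    using z by (meson seq_compactE)
  have zl: "(\<lambda>n. z (k n) j) \<longlonglongrightarrow> l j" for j
    using k(2) by (simp add: tendsto_fun_iff o_def)
  have inv: "(\<lambda>n. 1 / real (Suc (k n))) \<longlonglongrightarrow> 0"
    using LIMSEQ_subseq_LIMSEQ[OF LIMSEQ_inverse_real_of_nat k(1)] by (simp add: o_def inverse_eq_divide)
  have lim: "(\<lambda>n. f (y (k n)) i) \<longlonglongrightarrow> f l i" "(\<lambda>n. y (k n) i) \<longlonglongrightarrow> l i"
    if y: "\<And>p. y p \<in> C" "\<And>p j. \<bar>y p j - z p j\<bar> \<le> 1 / Suc p" for y i
  proof -
    have *: "(\<lambda>n. y (k n) j) \<longlonglongrightarrow> l j" for j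
    proof -
      have "(\<lambda>n. y (k n) j - z (k n) j) \<longlonglongrightarrow> 0"
        by (rule Lim_null_comparison[OF _ inv]) (use y in auto)
      from tendsto_add[OF this zl[of j]] show ?thesis by simp
    qed
    then show "(\<lambda>n. y (k n) i) \<longlonglongrightarrow> l i" .
    from * have "(\<lambda>n. y (k n)) \<longlonglongrightarrow> l" by (simp add: tendsto_fun_iff)
    then have "(\<lambda>n. f (y (k n))) \<longlonglongrightarrow> f l"
      using contf l y(1) by (auto simp: continuous_on_sequentially o_def)
    then show "(\<lambda>n. f (y (k n)) i) \<longlonglongrightarrow> f l i" by (simp add: tendsto_fun_iff)
  qed
  have "f l i = l i" for i
  proof (cases "i < N")
    case True
    have "l i \<le> f l i"
      using lim[of "\<lambda>p. r p i" i] rs[OF True] by (intro LIMSEQ_le[of _ "l i" _ "f l i"]) auto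
    moreover have "f l i \<le> l i"
      using lim[of "\<lambda>p. s p i" i] rs[OF True] by (intro LIMSEQ_le[of _ "f l i" _ "l i"]) auto
    ultimately show ?thesis by simp
  next
    case False
    moreover have "f l \<in> C" using fC l by auto
    ultimately show ?thesis using l by (auto simp: C_def)
  qed
  then show ?thesis using l by auto
qed

text \<open>Schauder projection: the weights \<open>w i / W\<close> form a partition of unity
  subordinate to a finite \<open>e\<close>-net \<open>h\<close> of the image. Brouwer is applied to
  the map taking coefficients \<open>c\<close> to the weights at \<open>T (X c)\<close>. A fixed
  \<open>c\<close> is a convex weight, and only net points within \<open>e\<close> of
  \<open>T (X c)\<close> have positive weight, so \<open>X c\<close> is within \<open>e\<close> of
  its image.\<close>

lemma schauder_approx:
  fixes S :: "'b::real_normed_vector set"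
  assumes S: "convex S" "S \<noteq> {}" and T: "continuous_on S T" "T ` S \<subseteq> S"
    and K: "compact K" "T ` S \<subseteq> K" and e: "e > 0"
  shows "\<exists>x\<in>S. dist x (T x) \<le> e"
proof -
  have "compact (closure (T ` S))"
    using compact_Int_closed[OF K(1) closed_closure[of "T ` S"]]
      closure_minimal[OF K(2) compact_imp_closed[OF K(1)]] by (simp add: inf.absorb2)
  moreover have "closure (T ` S) \<subseteq> (\<Union>y\<in>T ` S. ball y e)"
    using e by (auto simp: closure_approachable dist_commute)
  ultimately obtain F where F: "F \<subseteq> T ` S" "finite F" "closure (T ` S) \<subseteq> (\<Union>y\<in>F. ball y e)"
    using compactE_image[of "closure (T ` S)" "T ` S" "\<lambda>y. ball y e"] by (metis open_ball)
  have "F \<noteq> {}" using F(3) S(2) closure_subset[of "T ` S"] by auto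
  define N where "N = card F"
  have N: "N > 0" using \<open>F \<noteq> {}\<close> F(2) by (simp add: N_def card_gt_0_iff)
  obtain h where h: "bij_betw h {0..<N} F"
    using ex_bij_betw_nat_finite[OF F(2)] by (auto simp: N_def)
  have hS: "h i \<in> S" if "i < N" for i
  proof -
    have "h i \<in> F" using bij_betwE[OF h] that by simp
    then show ?thesis using F(1) T(2) by blast
  qed
  define C where "C = {x::nat \<Rightarrow> real. \<forall>i. if i < N then 0 \<le> x i \<and> x i \<le> 1 else x i = 0}"
  \<comment> \<open>Turns any point of the cube into convex weights: an excess of the sum over 1 is
    divided out, a deficit is added to index 0. Points of the simplex are left unchanged, so Brouwer
    for the cube suffices.\<close>
  define a where "a = (\<lambda>(c::nat \<Rightarrow> real) (i::nat). (c i + (if i = 0 then max 0 (1 - sum c {..<N}) else 0)) / max 1 (sum c {..<N}))"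
  define X where "X = (\<lambda>c. \<Sum>i<N. a c i *\<^sub>R h i)"
  define w where "w = (\<lambda>i y. max 0 (e - dist y (h i)))"
  define W where "W = (\<lambda>y. \<Sum>i<N. w i y)"
  define g where "g = (\<lambda>c i. if i < N then w i (T (X c)) / W (T (X c)) else 0)"
  have c_nonneg: "0 \<le> c i" if "c \<in> C" for c i
    using that by (cases "i < N") (auto simp: C_def dest: spec[of _ i])
  have a_sum: "(\<Sum>i<N. a c i) = 1" for c
  proof -
    have "(\<Sum>i<N. a c i) = (sum c {..<N} + max 0 (1 - sum c {..<N})) / max 1 (sum c {..<N})"
      unfolding a_def sum_divide_distrib[symmetric] using N by (simp add: sum.distrib)
    also have "\<dots> = 1" by (simp add: max_def)
    finally show ?thesis .
  qed
  have XS: "X c \<in> S" if "c \<in> C" for c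
    unfolding X_def
  proof (rule convex_sum)
    show "0 \<le> a c i" for i using c_nonneg[OF that] by (auto simp: a_def intro!: divide_nonneg_nonneg add_nonneg_nonneg)
  qed (use S hS a_sum in auto)
  have w: "w i y \<ge> 0" for i y by (simp add: w_def)
  have W: "W y > 0" if "y \<in> T ` S" for y
  proof -
    have "y \<in> (\<Union>x\<in>F. ball x e)" using F(3) that closure_subset[of "T ` S"] by blast
    then obtain x where "x \<in> F" "dist y x < e" by (auto simp: dist_commute)
    then obtain i where i: "i < N" "dist y (h i) < e"
      using h by (auto simp: bij_betw_def)
    then have "0 < w i y" by (simp add: w_def)
    also have "\<dots> \<le> W y" unfolding W_def using i w by (intro member_le_sum) auto
    finally show ?thesis .
  qed
  have proj: "continuous_on C (\<lambda>c. c i)" for i :: nat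
    by (rule continuous_on_subset[OF continuous_on_product_coordinates]) simp
  have ca: "continuous_on C (\<lambda>c. a c i)" for i
  proof -
    have nz: "max 1 s \<noteq> (0::real)" for s by linarith
    have "continuous_on C (\<lambda>c. (c i + max 0 (1 - sum c {..<N})) / max 1 (sum c {..<N}))"
      "continuous_on C (\<lambda>c. (c i + 0) / max 1 (sum c {..<N}))"
      by (intro continuous_intros continuous_on_max proj ballI nz)+
    then show ?thesis by (cases "i = 0") (simp_all add: a_def)
  qed
  have "continuous_on C X"
    unfolding X_def by (intro continuous_intros ca)
  then have TX: "continuous_on C (\<lambda>c. T (X c))"
    by (intro continuous_on_compose2[OF T(1)]) (auto simp: XS)
  have "continuous_on C g"
  proof (rule continuous_on_coordinatewise_then_product)
    fix i show "continuous_on C (\<lambda>c. g c i)"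
      unfolding g_def
    proof (cases "i < N")
      case True
      have "W (T (X c)) \<noteq> 0" if "c \<in> C" for c using W[of "T (X c)"] XS[OF that] by auto
      then have "continuous_on C (\<lambda>c. w i (T (X c)) / W (T (X c)))"
        unfolding w_def W_def by (intro continuous_intros TX) auto
      with True show "continuous_on C (\<lambda>c. if i < N then w i (T (X c)) / W (T (X c)) else 0)" by simp
    qed simp
  qed
  moreover have "g ` C \<subseteq> C"
  proof safe
    fix c assume "c \<in> C"
    then have *: "W (T (X c)) > 0" using W[of "T (X c)"] XS by auto
    have "w i (T (X c)) \<le> W (T (X c))" if "i < N" for i
      unfolding W_def using that w by (intro member_le_sum) auto
    then show "g c \<in> C" using * w by (auto simp: C_def g_def)
  qed
  ultimately obtain c where c: "c \<in> C" "g c = c"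
    using brouwer_nat_cube[of N g] unfolding C_def by blast
  define y where "y = T (X c)"
  have Wy: "W y > 0" using W[of y] XS[OF c(1)] by (auto simp: y_def)
  have ci: "c i = w i y / W y" if "i < N" for i
    using fun_cong[OF c(2), of i] that by (simp add: g_def y_def)
  have sc: "sum c {..<N} = 1"
    using Wy by (simp add: ci sum_divide_distrib[symmetric]) (simp add: W_def)
  have "X c = (\<Sum>i<N. c i *\<^sub>R h i)" unfolding X_def by (intro sum.cong) (auto simp: a_def sc)
  moreover have "y = (\<Sum>i<N. c i *\<^sub>R y)" using sc by (simp add: scaleR_left.sum[symmetric])
  ultimately have "X c - y = (\<Sum>i<N. c i *\<^sub>R (h i - y))"
    by (simp add: scaleR_diff_right sum_subtractf)
  then have "norm (X c - y) \<le> (\<Sum>i<N. norm (c i *\<^sub>R (h i - y)))" by (simp only: norm_sum)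
  also have "\<dots> \<le> (\<Sum>i<N. c i * e)"
  proof (rule sum_mono)
    fix i assume "i \<in> {..<N}"
    then have i: "i < N" by simp
    show "norm (c i *\<^sub>R (h i - y)) \<le> c i * e"
    proof (cases "dist y (h i) < e")
      case True
      then show ?thesis using c_nonneg[OF c(1), of i] by (auto simp: dist_norm norm_minus_commute intro!: mult_left_mono)
    next
      case False
      then have "c i = 0" using ci[OF i] by (simp add: w_def)
      then show ?thesis by simp
    qed
  qed
  also have "\<dots> = e" by (simp add: sum_distrib_right[symmetric] sc)
  finally show ?thesis using XS[OF c(1)] by (auto simp: y_def dist_norm)
qed

theorem schauder:
  fixes S :: "'b::real_normed_vector set"
  assumes S: "convex S" "closed S" "S \<noteq> {}" and T: "continuous_on S T" "T ` S \<subseteq> S"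
    and K: "compact K" "T ` S \<subseteq> K"
  shows "\<exists>x\<in>S. T x = x"
proof -
  have "\<exists>x\<in>S. dist x (T x) \<le> 1 / Suc n" for n
    by (rule schauder_approx[OF S(1,3) T K]) simp
  then obtain x where x: "\<And>n. x n \<in> S" "\<And>n. dist (x n) (T (x n)) \<le> 1 / Suc n" by metis
  have "\<forall>n. T (x n) \<in> K" using K x by auto
  then obtain l k where l: "l \<in> K" and k: "strict_mono k" "((\<lambda>n. T (x n)) \<circ> k) \<longlonglongrightarrow> l"
    using K(1) unfolding compact_def by meson
  have inv: "(\<lambda>n. 1 / real (Suc (k n))) \<longlonglongrightarrow> 0"
    using LIMSEQ_subseq_LIMSEQ[OF LIMSEQ_inverse_real_of_nat k(1)] by (simp add: o_def inverse_eq_divide)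
  have "(\<lambda>n. x (k n) - T (x (k n))) \<longlonglongrightarrow> 0"
    by (rule Lim_null_comparison[OF _ inv]) (use x(2) in \<open>auto simp: dist_norm\<close>)
  from tendsto_add[OF this k(2)] have xl: "(\<lambda>n. x (k n)) \<longlonglongrightarrow> l" by (simp add: o_def)
  then have lS: "l \<in> S" using S(2) x(1) by (meson closed_sequentially)
  have "(\<lambda>n. T (x (k n))) \<longlonglongrightarrow> T l"
    using T(1) lS xl x(1) by (auto simp: continuous_on_sequentially o_def)
  with k(2) have "T l = l" by (simp add: o_def LIMSEQ_unique)
  with lS show ?thesis by auto
qed

section \<open>Lipschitz functions with uniform decay\<close>

definition lipschitz_decay :: "real \<Rightarrow> ('a::euclidean_space \<Rightarrow> real) \<Rightarrow> ('a \<Rightarrow>\<^sub>C real) set" where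
  "lipschitz_decay L w = {f. (\<forall>x y. \<bar>apply_bcontfun f x - apply_bcontfun f y\<bar> \<le> L * dist x y) \<and>
     (\<forall>x. \<bar>apply_bcontfun f x\<bar> \<le> w x)}"

text \<open>Pointwise convergence becomes uniform: outside a large ball the envelope
  \<open>w\<close> makes both functions small, and inside it the common Lipschitz constant reduces
  the claim to finitely many points.\<close>

lemma lipschitz_decay_tendsto:
  fixes f :: "nat \<Rightarrow> 'a::euclidean_space \<Rightarrow>\<^sub>C real"
  assumes w: "(w \<longlongrightarrow> 0) at_infinity" and f: "\<And>n. f n \<in> lipschitz_decay L w" and g: "g \<in> lipschitz_decay L w"
    and lim: "\<And>x. (\<lambda>n. apply_bcontfun (f n) x) \<longlonglongrightarrow> apply_bcontfun g x"
  shows "f \<longlonglongrightarrow> g"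
proof (rule tendstoI)
  fix e :: real assume e: "e > 0"
  define L' where "L' = max L 1"
  have L': "L' > 0" by (simp add: L'_def)
  have lip: "\<bar>apply_bcontfun h x - apply_bcontfun h y\<bar> \<le> L' * dist x y" if "h \<in> lipschitz_decay L w" for h x y
  proof -
    have "\<bar>apply_bcontfun h x - apply_bcontfun h y\<bar> \<le> L * dist x y" using that by (auto simp: lipschitz_decay_def)
    also have "\<dots> \<le> L' * dist x y" by (intro mult_right_mono) (auto simp: L'_def)
    finally show ?thesis .
  qed
  obtain R where R: "\<And>x. norm x \<ge> R \<Longrightarrow> w x < e / 4"
    using order_tendstoD(2)[OF w, of "e / 4"] e by (auto simp: eventually_at_infinity)
  define d where "d = e / (8 * L')"
  have d: "d > 0" using e L' by (simp add: d_def)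
  have "cball (0::'a) R \<subseteq> (\<Union>x\<in>cball 0 R. ball x d)" using d by auto
  then obtain F where F: "finite F" "cball (0::'a) R \<subseteq> (\<Union>x\<in>F. ball x d)"
    using compactE_image[OF compact_cball, of "cball 0 R" "\<lambda>x. ball x d"] by (metis open_ball)
  have "\<forall>\<^sub>F n in sequentially. \<forall>x\<in>F. dist (apply_bcontfun (f n) x) (apply_bcontfun g x) < e / 4"
    using F(1) e by (intro eventually_ball_finite ballI tendstoD lim) auto
  then show "\<forall>\<^sub>F n in sequentially. dist (f n) g < e"
  proof eventually_elim
    case (elim n)
    have "dist (apply_bcontfun (f n) x) (apply_bcontfun g x) \<le> e / 2" for x
    proof (cases "norm x \<ge> R")
      case True
      have "\<bar>apply_bcontfun (f n) x\<bar> \<le> w x" "\<bar>apply_bcontfun g x\<bar> \<le> w x"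
        using f g by (auto simp: lipschitz_decay_def)
      with R[OF True] show ?thesis unfolding dist_real_def by linarith
    next
      case False
      then have "x \<in> cball 0 R" by simp
      then obtain p where p: "p \<in> F" "dist p x < d" using F(2) by auto
      have "L' * dist x p \<le> L' * d" using p(2) L' by (intro mult_left_mono) (auto simp: dist_commute)
      also have "\<dots> = e / 8" using L' by (simp add: d_def)
      finally have "L' * dist x p \<le> e / 8" .
      then show ?thesis
        using lip[OF f, of n x p] lip[OF g, of x p] bspec[OF elim p(1)] unfolding dist_real_def by linarith
    qed
    then have "dist (f n) g \<le> e / 2" by (rule dist_bound)
    then show ?case using e by simp
  qed
qed

text \<open>Arzela-Ascoli on the whole space. A diagonal subsequence converges on a countable dense
  set, the Lipschitz bound extends this to all points, and the envelope makes the convergence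
  uniform.\<close>

lemma compact_lipschitz_decay:
  fixes w :: "'a::euclidean_space \<Rightarrow> real"
  assumes w: "(w \<longlongrightarrow> 0) at_infinity" and D: "\<And>x. w x \<le> D"
  shows "compact (lipschitz_decay L w)"
  unfolding compact_def
proof (intro allI impI)
  fix f :: "nat \<Rightarrow> 'a \<Rightarrow>\<^sub>C real"
  assume "\<forall>n. f n \<in> lipschitz_decay L w"
  then have f: "\<And>n. f n \<in> lipschitz_decay L w" by auto
  obtain R :: "'a set" where R: "countable R" "UNIV \<subseteq> closure R" by (metis separable)
  have "norm (apply_bcontfun (f n) x) \<le> D" for n x
    using f[of n] D[of x] by (auto simp: lipschitz_decay_def intro: order_trans)
  then obtain k where k: "strict_mono k" "\<And>x. x \<in> R \<Longrightarrow> \<exists>l. (\<lambda>n. apply_bcontfun (f (k n)) x) \<longlonglongrightarrow> l"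
    using function_convergent_subsequence[OF R(1), of "\<lambda>n. apply_bcontfun (f n)" D] by metis
  have lip: "\<bar>apply_bcontfun (f n) x - apply_bcontfun (f n) y\<bar> \<le> L * dist x y" for n x y
    using f by (auto simp: lipschitz_decay_def)
  have "Cauchy (\<lambda>n. apply_bcontfun (f (k n)) x)" for x
  proof (rule metric_CauchyI)
    fix e :: real assume e: "e > 0"
    \<comment> \<open>\<open>max L 1\<close> guards against a vanishing or negative
      \<open>L\<close>.\<close>
    define d where "d = e / (3 * max L 1)"
    have d: "d > 0" using e by (simp add: d_def)
    obtain y where y: "y \<in> R" "dist y x < d" using R(2) d by (metis UNIV_I closure_approachable subsetD)
    have "L * dist x y \<le> max L 1 * d" using y(2) by (intro mult_mono) (auto simp: dist_commute)
    also have "\<dots> = e / 3" by (simp add: d_def)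
    finally have xy: "L * dist x y \<le> e / 3" .
    have "Cauchy (\<lambda>n. apply_bcontfun (f (k n)) y)"
      using k(2)[OF y(1)] by (auto intro: LIMSEQ_imp_Cauchy)
    then obtain M where M: "\<And>m n. m \<ge> M \<Longrightarrow> n \<ge> M \<Longrightarrow> dist (apply_bcontfun (f (k m)) y) (apply_bcontfun (f (k n)) y) < e / 3"
      using e by (metis metric_CauchyD zero_less_divide_iff zero_less_numeral)
    show "\<exists>M. \<forall>m\<ge>M. \<forall>n\<ge>M. dist (apply_bcontfun (f (k m)) x) (apply_bcontfun (f (k n)) x) < e"
    proof (intro exI allI impI)
      fix m n assume mn: "m \<ge> M" "n \<ge> M"
      show "dist (apply_bcontfun (f (k m)) x) (apply_bcontfun (f (k n)) x) < e"
        using M[OF mn] lip[of "k m" x y] lip[of "k n" x y] xy unfolding dist_real_def by linarith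
    qed
  qed
  then have conv: "convergent (\<lambda>n. apply_bcontfun (f (k n)) x)" for x
    by (rule Cauchy_convergent)
  define g where "g = (\<lambda>x. lim (\<lambda>n. apply_bcontfun (f (k n)) x))"
  have g: "(\<lambda>n. apply_bcontfun (f (k n)) x) \<longlonglongrightarrow> g x" for x
    using conv[of x] by (simp add: convergent_LIMSEQ_iff g_def)
  have glip: "\<bar>g x - g y\<bar> \<le> L * dist x y" for x y
    by (rule LIMSEQ_le_const2[OF tendsto_rabs[OF tendsto_diff[OF g g]]]) (use lip in auto)
  have gw: "\<bar>g x\<bar> \<le> w x" for x
    by (rule LIMSEQ_le_const2[OF tendsto_rabs[OF g]]) (use f in \<open>auto simp: lipschitz_decay_def\<close>)
  have "continuous_on UNIV g"
  proof (rule continuous_onI)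
    fix x :: 'a and e :: real assume e: "e > 0"
    show "\<exists>d>0. \<forall>x'\<in>UNIV. dist x' x < d \<longrightarrow> dist (g x') (g x) \<le> e"
    proof (intro exI[of _ "e / max L 1"] conjI ballI impI)
      fix x' assume "dist x' x < e / max L 1"
      then have "max L 1 * dist x' x \<le> max L 1 * (e / max L 1)" by (intro mult_left_mono) auto
      then have "max L 1 * dist x' x \<le> e" by simp
      moreover have "L * dist x' x \<le> max L 1 * dist x' x" by (intro mult_right_mono) auto
      ultimately show "dist (g x') (g x) \<le> e" using glip[of x' x] by (simp add: dist_real_def)
    qed (use e in auto)
  qed
  then have "g \<in> bcontfun" using gw D by (intro bcontfun_normI[of _ D]) (auto intro: order_trans)
  then have app: "apply_bcontfun (Bcontfun g) = g" by (simp add: Bcontfun_inverse)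
  then have gK: "Bcontfun g \<in> lipschitz_decay L w" using glip gw by (simp add: lipschitz_decay_def)
  have "(f \<circ> k) \<longlonglongrightarrow> Bcontfun g"
    by (rule lipschitz_decay_tendsto[OF w _ gK]) (use f g app in auto)
  with gK k(1) show "\<exists>l\<in>lipschitz_decay L w. \<exists>r. strict_mono r \<and> (f \<circ> r) \<longlonglongrightarrow> l" by blast
qed

section \<open>The fixed point equation\<close>

lemma abs_exp_diff_le: "\<bar>exp a - exp b\<bar> \<le> \<bar>a - b\<bar> * max (exp a) (exp (b::real))"
proof -
  have *: "exp x - exp y \<le> (x - y) * exp x" for x y :: real
  proof -
    have "1 + (y - x) \<le> exp (y - x)" by (rule exp_ge_add_one_self)
    then have "(1 + (y - x)) * exp x \<le> exp (y - x) * exp x" by (intro mult_right_mono) auto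
    then show ?thesis by (simp add: mult_exp_exp algebra_simps)
  qed
  show ?thesis
  proof (cases "b \<le> a")
    case True
    then show ?thesis using *[of a b] by (simp add: max_def)
  next
    case False
    then show ?thesis using *[of b a] by (simp add: max_def)
  qed
qed

locale fixed_point_data =
  fixes G :: "'a::euclidean_space \<Rightarrow> real" and \<kappa> Gm :: real
  assumes dim: "DIM('a) \<ge> 5" and G_cont: "continuous_on UNIV G" and G0: "G 0 > 0"
    and G_nonneg: "G x \<ge> 0" and G_le: "G x \<le> Gm" and G_radial: "radially_symmetric G" and \<kappa>: "\<kappa> > 0"
begin

section \<open>The fixed point map and its domain\<close>

definition \<gamma> :: real where "\<gamma> = gam TYPE('a)"
definition \<beta> :: real where "\<beta> = (real DIM('a) - 2) / (4 * real DIM('a) * \<gamma>)"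

text \<open>The Gaussian is borrowed from \<open>exp (- n |x|^4)\<close> and given back as
  \<open>exp (|x|^2)\<close> in \<open>S\<close>; the two cancel in \<open>qS\<close>. It makes
  \<open>dens \<tau>\<close> integrable with all moments for every bounded
  \<open>\<tau>\<close>.\<close>

definition q :: "'a \<Rightarrow> real" where "q y = G y * exp (- (norm y)\<^sup>2)"
definition dens :: "('a \<Rightarrow>\<^sub>C real) \<Rightarrow> 'a \<Rightarrow> real" where "dens \<tau> y = q y * apply_bcontfun \<tau> y"
definition A :: "('a \<Rightarrow>\<^sub>C real) \<Rightarrow> real" where "A \<tau> = (\<integral>y. norm y powr (- 2) * dens \<tau> y \<partial>lborel)"
text \<open>Normalised to vanish at 0, where the potential of a radial density is largest. The
  additive constant this suppresses is recovered at the end from the normalisation by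
  \<open>Z\<close>.\<close>

definition v :: "('a \<Rightarrow>\<^sub>C real) \<Rightarrow> 'a \<Rightarrow> real" where
  "v \<tau> x = (lnpot (dens \<tau>) x - lnpot (dens \<tau>) 0) / \<gamma> + \<beta> * A \<tau> * ((norm x)\<^sup>2 - norm x ^ 4)"
definition S :: "('a \<Rightarrow>\<^sub>C real) \<Rightarrow> 'a \<Rightarrow> real" where
  "S \<tau> x = exp ((norm x)\<^sup>2 - real DIM('a) * norm x ^ 4 + real DIM('a) * v \<tau> x)"
definition Z :: "('a \<Rightarrow>\<^sub>C real) \<Rightarrow> real" where "Z \<tau> = (\<integral>y. q y * S \<tau> y \<partial>lborel)"
definition TT :: "('a \<Rightarrow>\<^sub>C real) \<Rightarrow> 'a \<Rightarrow> real" where "TT \<tau> x = \<kappa> * S \<tau> x / Z \<tau>"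

text \<open>Mass and moment enter through inequalities: these survive convex combinations and
  limits, and 0 is a member. Radial symmetry is what makes the maximum of the potential at 0
  available.\<close>

definition cand :: "real \<Rightarrow> real \<Rightarrow> ('a \<Rightarrow>\<^sub>C real) set" where
  "cand D M = {\<tau>. radially_symmetric (apply_bcontfun \<tau>) \<and> (\<forall>x. 0 \<le> apply_bcontfun \<tau> x \<and> apply_bcontfun \<tau> x \<le> D) \<and>
     (\<integral>y. dens \<tau> y \<partial>lborel) \<le> \<kappa> \<and> A \<tau> \<le> M}"

lemma \<gamma>: "\<gamma> > 0" unfolding \<gamma>_def by (rule gam_pos)

lemma n: "real DIM('a) \<ge> 5" using dim by simp

lemma \<beta>: "\<beta> > 0" unfolding \<beta>_def using n \<gamma> by simp

lemma Gm: "Gm > 0" using G0 G_le[of 0] by linarith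

lemma G_measurable [measurable]: "G \<in> borel_measurable borel"
  by (rule borel_measurable_continuous_onI[OF G_cont])

lemma q_measurable [measurable]: "q \<in> borel_measurable borel" unfolding q_def by measurable

lemma bcontfun_measurable [measurable]: "apply_bcontfun (\<tau> :: 'a \<Rightarrow>\<^sub>C real) \<in> borel_measurable borel"
  by (rule borel_measurable_continuous_onI) simp

lemma dens_measurable [measurable]: "dens \<tau> \<in> borel_measurable borel" unfolding dens_def by measurable

lemma q_nonneg: "q y \<ge> 0" using G_nonneg by (simp add: q_def)

lemma q_le: "q y \<le> Gm * exp (- (norm y)\<^sup>2)" using G_le by (simp add: q_def mult_right_mono)

lemma q_density: "gauss_density q Gm"
  by standard (use dim q_nonneg q_le in auto)

lemma cand_density:
  assumes "\<tau> \<in> cand D M"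
  shows "gauss_density (dens \<tau>) (Gm * D)"
proof
  fix y
  have \<tau>: "0 \<le> apply_bcontfun \<tau> y" "apply_bcontfun \<tau> y \<le> D" using assms by (auto simp: cand_def)
  show "dens \<tau> y \<ge> 0" using \<tau> q_nonneg by (simp add: dens_def)
  have "dens \<tau> y \<le> (Gm * exp (- (norm y)\<^sup>2)) * D"
    unfolding dens_def using \<tau> q_le[of y] q_nonneg[of y] Gm by (intro mult_mono) auto
  then show "dens \<tau> y \<le> Gm * D * exp (- (norm y)\<^sup>2)" by (simp only: mult_ac)
qed (use dim in auto)

lemma cand_radial:
  assumes "\<tau> \<in> cand D M"
  shows "radially_symmetric (dens \<tau>)"
  unfolding radially_symmetric_def
proof (intro allI impI)
  fix x y :: 'a assume xy: "norm x = norm y"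
  have "radially_symmetric (apply_bcontfun \<tau>)" using assms unfolding cand_def by blast
  then have "apply_bcontfun \<tau> x = apply_bcontfun \<tau> y" using xy unfolding radially_symmetric_def by blast
  moreover have "G x = G y" using G_radial xy unfolding radially_symmetric_def by blast
  ultimately show "dens \<tau> x = dens \<tau> y" by (simp only: dens_def q_def xy)
qed

lemma A_nonneg:
  assumes "\<tau> \<in> cand D M" shows "A \<tau> \<ge> 0"
proof -
  have "0 \<le> norm y powr (- 2) * dens \<tau> y" for y
    using gauss_density.nonneg[OF cand_density[OF assms], of y] by (intro mult_nonneg_nonneg) auto
  then show ?thesis unfolding A_def by (intro integral_nonneg_AE AE_I2)
qed

section \<open>A priori bounds for the exponent, the normalising integral and the moment\<close>

lemma v_le: "\<tau> \<in> cand D M \<Longrightarrow> v \<tau> x \<le> \<beta> * A \<tau> * ((norm x)\<^sup>2 - norm x ^ 4)"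
proof -
  assume \<tau>: "\<tau> \<in> cand D M"
  have "lnpot (dens \<tau>) x - lnpot (dens \<tau>) 0 \<le> 0"
    using gauss_density.lnpot_le_0[OF cand_density[OF \<tau>] cand_radial[OF \<tau>], of x] by simp
  then show ?thesis using \<gamma> by (simp add: v_def divide_nonpos_pos)
qed

text \<open>The tangent point for \<open>lnpot_lower\<close>. With
  \<open>mm \<ge> 8 / (\<beta> \<gamma>)\<close> the potential takes back at most
  \<open>\<beta> A |x|^2 / 8\<close> of the quadratic gain, up to the constant \<open>K\<close>;
  \<open>mm \<ge> 1\<close> keeps \<open>ln mm\<close> nonnegative.\<close>

definition mm :: real where "mm = max 1 (8 / (\<beta> * \<gamma>))"
definition K :: real where "K = \<kappa> * (1 / mm + ln mm / 2) / \<gamma>"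

text \<open>For \<open>|x| \<le> 1/2\<close> one has \<open>|x|^2 - |x|^4 \<ge> 3/4 |x|^2\<close>,
  and the potential costs at most \<open>1/8\<close>, which leaves \<open>5/8\<close>. The loss
  \<open>K\<close> depends on neither \<open>\<tau>\<close> nor its moment.\<close>

lemma v_ge:
  assumes \<tau>: "\<tau> \<in> cand D M" and x: "norm x \<le> 1 / 2"
  shows "v \<tau> x \<ge> 5 / 8 * (\<beta> * A \<tau>) * (norm x)\<^sup>2 - K"
proof -
  interpret gauss_density "dens \<tau>" "Gm * D" by (rule cand_density[OF \<tau>])
  have mm: "mm \<ge> 1" "mm \<ge> 8 / (\<beta> * \<gamma>)" by (auto simp: mm_def)
  have mass: "mass \<le> \<kappa>" using \<tau> by (simp add: mass_def cand_def)
  have A: "A \<tau> \<ge> 0" by (rule A_nonneg[OF \<tau>])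
  have "8 \<le> mm * (\<beta> * \<gamma>)" using mm(2) \<beta> \<gamma> by (simp add: pos_divide_le_eq)
  then have "1 / mm \<le> \<beta> * \<gamma> / 8" using mm(1) by (simp add: pos_divide_le_eq mult.commute)
  then have "(norm x)\<^sup>2 * A \<tau> * (1 / mm) \<le> (norm x)\<^sup>2 * A \<tau> * (\<beta> * \<gamma> / 8)" using A by (intro mult_left_mono) auto
  then have 1: "(norm x)\<^sup>2 * A \<tau> / mm \<le> \<gamma> * (1 / 8 * (\<beta> * A \<tau>) * (norm x)\<^sup>2)" by (simp add: mult_ac)
  have "mass * (1 / mm + ln mm / 2) \<le> \<kappa> * (1 / mm + ln mm / 2)"
    using mass mm(1) by (intro mult_right_mono) auto
  also have "\<dots> = \<gamma> * K" using \<gamma> by (simp add: K_def)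
  finally have 2: "mass * (1 / mm + ln mm / 2) \<le> \<gamma> * K" .
  have "lnpot (dens \<tau>) x - lnpot (dens \<tau>) 0 \<ge> - ((norm x)\<^sup>2 * A \<tau> / mm + mass * (1 / mm + ln mm / 2))"
    using lnpot_lower[of mm x] mm(1) by (simp add: A_def)
  then have "lnpot (dens \<tau>) x - lnpot (dens \<tau>) 0 \<ge> \<gamma> * (- (1 / 8 * (\<beta> * A \<tau>) * (norm x)\<^sup>2) - K)"
    using 1 2 by (simp add: right_diff_distrib) 
  then have 3: "(lnpot (dens \<tau>) x - lnpot (dens \<tau>) 0) / \<gamma> \<ge> - (1 / 8 * (\<beta> * A \<tau>) * (norm x)\<^sup>2) - K"
    using \<gamma> by (simp add: pos_le_divide_eq mult.commute)
  have "(norm x)\<^sup>2 \<le> (1 / 2)\<^sup>2" using x by (intro power_mono) auto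
  then have "(norm x)\<^sup>2 * (norm x)\<^sup>2 \<le> (1 / 4) * (norm x)\<^sup>2" by (intro mult_right_mono) (auto simp: power2_eq_square)
  then have "norm x ^ 4 \<le> (norm x)\<^sup>2 / 4" by (simp flip: power_add)
  then have "\<beta> * A \<tau> * (3 / 4 * (norm x)\<^sup>2) \<le> \<beta> * A \<tau> * ((norm x)\<^sup>2 - norm x ^ 4)"
    using A \<beta> by (intro mult_left_mono) auto
  then show ?thesis using 3 unfolding v_def by linarith
qed

definition \<delta> :: real where
  "\<delta> = (SOME d. 0 < d \<and> d \<le> 1 / 2 \<and> (\<forall>x. norm x < d \<longrightarrow> G x \<ge> G 0 / 2))"

lemma \<delta>: "0 < \<delta>" "\<delta> \<le> 1 / 2" "norm (x::'a) < \<delta> \<Longrightarrow> G x \<ge> G 0 / 2"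
proof -
  have "isCont G 0" using G_cont by (simp add: continuous_on_eq_continuous_at)
  then obtain d where d: "d > 0" "\<And>x. dist x 0 < d \<Longrightarrow> dist (G x) (G 0) < G 0 / 2"
    using G0 unfolding continuous_at_eps_delta by (metis half_gt_zero)
  have P: "0 < min d (1/2) \<and> min d (1/2) \<le> 1 / 2 \<and> (\<forall>z::'a. norm z < min d (1/2) \<longrightarrow> G z \<ge> G 0 / 2)"
  proof (intro conjI allI impI)
    fix z :: 'a assume "norm z < min d (1/2)"
    then have "dist (G z) (G 0) < G 0 / 2" using d(2)[of z] by simp
    then show "G z \<ge> G 0 / 2" unfolding dist_real_def by linarith
  qed (use d(1) in auto)
  have "0 < \<delta> \<and> \<delta> \<le> 1 / 2 \<and> (\<forall>z::'a. norm z < \<delta> \<longrightarrow> G z \<ge> G 0 / 2)"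
    unfolding \<delta>_def by (rule someI[where P="\<lambda>d. 0 < d \<and> d \<le> 1 / 2 \<and> (\<forall>z::'a. norm z < d \<longrightarrow> G z \<ge> G 0 / 2)", OF P])
  then show "0 < \<delta>" "\<delta> \<le> 1 / 2" "norm x < \<delta> \<Longrightarrow> G x \<ge> G 0 / 2" by blast+
qed

text \<open>The ball of radius \<open>\<delta> / 8\<close> about this point lies in
  \<open>\<delta> / 2 \<le> |y| < \<delta>\<close>: inside the region where
  \<open>G \<ge> G 0 / 2\<close>, and at least twice as far from 0 as the region
  \<open>|y| < \<delta> / 4\<close> it will be compared with.\<close>

definition ctr :: 'a where "ctr = (3 / 4 * \<delta>) *\<^sub>R (SOME b. b \<in> Basis)"
definition z1 :: real where "z1 = G 0 / 2 * exp (- real DIM('a) - real DIM('a) * K) * measure lborel (ball ctr (\<delta> / 8))"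

lemma norm_ctr: "norm ctr = 3 / 4 * \<delta>"
  using \<delta>(1) by (simp add: ctr_def SOME_Basis)

lemma z1: "z1 > 0"
  unfolding z1_def using G0 \<delta>(1) by (simp add: content_ball)

lemma qS: "q y * S \<tau> y = G y * exp (- (real DIM('a) * norm y ^ 4) + real DIM('a) * v \<tau> y)"
  by (simp add: q_def S_def mult_exp_exp mult.assoc)

lemma S_le:
  assumes \<tau>: "\<tau> \<in> cand D M"
  shows "S \<tau> x \<le> exp ((1 + real DIM('a) * \<beta> * M) * (norm x)\<^sup>2 - real DIM('a) * norm x ^ 4)"
proof -
  have A: "0 \<le> A \<tau>" "A \<tau> \<le> M" using A_nonneg[OF \<tau>] \<tau> by (auto simp: cand_def)
  have "v \<tau> x \<le> \<beta> * A \<tau> * ((norm x)\<^sup>2 - norm x ^ 4)" by (rule v_le[OF \<tau>])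
  also have "\<dots> \<le> \<beta> * A \<tau> * (norm x)\<^sup>2" using A \<beta> by (intro mult_left_mono) auto
  also have "\<dots> \<le> \<beta> * M * (norm x)\<^sup>2" using A \<beta> by (intro mult_right_mono mult_left_mono) auto
  finally have "real DIM('a) * v \<tau> x \<le> real DIM('a) * (\<beta> * M * (norm x)\<^sup>2)" by (intro mult_left_mono) auto
  then show ?thesis by (simp add: S_def distrib_right mult.assoc)
qed

lemma lnpot_dens_continuous: "\<tau> \<in> cand D M \<Longrightarrow> continuous_on UNIV (lnpot (dens \<tau>))"
  using gauss_density.lnpot_Ck[OF cand_density] by (rule Ck_continuous)

lemma S_continuous: "\<tau> \<in> cand D M \<Longrightarrow> continuous_on UNIV (S \<tau>)"
  unfolding S_def v_def by (intro continuous_intros lnpot_dens_continuous) (use \<gamma> in auto)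

lemma S_measurable: "\<tau> \<in> cand D M \<Longrightarrow> S \<tau> \<in> borel_measurable borel"
  by (intro borel_measurable_continuous_onI S_continuous)

text \<open>Completing the square in \<open>s = |x|^2\<close>. In this form \<open>n |x|^4\<close>
  dominates every quadratic term in the exponents below.\<close>

lemma quad_le: "c * s - real DIM('a) * s\<^sup>2 \<le> c\<^sup>2 / (4 * real DIM('a))"
proof -
  have "0 \<le> (2 * real DIM('a) * s - c)\<^sup>2" by simp
  also have "\<dots> = 4 * real DIM('a) * (real DIM('a) * s\<^sup>2 - c * s) + c\<^sup>2" by (simp add: power2_eq_square algebra_simps)
  finally have "4 * real DIM('a) * (c * s - real DIM('a) * s\<^sup>2) \<le> c\<^sup>2" by (simp add: algebra_simps)
  then show ?thesis using n by (simp add: pos_le_divide_eq mult.commute)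
qed

lemma norm4: "norm (x::'a) ^ 4 = ((norm x)\<^sup>2)\<^sup>2" by (simp flip: power_mult)

lemma S_bounded: "\<tau> \<in> cand D M \<Longrightarrow> S \<tau> x \<le> exp ((1 + real DIM('a) * \<beta> * M)\<^sup>2 / (4 * real DIM('a)))"
  by (rule order_trans[OF S_le iffD2[OF exp_le_cancel_iff]], assumption) (simp only: norm4 quad_le)

lemma qS_integrable:
  assumes \<tau>: "\<tau> \<in> cand D M"
  shows "integrable lborel (\<lambda>y. q y * S \<tau> y)"
proof (rule Bochner_Integration.integrable_bound)
  show "integrable lborel (\<lambda>y. exp ((1 + real DIM('a) * \<beta> * M)\<^sup>2 / (4 * real DIM('a))) * q y)"
    by (intro integrable_mult_right gauss_density.integrable[OF q_density])
  show "AE y in lborel. norm (q y * S \<tau> y) \<le> norm (exp ((1 + real DIM('a) * \<beta> * M)\<^sup>2 / (4 * real DIM('a))) * q y)"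
    using S_bounded[OF \<tau>] q_nonneg by (intro AE_I2) (simp add: abs_mult S_def[of \<tau>] mult.commute[of _ "q _"] mult_left_mono)
  show "(\<lambda>y. q y * S \<tau> y) \<in> borel_measurable lborel" using S_measurable[OF \<tau>] by simp
qed

text \<open>Only the ball about \<open>ctr\<close> is kept. There
  \<open>|y| \<ge> \<delta> / 2\<close> turns \<open>5/8\<close> into \<open>5/32\<close>,
  \<open>|y|^4 \<le> 1\<close> costs the factor \<open>exp (- n)\<close>, and the remaining loss
  \<open>exp (- n K)\<close> is part of \<open>z1\<close>. What matters is the growth rate in
  \<open>A\<close>.\<close>

lemma Z_ge:
  assumes \<tau>: "\<tau> \<in> cand D M"
  shows "Z \<tau> \<ge> z1 * exp (real DIM('a) * (5 / 32 * (\<beta> * A \<tau>) * \<delta>\<^sup>2))"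
proof -
  let ?U = "ball ctr (\<delta> / 8)"
  have A: "0 \<le> A \<tau>" by (rule A_nonneg[OF \<tau>])
  let ?c = "G 0 / 2 * exp (- real DIM('a) - real DIM('a) * K) * exp (real DIM('a) * (5 / 32 * (\<beta> * A \<tau>) * \<delta>\<^sup>2))"
  have "z1 * exp (real DIM('a) * (5 / 32 * (\<beta> * A \<tau>) * \<delta>\<^sup>2)) = (\<integral>y. ?c * indicator ?U y \<partial>lborel)"
    by (simp add: z1_def mult_ac)
  also have "\<dots> \<le> Z \<tau>" unfolding Z_def
  proof (rule integral_mono)
    show "integrable lborel (\<lambda>y. ?c * indicator ?U y)"
      using emeasure_lborel_ball_finite[of ctr "\<delta> / 8"] by (intro integrable_mult_right) (simp add: integrable_indicator_iff)
    show "integrable lborel (\<lambda>y. q y * S \<tau> y)" by (rule qS_integrable[OF \<tau>])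
    fix y
    show "?c * indicator ?U y \<le> q y * S \<tau> y"
    proof (cases "y \<in> ?U")
      case True
      then have d: "norm (ctr - y) < \<delta> / 8" by (simp add: dist_norm)
      have "norm ctr \<le> norm (ctr - y) + norm y" "norm y \<le> norm (ctr - y) + norm ctr"
        by norm+
      then have y: "\<delta> / 2 \<le> norm y" "norm y < \<delta>" using d norm_ctr \<delta>(1) by linarith+
      have y1: "norm y \<le> 1 / 2" using y \<delta>(2) by linarith
      have "(\<delta> / 2)\<^sup>2 \<le> (norm y)\<^sup>2" using y \<delta>(1) by (intro power_mono) auto
      then have "5 / 8 * (\<beta> * A \<tau>) * (\<delta> / 2)\<^sup>2 \<le> 5 / 8 * (\<beta> * A \<tau>) * (norm y)\<^sup>2"
        using A \<beta> by (intro mult_left_mono) auto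
      then have "5 / 32 * (\<beta> * A \<tau>) * \<delta>\<^sup>2 - K \<le> v \<tau> y"
        using v_ge[OF \<tau> y1] by (simp add: power_divide)
      then have 1: "real DIM('a) * (5 / 32 * (\<beta> * A \<tau>) * \<delta>\<^sup>2 - K) \<le> real DIM('a) * v \<tau> y" by (intro mult_left_mono) auto
      have "norm y ^ 4 \<le> 1" using y1 by (intro power_le_one) auto
      then have 2: "real DIM('a) * norm y ^ 4 \<le> real DIM('a) * 1" by (intro mult_left_mono) auto
      have "?c = G 0 / 2 * exp (- real DIM('a) + real DIM('a) * (5 / 32 * (\<beta> * A \<tau>) * \<delta>\<^sup>2 - K))"
        by (simp add: mult_exp_exp mult.assoc right_diff_distrib)
      also have "\<dots> \<le> G y * exp (- (real DIM('a) * norm y ^ 4) + real DIM('a) * v \<tau> y)"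
      proof -
        have "- real DIM('a) + real DIM('a) * (5 / 32 * (\<beta> * A \<tau>) * \<delta>\<^sup>2 - K) \<le> - (real DIM('a) * norm y ^ 4) + real DIM('a) * v \<tau> y"
          using 1 2 by linarith
        then show ?thesis
          using \<delta>(3)[OF y(2)] G_nonneg by (intro mult_mono iffD2[OF exp_le_cancel_iff]) auto
      qed
      finally show ?thesis using True by (simp add: qS)
    next
      case False
      then show ?thesis using q_nonneg[of y] by (simp add: S_def)
    qed
  qed
  finally show ?thesis .
qed

lemma Z_ge': "\<tau> \<in> cand D M \<Longrightarrow> Z \<tau> \<ge> z1"
proof -
  assume \<tau>: "\<tau> \<in> cand D M"
  have "z1 * 1 \<le> z1 * exp (real DIM('a) * (5 / 32 * (\<beta> * A \<tau>) * \<delta>\<^sup>2))"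
    using z1 A_nonneg[OF \<tau>] \<beta> by (intro mult_left_mono) auto
  with Z_ge[OF \<tau>] show ?thesis by linarith
qed

definition W2 :: real where "W2 = (\<integral>y. norm y powr (- 2) * exp (- (norm (y::'a))\<^sup>2) \<partial>lborel)"
text \<open>The two terms bound the contributions of \<open>|y| \<ge> \<delta> / 4\<close>, where
  \<open>|y|^-2 \<le> 16 / \<delta>^2\<close>, and of \<open>|y| < \<delta> / 4\<close>. Neither
  involves the bound \<open>M\<close> assumed of the old moment, so \<open>MM\<close> may be used as
  that bound. \<open>cc\<close> and \<open>DD\<close> are then the quadratic coefficient and the sup
  bound that \<open>M = MM\<close> entails.\<close>

definition MM :: real where "MM = \<kappa> * (16 / \<delta>\<^sup>2 + Gm * exp 1 * W2 / z1)"
definition cc :: real where "cc = 1 + real DIM('a) * \<beta> * MM"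
definition DD :: real where "DD = \<kappa> / z1 * exp (cc\<^sup>2 / (4 * real DIM('a)))"

lemma W2_nonneg: "W2 \<ge> 0" unfolding W2_def by (intro integral_nonneg_AE) auto

lemma MM_nonneg: "MM \<ge> 0" unfolding MM_def using \<kappa> z1 Gm W2_nonneg by (intro mult_nonneg_nonneg add_nonneg_nonneg divide_nonneg_nonneg) auto

text \<open>The singular moment of the new density is controlled by \<open>MM\<close> whatever the moment of the old one is: a large
  moment \<open>A\<close> makes the weight \<open>exp (n \<beta> A |x|\<^sup>2)\<close> on the annulus beat its values near the origin.\<close>

lemma moment_le:
  assumes \<tau>: "\<tau> \<in> cand D M"
  shows "(\<integral>y. norm y powr (- 2) * (q y * (\<kappa> * S \<tau> y / Z \<tau>)) \<partial>lborel) \<le> MM"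
proof -
  define e where "e = exp (real DIM('a) * (1 / 16 * (\<beta> * A \<tau>) * \<delta>\<^sup>2))"
  have A: "0 \<le> A \<tau>" by (rule A_nonneg[OF \<tau>])
  have Zpos: "Z \<tau> > 0" using Z_ge'[OF \<tau>] z1 by linarith
  let ?w = "\<lambda>y::'a. norm y powr (- 2) * exp (- (norm y)\<^sup>2)"
  have wi: "integrable lborel ?w" using integrable_riesz_gaussian[of 2, where 'a='a] dim by simp
  have ptw: "norm y powr (- 2) * (q y * S \<tau> y) \<le> 16 / \<delta>\<^sup>2 * (q y * S \<tau> y) + Gm * exp 1 * e * ?w y" for y
  proof (cases "norm y < \<delta> / 4")
    case True
    then have y1: "norm y \<le> 1" using \<delta> by linarith
    have "(norm y)\<^sup>2 - norm y ^ 4 \<le> (norm y)\<^sup>2" by simp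
    also have "\<dots> \<le> (\<delta> / 4)\<^sup>2" using True by (intro power_mono) auto
    finally have "\<beta> * A \<tau> * ((norm y)\<^sup>2 - norm y ^ 4) \<le> \<beta> * A \<tau> * (\<delta> / 4)\<^sup>2" using A \<beta> by (intro mult_left_mono) auto
    then have "v \<tau> y \<le> 1 / 16 * (\<beta> * A \<tau>) * \<delta>\<^sup>2" using v_le[OF \<tau>, of y] by (simp add: power_divide)
    then have "real DIM('a) * v \<tau> y \<le> real DIM('a) * (1 / 16 * (\<beta> * A \<tau>) * \<delta>\<^sup>2)" by (intro mult_left_mono) auto
    moreover have "0 \<le> real DIM('a) * norm y ^ 4" by simp
    ultimately have "- (real DIM('a) * norm y ^ 4) + real DIM('a) * v \<tau> y \<le> real DIM('a) * (1 / 16 * (\<beta> * A \<tau>) * \<delta>\<^sup>2)" by linarith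
    then have "exp (- (real DIM('a) * norm y ^ 4) + real DIM('a) * v \<tau> y) \<le> e" unfolding e_def by (rule iffD2[OF exp_le_cancel_iff])
    then have "q y * S \<tau> y \<le> Gm * e" unfolding qS using G_le[of y] G_nonneg[of y] Gm by (intro mult_mono) auto
    also have "\<dots> \<le> Gm * e * (exp 1 * exp (- (norm y)\<^sup>2))"
    proof -
      have "1 \<le> exp 1 * exp (- (norm y)\<^sup>2)" using y1 by (simp add: mult_exp_exp power_le_one)
      then have "Gm * e * 1 \<le> Gm * e * (exp 1 * exp (- (norm y)\<^sup>2))" using Gm by (intro mult_left_mono) (auto simp: e_def)
      then show ?thesis by simp
    qed
    finally have "norm y powr (- 2) * (q y * S \<tau> y) \<le> norm y powr (- 2) * (Gm * e * (exp 1 * exp (- (norm y)\<^sup>2)))"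
      by (intro mult_left_mono) auto
    moreover have "0 \<le> 16 / \<delta>\<^sup>2 * (q y * S \<tau> y)" using q_nonneg[of y] by (simp add: S_def)
    ultimately show ?thesis by (simp add: mult_ac)
  next
    case False
    have "norm y powr (- 2) \<le> (\<delta> / 4) powr (- 2)" using False \<delta>(1) by (intro powr_mono2') auto
    also have "\<dots> = 16 / \<delta>\<^sup>2" using \<delta>(1) by (simp add: powr_minus power_divide inverse_eq_divide)
    finally have "norm y powr (- 2) * (q y * S \<tau> y) \<le> 16 / \<delta>\<^sup>2 * (q y * S \<tau> y)"
      using q_nonneg[of y] by (intro mult_right_mono) (auto simp: S_def)
    moreover have "0 \<le> Gm * exp 1 * e * ?w y" using Gm by (simp add: e_def)
    ultimately show ?thesis by linarith
  qed
  have iR: "integrable lborel (\<lambda>y. 16 / \<delta>\<^sup>2 * (q y * S \<tau> y) + Gm * exp 1 * e * ?w y)"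
    by (intro Bochner_Integration.integrable_add integrable_mult_right wi qS_integrable[OF \<tau>])
  have iL: "integrable lborel (\<lambda>y. norm y powr (- 2) * (q y * S \<tau> y))"
  proof (rule Bochner_Integration.integrable_bound[OF iR])
    show "AE y in lborel. norm (norm y powr (- 2) * (q y * S \<tau> y)) \<le> norm (16 / \<delta>\<^sup>2 * (q y * S \<tau> y) + Gm * exp 1 * e * ?w y)"
    proof (rule AE_I2)
      fix y
      have "0 \<le> norm y powr (- 2) * (q y * S \<tau> y)" using q_nonneg[of y] by (simp add: S_def)
      then show "norm (norm y powr (- 2) * (q y * S \<tau> y)) \<le> norm (16 / \<delta>\<^sup>2 * (q y * S \<tau> y) + Gm * exp 1 * e * ?w y)"
        using ptw[of y] by (simp only: real_norm_def abs_of_nonneg)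
    qed
    show "(\<lambda>y. norm y powr (- 2) * (q y * S \<tau> y)) \<in> borel_measurable lborel" using S_measurable[OF \<tau>] by simp
  qed
  have "(\<integral>y. norm y powr (- 2) * (q y * S \<tau> y) \<partial>lborel) \<le> (\<integral>y. 16 / \<delta>\<^sup>2 * (q y * S \<tau> y) + Gm * exp 1 * e * ?w y \<partial>lborel)"
    by (intro integral_mono iL iR ptw)
  also have "\<dots> = 16 / \<delta>\<^sup>2 * Z \<tau> + Gm * exp 1 * e * W2"
    unfolding Z_def W2_def
    by (subst Bochner_Integration.integral_add[OF integrable_mult_right[OF qS_integrable[OF \<tau>]] integrable_mult_right[OF wi]])
       (simp only: integral_mult_right_zero)
  also have "\<dots> \<le> 16 / \<delta>\<^sup>2 * Z \<tau> + (Gm * exp 1 * W2 / z1) * Z \<tau>"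
  proof -
    \<comment> \<open>The decisive comparison: the exponent near the origin grows at rate
      \<open>1/16\<close> in \<open>A\<close>, that of the lower bound for \<open>Z\<close> at rate
      \<open>5/32\<close>, so the normalisation absorbs \<open>e\<close> however large
      \<open>A\<close> is.\<close>
    have "z1 * e \<le> z1 * exp (real DIM('a) * (5 / 32 * (\<beta> * A \<tau>) * \<delta>\<^sup>2))"
      unfolding e_def using z1 A \<beta> by (intro mult_left_mono) (auto intro!: mult_right_mono)
    also have "\<dots> \<le> Z \<tau>" by (rule Z_ge[OF \<tau>])
    finally have "e \<le> Z \<tau> / z1" using z1 by (simp add: pos_le_divide_eq mult.commute)
    then have "Gm * exp 1 * W2 * e \<le> Gm * exp 1 * W2 * (Z \<tau> / z1)" using Gm W2_nonneg by (intro mult_left_mono) auto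
    then show ?thesis by (simp add: mult_ac)
  qed
  finally have 1: "(\<integral>y. norm y powr (- 2) * (q y * S \<tau> y) \<partial>lborel) \<le> (16 / \<delta>\<^sup>2 + Gm * exp 1 * W2 / z1) * Z \<tau>"
    by (simp only: distrib_right)
  have "(\<integral>y. norm y powr (- 2) * (q y * (\<kappa> * S \<tau> y / Z \<tau>)) \<partial>lborel) = (\<integral>y. (\<kappa> / Z \<tau>) * (norm y powr (- 2) * (q y * S \<tau> y)) \<partial>lborel)"
    by (intro Bochner_Integration.integral_cong) auto
  also have "\<dots> = (\<kappa> / Z \<tau>) * (\<integral>y. norm y powr (- 2) * (q y * S \<tau> y) \<partial>lborel)" by (rule integral_mult_right_zero)
  also have "\<dots> \<le> (\<kappa> / Z \<tau>) * ((16 / \<delta>\<^sup>2 + Gm * exp 1 * W2 / z1) * Z \<tau>)"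
    using \<kappa> Zpos by (intro mult_left_mono 1) auto
  also have "\<dots> = MM" using Zpos by (simp add: MM_def)
  finally show ?thesis .
qed

section \<open>Decay envelope and Lipschitz bound for the images\<close>

abbreviation CC :: "('a \<Rightarrow>\<^sub>C real) set" where "CC \<equiv> cand DD MM"

definition ww :: "'a \<Rightarrow> real" where "ww x = \<kappa> / z1 * exp (cc * (norm x)\<^sup>2 - real DIM('a) * norm x ^ 4)"

lemma ww_le: "ww x \<le> DD"
proof -
  have "cc * (norm x)\<^sup>2 - real DIM('a) * norm x ^ 4 \<le> cc\<^sup>2 / (4 * real DIM('a))"
    using quad_le[of cc "(norm x)\<^sup>2"] by (simp only: norm4)
  then have "exp (cc * (norm x)\<^sup>2 - real DIM('a) * norm x ^ 4) \<le> exp (cc\<^sup>2 / (4 * real DIM('a)))"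
    by (rule iffD2[OF exp_le_cancel_iff])
  then show ?thesis unfolding ww_def DD_def using \<kappa> z1 by (intro mult_left_mono) auto
qed

lemma ww_tendsto: "(ww \<longlongrightarrow> 0) at_infinity"
proof (rule Lim_null_comparison)
  let ?C = "\<kappa> / z1 * exp ((cc + 1)\<^sup>2 / (4 * real DIM('a)))"
  show "\<forall>\<^sub>F x in at_infinity. norm (ww x) \<le> ?C * exp (- (norm x)\<^sup>2)"
  proof (rule always_eventually, rule allI)
    fix x :: 'a
    have "cc * (norm x)\<^sup>2 - real DIM('a) * norm x ^ 4 \<le> (cc + 1)\<^sup>2 / (4 * real DIM('a)) + - (norm x)\<^sup>2"
      using quad_le[of "cc + 1" "(norm x)\<^sup>2"] unfolding norm4 distrib_right by linarith
    then have "exp (cc * (norm x)\<^sup>2 - real DIM('a) * norm x ^ 4) \<le> exp ((cc + 1)\<^sup>2 / (4 * real DIM('a)) + - (norm x)\<^sup>2)"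
      by (rule iffD2[OF exp_le_cancel_iff])
    then have "\<kappa> / z1 * exp (cc * (norm x)\<^sup>2 - real DIM('a) * norm x ^ 4) \<le> \<kappa> / z1 * (exp ((cc + 1)\<^sup>2 / (4 * real DIM('a))) * exp (- (norm x)\<^sup>2))"
      unfolding exp_add using \<kappa> z1 by (intro mult_left_mono) auto
    moreover have "0 \<le> ww x" using \<kappa> z1 by (simp add: ww_def)
    ultimately show "norm (ww x) \<le> ?C * exp (- (norm x)\<^sup>2)"
      unfolding real_norm_def by (simp only: abs_of_nonneg) (simp only: ww_def mult.assoc)
  qed
  have "((\<lambda>s::real. exp (- s\<^sup>2)) \<longlongrightarrow> 0) at_top" by real_asymp
  then have "((\<lambda>x::'a. exp (- (norm x)\<^sup>2)) \<longlongrightarrow> 0) at_infinity" by (rule filterlim_compose) (rule filterlim_norm_at_top)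
  from tendsto_mult_right_zero[OF this] show "((\<lambda>x::'a. ?C * exp (- (norm x)\<^sup>2)) \<longlongrightarrow> 0) at_infinity" .
qed

lemma TT_le: "\<tau> \<in> CC \<Longrightarrow> 0 \<le> TT \<tau> x \<and> TT \<tau> x \<le> ww x"
proof -
  assume \<tau>: "\<tau> \<in> CC"
  have Z: "0 < z1" "z1 \<le> Z \<tau>" using z1 Z_ge'[OF \<tau>] by auto
  have "\<kappa> * S \<tau> x / Z \<tau> \<le> \<kappa> * exp (cc * (norm x)\<^sup>2 - real DIM('a) * norm x ^ 4) / z1"
    using S_le[OF \<tau>, of x] \<kappa> Z by (intro frac_le mult_left_mono) (auto simp: cc_def)
  moreover have "0 \<le> \<kappa> * S \<tau> x / Z \<tau>" using \<kappa> Z by (simp add: S_def)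
  ultimately show ?thesis by (simp add: TT_def ww_def)
qed

lemma cand_mass:
  assumes "\<tau> \<in> cand D M" shows "gauss_density.mass (dens \<tau>) \<le> \<kappa>"
  using assms gauss_density.mass_def[OF cand_density[OF assms]] by (simp add: cand_def)

definition E :: "('a \<Rightarrow>\<^sub>C real) \<Rightarrow> 'a \<Rightarrow> real" where "E \<tau> x = (norm x)\<^sup>2 - real DIM('a) * norm x ^ 4 + real DIM('a) * v \<tau> x"

lemma S_E: "S \<tau> x = exp (E \<tau> x)" by (simp add: S_def E_def)

text \<open>\<open>\<Lambda>\<close> is a common Lipschitz constant of the potentials of candidates,
  \<open>C0\<close> collects the coefficients in the variation of the exponent \<open>E\<close>, and
  \<open>L0\<close> is the resulting Lipschitz constant of \<open>S\<close>.\<close>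

definition \<Lambda> :: real where "\<Lambda> = 2 * (riesz_const TYPE('a) 1 * (Gm * DD) + \<kappa>)"
definition C0 :: real where "C0 = (1 + real DIM('a) * \<beta> * MM) + (real DIM('a) + real DIM('a) * \<beta> * MM) + real DIM('a) / \<gamma> * \<Lambda>"
definition L0 :: real where "L0 = C0 * 8 * exp 3 * exp ((cc + 3)\<^sup>2 / (4 * real DIM('a))) + exp (cc\<^sup>2 / (4 * real DIM('a)))"

text \<open>The exponent is a quartic in \<open>|x|\<close> plus a Lipschitz term, so over distances
  at most 1 its variation is controlled with a cubic factor in \<open>|x|\<close>. The factor
  \<open>exp (- n |x|^4)\<close> will absorb that growth.\<close>

lemma E_diff:
  assumes \<tau>: "\<tau> \<in> CC" and d: "dist x x' \<le> 1"
  shows "\<bar>E \<tau> x - E \<tau> x'\<bar> \<le> C0 * (dist x x' * (2 * norm x + 1) ^ 3)"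
proof -
  define s s' N l where "s = norm x" "s' = norm x'" "N = 2 * s + 1" "l = lnpot (dens \<tau>) x - lnpot (dens \<tau>) x'"
  define p where "p = dist x x' * N ^ 3"
  have A: "0 \<le> A \<tau>" "A \<tau> \<le> MM" using A_nonneg[OF \<tau>] \<tau> by (auto simp: cand_def)
  have nA: "0 \<le> real DIM('a) * \<beta> * A \<tau>" "real DIM('a) * \<beta> * A \<tau> \<le> real DIM('a) * \<beta> * MM" using A \<beta> by (auto intro!: mult_left_mono)
  have nM: "0 \<le> real DIM('a) * \<beta> * MM" using nA by linarith
  have tri: "\<bar>a1 - a2 + a3\<bar> \<le> b1 + b2 + b3" if "\<bar>a1\<bar> \<le> b1" "\<bar>a2\<bar> \<le> b2" "\<bar>a3\<bar> \<le> b3" for a1 a2 a3 b1 b2 b3 :: real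
    using that by linarith
  have s: "0 \<le> s" "0 \<le> s'" "\<bar>s - s'\<bar> \<le> dist x x'" using norm_triangle_ineq3[of x x'] by (auto simp: s_s'_N_l_def dist_norm)
  have N: "1 \<le> N" "s + s' \<le> N" using s d by (auto simp: s_s'_N_l_def(3))
  have N3: "1 \<le> N ^ 3" "N \<le> N ^ 3" using N(1) by (auto intro: one_le_power self_le_power)
  have "s\<^sup>2 + s'\<^sup>2 \<le> (s + s')\<^sup>2" using s by (simp add: power2_sum)
  also have "\<dots> \<le> N\<^sup>2" using s N by (intro power_mono) auto
  finally have ss: "s\<^sup>2 + s'\<^sup>2 \<le> N\<^sup>2" .
  have e2: "s\<^sup>2 - s'\<^sup>2 = (s - s') * (s + s')" by (simp add: power2_eq_square algebra_simps)
  have e4: "s ^ 4 - s' ^ 4 = (s - s') * ((s + s') * (s\<^sup>2 + s'\<^sup>2))" by (simp add: power2_eq_square power4_eq_xxxx algebra_simps)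
  have "\<bar>s\<^sup>2 - s'\<^sup>2\<bar> = \<bar>s - s'\<bar> * (s + s')" unfolding e2 using s by (simp add: abs_mult)
  also have "\<dots> \<le> dist x x' * N ^ 3" using s N N3 by (intro mult_mono) auto
  finally have 2: "\<bar>s\<^sup>2 - s'\<^sup>2\<bar> \<le> p" by (simp add: p_def)
  have "\<bar>s ^ 4 - s' ^ 4\<bar> = \<bar>s - s'\<bar> * ((s + s') * (s\<^sup>2 + s'\<^sup>2))" unfolding e4 using s by (simp add: abs_mult)
  also have "\<dots> \<le> dist x x' * (N * N\<^sup>2)" using s N ss by (intro mult_mono) auto
  finally have 4: "\<bar>s ^ 4 - s' ^ 4\<bar> \<le> p" by (simp add: p_def power2_eq_square power3_eq_cube)
  have p: "0 \<le> p" "dist x x' \<le> p"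
    using N(1) mult_left_mono[OF N3(1), of "dist x x'"] by (simp_all add: p_def)
  \<comment> \<open>The sign is read off the Lipschitz inequality itself, taken between 0 and a
    basis vector at distance 1.\<close>
  have \<Lambda>0: "0 \<le> \<Lambda>"
  proof -
    have "0 \<le> \<bar>lnpot (dens \<tau>) 0 - lnpot (dens \<tau>) (SOME b. b \<in> Basis)\<bar>" by simp
    also have "\<dots> \<le> 2 * (riesz_const TYPE('a) 1 * (Gm * DD) + gauss_density.mass (dens \<tau>)) * dist (0::'a) (SOME b. b \<in> Basis)"
      by (rule gauss_density.lnpot_lipschitz[OF cand_density[OF \<tau>]])
    also have "\<dots> \<le> \<Lambda> * 1" using cand_mass[OF \<tau>] by (simp add: \<Lambda>_def SOME_Basis)
    finally show ?thesis by simp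
  qed
  have "\<bar>l\<bar> \<le> 2 * (riesz_const TYPE('a) 1 * (Gm * DD) + gauss_density.mass (dens \<tau>)) * dist x x'"
    unfolding s_s'_N_l_def(4) by (rule gauss_density.lnpot_lipschitz[OF cand_density[OF \<tau>]])
  also have "\<dots> \<le> \<Lambda> * dist x x'" using cand_mass[OF \<tau>] by (intro mult_right_mono) (auto simp: \<Lambda>_def)
  also have "\<dots> \<le> \<Lambda> * p" using p \<Lambda>0 by (intro mult_left_mono)
  finally have l: "\<bar>l\<bar> \<le> \<Lambda> * p" .
  have e: "E \<tau> x - E \<tau> x' = (1 + real DIM('a) * \<beta> * A \<tau>) * (s\<^sup>2 - s'\<^sup>2) - (real DIM('a) + real DIM('a) * \<beta> * A \<tau>) * (s ^ 4 - s' ^ 4) + real DIM('a) / \<gamma> * l"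
    unfolding E_def v_def s_s'_N_l_def by (simp add: algebra_simps add_divide_distrib diff_divide_distrib)
  have m1: "\<bar>(1 + real DIM('a) * \<beta> * A \<tau>) * (s\<^sup>2 - s'\<^sup>2)\<bar> \<le> (1 + real DIM('a) * \<beta> * MM) * p"
    unfolding abs_mult by (rule mult_mono) (use nA 2 nM in linarith)+
  have m2: "\<bar>(real DIM('a) + real DIM('a) * \<beta> * A \<tau>) * (s ^ 4 - s' ^ 4)\<bar> \<le> (real DIM('a) + real DIM('a) * \<beta> * MM) * p"
    unfolding abs_mult by (rule mult_mono) (use nA 4 nM in linarith)+
  have m3: "\<bar>real DIM('a) / \<gamma> * l\<bar> \<le> real DIM('a) / \<gamma> * (\<Lambda> * p)"
    unfolding abs_mult using l \<gamma> by (intro mult_mono) auto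
  have "\<bar>E \<tau> x - E \<tau> x'\<bar> \<le> (1 + real DIM('a) * \<beta> * MM) * p + (real DIM('a) + real DIM('a) * \<beta> * MM) * p + real DIM('a) / \<gamma> * (\<Lambda> * p)" unfolding e by (rule tri[OF m1 m2 m3])
  also have "\<dots> = C0 * p" unfolding C0_def by (simp only: distrib_right mult.assoc)
  finally show ?thesis by (simp add: p_def s_s'_N_l_def)
qed

lemma zero_in_CC: "(0 :: 'a \<Rightarrow>\<^sub>C real) \<in> CC"
  using \<kappa> z1 MM_nonneg by (auto simp: cand_def radially_symmetric_def dens_def A_def DD_def)

lemma C0: "C0 \<ge> 0"
proof -
  from E_diff[OF zero_in_CC, of 0 "SOME b. b \<in> Basis"] have "0 \<le> C0 * 1" by (simp add: SOME_Basis)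
  then show ?thesis by simp
qed

text \<open>When the exponent is larger at \<open>x\<close>, the mean value bound for
  \<open>exp\<close> involves \<open>S \<tau> x\<close> only. The cubic factor and the decay are
  then evaluated at the same point.\<close>

lemma S_lipschitz_aux:
  assumes \<tau>: "\<tau> \<in> CC" and d: "dist x x' \<le> 1" and le: "E \<tau> x' \<le> E \<tau> x"
  shows "\<bar>S \<tau> x - S \<tau> x'\<bar> \<le> L0 * dist x x'"
proof -
  \<comment> \<open>The cubic growth is moved into the exponent as \<open>3 + 3 |x|^2\<close>, so
    that \<open>quad_le\<close> disposes of it with \<open>cc + 3\<close> in place of
    \<open>cc\<close>.\<close>
  have "2 * norm x + 1 \<le> 2 * exp (norm x)" using exp_ge_add_one_self[of "norm x"] by linarith
  then have "(2 * norm x + 1) ^ 3 \<le> (2 * exp (norm x)) ^ 3" by (intro power_mono) auto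
  also have "\<dots> = 8 * exp (3 * norm x)" by (simp add: power_mult_distrib exp_of_nat_mult[symmetric])
  also have "\<dots> \<le> 8 * exp (3 + 3 * (norm x)\<^sup>2)"
  proof -
    have "0 \<le> (norm x - 1 / 2)\<^sup>2" by simp
    then have "norm x \<le> 1 + (norm x)\<^sup>2" by (simp add: power2_eq_square algebra_simps)
    then show ?thesis by simp
  qed
  finally have 1: "(2 * norm x + 1) ^ 3 \<le> 8 * exp (3 + 3 * (norm x)\<^sup>2)" .
  have "\<bar>S \<tau> x - S \<tau> x'\<bar> \<le> \<bar>E \<tau> x - E \<tau> x'\<bar> * max (exp (E \<tau> x)) (exp (E \<tau> x'))"
    unfolding S_E by (rule abs_exp_diff_le)
  also have "max (exp (E \<tau> x)) (exp (E \<tau> x')) = S \<tau> x" using le by (simp add: S_E max_def)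
  also have "\<bar>E \<tau> x - E \<tau> x'\<bar> * S \<tau> x \<le> (C0 * (dist x x' * (2 * norm x + 1) ^ 3)) * exp (cc * (norm x)\<^sup>2 - real DIM('a) * norm x ^ 4)"
    using E_diff[OF \<tau> d] S_le[OF \<tau>, of x] C0 by (intro mult_mono) (auto simp: cc_def S_def)
  also have "\<dots> \<le> (C0 * (dist x x' * (8 * exp (3 + 3 * (norm x)\<^sup>2)))) * exp (cc * (norm x)\<^sup>2 - real DIM('a) * norm x ^ 4)"
    using C0 1 by (intro mult_right_mono mult_left_mono) auto
  also have "\<dots> = C0 * 8 * dist x x' * exp (3 + ((cc + 3) * (norm x)\<^sup>2 - real DIM('a) * ((norm x)\<^sup>2)\<^sup>2))"
  proof -
    have "exp (3 + 3 * (norm x)\<^sup>2) * exp (cc * (norm x)\<^sup>2 - real DIM('a) * norm x ^ 4) = exp (3 + ((cc + 3) * (norm x)\<^sup>2 - real DIM('a) * ((norm x)\<^sup>2)\<^sup>2))"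
      unfolding mult_exp_exp norm4 by (rule arg_cong[where f=exp]) (simp add: algebra_simps)
    then show ?thesis by (simp add: mult_ac)
  qed
  also have "\<dots> \<le> C0 * 8 * dist x x' * exp (3 + (cc + 3)\<^sup>2 / (4 * real DIM('a)))"
    using C0 quad_le[of "cc + 3" "(norm x)\<^sup>2"] by (intro mult_left_mono) auto
  also have "\<dots> = (C0 * 8 * exp 3 * exp ((cc + 3)\<^sup>2 / (4 * real DIM('a)))) * dist x x'" by (simp add: exp_add mult_ac)
  also have "\<dots> \<le> L0 * dist x x'" unfolding L0_def by (intro mult_right_mono) auto
  finally show ?thesis .
qed

lemma S_lipschitz:
  assumes \<tau>: "\<tau> \<in> CC"
  shows "\<bar>S \<tau> x - S \<tau> x'\<bar> \<le> L0 * dist x x'"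
proof (cases "dist x x' \<le> 1")
  case True
  show ?thesis
  proof (cases "E \<tau> x' \<le> E \<tau> x")
    case le: True
    show ?thesis by (rule S_lipschitz_aux[OF \<tau> True le])
  next
    case False
    then show ?thesis using S_lipschitz_aux[OF \<tau>, of x' x] True by (simp add: dist_commute abs_minus_commute)
  qed
next
  case False
  \<comment> \<open>At distance greater than 1 boundedness suffices; the second summand of
    \<open>L0\<close> is that bound.\<close>
  have b: "0 \<le> S \<tau> z" "S \<tau> z \<le> exp (cc\<^sup>2 / (4 * real DIM('a)))" for z
    using S_bounded[OF \<tau>, of z] by (auto simp: S_def cc_def)
  have "0 \<le> C0 * 8 * exp 3 * exp ((cc + 3)\<^sup>2 / (4 * real DIM('a)))" using C0 by simp
  then have L: "exp (cc\<^sup>2 / (4 * real DIM('a))) \<le> L0" unfolding L0_def by linarith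
  have "\<bar>S \<tau> x - S \<tau> x'\<bar> \<le> L0" using b[of x] b[of x'] L by linarith
  also have "L0 * 1 \<le> L0 * dist x x'" using False L less_le_trans[OF exp_gt_zero L] by (intro mult_left_mono) auto
  then have "L0 \<le> L0 * dist x x'" by simp
  finally show ?thesis .
qed

definition LL :: real where "LL = \<kappa> / z1 * L0"

lemma TT_lipschitz:
  assumes \<tau>: "\<tau> \<in> CC"
  shows "\<bar>TT \<tau> x - TT \<tau> x'\<bar> \<le> LL * dist x x'"
proof -
  have Z: "z1 \<le> Z \<tau>" "0 < Z \<tau>" using Z_ge'[OF \<tau>] z1 by auto
  have "\<bar>TT \<tau> x - TT \<tau> x'\<bar> = \<kappa> / Z \<tau> * \<bar>S \<tau> x - S \<tau> x'\<bar>"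
    unfolding TT_def using \<kappa> Z by (simp add: abs_mult flip: right_diff_distrib diff_divide_distrib)
  also have "\<dots> \<le> \<kappa> / z1 * (L0 * dist x x')"
    using \<kappa> z1 Z S_lipschitz[OF \<tau>] by (intro mult_mono divide_left_mono) auto
  finally show ?thesis by (simp add: LL_def)
qed

section \<open>Invariance and continuity of the map, closedness and convexity of the domain\<close>

definition TB :: "('a \<Rightarrow>\<^sub>C real) \<Rightarrow> ('a \<Rightarrow>\<^sub>C real)" where "TB \<tau> = Bcontfun (TT \<tau>)"

lemma TB_apply:
  assumes \<tau>: "\<tau> \<in> CC"
  shows "apply_bcontfun (TB \<tau>) = TT \<tau>"
proof -
  have "norm (TT \<tau> x) \<le> DD" for x using TT_le[OF \<tau>, of x] ww_le[of x] by simp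
  moreover have "continuous_on UNIV (TT \<tau>)"
    unfolding TT_def using S_continuous[OF \<tau>] Z_ge'[OF \<tau>] z1 by (intro continuous_intros) auto
  ultimately have "TT \<tau> \<in> bcontfun" by (rule bcontfun_normI[rotated])
  then show ?thesis by (simp add: TB_def Bcontfun_inverse)
qed

lemma TB_lipschitz_decay: "\<tau> \<in> CC \<Longrightarrow> TB \<tau> \<in> lipschitz_decay LL ww"
  using TT_le TT_lipschitz by (simp add: lipschitz_decay_def TB_apply)

lemma dens_TB: "\<tau> \<in> CC \<Longrightarrow> dens (TB \<tau>) y = q y * (\<kappa> * S \<tau> y / Z \<tau>)"
  by (simp add: dens_def TB_apply TT_def)

lemma mass_TB:
  assumes \<tau>: "\<tau> \<in> CC"
  shows "(\<integral>y. dens (TB \<tau>) y \<partial>lborel) = \<kappa>"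
proof -
  have "(\<integral>y. dens (TB \<tau>) y \<partial>lborel) = (\<integral>y. (\<kappa> / Z \<tau>) * (q y * S \<tau> y) \<partial>lborel)"
    by (intro Bochner_Integration.integral_cong) (auto simp: dens_TB[OF \<tau>])
  also have "\<dots> = (\<kappa> / Z \<tau>) * Z \<tau>" unfolding Z_def by (rule integral_mult_right_zero)
  finally show ?thesis using Z_ge'[OF \<tau>] z1 by simp
qed

lemma TB_in: assumes \<tau>: "\<tau> \<in> CC" shows "TB \<tau> \<in> CC"
proof -
  have "radially_symmetric (TT \<tau>)"
    unfolding radially_symmetric_def
  proof (intro allI impI)
    fix x y :: 'a assume xy: "norm x = norm y"
    then have "lnpot (dens \<tau>) x = lnpot (dens \<tau>) y"
      using gauss_density.lnpot_radial[OF cand_density[OF \<tau>] cand_radial[OF \<tau>]] unfolding radially_symmetric_def by blast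
    then show "TT \<tau> x = TT \<tau> y" by (simp add: TT_def S_def v_def xy)
  qed
  moreover have "0 \<le> TT \<tau> x \<and> TT \<tau> x \<le> DD" for x using TT_le[OF \<tau>, of x] ww_le[of x] by simp
  moreover have "A (TB \<tau>) \<le> MM" using moment_le[OF \<tau>] by (simp add: A_def dens_TB[OF \<tau>])
  ultimately show ?thesis using mass_TB[OF \<tau>] by (simp add: cand_def TB_apply[OF \<tau>])
qed

lemma gauss: "gauss_density (\<lambda>y::'a. exp (- (norm y)\<^sup>2)) 1"
  by standard (use dim in auto)

text \<open>One dominated convergence for mass, singular moment and potential alike: the densities
  share a Gaussian majorant, so the weight \<open>g\<close> only has to be integrable against that
  Gaussian.\<close>

lemma dens_tendsto:
  assumes \<tau>: "\<And>k. \<tau> k \<in> cand D M" and lim: "\<And>x. (\<lambda>k. apply_bcontfun (\<tau> k) x) \<longlonglongrightarrow> apply_bcontfun \<tau>0 x"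
    and g: "integrable lborel (\<lambda>y::'a. g y * exp (- (norm y)\<^sup>2))" and [measurable]: "g \<in> borel_measurable borel"
  shows "(\<lambda>k. \<integral>y. g y * dens (\<tau> k) y \<partial>lborel) \<longlonglongrightarrow> (\<integral>y. g y * dens \<tau>0 y \<partial>lborel)"
proof (rule integral_dominated_convergence[where w="\<lambda>y. (Gm * D) * norm (g y * exp (- (norm y)\<^sup>2))"])
  show "integrable lborel (\<lambda>y. (Gm * D) * norm (g y * exp (- (norm y)\<^sup>2)))"
    by (intro integrable_mult_right integrable_norm g)
  show "AE y in lborel. (\<lambda>k. g y * dens (\<tau> k) y) \<longlonglongrightarrow> g y * dens \<tau>0 y"
    unfolding dens_def by (intro AE_I2 tendsto_intros lim)
  fix k
  interpret gauss_density "dens (\<tau> k)" "Gm * D" by (rule cand_density[OF \<tau>])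
  show "AE y in lborel. norm (g y * dens (\<tau> k) y) \<le> (Gm * D) * norm (g y * exp (- (norm y)\<^sup>2))"
  proof (rule AE_I2)
    fix y
    have "\<bar>g y\<bar> * dens (\<tau> k) y \<le> \<bar>g y\<bar> * (Gm * D * exp (- (norm y)\<^sup>2))" by (intro mult_left_mono bound) auto
    then show "norm (g y * dens (\<tau> k) y) \<le> (Gm * D) * norm (g y * exp (- (norm y)\<^sup>2))"
      using nonneg[of y] by (simp add: abs_mult mult_ac)
  qed
qed auto

lemma mass_tendsto:
  assumes \<tau>: "\<And>k. \<tau> k \<in> cand D M" and lim: "\<And>x. (\<lambda>k. apply_bcontfun (\<tau> k) x) \<longlonglongrightarrow> apply_bcontfun \<tau>0 x"
  shows "(\<lambda>k. \<integral>y. dens (\<tau> k) y \<partial>lborel) \<longlonglongrightarrow> (\<integral>y. dens \<tau>0 y \<partial>lborel)"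
  using dens_tendsto[OF \<tau> lim, of "\<lambda>_. 1"] gauss_density.integrable[OF gauss] by simp

lemma A_tendsto:
  assumes \<tau>: "\<And>k. \<tau> k \<in> cand D M" and lim: "\<And>x. (\<lambda>k. apply_bcontfun (\<tau> k) x) \<longlonglongrightarrow> apply_bcontfun \<tau>0 x"
  shows "(\<lambda>k. A (\<tau> k)) \<longlonglongrightarrow> A \<tau>0"
  unfolding A_def
proof (rule dens_tendsto[OF \<tau> lim])
  show "integrable lborel (\<lambda>y::'a. norm y powr (- 2) * exp (- (norm y)\<^sup>2))"
    using gauss_density.riesz_integrable[OF gauss, of 2 0] dim by simp
qed auto

lemma lnpot_tendsto:
  assumes \<tau>: "\<And>k. \<tau> k \<in> cand D M" and lim: "\<And>x. (\<lambda>k. apply_bcontfun (\<tau> k) x) \<longlonglongrightarrow> apply_bcontfun \<tau>0 x"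
  shows "(\<lambda>k. lnpot (dens (\<tau> k)) x) \<longlonglongrightarrow> lnpot (dens \<tau>0) x"
  unfolding lnpot_def
  by (intro tendsto_minus dens_tendsto[OF \<tau> lim] gauss_density.ln_integrable[OF gauss]) auto

lemma TT_tendsto:
  assumes \<tau>: "\<And>k. \<tau> k \<in> CC" and \<tau>0: "\<tau>0 \<in> CC" and lim: "\<And>x. (\<lambda>k. apply_bcontfun (\<tau> k) x) \<longlonglongrightarrow> apply_bcontfun \<tau>0 x"
  shows "(\<lambda>k. TT (\<tau> k) x) \<longlonglongrightarrow> TT \<tau>0 x"
proof -
  have S: "(\<lambda>k. S (\<tau> k) y) \<longlonglongrightarrow> S \<tau>0 y" for y
    unfolding S_def v_def using \<gamma> by (intro tendsto_intros lnpot_tendsto[OF \<tau> lim] A_tendsto[OF \<tau> lim]) auto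
  have "(\<lambda>k. Z (\<tau> k)) \<longlonglongrightarrow> Z \<tau>0"
    unfolding Z_def
  proof (rule integral_dominated_convergence[where w="\<lambda>y. exp (cc\<^sup>2 / (4 * real DIM('a))) * q y"])
    show "integrable lborel (\<lambda>y. exp (cc\<^sup>2 / (4 * real DIM('a))) * q y)"
      by (intro integrable_mult_right gauss_density.integrable[OF q_density])
    show "AE y in lborel. (\<lambda>k. q y * S (\<tau> k) y) \<longlonglongrightarrow> q y * S \<tau>0 y" by (intro AE_I2 tendsto_intros S)
    show "(\<lambda>y. q y * S \<tau>0 y) \<in> borel_measurable lborel" using S_measurable[OF \<tau>0] by simp
    fix k
    show "(\<lambda>y. q y * S (\<tau> k) y) \<in> borel_measurable lborel" using S_measurable[OF \<tau>] by simp
    show "AE y in lborel. norm (q y * S (\<tau> k) y) \<le> exp (cc\<^sup>2 / (4 * real DIM('a))) * q y"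
    proof (rule AE_I2)
      fix y
      have "S (\<tau> k) y * q y \<le> exp (cc\<^sup>2 / (4 * real DIM('a))) * q y"
        using S_bounded[OF \<tau>] q_nonneg by (intro mult_right_mono) (auto simp: cc_def)
      moreover have "0 \<le> S (\<tau> k) y * q y" using q_nonneg by (simp add: S_def)
      ultimately show "norm (q y * S (\<tau> k) y) \<le> exp (cc\<^sup>2 / (4 * real DIM('a))) * q y" by (simp add: mult.commute)
    qed
  qed
  then show ?thesis unfolding TT_def using Z_ge'[OF \<tau>0] z1 by (intro tendsto_intros S) auto
qed

lemma bcontfun_tendsto_apply: "\<tau> \<longlonglongrightarrow> (\<tau>0 :: 'a \<Rightarrow>\<^sub>C real) \<Longrightarrow> (\<lambda>k. apply_bcontfun (\<tau> k) x) \<longlonglongrightarrow> apply_bcontfun \<tau>0 x"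
  by (rule metric_tendsto_imp_tendsto) (auto intro!: always_eventually dist_bounded)

text \<open>Convergence of the arguments gives pointwise convergence of the images, and this is
  already uniform because all images lie in one equi-Lipschitz family with a common decay.\<close>

lemma TB_continuous: "continuous_on CC TB"
  unfolding continuous_on_sequentially
proof (intro allI ballI impI; elim conjE)
  fix \<tau> \<tau>0 assume a: "\<forall>k. \<tau> k \<in> CC" "\<tau> \<longlonglongrightarrow> \<tau>0" "\<tau>0 \<in> CC"
  have "(\<lambda>k. TB (\<tau> k)) \<longlonglongrightarrow> TB \<tau>0"
    using a TT_tendsto[of \<tau> \<tau>0, OF _ _ bcontfun_tendsto_apply[OF a(2)]]
    by (intro lipschitz_decay_tendsto[OF ww_tendsto TB_lipschitz_decay TB_lipschitz_decay]) (auto simp: TB_apply)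
  then show "(TB \<circ> \<tau>) \<longlonglongrightarrow> TB \<tau>0" by (simp add: o_def)
qed

lemma CC_closed: "closed CC"
  unfolding closed_sequential_limits
proof (intro allI impI; elim conjE)
  fix \<tau> \<tau>0 assume a: "\<forall>k. \<tau> k \<in> CC" "\<tau> \<longlonglongrightarrow> \<tau>0"
  have \<tau>: "\<And>k. \<tau> k \<in> CC" using a by blast
  have lim: "(\<lambda>k. apply_bcontfun (\<tau> k) x) \<longlonglongrightarrow> apply_bcontfun \<tau>0 x" for x
    by (rule bcontfun_tendsto_apply[OF a(2)])
  have b: "radially_symmetric (apply_bcontfun (\<tau> k))" "0 \<le> apply_bcontfun (\<tau> k) x" "apply_bcontfun (\<tau> k) x \<le> DD"
    "(\<integral>y. dens (\<tau> k) y \<partial>lborel) \<le> \<kappa>" "A (\<tau> k) \<le> MM" for k x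
    using \<tau>[of k] by (auto simp: cand_def)
  have "radially_symmetric (apply_bcontfun \<tau>0)"
    unfolding radially_symmetric_def
  proof (intro allI impI)
    fix x y :: 'a assume "norm x = norm y"
    then have "apply_bcontfun (\<tau> k) x = apply_bcontfun (\<tau> k) y" for k using b(1) unfolding radially_symmetric_def by blast
    then show "apply_bcontfun \<tau>0 x = apply_bcontfun \<tau>0 y" using LIMSEQ_unique[OF lim[of x]] lim[of y] by simp
  qed
  moreover have "0 \<le> apply_bcontfun \<tau>0 x" "apply_bcontfun \<tau>0 x \<le> DD" for x
    using LIMSEQ_le_const[OF lim[of x], of 0] LIMSEQ_le_const2[OF lim[of x], of DD] b(2,3) by auto
  moreover have "(\<integral>y. dens \<tau>0 y \<partial>lborel) \<le> \<kappa>"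
    using LIMSEQ_le_const2[OF mass_tendsto[OF \<tau> lim], of \<kappa>] b(4) by auto
  moreover have "A \<tau>0 \<le> MM"
    using LIMSEQ_le_const2[OF A_tendsto[OF \<tau> lim], of MM] b(5) by auto
  ultimately show "\<tau>0 \<in> CC" by (simp add: cand_def)
qed

lemma CC_convex: "convex CC"
proof (rule convexI)
  fix \<tau> \<sigma> and a b :: real assume \<tau>: "\<tau> \<in> CC" and \<sigma>: "\<sigma> \<in> CC" and ab: "0 \<le> a" "0 \<le> b" "a + b = 1"
  let ?r = "a *\<^sub>R \<tau> + b *\<^sub>R \<sigma>"
  have app: "apply_bcontfun ?r x = a * apply_bcontfun \<tau> x + b * apply_bcontfun \<sigma> x" for x by simp
  have d: "dens ?r y = a * dens \<tau> y + b * dens \<sigma> y" for y unfolding dens_def app by (simp add: algebra_simps)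
  have conv: "a * s + b * t \<le> z" if "s \<le> z" "t \<le> z" for s t z :: real
  proof -
    have "a * s + b * t \<le> a * z + b * z" using that ab by (intro add_mono mult_left_mono) auto
    then show ?thesis using ab by (simp flip: distrib_right)
  qed
  have i: "integrable lborel (dens \<tau>)" "integrable lborel (dens \<sigma>)"
    using gauss_density.integrable[OF cand_density[OF \<tau>]] gauss_density.integrable[OF cand_density[OF \<sigma>]] by auto
  have j: "integrable lborel (\<lambda>y. norm y powr (- 2) * dens \<tau> y)" "integrable lborel (\<lambda>y. norm y powr (- 2) * dens \<sigma> y)"
    using gauss_density.riesz_integrable[OF cand_density[OF \<tau>], of 2 0] gauss_density.riesz_integrable[OF cand_density[OF \<sigma>], of 2 0] dim by auto
  have "(\<integral>y. dens ?r y \<partial>lborel) = a * (\<integral>y. dens \<tau> y \<partial>lborel) + b * (\<integral>y. dens \<sigma> y \<partial>lborel)"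
    unfolding d using i by simp
  moreover have "A ?r = a * A \<tau> + b * A \<sigma>"
  proof -
    have "A ?r = (\<integral>y. a * (norm y powr (- 2) * dens \<tau> y) + b * (norm y powr (- 2) * dens \<sigma> y) \<partial>lborel)"
      unfolding A_def d by (intro Bochner_Integration.integral_cong) (auto simp: algebra_simps)
    also have "\<dots> = a * A \<tau> + b * A \<sigma>"
      unfolding A_def by (subst Bochner_Integration.integral_add[OF integrable_mult_right[OF j(1)] integrable_mult_right[OF j(2)]])
        (simp only: integral_mult_right_zero)
    finally show ?thesis .
  qed
  moreover have "radially_symmetric (apply_bcontfun ?r)"
    unfolding radially_symmetric_def
  proof (intro allI impI)
    fix x y :: 'a assume "norm x = norm y"
    then have "apply_bcontfun \<tau> x = apply_bcontfun \<tau> y" "apply_bcontfun \<sigma> x = apply_bcontfun \<sigma> y"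
      using \<tau> \<sigma> unfolding cand_def mem_Collect_eq radially_symmetric_def by blast+
    then show "apply_bcontfun ?r x = apply_bcontfun ?r y" by simp
  qed
  moreover have "0 \<le> apply_bcontfun ?r x" "apply_bcontfun ?r x \<le> DD" for x
    unfolding app using \<tau> \<sigma> ab conv by (auto simp: cand_def)
  ultimately show "?r \<in> CC" using \<tau> \<sigma> conv by (auto simp: cand_def simp del: plus_bcontfun.rep_eq scaleR_bcontfun.rep_eq)
qed

theorem normalized_density:
  obtains \<rho> B c where "gauss_density \<rho> B" "radially_symmetric \<rho>" "(\<integral>y. \<rho> y \<partial>lborel) = \<kappa>"
    "(\<integral>y. norm y powr (- 2) * \<rho> y \<partial>lborel) > 0"
    "\<And>x. \<rho> x = G x * exp (real DIM('a) * (lnpot \<rho> x / gam TYPE('a)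
      - (real DIM('a) - 2) / (4 * real DIM('a) * gam TYPE('a)) * (\<integral>y. norm y powr (- 2) * \<rho> y \<partial>lborel) * (norm x ^ 4 - (norm x)\<^sup>2) + c - norm x ^ 4))"
proof -
  have "\<exists>\<tau>\<in>CC. TB \<tau> = \<tau>"
  proof (rule schauder[OF CC_convex CC_closed _ TB_continuous _ compact_lipschitz_decay[OF ww_tendsto ww_le]])
    show "CC \<noteq> {}" using zero_in_CC by blast
    show "TB ` CC \<subseteq> CC" using TB_in by blast
    show "TB ` CC \<subseteq> lipschitz_decay LL ww" using TB_lipschitz_decay by blast
  qed
  then obtain \<tau> where \<tau>: "\<tau> \<in> CC" "TB \<tau> = \<tau>" by blast
  define \<rho> where "\<rho> = dens \<tau>"
  have gd: "gauss_density \<rho> (Gm * DD)" unfolding \<rho>_def by (rule cand_density[OF \<tau>(1)])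
  interpret gauss_density \<rho> "Gm * DD" by (rule gd)
  have mass: "(\<integral>y. \<rho> y \<partial>lborel) = \<kappa>" using mass_TB[OF \<tau>(1)] \<tau>(2) by (simp add: \<rho>_def)
  have Z: "Z \<tau> > 0" using Z_ge'[OF \<tau>(1)] z1 by linarith
  \<comment> \<open>Undoes both normalisations: the factor \<open>\<kappa> / Z\<close> becomes the
    summand \<open>ln (\<kappa> / Z) / n\<close> of the exponent, and the value of the potential at
    0 subtracted in \<open>v\<close> is restored.\<close>
  define c where "c = ln (\<kappa> / Z \<tau>) / real DIM('a) - lnpot \<rho> 0 / \<gamma>"
  show ?thesis
  proof (rule that[OF gd _ mass])
    show "radially_symmetric \<rho>" unfolding \<rho>_def by (rule cand_radial[OF \<tau>(1)])
    have ri: "Bochner_Integration.integrable lborel (\<lambda>y. norm y powr (- 2) * \<rho> y)" using riesz_integrable[of 2 0] dim by simp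
    \<comment> \<open>Strict positivity of the moment gives the strict signs of the coefficients in
      the final expansion. If it were 0, \<open>\<rho>\<close> would vanish almost everywhere,
      against its mass \<open>\<kappa> > 0\<close>.\<close>
    show "(\<integral>y. norm y powr (- 2) * \<rho> y \<partial>lborel) > 0"
    proof (rule ccontr)
      assume "\<not> ?thesis"
      moreover have "(\<integral>y. norm y powr (- 2) * \<rho> y \<partial>lborel) \<ge> 0" using nonneg by (intro integral_nonneg_AE) auto
      ultimately have "(\<integral>y. norm y powr (- 2) * \<rho> y \<partial>lborel) = 0" by linarith
      then have "AE y in lborel. norm y powr (- 2) * \<rho> y = 0"
        using integral_nonneg_eq_0_iff_AE[OF ri] nonneg by auto
      then have "AE y in lborel. \<rho> y = 0" using AE_lborel_singleton[of "0::'a"] by eventually_elim auto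
      then have "(\<integral>y. \<rho> y \<partial>lborel) = 0" by (rule integral_eq_zero_AE)
      then show False using mass \<kappa> by simp
    qed
    fix x
    have "\<rho> x = q x * (\<kappa> * S \<tau> x / Z \<tau>)" using dens_TB[OF \<tau>(1)] \<tau>(2) by (simp add: \<rho>_def)
    also have "\<dots> = (\<kappa> / Z \<tau>) * (q x * S \<tau> x)" by simp
    also have "\<dots> = G x * (exp (ln (\<kappa> / Z \<tau>)) * exp (- (real DIM('a) * norm x ^ 4) + real DIM('a) * v \<tau> x))"
      unfolding qS using \<kappa> Z by simp
    also have "\<dots> = G x * exp (real DIM('a) * (lnpot \<rho> x / \<gamma> - \<beta> * A \<tau> * (norm x ^ 4 - (norm x)\<^sup>2) + c - norm x ^ 4))"
    proof -
      have "ln (\<kappa> / Z \<tau>) = real DIM('a) * c + real DIM('a) * (lnpot \<rho> 0 / \<gamma>)" using n by (simp add: c_def right_diff_distrib)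
      then have "ln (\<kappa> / Z \<tau>) + (- (real DIM('a) * norm x ^ 4) + real DIM('a) * v \<tau> x) = real DIM('a) * (lnpot \<rho> x / \<gamma> - \<beta> * A \<tau> * (norm x ^ 4 - (norm x)\<^sup>2) + c - norm x ^ 4)"
        by (simp add: v_def \<rho>_def algebra_simps diff_divide_distrib)
      then show ?thesis by (simp add: mult_exp_exp)
    qed
    finally show "\<rho> x = G x * exp (real DIM('a) * (lnpot \<rho> x / gam TYPE('a)
      - (real DIM('a) - 2) / (4 * real DIM('a) * gam TYPE('a)) * (\<integral>y. norm y powr (- 2) * \<rho> y \<partial>lborel) * (norm x ^ 4 - (norm x)\<^sup>2) + c - norm x ^ 4))"
      by (simp add: \<beta>_def \<gamma>_def A_def \<rho>_def)
  qed
qed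

end

section \<open>Pairings with the density\<close>

text \<open>With \<open>z = n/2\<close> the sphere has area
  \<open>2 pi^(z + 1/2) / Gamma (z + 1/2)\<close> and \<open>(n-1)!\<close> is
  \<open>Gamma (2 z)\<close>. Legendre's duplication formula, transferred from the complex Gamma
  function, cancels \<open>Gamma (z + 1/2)\<close>.\<close>

lemma Lambda1_gam: "Lambda1 TYPE('a::euclidean_space) = 2 * gam TYPE('a)"
proof -
  let ?n = "real DIM('a)"
  define z where "z = ?n / 2"
  have z: "z > 0" by (simp add: z_def)
  have nz: "x \<notin> \<int>\<^sub>\<le>\<^sub>0" if "x > 0" for x :: real
    using that nonpos_Ints_nonpos[of x] by linarith
  have dup: "Gamma z * Gamma (z + 1 / 2) = exp ((1 - 2 * z) * ln 2) * sqrt pi * Gamma (2 * z)"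
  proof -
    have g1: "Gamma (complex_of_real z) = complex_of_real (Gamma z)" by (rule Gamma_complex_of_real)
    have g2: "Gamma (complex_of_real z + 1 / 2) = complex_of_real (Gamma (z + 1 / 2))"
      using Gamma_complex_of_real[of "z + 1 / 2"] by simp
    have g3: "Gamma (2 * complex_of_real z) = complex_of_real (Gamma (2 * z))"
      using Gamma_complex_of_real[of "2 * z"] by simp
    have g4: "exp ((1 - 2 * complex_of_real z) * complex_of_real (ln 2)) = complex_of_real (exp ((1 - 2 * z) * ln 2))"
      using exp_of_real[of "(1 - 2 * z) * ln 2", where 'a=complex] by simp
    have nc: "complex_of_real x \<notin> \<int>\<^sub>\<le>\<^sub>0" if x: "x > 0" for x
    proof
      assume "complex_of_real x \<in> \<int>\<^sub>\<le>\<^sub>0"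
      then obtain k where k: "complex_of_real x = of_int k" "k \<le> 0" by (blast elim: nonpos_Ints_cases)
      have "Re (complex_of_real x) = Re (of_int k)" by (simp only: k(1))
      then show False using x k(2) by simp
    qed
    have n1: "complex_of_real z \<notin> \<int>\<^sub>\<le>\<^sub>0" by (rule nc[OF z])
    have "complex_of_real (z + 1 / 2) \<notin> \<int>\<^sub>\<le>\<^sub>0" using z by (intro nc) simp
    then have n2: "complex_of_real z + 1 / 2 \<notin> \<int>\<^sub>\<le>\<^sub>0" by simp
    have "complex_of_real (Gamma z) * complex_of_real (Gamma (z + 1 / 2))
      = complex_of_real (exp ((1 - 2 * z) * ln 2)) * complex_of_real (sqrt pi) * complex_of_real (Gamma (2 * z))"
      using Gamma_legendre_duplication[OF n1 n2] unfolding g1 g2 g3 g4 .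
    then show ?thesis by (simp only: of_real_mult[symmetric] of_real_eq_iff)
  qed
  have G: "Gamma (2 * z) = fact (DIM('a) - 1)"
  proof -
    have "2 * z = 1 + of_nat (DIM('a) - 1)" by (simp add: z_def)
    then show ?thesis by (simp only: Gamma_fact)
  qed
  have h: "Gamma (z + 1 / 2) > 0" "Gamma z > 0" using z by (auto intro!: Gamma_real_pos)
  have d: "real DIM('a \<times> real) = ?n + 1" by simp
  have gp: "Gamma (z + 1 / 2 + 1) = (z + 1 / 2) * Gamma (z + 1 / 2)"
    using z by (intro Gamma_plus1 nz) simp
  have d1: "(?n + 1) / 2 = z + 1 / 2" by (simp add: z_def add_divide_distrib)
  have n1: "?n + 1 = 2 * (z + 1 / 2)" by (simp add: z_def)
  have gen: "2 * a * (b / (a * c)) = 2 * b / c" if "a \<noteq> 0" for a b c :: real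
    using that by simp
  have S: "surface_measure (sphere (0 :: 'a \<times> real) 1) = 2 * pi powr (z + 1 / 2) / Gamma (z + 1 / 2)"
    unfolding surface_measure_sphere unit_ball_vol_def d d1 gp unfolding n1 by (rule gen) (use z in linarith)
  have l4: "ln (4 :: real) = 2 * ln 2" using ln_realpow[of "2::real" 2] by simp
  have "exp ((1 - 2 * z) * ln 2) = exp (ln 2 - z * ln (4::real))"
    unfolding l4 by (rule arg_cong[where f=exp]) (simp add: left_diff_distrib)
  also have "\<dots> = 2 / 4 powr z" by (simp add: exp_diff powr_def)
  finally have e: "exp ((1 - 2 * z) * ln 2) = 2 / 4 powr z" .
  have "Gamma z * Gamma (z + 1 / 2) * 4 powr z = 2 * sqrt pi * Gamma (2 * z)"
    unfolding dup e by simp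
  then have "Gamma (2 * z) = Gamma z * Gamma (z + 1 / 2) * 4 powr z / (2 * sqrt pi)" by simp
  then have "Lambda1 TYPE('a) = (Gamma z * Gamma (z + 1 / 2) * 4 powr z / (2 * sqrt pi)) * (2 * pi powr (z + 1 / 2) / Gamma (z + 1 / 2))"
    unfolding Lambda1_def S by (simp add: G)
  also have "\<dots> = Gamma z * (4 powr z * pi powr z)"
    using h by (simp add: powr_add powr_half_sqrt)
  also have "\<dots> = 2 * gam TYPE('a)"
    unfolding gam_def z_def[symmetric] by (simp add: powr_mult)
  finally show ?thesis .
qed

section \<open>Integrable functions as distributions\<close>

lemma uniform_limit_bound:
  assumes "uniform_limit UNIV \<Phi> (\<lambda>_. 0) sequentially" "e > 0"
  shows "\<forall>\<^sub>F j in sequentially. \<forall>x. norm (\<Phi> j x) < e"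
  using uniform_limitD[OF assms] by simp

lemma regular_distribution_null:
  fixes f :: "'a::euclidean_space \<Rightarrow> real"
  assumes f: "integrable lborel f" and \<Phi>: "\<And>j. \<Phi> j \<in> schwartz_space"
    and lim: "uniform_limit UNIV \<Phi> (\<lambda>_. 0) sequentially"
  shows "(\<lambda>j. regular_distribution f (\<Phi> j)) \<longlonglongrightarrow> 0"
proof (rule tendstoI)
  fix e :: real assume e: "e > 0"
  note [measurable] = borel_measurable_integrable[OF f] schwartz_measurable[OF \<Phi>]
  define I where "I = (\<integral>x. \<bar>f x\<bar> \<partial>lborel)"
  have I: "I \<ge> 0" unfolding I_def by (intro integral_nonneg_AE) auto
  have "e / (I + 1) > 0" using e I by simp
  from uniform_limit_bound[OF lim this]
  show "\<forall>\<^sub>F j in sequentially. dist (regular_distribution f (\<Phi> j)) 0 < e"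
  proof (rule eventually_mono)
    fix j assume j: "\<forall>x. norm (\<Phi> j x) < e / (I + 1)"
    have r: "regular_distribution f (\<Phi> j) = (\<integral>x. f x *\<^sub>R \<Phi> j x \<partial>lborel)"
      unfolding regular_distribution_def by (rule integral_lebesgue_lborel) simp
    have m1: "norm (\<integral>x. f x *\<^sub>R \<Phi> j x \<partial>lborel) \<le> (\<integral>x. e / (I + 1) * \<bar>f x\<bar> \<partial>lborel)"
    proof -
      have i: "integrable lborel (\<lambda>x. e / (I + 1) * \<bar>f x\<bar>)" using f by (intro integrable_mult_right) auto
      have le: "norm (f x *\<^sub>R \<Phi> j x) \<le> e / (I + 1) * \<bar>f x\<bar>" for x
        using mult_right_mono[OF less_imp_le[OF spec[OF j, of x]], of "\<bar>f x\<bar>"] by (simp add: mult.commute)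
      have fi: "integrable lborel (\<lambda>x. f x *\<^sub>R \<Phi> j x)"
      proof (rule Bochner_Integration.integrable_bound[OF i])
        show "AE x in lborel. norm (f x *\<^sub>R \<Phi> j x) \<le> norm (e / (I + 1) * \<bar>f x\<bar>)"
          using order_trans[OF le abs_ge_self] by (intro AE_I2) (simp only: real_norm_def)
      qed simp
      have "norm (\<integral>x. f x *\<^sub>R \<Phi> j x \<partial>lborel) \<le> (\<integral>x. norm (f x *\<^sub>R \<Phi> j x) \<partial>lborel)" by (rule integral_norm_bound)
      also have "\<dots> \<le> (\<integral>x. e / (I + 1) * \<bar>f x\<bar> \<partial>lborel)" by (rule integral_mono[OF integrable_norm[OF fi] i le])
      finally show ?thesis .
    qed
    have m2: "(\<integral>x. e / (I + 1) * \<bar>f x\<bar> \<partial>lborel) = e * (I / (I + 1))"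
      by (simp add: I_def)
    have m3: "e * (I / (I + 1)) < e * 1" using e I by (intro mult_strict_left_mono) auto
    have "norm (\<integral>x. f x *\<^sub>R \<Phi> j x \<partial>lborel) < e" using m1 m3 unfolding m2 by linarith
    then show "dist (regular_distribution f (\<Phi> j)) 0 < e" by (simp only: r dist_norm diff_0_right)
  qed
qed

lemma regular_distribution_linear:
  fixes f :: "'a::euclidean_space \<Rightarrow> real"
  assumes f: "integrable lborel f" and \<phi>: "\<phi> \<in> schwartz_space" and \<psi>: "\<psi> \<in> schwartz_space"
  shows "regular_distribution f (\<lambda>x. a * \<phi> x + b * \<psi> x) = a * regular_distribution f \<phi> + b * regular_distribution f \<psi>"
proof -
  note [measurable] = borel_measurable_integrable[OF f] schwartz_measurable[OF \<phi>] schwartz_measurable[OF \<psi>]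
  have i: "integrable lborel (\<lambda>x. f x *\<^sub>R \<eta> x)" if \<eta>: "\<eta> \<in> schwartz_space" for \<eta> :: "'a \<Rightarrow> complex"
  proof -
    note [measurable] = schwartz_measurable[OF \<eta>]
    obtain B where B: "\<And>x. norm (\<eta> x) \<le> B" using schwartz_bounded[OF \<eta>] by blast
    show ?thesis
    proof (rule Bochner_Integration.integrable_bound)
      show "integrable lborel (\<lambda>x. B * f x)" using f by simp
      have "norm (f x *\<^sub>R \<eta> x) \<le> norm (B * f x)" for x
        using mult_right_mono[OF order_trans[OF B[of x] abs_ge_self], of "\<bar>f x\<bar>"] by (simp add: abs_mult mult.commute)
      then show "AE x in lborel. norm (f x *\<^sub>R \<eta> x) \<le> norm (B * f x)" by simp
    qed simp
  qed
  have r: "regular_distribution f \<eta> = (\<integral>x. f x *\<^sub>R \<eta> x \<partial>lborel)" if "\<eta> \<in> borel_measurable borel" for \<eta>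
    unfolding regular_distribution_def using that by (intro integral_lebesgue_lborel) simp
  have "regular_distribution f (\<lambda>x. a * \<phi> x + b * \<psi> x) = (\<integral>x. f x *\<^sub>R (a * \<phi> x + b * \<psi> x) \<partial>lborel)"
    by (rule r) simp
  also have "\<dots> = (\<integral>x. a * (f x *\<^sub>R \<phi> x) + b * (f x *\<^sub>R \<psi> x) \<partial>lborel)"
    by (intro Bochner_Integration.integral_cong) (auto simp: scaleR_add_right)
  also have "\<dots> = a * (\<integral>x. f x *\<^sub>R \<phi> x \<partial>lborel) + b * (\<integral>x. f x *\<^sub>R \<psi> x \<partial>lborel)"
    by (subst Bochner_Integration.integral_add[OF integrable_mult_right[OF i[OF \<phi>]] integrable_mult_right[OF i[OF \<psi>]]])
       (simp only: integral_mult_right_zero)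
  finally show ?thesis by (simp add: r)
qed

lemma distribution_regular:
  fixes f :: "'a::euclidean_space \<Rightarrow> real"
  assumes f: "integrable lborel f"
  shows "distribution (regular_distribution f)" "tempered_distribution (regular_distribution f)"
proof -
  show "distribution (regular_distribution f)"
    unfolding distribution_def linear_functional_on_def
  proof (intro conjI ballI allI impI)
    fix \<phi> \<psi> :: "'a \<Rightarrow> complex" and a b assume "\<phi> \<in> test_functions" "\<psi> \<in> test_functions"
    then show "regular_distribution f (\<lambda>x. a * \<phi> x + b * \<psi> x) = a * regular_distribution f \<phi> + b * regular_distribution f \<psi>"
      by (intro regular_distribution_linear[OF f] test_in_schwartz)
  next
    fix \<Phi> :: "nat \<Rightarrow> 'a \<Rightarrow> complex" assume "test_null_sequence \<Phi>"
    then have r: "range \<Phi> \<subseteq> test_functions"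
      and l: "\<forall>bs\<in>lists Basis. uniform_limit UNIV (\<lambda>j. partial_derivs bs (\<Phi> j)) (\<lambda>_. 0) sequentially"
      unfolding test_null_sequence_def by blast+
    have s: "\<Phi> j \<in> schwartz_space" for j using r test_in_schwartz by blast
    have "uniform_limit UNIV \<Phi> (\<lambda>_. 0) sequentially" using bspec[OF l lists.Nil] by simp
    then show "(\<lambda>j. regular_distribution f (\<Phi> j)) \<longlonglongrightarrow> 0" by (rule regular_distribution_null[OF f s])
  qed
  show "tempered_distribution (regular_distribution f)"
    unfolding tempered_distribution_def linear_functional_on_def
  proof (intro conjI ballI allI impI)
    fix \<phi> \<psi> :: "'a \<Rightarrow> complex" and a b assume "\<phi> \<in> schwartz_space" "\<psi> \<in> schwartz_space"
    then show "regular_distribution f (\<lambda>x. a * \<phi> x + b * \<psi> x) = a * regular_distribution f \<phi> + b * regular_distribution f \<psi>"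
      by (intro regular_distribution_linear[OF f])
  next
    fix \<Phi> :: "nat \<Rightarrow> 'a \<Rightarrow> complex" assume "schwartz_null_sequence \<Phi>"
    then have r: "range \<Phi> \<subseteq> schwartz_space"
      and l: "\<forall>k. \<forall>bs\<in>lists Basis. uniform_limit UNIV (\<lambda>j x. norm x ^ k *\<^sub>R partial_derivs bs (\<Phi> j) x) (\<lambda>_. 0) sequentially"
      unfolding schwartz_null_sequence_def by blast+
    have s: "\<Phi> j \<in> schwartz_space" for j using r by blast
    have "uniform_limit UNIV \<Phi> (\<lambda>_. 0) sequentially" using bspec[OF spec[OF l, of 0] lists.Nil] by simp
    then show "(\<lambda>j. regular_distribution f (\<Phi> j)) \<longlonglongrightarrow> 0" by (rule regular_distribution_null[OF f s])
  qed
qed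

text \<open>Connects the two conventions in the definitions: the even equation and the Fourier
  lemmas iterate the negative Laplacian, the weak Laplacian power iterates the Laplacian.\<close>

lemma test_nlap_power:
  fixes \<phi> :: "'a::euclidean_space \<Rightarrow> complex"
  assumes \<phi>: "\<phi> \<in> test_functions"
  shows "((\<lambda>\<psi> x. - laplacian \<psi> x) ^^ m) \<phi> = (\<lambda>x. (-1) ^ m *\<^sub>R (laplacian ^^ m) \<phi> x)"
proof (induction m)
  case (Suc m)
  have s: "smooth ((laplacian ^^ m) \<phi>)" using test_laplacian_power[OF \<phi>, of m] by (simp add: test_functions_def)
  have pd: "partial_deriv b (partial_deriv b (\<lambda>x. c *\<^sub>R (laplacian ^^ m) \<phi> x)) x = c *\<^sub>R partial_deriv b (partial_deriv b ((laplacian ^^ m) \<phi>)) x"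
    if "b \<in> Basis" for b x and c :: real
    using partial_derivs_scaleR[OF s, of "[b, b]" c] that by (simp add: fun_eq_iff)
  have lap: "laplacian (\<lambda>x. c *\<^sub>R (laplacian ^^ m) \<phi> x) x = c *\<^sub>R laplacian ((laplacian ^^ m) \<phi>) x" for c :: real and x
    unfolding laplacian_def[of "\<lambda>x. c *\<^sub>R (laplacian ^^ m) \<phi> x"] laplacian_def[of "(laplacian ^^ m) \<phi>"] scaleR_sum_right
    by (intro sum.cong refl pd)
  have "((\<lambda>\<psi> x. - laplacian \<psi> x) ^^ Suc m) \<phi> = (\<lambda>x. - laplacian (((\<lambda>\<psi> x. - laplacian \<psi> x) ^^ m) \<phi>) x)" by simp
  also have "\<dots> = (\<lambda>x. (-1) ^ Suc m *\<^sub>R (laplacian ^^ Suc m) \<phi> x)" unfolding Suc.IH lap by simp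
  finally show ?case .
qed simp

lemma test_zero: "(\<lambda>x. 0) \<in> test_functions"
  by (rule test_functionsI[OF schwartz_smooth[OF schwartz_zero] compact_empty]) simp

lemma test_scaleR:
  fixes \<phi> :: "'a::euclidean_space \<Rightarrow> complex"
  assumes \<phi>: "\<phi> \<in> test_functions"
  shows "(\<lambda>x. c *\<^sub>R \<phi> x) \<in> test_functions"
proof -
  obtain K where K: "compact K" "\<And>x bs. x \<notin> K \<Longrightarrow> partial_derivs bs \<phi> x = 0" "smooth \<phi>"
    using test_functionsE[OF \<phi>] by blast
  show ?thesis
    using K(2)[where bs="[]"] by (intro test_functionsI[OF smooth_scaleR[OF K(3)] K(1)]) simp
qed

lemma test_integrable:
  fixes u :: "'a::euclidean_space \<Rightarrow> real"
  assumes u: "continuous_on UNIV u" and \<phi>: "\<phi> \<in> test_functions"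
  shows "integrable lborel (\<lambda>x. u x *\<^sub>R \<phi> x)"
proof -
  obtain K where K: "compact K" "\<And>x bs. x \<notin> K \<Longrightarrow> partial_derivs bs \<phi> x = 0" "smooth \<phi>"
    using test_functionsE[OF \<phi>] by blast
  show ?thesis
    using K(2)[where bs="[]"] by (intro integrable_compact_support[OF _ K(1)] continuous_intros u smooth_continuous K(3)) auto
qed

section \<open>The potential solves the equation, in even and in odd dimensions\<close>

context gauss_density
begin

text \<open>Fubini is justified by the bound \<open>C + mass * |x|\<close> for the absolute
  logarithmic integral, which is integrable against a Schwartz function. Afterwards the derivatives
  inside \<open>\<psi>\<close> act on the kernel for fixed \<open>y\<close>.\<close>

lemma lnpot_pairing:
  fixes \<psi> :: "'a \<Rightarrow> complex"
  assumes \<psi>: "\<psi> \<in> schwartz_space"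
  shows "(\<integral>x. lnpot \<rho> x *\<^sub>R \<psi> x \<partial>lborel) = - (\<integral>y. \<rho> y *\<^sub>R (\<integral>x. ln (norm (x - y)) *\<^sub>R \<psi> x \<partial>lborel) \<partial>lborel)"
proof -
  note [measurable] = schwartz_measurable[OF \<psi>]
  define C where "C = riesz_const TYPE('a) 1 * B + mass + (\<integral>y. norm y * \<rho> y \<partial>lborel)"
  define h where "h = (\<lambda>x y. (ln (norm (x - y)) * \<rho> y) *\<^sub>R \<psi> x)"
  have hm: "case_prod h \<in> borel_measurable (borel \<Otimes>\<^sub>M borel)" unfolding h_def by measurable
  have hi: "Bochner_Integration.integrable lborel (h x)" for x unfolding h_def using ln_integrable by (intro integrable_scaleR_left) auto
  have lnle: "(\<integral>y. \<bar>ln (norm (x - y)) * \<rho> y\<bar> \<partial>lborel) \<le> C + mass * norm x" for x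
  proof -
    have r: "Bochner_Integration.integrable lborel (\<lambda>y. norm (x - y) powr (- 1) * \<rho> y)" using dim by (intro riesz_integrable) auto
    have i2: "Bochner_Integration.integrable lborel (\<lambda>y. norm x * \<rho> y + norm y * \<rho> y)"
      by (intro Bochner_Integration.integrable_add integrable_mult_right integrable integrable_norm_mult)
    have "(\<integral>y. \<bar>ln (norm (x - y)) * \<rho> y\<bar> \<partial>lborel) \<le> (\<integral>y. norm (x - y) powr (- 1) * \<rho> y + (norm x * \<rho> y + norm y * \<rho> y) \<partial>lborel)"
    proof (rule integral_mono)
      fix y
      have "\<bar>ln (norm (x - y))\<bar> \<le> norm (x - y) + norm (x - y) powr (- 1)" by (rule abs_ln_le) simp
      then have "\<bar>ln (norm (x - y))\<bar> \<le> norm x + norm y + norm (x - y) powr (- 1)"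
        using norm_triangle_ineq4[of x y] by linarith
      from mult_right_mono[OF this nonneg[of y]]
      have "\<bar>ln (norm (x - y))\<bar> * \<rho> y \<le> (norm x + norm y + norm (x - y) powr (- 1)) * \<rho> y" .
      then show "\<bar>ln (norm (x - y)) * \<rho> y\<bar> \<le> norm (x - y) powr (- 1) * \<rho> y + (norm x * \<rho> y + norm y * \<rho> y)"
        using nonneg[of y] by (simp add: abs_mult distrib_right)
    qed (intro integrable_abs ln_integrable Bochner_Integration.integrable_add r i2)+
    also have "\<dots> = (\<integral>y. norm (x - y) powr (- 1) * \<rho> y \<partial>lborel) + (norm x * mass + (\<integral>y. norm y * \<rho> y \<partial>lborel))"
      unfolding mass_def
      by (subst Bochner_Integration.integral_add[OF r i2], subst Bochner_Integration.integral_add[OF integrable_mult_right[OF integrable] integrable_norm_mult])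
         (simp only: integral_mult_right_zero)
    also have "\<dots> \<le> C + mass * norm x" using riesz_le[of 1 x] dim by (simp add: C_def mult.commute)
    finally show ?thesis .
  qed
  have g: "Bochner_Integration.integrable lborel (\<lambda>x. C * norm (\<psi> x) + mass * (norm x * norm (\<psi> x)))"
    using schwartz_integrable[OF \<psi>] schwartz_norm_mult_integrable[OF \<psi>]
    by (intro Bochner_Integration.integrable_add integrable_mult_right integrable_norm)
  have le: "(\<integral>y. norm (h x y) \<partial>lborel) \<le> C * norm (\<psi> x) + mass * (norm x * norm (\<psi> x))" for x
  proof -
    have "(\<integral>y. norm (h x y) \<partial>lborel) = (\<integral>y. \<bar>ln (norm (x - y)) * \<rho> y\<bar> \<partial>lborel) * norm (\<psi> x)" by (simp add: h_def)
    also have "\<dots> \<le> (C + mass * norm x) * norm (\<psi> x)" by (intro mult_right_mono lnle) auto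
    finally show ?thesis by (simp add: distrib_right mult.assoc)
  qed
  have hx: "(\<integral>y. h x y \<partial>lborel) = (\<integral>y. ln (norm (x - y)) * \<rho> y \<partial>lborel) *\<^sub>R \<psi> x" for x
    unfolding h_def by (rule integral_scaleR_left) (intro ln_integrable)
  have "(\<integral>x. lnpot \<rho> x *\<^sub>R \<psi> x \<partial>lborel) = (\<integral>x. - (\<integral>y. h x y \<partial>lborel) \<partial>lborel)"
    unfolding hx lnpot_def by (simp only: scaleR_minus_left)
  also have "\<dots> = - (\<integral>x. (\<integral>y. h x y \<partial>lborel) \<partial>lborel)" by simp
  also have "(\<integral>x. (\<integral>y. h x y \<partial>lborel) \<partial>lborel) = (\<integral>y. (\<integral>x. h x y \<partial>lborel) \<partial>lborel)"
    using hi le by (intro fubini_iterated(2)[OF hm _ g, symmetric]) auto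
  also have "\<dots> = (\<integral>y. \<rho> y *\<^sub>R (\<integral>x. ln (norm (x - y)) *\<^sub>R \<psi> x \<partial>lborel) \<partial>lborel)"
  proof (rule Bochner_Integration.integral_cong)
    fix y
    have "(\<integral>x. h x y \<partial>lborel) = (\<integral>x. \<rho> y *\<^sub>R (ln (norm (x - y)) *\<^sub>R \<psi> x) \<partial>lborel)"
      by (intro Bochner_Integration.integral_cong) (auto simp: h_def mult.commute)
    then show "(\<integral>x. h x y \<partial>lborel) = \<rho> y *\<^sub>R (\<integral>x. ln (norm (x - y)) *\<^sub>R \<psi> x \<partial>lborel)" by (simp only: integral_scaleR_right)
  qed simp
  finally show ?thesis .
qed

text \<open>For \<open>n = 2 m + 1\<close> the \<open>m\<close>-th power of the negative Laplacian
  takes \<open>lnpot \<rho> / gam\<close> to \<open>riesz_pot / sqrt pi\<close>, in the weak sense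
  established in \<open>solution_odd_potential\<close>.\<close>

definition riesz_pot :: "'a \<Rightarrow> real" where "riesz_pot x = (\<integral>y. riesz_kernel (x - y) * \<rho> y \<partial>lborel)"

lemma riesz_pot_integrable: "Bochner_Integration.integrable lborel (\<lambda>y. riesz_kernel (x - y) * \<rho> y)"
  using integrable_mult_right[OF riesz_integrable[of "real DIM('a) - 1" x], of "riesz_coeff TYPE('a)"] dim
  by (simp add: riesz_kernel_def mult.assoc)

lemma riesz_pot_measurable [measurable]: "riesz_pot \<in> borel_measurable borel"
  unfolding riesz_pot_def[abs_def] by measurable

lemma riesz_pot_nonneg: "riesz_pot x \<ge> 0"
  unfolding riesz_pot_def using riesz_kernel_nonneg[where 'a='a] nonneg dim by (intro integral_nonneg_AE) auto

lemma riesz_pot_le: "riesz_pot x \<le> riesz_coeff TYPE('a) * (riesz_const TYPE('a) (real DIM('a) - 1) * B + mass)"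
proof -
  have "riesz_pot x = riesz_coeff TYPE('a) * (\<integral>y. norm (x - y) powr (- (real DIM('a) - 1)) * \<rho> y \<partial>lborel)"
    by (simp add: riesz_pot_def riesz_kernel_def mult.assoc)
  also have "\<dots> \<le> riesz_coeff TYPE('a) * (riesz_const TYPE('a) (real DIM('a) - 1) * B + mass)"
    using dim by (intro mult_left_mono riesz_le) (auto simp: riesz_coeff_def)
  finally show ?thesis .
qed

lemma riesz_pot_pairing:
  fixes f :: "'a \<Rightarrow> complex"
  assumes f: "Bochner_Integration.integrable lborel f"
  shows "(\<integral>x. riesz_pot x *\<^sub>R f x \<partial>lborel) = (\<integral>y. \<rho> y *\<^sub>R (\<integral>x. riesz_kernel (x - y) *\<^sub>R f x \<partial>lborel) \<partial>lborel)"
proof -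
  note [measurable] = borel_measurable_integrable[OF f]
  define C where "C = riesz_coeff TYPE('a) * (riesz_const TYPE('a) (real DIM('a) - 1) * B + mass)"
  define h where "h = (\<lambda>x y. (riesz_kernel (x - y) * \<rho> y) *\<^sub>R f x)"
  have hm: "case_prod h \<in> borel_measurable (borel \<Otimes>\<^sub>M borel)" unfolding h_def by measurable
  have hi: "Bochner_Integration.integrable lborel (h x)" for x
    unfolding h_def using riesz_pot_integrable by (intro integrable_scaleR_left) auto
  have g: "Bochner_Integration.integrable lborel (\<lambda>x. C * norm (f x))" using f by simp
  have le: "(\<integral>y. norm (h x y) \<partial>lborel) \<le> C * norm (f x)" for x
  proof -
    have "(\<integral>y. norm (h x y) \<partial>lborel) = (\<integral>y. riesz_kernel (x - y) * \<rho> y \<partial>lborel) * norm (f x)"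
      using riesz_kernel_nonneg[where 'a='a] nonneg dim by (simp add: h_def abs_mult)
    also have "\<dots> \<le> C * norm (f x)" using riesz_pot_le by (intro mult_right_mono) (auto simp: C_def riesz_pot_def)
    finally show ?thesis .
  qed
  have hx: "(\<integral>y. h x y \<partial>lborel) = riesz_pot x *\<^sub>R f x" for x
    unfolding h_def riesz_pot_def by (rule integral_scaleR_left) (intro riesz_pot_integrable)
  have "(\<integral>x. riesz_pot x *\<^sub>R f x \<partial>lborel) = (\<integral>x. (\<integral>y. h x y \<partial>lborel) \<partial>lborel)"
    unfolding hx ..
  also have "\<dots> = (\<integral>y. (\<integral>x. h x y \<partial>lborel) \<partial>lborel)"
    using hi le by (intro fubini_iterated(2)[OF hm _ g, symmetric]) auto
  also have "\<dots> = (\<integral>y. \<rho> y *\<^sub>R (\<integral>x. riesz_kernel (x - y) *\<^sub>R f x \<partial>lborel) \<partial>lborel)"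
  proof (rule Bochner_Integration.integral_cong)
    fix y
    have "(\<integral>x. h x y \<partial>lborel) = (\<integral>x. \<rho> y *\<^sub>R (riesz_kernel (x - y) *\<^sub>R f x) \<partial>lborel)"
      by (intro Bochner_Integration.integral_cong) (auto simp: h_def mult.commute)
    then show "(\<integral>x. h x y \<partial>lborel) = \<rho> y *\<^sub>R (\<integral>x. riesz_kernel (x - y) *\<^sub>R f x \<partial>lborel)" by (simp only: integral_scaleR_right)
  qed simp
  finally show ?thesis .
qed

lemma regular_distribution_density:
  assumes "\<phi> \<in> borel_measurable borel"
  shows "regular_distribution \<rho> \<phi> = (\<integral>x. \<rho> x *\<^sub>R \<phi> x \<partial>lborel)"
  unfolding regular_distribution_def using assms by (intro integral_lebesgue_lborel) simp

lemma pairing_sum: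
  fixes \<psi> :: "'a \<Rightarrow> complex"
  assumes p: "poly_fun d p" and u: "\<And>x. u x = lnpot \<rho> x / gam TYPE('a) + p x" and \<psi>: "\<psi> \<in> test_functions"
  shows "(\<integral>x. u x *\<^sub>R \<psi> x \<partial>lebesgue) = (1 / gam TYPE('a)) *\<^sub>R (\<integral>x. lnpot \<rho> x *\<^sub>R \<psi> x \<partial>lborel) + (\<integral>x. p x *\<^sub>R \<psi> x \<partial>lborel)"
proof -
  have c: "continuous_on UNIV (lnpot \<rho>)" "continuous_on UNIV p"
    by (rule Ck_continuous[OF lnpot_Ck], rule Ck_continuous[OF poly_fun_Ck[OF p]])
  note [measurable] = borel_measurable_continuous_onI[OF c(1)] borel_measurable_continuous_onI[OF c(2)] test_measurable[OF \<psi>]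
  have "(\<integral>x. u x *\<^sub>R \<psi> x \<partial>lebesgue) = (\<integral>x. u x *\<^sub>R \<psi> x \<partial>lborel)"
    unfolding u by (rule integral_lebesgue_lborel) simp
  also have "\<dots> = (\<integral>x. (1 / gam TYPE('a)) *\<^sub>R (lnpot \<rho> x *\<^sub>R \<psi> x) + p x *\<^sub>R \<psi> x \<partial>lborel)"
    unfolding u by (intro Bochner_Integration.integral_cong) (auto simp: scaleR_add_left)
  also have "\<dots> = (1 / gam TYPE('a)) *\<^sub>R (\<integral>x. lnpot \<rho> x *\<^sub>R \<psi> x \<partial>lborel) + (\<integral>x. p x *\<^sub>R \<psi> x \<partial>lborel)"
    using test_integrable[OF c(1) \<psi>] test_integrable[OF c(2) \<psi>]
    by (subst Bochner_Integration.integral_add) (auto simp del: scaleR_scaleR)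
  finally show ?thesis .
qed

text \<open>The kernel identity makes the potential over \<open>gam\<close> a solution with
  right-hand side \<open>\<rho>\<close>. The polynomial contributes nothing, since its degree
  \<open>n - 1\<close> is below the order \<open>2 m = n\<close> of the operator.\<close>

lemma solution_even_potential:
  assumes p: "poly_fun (DIM('a) - 1) p" and u: "\<And>x. u x = lnpot \<rho> x / gam TYPE('a) + p x" and ev: "even DIM('a)"
  shows "solution_even u (regular_distribution \<rho>)"
proof -
  define m where "m = DIM('a) div 2"
  have m: "DIM('a) = 2 * m" using ev by (simp add: m_def)
  have "continuous_on UNIV u" unfolding u
    by (intro continuous_intros Ck_continuous[OF lnpot_Ck] Ck_continuous[OF poly_fun_Ck[OF p]])
       (use gam_pos[where 'a='a] in auto)
  then have L: "L1_loc u" by (rule L1_loc_continuous)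
  have "(\<integral>x. u x *\<^sub>R ((\<lambda>\<psi> y. - laplacian \<psi> y) ^^ m) \<phi> x \<partial>lebesgue) = regular_distribution \<rho> \<phi>" if \<phi>: "\<phi> \<in> test_functions" for \<phi>
  proof -
    let ?\<psi> = "((\<lambda>\<psi> y. - laplacian \<psi> y) ^^ m) \<phi>"
    have \<phi>s: "\<phi> \<in> schwartz_space" by (rule test_in_schwartz[OF \<phi>])
    have \<psi>: "?\<psi> \<in> test_functions"
      unfolding test_nlap_power[OF \<phi>] using test_scaleR test_laplacian_power[OF \<phi>] by blast
    have "(\<integral>x. lnpot \<rho> x *\<^sub>R ?\<psi> x \<partial>lborel) = - (\<integral>y. \<rho> y *\<^sub>R (- complex_of_real (gam TYPE('a)) * \<phi> y) \<partial>lborel)"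
      using integral_ln_nlap_even[OF _ m \<phi>s] dim by (simp add: lnpot_pairing[OF schwartz_nlap_power[OF \<phi>s]])
    also have "\<dots> = - (\<integral>y. (- gam TYPE('a)) *\<^sub>R (\<rho> y *\<^sub>R \<phi> y) \<partial>lborel)"
      by (intro arg_cong[where f=uminus] Bochner_Integration.integral_cong) (auto simp: scaleR_conv_of_real)
    also have "\<dots> = gam TYPE('a) *\<^sub>R (\<integral>y. \<rho> y *\<^sub>R \<phi> y \<partial>lborel)" unfolding integral_scaleR_right by simp
    finally have 1: "(\<integral>x. lnpot \<rho> x *\<^sub>R ?\<psi> x \<partial>lborel) = gam TYPE('a) *\<^sub>R (\<integral>y. \<rho> y *\<^sub>R \<phi> y \<partial>lborel)" .
    have "(\<integral>x. p x *\<^sub>R (laplacian ^^ m) \<phi> x \<partial>lborel) = 0"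
      using poly_fun_integral_laplacian_power[OF p \<phi>, of m] \<phi> m dim by auto
    then have "(\<integral>x. p x *\<^sub>R ?\<psi> x \<partial>lborel) = 0"
      unfolding test_nlap_power[OF \<phi>] by (simp add: scaleR_left_commute[of "p _"] del: scaleR_scaleR)
    with 1 show ?thesis
      unfolding pairing_sum[OF p u \<psi>] regular_distribution_density[OF test_measurable[OF \<phi>]]
      using gam_pos[where 'a='a] by simp
  qed
  then show ?thesis
    unfolding solution_even_def m_def using L distribution_regular(1)[OF integrable] by blast
qed

text \<open>Up to the factor \<open>2^((n+1)/2)\<close> the weight \<open>1 + |x|^(n+1)\<close>
  dominates \<open>(1 + |x|^2)^((n+1)/2)\<close>, whose reciprocal is integrable because
  \<open>(n+1)/2 > n/2\<close>.\<close>

lemma L_space_bounded: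
  fixes w :: "'a \<Rightarrow> real"
  assumes w [measurable]: "w \<in> borel_measurable borel" and B: "\<And>x. \<bar>w x\<bar> \<le> C"
  shows "L_space (1 / 2) w"
proof -
  let ?k = "(real DIM('a) + 1) / 2"
  have "Bochner_Integration.integrable lborel (\<lambda>x. \<bar>w x\<bar> / (1 + norm x powr (real DIM('a) + 2 * (1 / 2))))"
  proof (rule Bochner_Integration.integrable_bound)
    show "Bochner_Integration.integrable lborel (\<lambda>x::'a. (C * 2 powr ?k) * (1 + (norm x)\<^sup>2) powr (- ?k))"
      by (intro integrable_mult_right integrable_decay) simp
    show "AE x in lborel. norm (\<bar>w x\<bar> / (1 + norm x powr (real DIM('a) + 2 * (1 / 2)))) \<le> norm ((C * 2 powr ?k) * (1 + (norm x)\<^sup>2) powr (- ?k))"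
    proof (rule AE_I2)
      fix x :: 'a
      have C: "C \<ge> 0" using B[of x] by linarith
      let ?D = "1 + norm x powr (real DIM('a) + 1)"
      have D: "?D \<ge> 1" by simp
      have sq: "((norm x)\<^sup>2) powr ?k = norm x powr (real DIM('a) + 1)"
      proof (cases "x = 0")
        case False
        then have "(norm x)\<^sup>2 = norm x powr 2" by simp
        moreover have "2 * ((real DIM('a) + 1) / 2) = real DIM('a) + 1" by simp
        ultimately show ?thesis by (simp only: powr_powr)
      qed simp
      have "(1 + (norm x)\<^sup>2) powr ?k \<le> 2 powr ?k * ?D"
      proof (cases "norm x \<le> 1")
        case True
        then have "(norm x)\<^sup>2 \<le> 1" by (simp add: power_le_one)
        then have "(1 + (norm x)\<^sup>2) powr ?k \<le> 2 powr ?k * 1" by (simp add: powr_mono2)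
        also have "\<dots> \<le> 2 powr ?k * ?D" using D by (intro mult_left_mono) auto
        finally show ?thesis .
      next
        case False
        then have "1 \<le> (norm x)\<^sup>2" by simp
        then have "(1 + (norm x)\<^sup>2) powr ?k \<le> (2 * (norm x)\<^sup>2) powr ?k" by (intro powr_mono2) auto
        also have "\<dots> = 2 powr ?k * norm x powr (real DIM('a) + 1)" by (simp add: powr_mult sq)
        also have "\<dots> \<le> 2 powr ?k * ?D" by (intro mult_left_mono) auto
        finally show ?thesis .
      qed
      moreover have "0 < (1 + (norm x)\<^sup>2) powr ?k"
      proof -
        have "0 < 1 + (norm x)\<^sup>2" by (simp add: add_pos_nonneg)
        then show ?thesis unfolding powr_gt_zero by linarith
      qed
      moreover have "1 / d \<le> b * inverse y" if "y \<le> b * d" "0 < y" "1 \<le> d" for b d y :: real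
      proof -
        have "y / d \<le> b" using that by (subst pos_divide_le_eq) auto
        then have "y / d * inverse y \<le> b * inverse y" using that by (intro mult_right_mono) auto
        then show ?thesis using that by simp
      qed
      ultimately have "1 / ?D \<le> 2 powr ?k * (1 + (norm x)\<^sup>2) powr (- ?k)"
        unfolding powr_minus using D by blast
      then have "C * (1 / ?D) \<le> C * (2 powr ?k * (1 + (norm x)\<^sup>2) powr (- ?k))" using C by (intro mult_left_mono)
      moreover have "\<bar>w x\<bar> / ?D \<le> C * (1 / ?D)" using B[of x] D by (simp add: divide_right_mono)
      ultimately have "\<bar>w x\<bar> / ?D \<le> (C * 2 powr ?k) * (1 + (norm x)\<^sup>2) powr (- ?k)" by simp
      then show "norm (\<bar>w x\<bar> / (1 + norm x powr (real DIM('a) + 2 * (1 / 2)))) \<le> norm ((C * 2 powr ?k) * (1 + (norm x)\<^sup>2) powr (- ?k))"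
        using C D by (simp add: abs_mult)
    qed
  qed simp
  then have 1: "Bochner_Integration.integrable lebesgue (\<lambda>x. \<bar>w x\<bar> / (1 + norm x powr (real DIM('a) + 2 * (1 / 2))))"
    by (subst integrable_completion) auto
  have "set_integrable lebesgue K w" if K: "compact K" for K
  proof -
    have [measurable]: "K \<in> sets borel" using compact_imp_closed[OF K] by simp
    have "Bochner_Integration.integrable lborel (\<lambda>x. indicator K x *\<^sub>R w x)"
    proof (rule Bochner_Integration.integrable_bound)
      show "Bochner_Integration.integrable lborel (\<lambda>x. C * indicator K x)"
        using emeasure_bounded_finite[OF compact_imp_bounded[OF K]] by (intro integrable_mult_right) (simp add: integrable_indicator_iff)
      show "AE x in lborel. norm (indicator K x *\<^sub>R w x) \<le> norm (C * indicator K x)"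
        using order_trans[OF B abs_ge_self] by (intro AE_I2) (auto simp: indicator_def)
    qed simp
    then show ?thesis unfolding set_integrable_def by (subst integrable_completion) auto
  qed
  with 1 show ?thesis by (simp add: L_space_def L1_loc_def)
qed

text \<open>The weak Laplacian power of \<open>u\<close> is a signed multiple of the Riesz potential
  plus the constant \<open>c\<close> left by a polynomial of degree \<open>n - 1 = 2 m\<close>.
  Against the half-Laplacian of a Schwartz function the constant gives 0, and the Riesz kernel
  inverts the half-Laplacian, so \<open>\<rho>\<close> remains.\<close>

lemma solution_odd_potential:
  assumes p: "poly_fun (DIM('a) - 1) p" and u: "\<And>x. u x = lnpot \<rho> x / gam TYPE('a) + p x" and od: "odd DIM('a)"
  shows "solution_odd u (regular_distribution \<rho>)"
proof -
  define m where "m = (DIM('a) - 1) div 2"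
  have m: "DIM('a) = 2 * m + 1" using od by (auto simp: m_def elim!: oddE)
  have gp: "gam TYPE('a) > 0" by (rule gam_pos)
  obtain c where c: "\<And>\<phi>. \<phi> \<in> test_functions \<Longrightarrow> (\<integral>x. p x *\<^sub>R (laplacian ^^ m) \<phi> x \<partial>lborel) = c *\<^sub>R (\<integral>x. \<phi> x \<partial>lborel)"
    using poly_fun_integral_laplacian_power[OF p test_zero, of m] m by auto
  have "Ck (DIM('a) - 1) (\<lambda>x. (1 / gam TYPE('a)) * lnpot \<rho> x + p x)"
    by (intro Ck_add Ck_cmult lnpot_Ck poly_fun_Ck[OF p])
  also have "(\<lambda>x. (1 / gam TYPE('a)) * lnpot \<rho> x + p x) = u" by (simp add: u fun_eq_iff)
  finally have W: "W1_loc (DIM('a) - 1) u" by (rule Ck_W1_loc)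
  \<comment> \<open>The sign \<open>(-1) ^ m\<close> converts the negative Laplacian of the kernel
    identity into the Laplacian; \<open>solution_odd\<close> multiplies by the same sign again and
    so removes it from the Riesz term.\<close>
  define w where "w x = (-1) ^ m * (1 / sqrt pi) * riesz_pot x + c" for x
  have wm [measurable]: "w \<in> borel_measurable borel" unfolding w_def[abs_def] by measurable
  define CR where "CR = riesz_coeff TYPE('a) * (riesz_const TYPE('a) (real DIM('a) - 1) * B + mass)"
  have "\<bar>w x\<bar> \<le> 1 / sqrt pi * CR + \<bar>c\<bar>" for x
  proof -
    have "\<bar>w x\<bar> \<le> \<bar>(-1) ^ m * (1 / sqrt pi) * riesz_pot x\<bar> + \<bar>c\<bar>" unfolding w_def by (rule abs_triangle_ineq)
    also have "\<bar>(-1) ^ m * (1 / sqrt pi) * riesz_pot x\<bar> = 1 / sqrt pi * riesz_pot x"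
      using riesz_pot_nonneg by (simp add: abs_mult power_abs)
    also have "\<dots> \<le> 1 / sqrt pi * CR" unfolding CR_def by (intro mult_left_mono riesz_pot_le) auto
    finally show ?thesis by simp
  qed
  then have Lw: "L_space (1 / 2) w" by (rule L_space_bounded[OF wm])
  have split: "(\<integral>x. (a * w x) *\<^sub>R f x \<partial>lborel) = (a * (-1) ^ m * (1 / sqrt pi)) *\<^sub>R (\<integral>x. riesz_pot x *\<^sub>R f x \<partial>lborel) + (a * c) *\<^sub>R (\<integral>x. f x \<partial>lborel)"
    if f: "Bochner_Integration.integrable lborel f" for f :: "'a \<Rightarrow> complex" and a :: real
  proof -
    note [measurable] = borel_measurable_integrable[OF f]
    have i: "Bochner_Integration.integrable lborel (\<lambda>x. riesz_pot x *\<^sub>R f x)"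
    proof (rule Bochner_Integration.integrable_bound)
      show "Bochner_Integration.integrable lborel (\<lambda>x. CR *\<^sub>R f x)" using f by simp
      have "norm (riesz_pot x *\<^sub>R f x) \<le> norm (CR *\<^sub>R f x)" for x
        using riesz_pot_nonneg[of x] riesz_pot_le[of x] by (auto simp: CR_def intro!: mult_right_mono)
      then show "AE x in lborel. norm (riesz_pot x *\<^sub>R f x) \<le> norm (CR *\<^sub>R f x)" by simp
    qed simp
    have "(\<integral>x. (a * w x) *\<^sub>R f x \<partial>lborel) = (\<integral>x. (a * (-1) ^ m * (1 / sqrt pi)) *\<^sub>R (riesz_pot x *\<^sub>R f x) + (a * c) *\<^sub>R f x \<partial>lborel)"
      unfolding w_def by (intro Bochner_Integration.integral_cong) (auto simp: distrib_left scaleR_add_left mult.assoc)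
    also have "\<dots> = (a * (-1) ^ m * (1 / sqrt pi)) *\<^sub>R (\<integral>x. riesz_pot x *\<^sub>R f x \<partial>lborel) + (a * c) *\<^sub>R (\<integral>x. f x \<partial>lborel)"
      by (subst Bochner_Integration.integral_add[OF integrable_scaleR_right[OF i] integrable_scaleR_right[OF f]])
         (simp only: integral_scaleR_right)
    finally show ?thesis .
  qed
  have weak: "weak_laplacian_power m u w"
    unfolding weak_laplacian_power_def
  proof (intro conjI ballI)
    show "L1_loc w" using Lw by (simp add: L_space_def)
    fix \<phi> :: "'a \<Rightarrow> complex" assume \<phi>: "\<phi> \<in> test_functions"
    let ?\<psi> = "(laplacian ^^ m) \<phi>"
    have \<phi>s: "\<phi> \<in> schwartz_space" by (rule test_in_schwartz[OF \<phi>])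
    note [measurable] = test_measurable[OF \<phi>]
    have \<psi>: "?\<psi> \<in> test_functions" by (rule test_laplacian_power[OF \<phi>])
    have "(-1) ^ m *\<^sub>R (\<integral>x. lnpot \<rho> x *\<^sub>R ?\<psi> x \<partial>lborel) = (\<integral>x. lnpot \<rho> x *\<^sub>R ((\<lambda>\<psi> y. - laplacian \<psi> y) ^^ m) \<phi> x \<partial>lborel)"
      unfolding test_nlap_power[OF \<phi>] by (subst integral_scaleR_right[symmetric]) (simp only: scaleR_left_commute)
    also have "\<dots> = - (\<integral>y. \<rho> y *\<^sub>R (- complex_of_real (gam TYPE('a) / sqrt pi) * (\<integral>x. riesz_kernel (x - y) *\<^sub>R \<phi> x \<partial>lborel)) \<partial>lborel)"
      unfolding lnpot_pairing[OF schwartz_nlap_power[OF \<phi>s]]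
      by (subst integral_ln_nlap_odd[OF _ m \<phi>s]) (use dim in auto)
    also have "\<dots> = - (\<integral>y. (- (gam TYPE('a) / sqrt pi)) *\<^sub>R (\<rho> y *\<^sub>R (\<integral>x. riesz_kernel (x - y) *\<^sub>R \<phi> x \<partial>lborel)) \<partial>lborel)"
      by (intro arg_cong[where f=uminus] Bochner_Integration.integral_cong) (auto simp: scaleR_conv_of_real)
    also have "\<dots> = (gam TYPE('a) / sqrt pi) *\<^sub>R (\<integral>x. riesz_pot x *\<^sub>R \<phi> x \<partial>lborel)"
      unfolding riesz_pot_pairing[OF schwartz_integrable[OF \<phi>s]] integral_scaleR_right by simp
    finally have e: "(-1) ^ m *\<^sub>R (\<integral>x. lnpot \<rho> x *\<^sub>R ?\<psi> x \<partial>lborel) = (gam TYPE('a) / sqrt pi) *\<^sub>R (\<integral>x. riesz_pot x *\<^sub>R \<phi> x \<partial>lborel)" .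
    have "(\<integral>x. lnpot \<rho> x *\<^sub>R ?\<psi> x \<partial>lborel) = (-1) ^ m *\<^sub>R ((-1) ^ m *\<^sub>R (\<integral>x. lnpot \<rho> x *\<^sub>R ?\<psi> x \<partial>lborel))"
      by (simp flip: power_mult_distrib)
    also have "\<dots> = gam TYPE('a) *\<^sub>R (((-1) ^ m * (1 / sqrt pi)) *\<^sub>R (\<integral>x. riesz_pot x *\<^sub>R \<phi> x \<partial>lborel))"
      unfolding e by simp
    finally have "(1 / gam TYPE('a)) *\<^sub>R (\<integral>x. lnpot \<rho> x *\<^sub>R ?\<psi> x \<partial>lborel) = ((-1) ^ m * (1 / sqrt pi)) *\<^sub>R (\<integral>x. riesz_pot x *\<^sub>R \<phi> x \<partial>lborel)"
      using gp by simp
    then have "(\<integral>x. u x *\<^sub>R ?\<psi> x \<partial>lebesgue) = (\<integral>x. (1 * w x) *\<^sub>R \<phi> x \<partial>lborel)"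
      unfolding pairing_sum[OF p u \<psi>] c[OF \<phi>] split[OF schwartz_integrable[OF \<phi>s]] by simp
    also have "\<dots> = (\<integral>x. w x *\<^sub>R \<phi> x \<partial>lebesgue)" by (subst integral_lebesgue_lborel) auto
    finally show "(\<integral>x. u x *\<^sub>R ?\<psi> x \<partial>lebesgue) = (\<integral>x. w x *\<^sub>R \<phi> x \<partial>lebesgue)" .
  qed
  have "(\<integral>x. ((-1) ^ m * w x) *\<^sub>R half_laplacian \<phi> x \<partial>lebesgue) = regular_distribution \<rho> \<phi>" if \<phi>: "\<phi> \<in> schwartz_space" for \<phi>
  proof -
    note hi = half_laplacian_integrable(1)[OF \<phi>]
    have hm [measurable]: "half_laplacian \<phi> \<in> borel_measurable borel" using borel_measurable_integrable[OF hi] by simp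
    have "(\<integral>x. ((-1) ^ m * w x) *\<^sub>R half_laplacian \<phi> x \<partial>lebesgue) = (\<integral>x. ((-1) ^ m * w x) *\<^sub>R half_laplacian \<phi> x \<partial>lborel)"
      by (rule integral_lebesgue_lborel) simp
    also have "\<dots> = (1 / sqrt pi) *\<^sub>R (\<integral>x. riesz_pot x *\<^sub>R half_laplacian \<phi> x \<partial>lborel)"
      unfolding split[OF hi] half_laplacian_integrable(2)[OF \<phi>] by (simp flip: power_mult_distrib)
    also have "\<dots> = (1 / sqrt pi) *\<^sub>R (\<integral>y. \<rho> y *\<^sub>R (complex_of_real (sqrt pi) * \<phi> y) \<partial>lborel)"
      unfolding riesz_pot_pairing[OF hi] using riesz_kernel_half_laplacian[OF _ \<phi>] dim by simp
    also have "\<dots> = (1 / sqrt pi) *\<^sub>R (\<integral>y. sqrt pi *\<^sub>R (\<rho> y *\<^sub>R \<phi> y) \<partial>lborel)"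
      by (intro arg_cong[where f="scaleR _"] Bochner_Integration.integral_cong) (auto simp: scaleR_conv_of_real)
    also have "\<dots> = (\<integral>y. \<rho> y *\<^sub>R \<phi> y \<partial>lborel)" unfolding integral_scaleR_right by simp
    finally show ?thesis by (simp add: regular_distribution_density[OF schwartz_measurable[OF \<phi>]])
  qed
  with W Lw weak distribution_regular(2)[OF integrable] show ?thesis
    unfolding solution_odd_def m_def by blast
qed

end

section \<open>The solution\<close>

lemma laplacian_add:
  assumes "Ck 2 f" "Ck 2 g"
  shows "laplacian (\<lambda>x. f x + g x) x = laplacian f x + laplacian (g :: 'a::euclidean_space \<Rightarrow> real) x"
proof -
  have "partial_derivs [b, b] (\<lambda>x. f x + g x) x = partial_derivs [b, b] f x + partial_derivs [b, b] g x" if "b \<in> Basis" for b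
    using Ck_partial_derivs_add[OF assms, of "[b, b]"] that by (simp add: fun_eq_iff)
  then show ?thesis by (simp add: laplacian_def sum.distrib)
qed

lemma laplacian_cmult:
  assumes "Ck 2 f"
  shows "laplacian (\<lambda>x. c * f x) x = c * laplacian (f :: 'a::euclidean_space \<Rightarrow> real) x"
proof -
  have "partial_derivs [b, b] (\<lambda>x. c * f x) x = c * partial_derivs [b, b] f x" if "b \<in> Basis" for b
    using Ck_partial_derivs_cmult[OF assms, of "[b, b]" c] that by (simp add: fun_eq_iff)
  then show ?thesis by (simp add: laplacian_def sum_distrib_left)
qed

lemma laplacian_norm4_norm2: "laplacian (\<lambda>x::'a::euclidean_space. norm x ^ 4 - (norm x)\<^sup>2) 0 = - 2 * real DIM('a)"
proof -
  have 1: "partial_deriv b (\<lambda>x::'a. norm x ^ 4 - (norm x)\<^sup>2) = (\<lambda>x. 4 * (x \<bullet> x) * (x \<bullet> b) - 2 * (x \<bullet> b))" for b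
  proof
    fix x :: 'a
    have "((\<lambda>x::'a. (x \<bullet> x)\<^sup>2 - x \<bullet> x) has_derivative (\<lambda>h. 2 * (x \<bullet> x) * (2 * (x \<bullet> h)) - 2 * (x \<bullet> h))) (at x)"
      by (auto intro!: derivative_eq_intros simp: inner_commute)
    moreover have "(\<lambda>x::'a. (x \<bullet> x)\<^sup>2 - x \<bullet> x) = (\<lambda>x. norm x ^ 4 - (norm x)\<^sup>2)"
      by (simp add: fun_eq_iff power2_norm_eq_inner[symmetric] flip: power_mult)
    ultimately show "partial_deriv b (\<lambda>x::'a. norm x ^ 4 - (norm x)\<^sup>2) x = 4 * (x \<bullet> x) * (x \<bullet> b) - 2 * (x \<bullet> b)"
      using partial_deriv_eq by fastforce
  qed
  have "partial_deriv b (\<lambda>x::'a. 4 * (x \<bullet> x) * (x \<bullet> b) - 2 * (x \<bullet> b)) 0 = - 2" if "b \<in> Basis" for b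
  proof -
    have "((\<lambda>x::'a. 4 * (x \<bullet> x) * (x \<bullet> b) - 2 * (x \<bullet> b)) has_derivative (\<lambda>h. - 2 * (h \<bullet> b))) (at 0)"
      by (auto intro!: derivative_eq_intros)
    from partial_deriv_eq[OF this, of b] show ?thesis using that by simp
  qed
  then show ?thesis by (simp add: laplacian_def 1)
qed

lemma Ck_twice_differentiable:
  assumes "Ck 2 f"
  shows "twice_differentiable_at f x"
  using CkD(1)[OF assms, of "[]"] CkD(1)[OF assms, of "[b]" for b] by (simp add: twice_differentiable_at_def)

theorem theorem1p1:
  fixes P Q :: "'a::euclidean_space \<Rightarrow> real"
  assumes dim: "DIM('a) \<ge> 5"
    and P: "polynomial_of_degree_le (DIM('a) - 1) P"
    and Q_cont: "continuous_on UNIV Q"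
    and Q_pos: "Q 0 > 0"
    and Q_nonneg: "\<And>x. Q x \<ge> 0"
    and radial: "radially_symmetric (\<lambda>x. Q x * exp (real DIM('a) * P x))"
    and bdd: "bdd_above (range (\<lambda>x. Q x * exp (real DIM('a) * P x)))"
  shows "\<forall>\<kappa>>0. \<exists>u c\<^sub>1 c\<^sub>2 c\<^sub>v.
    is_solution u (regular_distribution (\<lambda>x. Q x * exp (real DIM('a) * u x))) \<and>
    integrable lebesgue (\<lambda>x. Q x * exp (real DIM('a) * u x)) \<and>
    (\<integral>x. Q x * exp (real DIM('a) * u x) \<partial>lebesgue) = \<kappa> \<and>
    c\<^sub>1 > 0 \<and> c\<^sub>2 > 0 \<and>
    (\<lambda>x. u x - (- (2 * \<kappa> / Lambda1 TYPE('a)) * ln (norm x) + P x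
              + c\<^sub>1 * norm x ^ 2 - c\<^sub>2 * norm x ^ 4 + c\<^sub>v)) \<in> o[at_infinity](\<lambda>_. 1) \<and>
    (\<exists>v. radially_symmetric v \<and> twice_differentiable_at v 0 \<and>
      (\<lambda>x. v x - (- (2 * \<kappa> / Lambda1 TYPE('a)) * ln (norm x)
              + 1 / (2 * real DIM('a)) * laplacian v 0 * (norm x ^ 4 - norm x ^ 2)))
        \<in> o[at_infinity](\<lambda>_. 1) \<and>
      (\<forall>x. u x = P x + v x + c\<^sub>v - norm x ^ 4))"
proof (intro allI impI)
  fix \<kappa> :: real assume \<kappa>: "\<kappa> > 0"
  let ?n = "real DIM('a)" and ?g = "gam TYPE('a)"
  define G where "G = (\<lambda>x. Q x * exp (?n * P x))"
  obtain Gm where Gm: "\<And>x. G x \<le> Gm" using bdd unfolding bdd_above_def G_def by auto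
  have pP: "poly_fun (DIM('a) - 1) P" by (rule polynomial_poly_fun[OF P])
  have fpd: "fixed_point_data G \<kappa> Gm"
  proof
    show "continuous_on UNIV G"
      unfolding G_def by (intro continuous_intros Q_cont Ck_continuous[OF poly_fun_Ck[OF pP]])
    show "G x \<ge> 0" for x using Q_nonneg by (simp add: G_def)
  qed (use dim Q_pos Gm radial \<kappa> in \<open>auto simp: G_def\<close>)
  obtain \<rho> B c where gd: "gauss_density \<rho> B" and rad: "radially_symmetric \<rho>" and mass\<rho>: "(\<integral>y. \<rho> y \<partial>lborel) = \<kappa>"
    and A0: "(\<integral>y. norm y powr (- 2) * \<rho> y \<partial>lborel) > 0"
    and eq: "\<And>x. \<rho> x = G x * exp (?n * (lnpot \<rho> x / ?g
      - (?n - 2) / (4 * ?n * ?g) * (\<integral>y. norm y powr (- 2) * \<rho> y \<partial>lborel) * (norm x ^ 4 - (norm x)\<^sup>2) + c - norm x ^ 4))"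
    using fixed_point_data.normalized_density[OF fpd] by blast
  interpret gauss_density \<rho> B by (rule gd)
  define A where "A = (\<integral>y. norm y powr (- 2) * \<rho> y \<partial>lborel)"
  define a where "a = - ((?n - 2) / (4 * ?n * ?g) * A)"
  have g: "?g > 0" by (rule gam_pos)
  have n: "?n \<ge> 5" using dim by simp
  have a: "a < 0" unfolding a_def A_def using A0 g n by simp
  define v where "v = (\<lambda>x. (1 / ?g) * lnpot \<rho> x + a * (norm x ^ 4 - (norm x)\<^sup>2))"
  define u where "u = (\<lambda>x. P x + v x + c - norm x ^ 4)"
  \<comment> \<open>Everything in \<open>u\<close> except the potential. Its degree is at most
    \<open>n - 1\<close> because \<open>4 \<le> n - 1\<close>, so the correction
    \<open>|x|^4 - |x|^2\<close> and the term \<open>- |x|^4\<close> are as harmless for the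
    equation as \<open>P\<close>.\<close>
  define p where "p = (\<lambda>x. P x + ((a - 1) * norm x ^ 4 + ((- a) * (norm x)\<^sup>2 + c)))"
  have \<rho>u: "\<rho> = (\<lambda>x. Q x * exp (?n * u x))"
  proof
    fix x
    have "\<rho> x = Q x * (exp (?n * P x) * exp (?n * (v x + c - norm x ^ 4)))"
      by (subst eq) (simp add: G_def v_def a_def A_def)
    also have "exp (?n * P x) * exp (?n * (v x + c - norm x ^ 4)) = exp (?n * u x)"
      unfolding mult_exp_exp u_def by (simp add: algebra_simps)
    finally show "\<rho> x = Q x * exp (?n * u x)" .
  qed
  have pp: "poly_fun (DIM('a) - 1) p"
    unfolding p_def using dim
    by (intro poly_fun.add pP poly_fun_cmult poly_fun.const poly_fun.mono[OF poly_fun_norm4] poly_fun.mono[OF poly_fun_norm2]) auto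
  have up: "u x = lnpot \<rho> x / ?g + p x" for x
    by (simp add: u_def v_def p_def algebra_simps)
  have sol: "is_solution u (regular_distribution \<rho>)"
    unfolding is_solution_def using solution_even_potential[OF pp up] solution_odd_potential[OF pp up] by simp
  have int: "Bochner_Integration.integrable lebesgue \<rho>" "(\<integral>x. \<rho> x \<partial>lebesgue) = \<kappa>"
    using integrable mass\<rho> integral_lebesgue_lborel[of \<rho>] by (simp_all add: integrable_completion)
  have Lam: "2 * \<kappa> / Lambda1 TYPE('a) = \<kappa> / ?g" by (simp add: Lambda1_gam)
  have C2: "Ck 2 (lnpot \<rho>)" using dim by (intro Ck_mono[OF lnpot_Ck]) auto
  have q: "poly_fun 4 (\<lambda>x::'a. norm x ^ 4 - (norm x)\<^sup>2)"
    using poly_fun.add[OF poly_fun_norm4 poly_fun.mono[OF poly_fun_cmult[OF poly_fun_norm2, of "-1"]]] by simp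
  have v2: "Ck 2 v" unfolding v_def by (intro Ck_add Ck_cmult C2 poly_fun_Ck[OF q])
  have l1: "laplacian (\<lambda>x. (1 / ?g) * lnpot \<rho> x) 0 = (1 / ?g) * laplacian (lnpot \<rho>) 0" by (rule laplacian_cmult[OF C2])
  have l2: "laplacian (\<lambda>x::'a. a * (norm x ^ 4 - (norm x)\<^sup>2)) 0 = a * laplacian (\<lambda>x::'a. norm x ^ 4 - (norm x)\<^sup>2) 0"
    by (rule laplacian_cmult[OF poly_fun_Ck[OF q]])
  have l3: "laplacian (lnpot \<rho>) 0 = - (?n - 2) * A" using laplacian_lnpot[of 0] by (simp add: A_def)
  have gen: "m * - ((m - 2) / (4 * m * h) * D) = - ((m - 2) * D / (4 * h))" if "m \<noteq> 0" for m h D :: real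
    by (cases "h = 0") (use that in \<open>simp_all add: field_simps\<close>)
  have na: "?n * a = - ((?n - 2) * A / (4 * ?g))" unfolding a_def using n by (intro gen) simp
  \<comment> \<open>The self-consistency of the coefficient: the potential contributes
    \<open>4 n a\<close> to the Laplacian of \<open>v\<close> at 0 and the polynomial
    \<open>- 2 n a\<close>, which leaves \<open>2 n a\<close>.\<close>
  have "(1 / ?g) * (- (?n - 2) * A) = 4 * (?n * a)" unfolding na using g by (simp add: field_simps)
  moreover have "laplacian v 0 = (1 / ?g) * (- (?n - 2) * A) + a * (- 2 * ?n)"
    unfolding v_def laplacian_add[OF Ck_cmult[OF C2] Ck_cmult[OF poly_fun_Ck[OF q]]] l1 l2 l3 laplacian_norm4_norm2 ..
  ultimately have "laplacian v 0 = 2 * ?n * a" by (simp add: algebra_simps)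
  then have lap: "1 / (2 * ?n) * laplacian v 0 = a" using n by simp
  define D where "D = 2 * (\<integral>y. norm y * \<rho> y \<partial>lborel) + riesz_const TYPE('a) 1 * (2 * B) + (\<integral>y. (norm y)\<^sup>2 * \<rho> y \<partial>lborel)"
  have lim: "((\<lambda>x. (lnpot \<rho> x + \<kappa> * ln (norm x)) / ?g) \<longlongrightarrow> 0) at_infinity"
  proof (rule Lim_null_comparison)
    have "\<forall>\<^sub>F x :: 'a in at_infinity. x \<noteq> 0"
      unfolding eventually_at_infinity by (rule exI[of _ 1]) auto
    then show "\<forall>\<^sub>F x in at_infinity. norm ((lnpot \<rho> x + \<kappa> * ln (norm x)) / ?g) \<le> D / ?g / norm x"
    proof eventually_elim
      case (elim x)
      have "\<bar>lnpot \<rho> x + \<kappa> * ln (norm x)\<bar> \<le> D / norm x"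
        using lnpot_asymptotic[OF elim] mass\<rho> by (simp add: D_def mass_def)
      then have "\<bar>lnpot \<rho> x + \<kappa> * ln (norm x)\<bar> / ?g \<le> D / norm x / ?g" using g by (intro divide_right_mono) auto
      then show ?case using g by (simp add: abs_divide mult.commute)
    qed
    show "((\<lambda>x::'a. D / ?g / norm x) \<longlongrightarrow> 0) at_infinity"
      by (rule tendsto_divide_0[OF tendsto_const]) (intro filterlim_at_top_imp_at_infinity filterlim_norm_at_top)
  qed
  have o: "f \<in> o[at_infinity](\<lambda>_. 1)" if "\<And>x. f x = (lnpot \<rho> x + \<kappa> * ln (norm x)) / ?g" for f :: "'a \<Rightarrow> real"
  proof (rule smalloI_tendsto)
    have "f = (\<lambda>x. (lnpot \<rho> x + \<kappa> * ln (norm x)) / ?g)" using that by auto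
    then show "((\<lambda>x. f x / 1) \<longlongrightarrow> 0) at_infinity" using lim by simp
  qed simp
  have rv: "radially_symmetric v"
    unfolding radially_symmetric_def
  proof (intro allI impI)
    fix x y :: 'a assume xy: "norm x = norm y"
    then have "lnpot \<rho> x = lnpot \<rho> y" using lnpot_radial[OF rad] unfolding radially_symmetric_def by blast
    then show "v x = v y" by (simp add: v_def xy)
  qed
  have ov: "(\<lambda>x. v x - (- (2 * \<kappa> / Lambda1 TYPE('a)) * ln (norm x)
      + 1 / (2 * ?n) * laplacian v 0 * (norm x ^ 4 - norm x ^ 2))) \<in> o[at_infinity](\<lambda>_. 1)"
    unfolding lap Lam by (rule o) (simp add: v_def add_divide_distrib algebra_simps)
  have ou: "(\<lambda>x. u x - (- (2 * \<kappa> / Lambda1 TYPE('a)) * ln (norm x) + P x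
      + (- a) * norm x ^ 2 - (1 - a) * norm x ^ 4 + c)) \<in> o[at_infinity](\<lambda>_. 1)"
    unfolding Lam by (rule o) (simp add: u_def v_def add_divide_distrib algebra_simps)
  \<comment> \<open>These are the witnesses for \<open>c\<^sub>1\<close> and
    \<open>c\<^sub>2\<close>: in \<open>v\<close> the coefficient of \<open>|x|^2\<close> is
    \<open>- a\<close> and that of \<open>|x|^4\<close> is \<open>a\<close>, and the explicit
    \<open>- |x|^4\<close> in \<open>u\<close> adds the 1. Both are positive because
    \<open>a < 0\<close>.\<close>
  have p1: "- a > 0" and p2: "1 - a > 0" using a by simp_all
  have ux: "u x = P x + v x + c - norm x ^ 4" for x by (simp add: u_def)
  show "\<exists>u c\<^sub>1 c\<^sub>2 c\<^sub>v.
    is_solution u (regular_distribution (\<lambda>x. Q x * exp (?n * u x))) \<and>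
    Bochner_Integration.integrable lebesgue (\<lambda>x. Q x * exp (?n * u x)) \<and>
    (\<integral>x. Q x * exp (?n * u x) \<partial>lebesgue) = \<kappa> \<and>
    c\<^sub>1 > 0 \<and> c\<^sub>2 > 0 \<and>
    (\<lambda>x. u x - (- (2 * \<kappa> / Lambda1 TYPE('a)) * ln (norm x) + P x
              + c\<^sub>1 * norm x ^ 2 - c\<^sub>2 * norm x ^ 4 + c\<^sub>v)) \<in> o[at_infinity](\<lambda>_. 1) \<and>
    (\<exists>v. radially_symmetric v \<and> twice_differentiable_at v 0 \<and>
      (\<lambda>x. v x - (- (2 * \<kappa> / Lambda1 TYPE('a)) * ln (norm x)
              + 1 / (2 * ?n) * laplacian v 0 * (norm x ^ 4 - norm x ^ 2)))
        \<in> o[at_infinity](\<lambda>_. 1) \<and>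
      (\<forall>x. u x = P x + v x + c\<^sub>v - norm x ^ 4))"
    by (rule exI[of _ u], rule exI[of _ "- a"], rule exI[of _ "1 - a"], rule exI[of _ c],
        intro conjI sol[unfolded \<rho>u] int[unfolded \<rho>u] p1 p2 ou, rule exI[of _ v],
        intro conjI allI rv Ck_twice_differentiable[OF v2] ov ux)
qed

end
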